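(* Let $E$ be an arbitrary directed graph. The following conditions are equivalent. (1) Every element $a\in F_E^\Gamma$ is periodic. (2) Every vertex of $E$ (as an element of $F_E^\Gamma$) is periodic. (3) For every vertex $v$, $\{v\}\to^{A1} V$ for some stationary set $V$ which contains core vertices only and every core cycle has no exits. (4) Each path is a prefix of a path $p$ ending in a cycle with no exits and such that the vertices on $p$ are regular. Every infinite path ends in a cycle with no exits. (5) $E$ is a row-finite, no-exit graph without sinks such that every infinite path ends in a cycle. (6) For any field $K$, the Leavitt path algebra $L_K(E)$ is graded isomorphic to an algebra of the form $$\bigoplus_{i\in I}\mathbb M_{\mu_i}(K[x^{n_i},x^{-n_i}])(\overline\gamma_i)$$ where $I$ is a set, $\mu_i$ are cardinals, $n_i$ are positive integers, and $\overline\gamma_i$ are maps $\mu_i\to\mathbb Z$ for $i\in I$. (7) The graph $\Gamma$-monoid $M_E^\Gamma$ is isomorphic to $\bigoplus_{i\in I}\mathbb Z^+[x]/\langle x^{n_i}=1\rangle$ where $I$ is a set and $n_i$ are positive integers for $i\in I$. (8) The Grothendieck $\Gamma$-group $G_E^\Gamma$ is isomorphic to $\bigoplus_{i\in I}\mathbb Z[x]/\langle x^{n_i}=1\rangle$ where $I$ is a set and $n_i$ are positive integers for $i\in I$.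
   Context: Setup. $\Gamma=\{x^n\mid n\in\mathbb Z\}$ is the infinite cyclic group generated by $x$. $E$ is an arbitrary directed graph with vertex set $E^0$, edge set $E^1$, source map $\mathbf s$ and range map $\mathbf r$. A vertex $v$ is a sink if $\mathbf s^{-1}(v)=\emptyset$, regular if $\mathbf s^{-1}(v)$ is finite and nonempty, and an infinite emitter if $\mathbf s^{-1}(v)$ is infinite. $E$ is row-finite if it has no infinite emitters. For every infinite emitter $v$ and every finite nonempty $Z\subseteq \mathbf s^{-1}(v)$ introduce a symbol $q_Z=q_Z^v$, called an improper vertex; elements of $E^0$ are called proper vertices. Whenever $q_Z^v$ is written, $v$ is an infinite emitter and $Z$ is a finite nonempty subset of $\mathbf s^{-1}(v)$. $F_E^\Gamma$ is the free commutative $\Gamma$-monoid on all proper and improper vertices (these are called the generators): its elements are finite formal sums of monomials $x^m g$ ($m\in\mathbb Z$, $g$ a generator), and $x^n$ acts by $x^n(x^m g)=x^{n+m}g$. The relation $\to_1$ on $F_E^\Gamma-\{0\}$ is given, for all $a\in F_E^\Gamma$ and $m\in\mathbb Z$, by: (A1) $a+x^m v\to_1 a+\sum_{e\in \mathbf s^{-1}(v)}x^{m+1}\mathbf r(e)$ for $v$ regular; (A2) $a+x^m v\to_1 a+x^m q_Z+\sum_{e\in Z}x^{m+1}\mathbf r(e)$ for $v$ an infinite emitter and $Z\subseteq \mathbf s^{-1}(v)$ finite and nonempty; (A3) $a+x^m q_Z\to_1 a+x^m q_W+\sum_{e\in W-Z}x^{m+1}\mathbf r(e)$ for $v$ an infinite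 emitter and finite nonempty $Z\subsetneq W\subseteq \mathbf s^{-1}(v)$. The relation $\to$ is the reflexive and transitive closure of $\to_1$ on $F_E^\Gamma$, and $\sim$ is the congruence on $F_E^\Gamma$ generated by $\to$. $M_E^\Gamma=F_E^\Gamma/\sim$ is the graph $\Gamma$-monoid and $G_E^\Gamma$, its Grothendieck group completion with the induced $\Gamma$-action, is the Grothendieck $\Gamma$-group. The isomorphisms in (7) and (8) are isomorphisms of $\Gamma$-monoids and of $\Gamma$-groups, respectively. An element $a\in F_E^\Gamma$ is periodic if $a\sim x^n a$ for some positive integer $n$. Paths. Vertices are paths of length $0$ (trivial paths). A path $q$ is a prefix of $p$ if $p=qr$ for some (possibly trivial) path $r$. A cycle is a closed path $e_1\cdots e_n$, $n\geq 1$, with $\mathbf s(e_i)\neq \mathbf s(e_j)$ for $i\ne j$. A cycle has an exit if some vertex on it emits an edge which is not on the cycle; $E$ is no-exit if no cycle has an exit. A path ends in a cycle if its range is a vertex of that cycle. An infinite path is a sequence $e_1e_2\ldots$ of edges with $\mathbf r(e_i)=\mathbf s(e_{i+1})$; it ends in a cycle if there are a positive integer $n$ and a cycle $c$ with $e_ne_{n+1}\ldots=cc\ldots$. Connecting. For generators $g,h$ and a path $p$ of $E$, $g$ connects to $h$ by $p$, written $g\rightsquigarrow^p h$, if one of the following holds: $g=v$, $h=w$ are proper and $p$ is a path from $v$ to $w$; $g=v$ is proper, $h=q^w_Z$ and $p$ is a path from $v$ to $w$; $g=q^v_Z$, $h=w$ is proper and $p$ is a path from $v$ to $w$ of positive length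 whose first edge is not in $Z$; $g=q^v_Z$, $h=q^w_W$, $p$ is a path from $v$ to $w$, and either $p$ is trivial (so $v=w$) and $Z\subseteq W$, or $p$ has positive length and its first edge is not in $Z$. The generator $g$ connects to $h$ if $g\rightsquigarrow^p h$ for some $p$, and $g$ is on a cycle if $g\rightsquigarrow^p g$ for some $p$ of positive length. Stationary sets. A finite nonempty set $V$ of generators is stationary if every $g\in V$ is either on a cycle or on a path exiting a cycle which contains some generator $h\in V$ (that is, some $h\in V$ which is on a cycle connects to $g$). The elements of $V$ which are on cycles are the core generators (core vertices) of $V$, and the cycles which contain core generators are the core cycles of $V$. Thus $V$ contains core vertices only if every element of $V$ is on a cycle. Relations between sets. For finite nonempty sets $G$ and $H$ of generators, $G\to H$ means: there are $k\ge|G|$ and $l\ge|H|$ such that the elements of $G$ and $H$ can be indexed as $g_1,\ldots,g_k$ and $h_1,\ldots,h_l$ (with repetitions allowed) respectively, and there is a partition $\{I_1,\ldots,I_k\}$ of $\{1,\ldots,l\}$ and finitely many paths $p_{ij}$, $j\in I_i$, $i=1,\ldots,k$, such that $g_i\rightsquigarrow^{p_{ij}}h_j$ for all $j\in I_i$, $i=1,\ldots,k$, and such that if $p$ is a prefix of $p_{ij}$, $v=\mathbf r(p)$, and $$P_p=\{e\in\mathbf s^{-1}(v)\mid e\text{ is on }p_{ij'}\text{ for some }j'\in I_i\},$$ then: (i) if $v$ is regular and $P_p$ is nonempty, then $P_p=\mathbf s^{-1}(v)$; (ii) if $v$ is an infinite emitter and $P_p$ is nonempty, then there is $j'\in I_i$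 such that $h_{j'}=q_Z^v$ for some $Z$ such that $P_p\subseteq Z$; (iii) if $v$ is an infinite emitter and $h_j=q_Z^v$ for some $Z$, then $P_{p_{ij}}\subseteq Z$. If $V$ is a finite nonempty set of regular vertices and $W$ is a finite nonempty set of proper vertices such that $V\to W$, one writes $V\to^{A1}W$. (In particular, $\{v\}\to^{A1}V$ includes the requirement that $v$ is regular and that $V$ consists of proper vertices.) Algebras. $L_K(E)$ is the $K$-algebra generated by $E^0\cup E^1\cup\{e^*\mid e\in E^1\}$ subject to: $vw=0$ for distinct vertices and $vv=v$; $\mathbf s(e)e=e\mathbf r(e)=e$; $\mathbf r(e)e^*=e^*\mathbf s(e)=e^*$; $e^*f=0$ for $e\neq f$ and $e^*e=\mathbf r(e)$; $v=\sum_{e\in\mathbf s^{-1}(v)}ee^*$ for $v$ regular. It is $\mathbb Z$-graded by letting $pq^*$ ($p,q$ paths) have degree $|p|-|q|$, where $|p|$ is the length of $p$. $K[x^{n},x^{-n}]$ is $\mathbb Z$-graded with $x^{kn}$ in degree $kn$. For a $\mathbb Z$-graded ring $R$, a cardinal $\mu$ and a map $\overline\gamma:\mu\to\mathbb Z$, $\mathbb M_\mu(R)(\overline\gamma)$ is the ring of $\mu\times\mu$ matrices over $R$ with finitely many nonzero entries, graded so that its $\delta$-component consists of the matrices $(a_{\alpha\beta})$ with $a_{\alpha\beta}\in R_{\delta+\overline\gamma(\beta)-\overline\gamma(\alpha)}$. $\mathbb Z^+$ is the monoid of nonnegative integers; $\mathbb Z^+[x]/\langle x^n=1\rangle$ and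 $\mathbb Z[x]/\langle x^n=1\rangle$ are the free commutative monoid and the free abelian group on $1,x,\ldots,x^{n-1}$, with $x\in\Gamma$ acting by multiplication by $x$ subject to $x^n=1$.
   Formalization: In (3), P_p is taken as the edges that directly follow the prefix p on some path p_{ij'}; with "e is on p_{ij'}" read literally, (3) does not imply (5). In (6)–(8) the index sets I and μ_i consist of elements of the type of the algebra, monoid or group, no loss up to bijection. *)

theory Defs
  imports
    "Graph_Theory.Arc_Walk"
    "HOL-Algebra.Free_Abelian_Groups"
    "HOL-Algebra.Module"
    "HOL-Library.Multiset"
    "HOL-Library.Disjoint_Sets"
    "HOL-Library.Sublist"
begin

text \<open>
  Directed graphs are those of \<^locale>\<open>wf_digraph\<close> (arbitrary vertex and arc sets, loops and
  parallel arcs allowed), with \<open>tail\<close> as source map, \<open>head\<close> as range map, and \<open>out_arcs E v\<close> as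
  the set of edges with source \<open>v\<close>. A path from \<open>u\<close> to \<open>v\<close> is a list \<open>p\<close> of edges with
  \<open>pre_digraph.awalk E u p v\<close>; the vertex \<open>u\<close> is recorded separately because \<open>p\<close> may be empty
  (trivial path). The element \<open>x ^ n\<close> of the group \<open>\<Gamma>\<close> is represented by the integer \<open>n\<close>.
\<close>

definition regular :: "('v, 'e) pre_digraph \<Rightarrow> 'v \<Rightarrow> bool" where
  "regular E v \<longleftrightarrow> v \<in> verts E \<and> finite (out_arcs E v) \<and> out_arcs E v \<noteq> {}"

definition sink :: "('v, 'e) pre_digraph \<Rightarrow> 'v \<Rightarrow> bool" where
  "sink E v \<longleftrightarrow> v \<in> verts E \<and> out_arcs E v = {}"

definition inf_emitter :: "('v, 'e) pre_digraph \<Rightarrow> 'v \<Rightarrow> bool" where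
  "inf_emitter E v \<longleftrightarrow> v \<in> verts E \<and> infinite (out_arcs E v)"

definition row_finite :: "('v, 'e) pre_digraph \<Rightarrow> bool" where
  "row_finite E \<longleftrightarrow> \<not> (\<exists>v. inf_emitter E v)"


section \<open>Cycles and infinite paths\<close>

definition cycle_verts :: "('v, 'e) pre_digraph \<Rightarrow> 'e list \<Rightarrow> 'v set" where
  "cycle_verts E c = tail E ` set c"

definition has_exit :: "('v, 'e) pre_digraph \<Rightarrow> 'e list \<Rightarrow> bool" where
  "has_exit E c \<longleftrightarrow> (\<exists>v \<in> cycle_verts E c. \<exists>e \<in> out_arcs E v. e \<notin> set c)"

definition no_exit_graph :: "('v, 'e) pre_digraph \<Rightarrow> bool" where
  "no_exit_graph E \<longleftrightarrow> (\<forall>c. pre_digraph.cycle E c \<longrightarrow> \<not> has_exit E c)"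

definition inf_path :: "('v, 'e) pre_digraph \<Rightarrow> (nat \<Rightarrow> 'e) \<Rightarrow> bool" where
  "inf_path E f \<longleftrightarrow> (\<forall>i. f i \<in> arcs E \<and> head E (f i) = tail E (f (Suc i)))"

definition inf_path_ends_in :: "(nat \<Rightarrow> 'e) \<Rightarrow> 'e list \<Rightarrow> bool" where
  "inf_path_ends_in f c \<longleftrightarrow> (\<exists>n. \<forall>k. f (n + k) = c ! (k mod length c))"


section \<open>The free commutative monoid with action and the congruence\<close>

text \<open>\<open>Improper v Z\<close> is the improper vertex \<open>q_Z\<close> at the infinite emitter \<open>v\<close>.\<close>

datatype ('v, 'e) gen = Proper 'v | Improper 'v "'e set"

definition gens :: "('v, 'e) pre_digraph \<Rightarrow> ('v, 'e) gen set" where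
  "gens E = Proper ` verts E \<union>
     {Improper v Z | v Z. inf_emitter E v \<and> finite Z \<and> Z \<noteq> {} \<and> Z \<subseteq> out_arcs E v}"

text \<open>A finite formal sum of monomials \<open>x ^ m g\<close> is the multiset of the pairs \<open>(m, g)\<close>.\<close>

type_synonym ('v, 'e) formal_sum = "(int \<times> ('v, 'e) gen) multiset"

definition free_gamma :: "('v, 'e) pre_digraph \<Rightarrow> ('v, 'e) formal_sum set" where
  "free_gamma E = {a. snd ` set_mset a \<subseteq> gens E}"

definition shift :: "int \<Rightarrow> ('v, 'e) formal_sum \<Rightarrow> ('v, 'e) formal_sum" where
  "shift n a = {#(n + m, g). (m, g) \<in># a#}"

definition vertex_elem :: "'v \<Rightarrow> ('v, 'e) formal_sum" where
  "vertex_elem v = {#(0, Proper v)#}"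

definition range_sum :: "('v, 'e) pre_digraph \<Rightarrow> int \<Rightarrow> 'e set \<Rightarrow> ('v, 'e) formal_sum" where
  "range_sum E m Z = {#(m, Proper (head E e)). e \<in># mset_set Z#}"

inductive arrow1 :: "('v, 'e) pre_digraph \<Rightarrow> ('v, 'e) formal_sum \<Rightarrow> ('v, 'e) formal_sum \<Rightarrow> bool"
  for E :: "('v, 'e) pre_digraph" where
  A1: "\<lbrakk>a \<in> free_gamma E; regular E v\<rbrakk> \<Longrightarrow>
    arrow1 E (a + {#(m, Proper v)#}) (a + range_sum E (m + 1) (out_arcs E v))"
| A2: "\<lbrakk>a \<in> free_gamma E; inf_emitter E v; finite Z; Z \<noteq> {}; Z \<subseteq> out_arcs E v\<rbrakk> \<Longrightarrow>
    arrow1 E (a + {#(m, Proper v)#}) (a + {#(m, Improper v Z)#} + range_sum E (m + 1) Z)"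
| A3: "\<lbrakk>a \<in> free_gamma E; inf_emitter E v; Z \<noteq> {}; Z \<subset> W; finite W; W \<subseteq> out_arcs E v\<rbrakk> \<Longrightarrow>
    arrow1 E (a + {#(m, Improper v Z)#}) (a + {#(m, Improper v W)#} + range_sum E (m + 1) (W - Z))"

definition arrow :: "('v, 'e) pre_digraph \<Rightarrow> ('v, 'e) formal_sum \<Rightarrow> ('v, 'e) formal_sum \<Rightarrow> bool" where
  "arrow E a b \<longleftrightarrow> a \<in> free_gamma E \<and> (arrow1 E)\<^sup>*\<^sup>* a b"

inductive_set sim :: "('v, 'e) pre_digraph \<Rightarrow> (('v, 'e) formal_sum \<times> ('v, 'e) formal_sum) set"
  for E :: "('v, 'e) pre_digraph" where
  sim_arrow: "arrow E a b \<Longrightarrow> (a, b) \<in> sim E"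
| sim_refl: "a \<in> free_gamma E \<Longrightarrow> (a, a) \<in> sim E"
| sim_sym: "(a, b) \<in> sim E \<Longrightarrow> (b, a) \<in> sim E"
| sim_trans: "\<lbrakk>(a, b) \<in> sim E; (b, c) \<in> sim E\<rbrakk> \<Longrightarrow> (a, c) \<in> sim E"
| sim_add: "\<lbrakk>(a, b) \<in> sim E; (c, d) \<in> sim E\<rbrakk> \<Longrightarrow> (a + c, b + d) \<in> sim E"
| sim_shift: "(a, b) \<in> sim E \<Longrightarrow> (shift n a, shift n b) \<in> sim E"

definition periodic :: "('v, 'e) pre_digraph \<Rightarrow> ('v, 'e) formal_sum \<Rightarrow> bool" where
  "periodic E a \<longleftrightarrow> (\<exists>n::int. n > 0 \<and> (a, shift n a) \<in> sim E)"


section \<open>The graph monoid and its Grothendieck group\<close>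

definition graph_monoid :: "('v, 'e) pre_digraph \<Rightarrow> ('v, 'e) formal_sum set monoid" where
  "graph_monoid E =
    \<lparr>carrier = free_gamma E // sim E,
     monoid.mult = (\<lambda>A B. sim E `` {a + b | a b. a \<in> A \<and> b \<in> B}),
     one = sim E `` {{#}}\<rparr>"

definition graph_monoid_act ::
  "('v, 'e) pre_digraph \<Rightarrow> int \<Rightarrow> ('v, 'e) formal_sum set \<Rightarrow> ('v, 'e) formal_sum set" where
  "graph_monoid_act E n A = sim E `` (shift n ` A)"

text \<open>
  Group completion of a commutative monoid: the class of \<open>(a, b)\<close> is the formal difference
  of \<open>a\<close> and \<open>b\<close>.
\<close>

definition groth_rel :: "'a monoid \<Rightarrow> (('a \<times> 'a) \<times> ('a \<times> 'a)) set" where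
  "groth_rel M = {((a, b), (c, d)).
     a \<in> carrier M \<and> b \<in> carrier M \<and> c \<in> carrier M \<and> d \<in> carrier M \<and>
     (\<exists>k \<in> carrier M. a \<otimes>\<^bsub>M\<^esub> d \<otimes>\<^bsub>M\<^esub> k = c \<otimes>\<^bsub>M\<^esub> b \<otimes>\<^bsub>M\<^esub> k)}"

definition groth_group :: "'a monoid \<Rightarrow> ('a \<times> 'a) set monoid" where
  "groth_group M =
    \<lparr>carrier = (carrier M \<times> carrier M) // groth_rel M,
     monoid.mult = (\<lambda>X Y. groth_rel M ``
       {(a \<otimes>\<^bsub>M\<^esub> c, b \<otimes>\<^bsub>M\<^esub> d) | a b c d. (a, b) \<in> X \<and> (c, d) \<in> Y}),
     one = groth_rel M `` {(\<one>\<^bsub>M\<^esub>, \<one>\<^bsub>M\<^esub>)}\<rparr>"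

definition groth_act ::
  "'a monoid \<Rightarrow> (int \<Rightarrow> 'a \<Rightarrow> 'a) \<Rightarrow> int \<Rightarrow> ('a \<times> 'a) set \<Rightarrow> ('a \<times> 'a) set" where
  "groth_act M act n X = groth_rel M `` (map_prod (act n) (act n) ` X)"

definition gamma_isomorphic ::
  "'a monoid \<Rightarrow> (int \<Rightarrow> 'a \<Rightarrow> 'a) \<Rightarrow> 'b monoid \<Rightarrow> (int \<Rightarrow> 'b \<Rightarrow> 'b) \<Rightarrow> bool" where
  "gamma_isomorphic M actM N actN \<longleftrightarrow>
    (\<exists>h \<in> iso M N. \<forall>n. \<forall>a \<in> carrier M. h (actM n a) = actN n (h a))"


section \<open>Direct sums of cyclic objects\<close>

text \<open>The basis element \<open>x ^ k\<close>, \<open>k < n\<close>, is represented by \<open>k\<close>.\<close>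

definition cyc_shift :: "nat \<Rightarrow> int \<Rightarrow> nat \<Rightarrow> nat" where
  "cyc_shift n m k = nat ((int k + m) mod int n)"

definition cyc_monoid :: "nat \<Rightarrow> nat multiset monoid" where
  "cyc_monoid n = \<lparr>carrier = {A. set_mset A \<subseteq> {..<n}}, monoid.mult = (+), one = {#}\<rparr>"

definition cyc_monoid_act :: "nat \<Rightarrow> int \<Rightarrow> nat multiset \<Rightarrow> nat multiset" where
  "cyc_monoid_act n m = image_mset (cyc_shift n m)"

definition cyc_group :: "nat \<Rightarrow> (nat \<Rightarrow>\<^sub>0 int) monoid" where
  "cyc_group n = free_Abelian_group {..<n}"

definition cyc_group_act :: "nat \<Rightarrow> int \<Rightarrow> (nat \<Rightarrow>\<^sub>0 int) \<Rightarrow> (nat \<Rightarrow>\<^sub>0 int)" where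
  "cyc_group_act n m = frag_extend (\<lambda>k. frag_of (cyc_shift n m k))"

text \<open>
  The library's \<^const>\<open>sum_group\<close> is the subgroup generated by the finitely supported families,
  so it is only usable for groups.
\<close>

definition sum_monoid :: "'i set \<Rightarrow> ('i \<Rightarrow> 'a monoid) \<Rightarrow> ('i \<Rightarrow> 'a) monoid" where
  "sum_monoid I M =
    \<lparr>carrier = {f \<in> \<Pi>\<^sub>E i\<in>I. carrier (M i). finite {i \<in> I. f i \<noteq> \<one>\<^bsub>M i\<^esub>}},
     monoid.mult = (\<lambda>f g. \<lambda>i\<in>I. f i \<otimes>\<^bsub>M i\<^esub> g i),
     one = (\<lambda>i\<in>I. \<one>\<^bsub>M i\<^esub>)\<rparr>"

definition sum_act ::
  "'i set \<Rightarrow> ('i \<Rightarrow> int \<Rightarrow> 'a \<Rightarrow> 'a) \<Rightarrow> int \<Rightarrow> ('i \<Rightarrow> 'a) \<Rightarrow> ('i \<Rightarrow> 'a)" where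
  "sum_act I act m f = (\<lambda>i\<in>I. act i m (f i))"


section \<open>Connecting generators and stationary sets\<close>

fun gen_base :: "('v, 'e) gen \<Rightarrow> 'v" where
  "gen_base (Proper v) = v"
| "gen_base (Improper v Z) = v"

fun connects_aux :: "('v, 'e) gen \<Rightarrow> 'e list \<Rightarrow> ('v, 'e) gen \<Rightarrow> bool" where
  "connects_aux (Proper v) p h \<longleftrightarrow> True"
| "connects_aux (Improper v Z) p (Proper w) \<longleftrightarrow> p \<noteq> [] \<and> hd p \<notin> Z"
| "connects_aux (Improper v Z) p (Improper w W) \<longleftrightarrow> (p = [] \<and> Z \<subseteq> W) \<or> (p \<noteq> [] \<and> hd p \<notin> Z)"

definition connects_by ::
  "('v, 'e) pre_digraph \<Rightarrow> ('v, 'e) gen \<Rightarrow> 'e list \<Rightarrow> ('v, 'e) gen \<Rightarrow> bool" where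
  "connects_by E g p h \<longleftrightarrow> g \<in> gens E \<and> h \<in> gens E \<and>
     pre_digraph.awalk E (gen_base g) p (gen_base h) \<and> connects_aux g p h"

definition connects :: "('v, 'e) pre_digraph \<Rightarrow> ('v, 'e) gen \<Rightarrow> ('v, 'e) gen \<Rightarrow> bool" where
  "connects E g h \<longleftrightarrow> (\<exists>p. connects_by E g p h)"

definition on_cycle :: "('v, 'e) pre_digraph \<Rightarrow> ('v, 'e) gen \<Rightarrow> bool" where
  "on_cycle E g \<longleftrightarrow> (\<exists>p. p \<noteq> [] \<and> connects_by E g p g)"

definition stationary :: "('v, 'e) pre_digraph \<Rightarrow> ('v, 'e) gen set \<Rightarrow> bool" where
  "stationary E V \<longleftrightarrow> finite V \<and> V \<noteq> {} \<and> V \<subseteq> gens E \<and>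
     (\<forall>g \<in> V. on_cycle E g \<or> (\<exists>h \<in> V. on_cycle E h \<and> connects E h g))"

definition core :: "('v, 'e) pre_digraph \<Rightarrow> ('v, 'e) gen set \<Rightarrow> ('v, 'e) gen set" where
  "core E V = {g \<in> V. on_cycle E g}"

text \<open>
  A cycle contains the generator \<open>g\<close> if, started at a suitable vertex, it connects \<open>g\<close> to itself.
  For a proper vertex this just says that the vertex is on the cycle.
\<close>

definition cycle_contains :: "('v, 'e) pre_digraph \<Rightarrow> 'e list \<Rightarrow> ('v, 'e) gen \<Rightarrow> bool" where
  "cycle_contains E c g \<longleftrightarrow> (\<exists>k. connects_by E g (rotate k c) g)"

definition core_cycle :: "('v, 'e) pre_digraph \<Rightarrow> ('v, 'e) gen set \<Rightarrow> 'e list \<Rightarrow> bool" where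
  "core_cycle E V c \<longleftrightarrow> pre_digraph.cycle E c \<and> (\<exists>g \<in> core E V. cycle_contains E c g)"


section \<open>The arrow relation on finite sets of generators\<close>

text \<open>
  \<open>next_edges E v q S\<close> is the set \<open>P_q\<close> of the edges with source \<open>v\<close> (the range of \<open>q\<close>) which
  are on some path in \<open>S\<close>, where ``on'' refers to the position after the prefix \<open>q\<close>: the edge
  has to follow \<open>q\<close> on that path. Without this a path passing through \<open>v\<close> twice could use up the
  edges of \<open>v\<close> on different visits. For example, if \<open>v\<close> emits exactly a loop \<open>e\<close> and an edge
  \<open>f\<close> to \<open>w\<close>, then the single path \<open>ef\<close> would yield \<open>{v} \<rightarrow> {w}\<close>, although no iteration of
  (A1) replaces \<open>v\<close> by copies of \<open>w\<close> alone.
\<close>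

definition next_edges ::
  "('v, 'e) pre_digraph \<Rightarrow> 'v \<Rightarrow> 'e list \<Rightarrow> 'e list set \<Rightarrow> 'e set" where
  "next_edges E v q S = {e \<in> out_arcs E v. \<exists>r \<in> S. prefix (q @ [e]) r}"

definition set_arrow ::
  "('v, 'e) pre_digraph \<Rightarrow> ('v, 'e) gen set \<Rightarrow> ('v, 'e) gen set \<Rightarrow> bool" where
  "set_arrow E G H \<longleftrightarrow>
     finite G \<and> G \<noteq> {} \<and> G \<subseteq> gens E \<and> finite H \<and> H \<noteq> {} \<and> H \<subseteq> gens E \<and>
     (\<exists>gs hs I p.
        set gs = G \<and> set hs = H \<and>
        inj_on I {..<length gs} \<and> partition_on {..<length hs} (I ` {..<length gs}) \<and>
        (\<forall>i < length gs. \<forall>j \<in> I i.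
           connects_by E (gs ! i) (p i j) (hs ! j) \<and>
           (\<forall>q v. prefix q (p i j) \<and> pre_digraph.awalk E (gen_base (gs ! i)) q v \<longrightarrow>
              (let P = (\<lambda>q. next_edges E v q (p i ` I i)) in
                (regular E v \<and> P q \<noteq> {} \<longrightarrow> P q = out_arcs E v) \<and>
                (inf_emitter E v \<and> P q \<noteq> {} \<longrightarrow>
                   (\<exists>j' \<in> I i. \<exists>Z. hs ! j' = Improper v Z \<and> P q \<subseteq> Z)) \<and>
                (inf_emitter E v \<longrightarrow>
                   (\<forall>Z. hs ! j = Improper v Z \<longrightarrow> P (p i j) \<subseteq> Z))))))"

definition set_arrow_A1 ::
  "('v, 'e) pre_digraph \<Rightarrow> ('v, 'e) gen set \<Rightarrow> ('v, 'e) gen set \<Rightarrow> bool" where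
  "set_arrow_A1 E V W \<longleftrightarrow>
     V \<subseteq> Proper ` {v. regular E v} \<and> W \<subseteq> Proper ` verts E \<and> set_arrow E V W"


section \<open>Graded algebras\<close>

text \<open>
  The algebras below need not be unital. The record field \<open>one\<close> is inherited from the library's
  record and plays no role; it is left \<open>undefined\<close> where there need not be a unit.
\<close>

record ('k, 'a) graded_algebra = "('k, 'a) module" +
  component :: "int \<Rightarrow> 'a set"

definition graded_isomorphic ::
  "'k ring \<Rightarrow> ('k, 'a) graded_algebra \<Rightarrow> ('k, 'b) graded_algebra \<Rightarrow> bool" where
  "graded_isomorphic K A B \<longleftrightarrow>
    (\<exists>h. bij_betw h (carrier A) (carrier B) \<and>
         (\<forall>a \<in> carrier A. \<forall>b \<in> carrier A. h (a \<oplus>\<^bsub>A\<^esub> b) = h a \<oplus>\<^bsub>B\<^esub> h b) \<and>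
         (\<forall>a \<in> carrier A. \<forall>b \<in> carrier A. h (a \<otimes>\<^bsub>A\<^esub> b) = h a \<otimes>\<^bsub>B\<^esub> h b) \<and>
         (\<forall>k \<in> carrier K. \<forall>a \<in> carrier A. h (k \<odot>\<^bsub>A\<^esub> a) = k \<odot>\<^bsub>B\<^esub> h a) \<and>
         (\<forall>d. h ` component A d = component B d))"

text \<open>
  The algebra \<open>K[x ^ n, x ^ (-n)]\<close>; a Laurent polynomial in \<open>x\<close> is its coefficient function.
\<close>

definition laurent_algebra :: "'k ring \<Rightarrow> nat \<Rightarrow> ('k, int \<Rightarrow> 'k) graded_algebra" where
  "laurent_algebra K n =
    (let C = {a. (\<forall>k. a k \<in> carrier K) \<and> finite {k. a k \<noteq> \<zero>\<^bsub>K\<^esub>} \<and>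
                 (\<forall>k. a k \<noteq> \<zero>\<^bsub>K\<^esub> \<longrightarrow> int n dvd k)}
     in \<lparr>carrier = C,
         monoid.mult = (\<lambda>a b k. \<Oplus>\<^bsub>K\<^esub>i\<in>{i. a i \<noteq> \<zero>\<^bsub>K\<^esub>}. a i \<otimes>\<^bsub>K\<^esub> b (k - i)),
         one = (\<lambda>k. if k = 0 then \<one>\<^bsub>K\<^esub> else \<zero>\<^bsub>K\<^esub>),
         zero = (\<lambda>k. \<zero>\<^bsub>K\<^esub>),
         add = (\<lambda>a b k. a k \<oplus>\<^bsub>K\<^esub> b k),
         smult = (\<lambda>c a k. c \<otimes>\<^bsub>K\<^esub> a k),
         component = (\<lambda>d. {a \<in> C. \<forall>k. a k \<noteq> \<zero>\<^bsub>K\<^esub> \<longrightarrow> k = d})\<rparr>)"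

definition matrix_algebra ::
  "('k, 'a) graded_algebra \<Rightarrow> 'm set \<Rightarrow> ('m \<Rightarrow> int) \<Rightarrow> ('k, 'm \<Rightarrow> 'm \<Rightarrow> 'a) graded_algebra" where
  "matrix_algebra R \<mu> \<gamma> =
    (let C = {A. (\<forall>\<alpha> \<in> \<mu>. \<forall>\<beta> \<in> \<mu>. A \<alpha> \<beta> \<in> carrier R) \<and>
                 (\<forall>\<alpha> \<beta>. \<not> (\<alpha> \<in> \<mu> \<and> \<beta> \<in> \<mu>) \<longrightarrow> A \<alpha> \<beta> = \<zero>\<^bsub>R\<^esub>) \<and>
                 finite {(\<alpha>, \<beta>). A \<alpha> \<beta> \<noteq> \<zero>\<^bsub>R\<^esub>}}
     in \<lparr>carrier = C,
         monoid.mult = (\<lambda>A B \<alpha> \<beta>. \<Oplus>\<^bsub>R\<^esub>\<kappa>\<in>{\<kappa> \<in> \<mu>. A \<alpha> \<kappa> \<noteq> \<zero>\<^bsub>R\<^esub>}. A \<alpha> \<kappa> \<otimes>\<^bsub>R\<^esub> B \<kappa> \<beta>),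
         one = undefined,
         zero = (\<lambda>\<alpha> \<beta>. \<zero>\<^bsub>R\<^esub>),
         add = (\<lambda>A B \<alpha> \<beta>. A \<alpha> \<beta> \<oplus>\<^bsub>R\<^esub> B \<alpha> \<beta>),
         smult = (\<lambda>c A \<alpha> \<beta>. c \<odot>\<^bsub>R\<^esub> A \<alpha> \<beta>),
         component = (\<lambda>\<delta>. {A \<in> C. \<forall>\<alpha> \<in> \<mu>. \<forall>\<beta> \<in> \<mu>. A \<alpha> \<beta> \<in> component R (\<delta> + \<gamma> \<beta> - \<gamma> \<alpha>)})\<rparr>)"

definition sum_algebra ::
  "'i set \<Rightarrow> ('i \<Rightarrow> ('k, 'a) graded_algebra) \<Rightarrow> ('k, 'i \<Rightarrow> 'a) graded_algebra" where
  "sum_algebra I A =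
    (let C = {f \<in> \<Pi>\<^sub>E i\<in>I. carrier (A i). finite {i \<in> I. f i \<noteq> \<zero>\<^bsub>A i\<^esub>}}
     in \<lparr>carrier = C,
         monoid.mult = (\<lambda>f g. \<lambda>i\<in>I. f i \<otimes>\<^bsub>A i\<^esub> g i),
         one = undefined,
         zero = (\<lambda>i\<in>I. \<zero>\<^bsub>A i\<^esub>),
         add = (\<lambda>f g. \<lambda>i\<in>I. f i \<oplus>\<^bsub>A i\<^esub> g i),
         smult = (\<lambda>c f. \<lambda>i\<in>I. c \<odot>\<^bsub>A i\<^esub> f i),
         component = (\<lambda>d. {f \<in> C. \<forall>i \<in> I. f i \<in> component (A i) d})\<rparr>)"


section \<open>Leavitt path algebras\<close>

text \<open>
  The algebra given by generators and relations is the set of algebra terms over the generators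
  modulo the least congruence containing the (non-unital, associative) algebra laws over \<open>K\<close> and
  the defining relations. Negation is multiplication by the scalar \<open>-1\<close>.
\<close>

datatype ('k, 'v, 'e) lterm =
    Vert 'v
  | Edge 'e
  | Ghost 'e
  | LZero
  | LAdd "('k, 'v, 'e) lterm" "('k, 'v, 'e) lterm"
  | LMult "('k, 'v, 'e) lterm" "('k, 'v, 'e) lterm"
  | LScale 'k "('k, 'v, 'e) lterm"

inductive_set lterms :: "'k ring \<Rightarrow> ('v, 'e) pre_digraph \<Rightarrow> ('k, 'v, 'e) lterm set"
  for K :: "'k ring" and E :: "('v, 'e) pre_digraph" where
  "v \<in> verts E \<Longrightarrow> Vert v \<in> lterms K E"
| "e \<in> arcs E \<Longrightarrow> Edge e \<in> lterms K E"
| "e \<in> arcs E \<Longrightarrow> Ghost e \<in> lterms K E"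
| "LZero \<in> lterms K E"
| "\<lbrakk>s \<in> lterms K E; t \<in> lterms K E\<rbrakk> \<Longrightarrow> LAdd s t \<in> lterms K E"
| "\<lbrakk>s \<in> lterms K E; t \<in> lterms K E\<rbrakk> \<Longrightarrow> LMult s t \<in> lterms K E"
| "\<lbrakk>a \<in> carrier K; t \<in> lterms K E\<rbrakk> \<Longrightarrow> LScale a t \<in> lterms K E"

definition lsum :: "('k, 'v, 'e) lterm list \<Rightarrow> ('k, 'v, 'e) lterm" where
  "lsum ts = foldr LAdd ts LZero"

inductive_set lpa_rel ::
  "'k ring \<Rightarrow> ('v, 'e) pre_digraph \<Rightarrow> (('k, 'v, 'e) lterm \<times> ('k, 'v, 'e) lterm) set"
  for K :: "'k ring" and E :: "('v, 'e) pre_digraph" where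
  refl: "t \<in> lterms K E \<Longrightarrow> (t, t) \<in> lpa_rel K E"
| sym: "(s, t) \<in> lpa_rel K E \<Longrightarrow> (t, s) \<in> lpa_rel K E"
| trans: "\<lbrakk>(s, t) \<in> lpa_rel K E; (t, u) \<in> lpa_rel K E\<rbrakk> \<Longrightarrow> (s, u) \<in> lpa_rel K E"
| cong_add: "\<lbrakk>(s, s') \<in> lpa_rel K E; (t, t') \<in> lpa_rel K E\<rbrakk> \<Longrightarrow>
    (LAdd s t, LAdd s' t') \<in> lpa_rel K E"
| cong_mult: "\<lbrakk>(s, s') \<in> lpa_rel K E; (t, t') \<in> lpa_rel K E\<rbrakk> \<Longrightarrow>
    (LMult s t, LMult s' t') \<in> lpa_rel K E"
| cong_scale: "\<lbrakk>a \<in> carrier K; (s, t) \<in> lpa_rel K E\<rbrakk> \<Longrightarrow> (LScale a s, LScale a t) \<in> lpa_rel K E"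
| add_assoc: "\<lbrakk>s \<in> lterms K E; t \<in> lterms K E; u \<in> lterms K E\<rbrakk> \<Longrightarrow>
    (LAdd (LAdd s t) u, LAdd s (LAdd t u)) \<in> lpa_rel K E"
| add_comm: "\<lbrakk>s \<in> lterms K E; t \<in> lterms K E\<rbrakk> \<Longrightarrow> (LAdd s t, LAdd t s) \<in> lpa_rel K E"
| add_zero: "t \<in> lterms K E \<Longrightarrow> (LAdd LZero t, t) \<in> lpa_rel K E"
| scale_zero: "t \<in> lterms K E \<Longrightarrow> (LScale \<zero>\<^bsub>K\<^esub> t, LZero) \<in> lpa_rel K E"
| scale_one: "t \<in> lterms K E \<Longrightarrow> (LScale \<one>\<^bsub>K\<^esub> t, t) \<in> lpa_rel K E"
| scale_scale: "\<lbrakk>a \<in> carrier K; b \<in> carrier K; t \<in> lterms K E\<rbrakk> \<Longrightarrow>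
    (LScale (a \<otimes>\<^bsub>K\<^esub> b) t, LScale a (LScale b t)) \<in> lpa_rel K E"
| scale_add_left: "\<lbrakk>a \<in> carrier K; b \<in> carrier K; t \<in> lterms K E\<rbrakk> \<Longrightarrow>
    (LScale (a \<oplus>\<^bsub>K\<^esub> b) t, LAdd (LScale a t) (LScale b t)) \<in> lpa_rel K E"
| scale_add_right: "\<lbrakk>a \<in> carrier K; s \<in> lterms K E; t \<in> lterms K E\<rbrakk> \<Longrightarrow>
    (LScale a (LAdd s t), LAdd (LScale a s) (LScale a t)) \<in> lpa_rel K E"
| mult_assoc: "\<lbrakk>s \<in> lterms K E; t \<in> lterms K E; u \<in> lterms K E\<rbrakk> \<Longrightarrow>
    (LMult (LMult s t) u, LMult s (LMult t u)) \<in> lpa_rel K E"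
| distrib_left: "\<lbrakk>s \<in> lterms K E; t \<in> lterms K E; u \<in> lterms K E\<rbrakk> \<Longrightarrow>
    (LMult s (LAdd t u), LAdd (LMult s t) (LMult s u)) \<in> lpa_rel K E"
| distrib_right: "\<lbrakk>s \<in> lterms K E; t \<in> lterms K E; u \<in> lterms K E\<rbrakk> \<Longrightarrow>
    (LMult (LAdd s t) u, LAdd (LMult s u) (LMult t u)) \<in> lpa_rel K E"
| scale_mult_left: "\<lbrakk>a \<in> carrier K; s \<in> lterms K E; t \<in> lterms K E\<rbrakk> \<Longrightarrow>
    (LMult (LScale a s) t, LScale a (LMult s t)) \<in> lpa_rel K E"
| scale_mult_right: "\<lbrakk>a \<in> carrier K; s \<in> lterms K E; t \<in> lterms K E\<rbrakk> \<Longrightarrow>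
    (LMult s (LScale a t), LScale a (LMult s t)) \<in> lpa_rel K E"
| vertex_idem: "v \<in> verts E \<Longrightarrow> (LMult (Vert v) (Vert v), Vert v) \<in> lpa_rel K E"
| vertex_orth: "\<lbrakk>v \<in> verts E; w \<in> verts E; v \<noteq> w\<rbrakk> \<Longrightarrow> (LMult (Vert v) (Vert w), LZero) \<in> lpa_rel K E"
| source_edge: "e \<in> arcs E \<Longrightarrow> (LMult (Vert (tail E e)) (Edge e), Edge e) \<in> lpa_rel K E"
| edge_range: "e \<in> arcs E \<Longrightarrow> (LMult (Edge e) (Vert (head E e)), Edge e) \<in> lpa_rel K E"
| range_ghost: "e \<in> arcs E \<Longrightarrow> (LMult (Vert (head E e)) (Ghost e), Ghost e) \<in> lpa_rel K E"
| ghost_source: "e \<in> arcs E \<Longrightarrow> (LMult (Ghost e) (Vert (tail E e)), Ghost e) \<in> lpa_rel K E"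
| CK1_orth: "\<lbrakk>e \<in> arcs E; f \<in> arcs E; e \<noteq> f\<rbrakk> \<Longrightarrow> (LMult (Ghost e) (Edge f), LZero) \<in> lpa_rel K E"
| CK1: "e \<in> arcs E \<Longrightarrow> (LMult (Ghost e) (Edge e), Vert (head E e)) \<in> lpa_rel K E"
| CK2: "\<lbrakk>regular E v; distinct es; set es = out_arcs E v\<rbrakk> \<Longrightarrow>
    (Vert v, lsum (map (\<lambda>e. LMult (Edge e) (Ghost e)) es)) \<in> lpa_rel K E"

text \<open>\<open>path_term u p\<close> and \<open>ghost_term u p\<close> are \<open>p\<close> and \<open>p*\<close> for a path \<open>p\<close> with source \<open>u\<close>.\<close>

fun path_term :: "'v \<Rightarrow> 'e list \<Rightarrow> ('k, 'v, 'e) lterm" where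
  "path_term u [] = Vert u"
| "path_term u [e] = Edge e"
| "path_term u (e # f # p) = LMult (Edge e) (path_term u (f # p))"

fun ghost_term :: "'v \<Rightarrow> 'e list \<Rightarrow> ('k, 'v, 'e) lterm" where
  "ghost_term u [] = Vert u"
| "ghost_term u [e] = Ghost e"
| "ghost_term u (e # f # p) = LMult (ghost_term u (f # p)) (Ghost e)"

inductive_set lpa_homogeneous ::
  "'k ring \<Rightarrow> ('v, 'e) pre_digraph \<Rightarrow> int \<Rightarrow> ('k, 'v, 'e) lterm set"
  for K :: "'k ring" and E :: "('v, 'e) pre_digraph" and d :: int where
  "\<lbrakk>pre_digraph.awalk E u p w; pre_digraph.awalk E u' q w; int (length p) - int (length q) = d\<rbrakk> \<Longrightarrow>
    LMult (path_term u p) (ghost_term u' q) \<in> lpa_homogeneous K E d"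
| "LZero \<in> lpa_homogeneous K E d"
| "\<lbrakk>s \<in> lpa_homogeneous K E d; t \<in> lpa_homogeneous K E d\<rbrakk> \<Longrightarrow> LAdd s t \<in> lpa_homogeneous K E d"
| "\<lbrakk>a \<in> carrier K; t \<in> lpa_homogeneous K E d\<rbrakk> \<Longrightarrow> LScale a t \<in> lpa_homogeneous K E d"

definition leavitt ::
  "'k ring \<Rightarrow> ('v, 'e) pre_digraph \<Rightarrow> ('k, ('k, 'v, 'e) lterm set) graded_algebra" where
  "leavitt K E =
    \<lparr>carrier = lterms K E // lpa_rel K E,
     monoid.mult = (\<lambda>A B. lpa_rel K E `` {LMult s t | s t. s \<in> A \<and> t \<in> B}),
     one = undefined,
     zero = lpa_rel K E `` {LZero},
     add = (\<lambda>A B. lpa_rel K E `` {LAdd s t | s t. s \<in> A \<and> t \<in> B}),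
     smult = (\<lambda>a A. lpa_rel K E `` (LScale a ` A)),
     component = (\<lambda>d. (\<lambda>t. lpa_rel K E `` {t}) ` lpa_homogeneous K E d)\<rparr>"


section \<open>Equivalence of a list of statements\<close>

text \<open>
  In the theorem, ``any field'' ranges over the fields with carrier in an arbitrary type; a type
  with one element is excluded there because it carries no field at all. The index sets of the
  direct sums and matrices are sets of elements of the algebra, monoid or group in question. This
  is no restriction: distinct cyclic summands have distinct generators, distinct nonzero matrix
  summands contain distinct diagonal matrix units, and distinct rows give distinct diagonal matrix
  units. A cardinal is represented by an index set \<open>\<mu>\<close> of that cardinality.
\<close>

definition all_equivalent :: "bool list \<Rightarrow> bool" where
  "all_equivalent Ps \<longleftrightarrow> (\<forall>P \<in> set Ps. \<forall>Q \<in> set Ps. P \<longleftrightarrow> Q)"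

end

theory Submission
  imports Defs
begin

text \<open>
  Every condition is compared with condition (5), packaged as the locale \<open>tame_graph\<close>.  In such a
  graph every walk runs into a cycle without exits, and the walks from \<open>v\<close> up to the first of the chosen
  base vertices on the cycles form a finite set, obtained by prolonging the corresponding walks of the
  ranges of the edges leaving \<open>v\<close>.  Expanding vertices along these walks and reducing exponents
  modulo the cycle lengths is a complete invariant of \<open>\<sim>\<close>, which gives (7).  The matrix units of (6) are
  \<open>p c ^ j q*\<close> with \<open>p\<close>, \<open>q\<close> such walks and \<open>c\<close> the cycle at their end; their independence is seen in
  the action of the algebra on functions on boundary paths.

  Conversely, (8) gives \<open>x ^ n v + k \<sim> v + k\<close> for some \<open>k\<close>.  The coefficients obtained by iterating
  (A1) are invariant under \<open>\<sim>\<close> and cancellative, so far down they are those of \<open>v\<close> shifted by \<open>n\<close>.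
  This excludes sinks, infinite emitters and exits, and lowers walk lengths by \<open>n\<close>, which makes
  infinite paths recur.  In (6), multiplication by \<open>x ^ N\<close> in the finitely many blocks met by \<open>v\<close> yields a
  homogeneous element of degree \<open>N\<close> invertible in the corner of \<open>v\<close>, whose action on boundary paths again
  lowers walk lengths; exits are excluded because the degree \<open>0\<close> part of that corner is finite-dimensional.
\<close>

section \<open>Closed walks and infinite paths\<close>

text \<open>Under (5) everything rests on termination. An infinite path ends in a cycle, a cycle
  without exits is followed without choice, so the path meets the base vertex of that cycle; hence
  moving along edges that leave non-base vertices is well-founded, and most facts about such graphs
  are inductions on this relation. In the converse direction the obstacle is that nothing is known
  about the graph, and (8) gives equality only after adding an unknown \<open>k\<close>, possibly
  with improper vertices. The invariant therefore takes integer values and is defined on improper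
  vertices as well, so that \<open>k\<close> can be subtracted; equality is only eventual because
  each use of (A1) costs one round. Periodicity is the special case \<open>k = 0\<close>, so one
  argument serves (1), (2), (7) and (8). The boundary paths include finite ones that stop at a sink
  or an infinite emitter, because the algebra has to act before these are excluded. The integer
  stored with a path is needed because a power of a cycle \<open>c\<close> fixes the path
  \<open>ccc...\<close>; without it the powers of \<open>c\<close> could not be told apart.\<close>

context wf_digraph
begin

definition on_closed :: "'a \<Rightarrow> bool" where
  "on_closed v \<longleftrightarrow> (\<exists>p. p \<noteq> [] \<and> awalk v p v)"

lemma on_closed_in_verts: "on_closed v \<Longrightarrow> v \<in> verts G"
  by (auto simp: on_closed_def)

lemma on_closed_reachable1: "on_closed v \<longleftrightarrow> v \<rightarrow>\<^sup>+ v"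
  by (auto simp: on_closed_def reachable1_awalk)

text \<open>A shortest nontrivial closed walk at \<open>v\<close> is a cycle: a vertex repeated
  after the first edge would allow a loop to be cut out, which leaves a shorter closed walk at
  \<open>v\<close>.\<close>

lemma on_closed_imp_cycle:
  assumes "on_closed v"
  obtains c where "pre_digraph.cycle G c" "awalk v c v"
proof -
  obtain p0 where "p0 \<noteq> [] \<and> awalk v p0 v" using assms by (auto simp: on_closed_def)
  from ex_has_least_nat[of "\<lambda>p. p \<noteq> [] \<and> awalk v p v", OF this, of length]
  obtain p where p: "p \<noteq> []" "awalk v p v"
    and least: "\<And>q. q \<noteq> [] \<Longrightarrow> awalk v q v \<Longrightarrow> length p \<le> length q"
    by auto
  obtain e es where pe: "p = e # es" using p by (cases p) auto
  have w: "awalk (head G e) es v" and e: "e \<in> arcs G" "tail G e = v"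
    using p pe by (auto simp: awalk_Cons_iff)
  have "distinct (awalk_verts (head G e) es)"
  proof (rule ccontr)
    assume "\<not> distinct (awalk_verts (head G e) es)"
    from awalk_not_distinct_decomp[OF w this] obtain q r s x where
      "es = q @ r @ s" "0 < length r" "awalk (head G e) q x" "awalk x s v" by metis
    then have "awalk v (e # q @ s) v" "length (e # q @ s) < length p"
      using e pe by (auto simp: awalk_Cons_iff intro: awalk_appendI)
    then show False using least[of "e # q @ s"] by auto
  qed
  then have "pre_digraph.cycle G p"
    using p pe e by (auto simp: cycle_altdef closed_w_def cycle_def)
  then show ?thesis using that p by blast
qed

lemma awalk_nth_tail: "awalk u p v \<Longrightarrow> j < length p \<Longrightarrow> p ! j \<in> arcs G"
  by (auto simp: awalk_def)

lemma awalk_head_nth: "awalk u p v \<Longrightarrow> Suc j < length p \<Longrightarrow> head G (p ! j) = tail G (p ! Suc j)"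
proof (induction p arbitrary: u j)
  case (Cons e p)
  then show ?case by (cases j; cases p) (auto simp: awalk_Cons_iff)
qed simp

lemma awalk_head_last: "awalk u p v \<Longrightarrow> p \<noteq> [] \<Longrightarrow> head G (last p) = v"
  by (induction p arbitrary: u) (auto simp: awalk_Cons_iff awalk_Nil_iff)

lemma closed_walk_nth:
  assumes "awalk u c u" "c \<noteq> []" "j < length c"
  shows "head G (c ! j) = tail G (c ! (Suc j mod length c))"
proof (cases "Suc j = length c")
  case True
  then have "c ! j = last c" using assms by (metis diff_Suc_1 last_conv_nth)
  moreover have "tail G (c ! 0) = u" using assms by (cases c) (auto simp: awalk_Cons_iff)
  ultimately show ?thesis using True assms awalk_head_last[OF assms(1,2)] by simp
next
  case False
  then show ?thesis using assms awalk_head_nth[OF assms(1)] by simp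
qed

text \<open>The definition of a cycle makes the heads of its edges distinct. For a closed walk the
  multisets of heads and of tails agree, so the tails are distinct as well.\<close>

lemma cycle_edge_unique:
  assumes "pre_digraph.cycle G c" "e \<in> set c" "e' \<in> set c" "tail G e = tail G e'"
  shows "e = e'"
proof -
  obtain u where u: "awalk u c u" "distinct (tl (awalk_verts u c))" "c \<noteq> []"
    using assms(1) by (auto simp: cycle_def)
  have cas: "cas u c u" using u by blast
  have hd: "distinct (map (head G) c)"
    using u(2,3) awalk_verts_conv'[OF cas] by simp
  have "awalk_verts u c = map (tail G) c @ [u]"
    using awalk_verts_conv[of u c] u(3) awalk_head_last[OF u(1,3)] by simp
  moreover have "awalk_verts u c = u # map (head G) c"
    using awalk_verts_conv'[OF cas] u(1,3) by (cases c) (auto simp: awalk_Cons_iff)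
  ultimately have "mset (map (tail G) c @ [u]) = mset (u # map (head G) c)" by simp
  then have "mset (map (tail G) c) = mset (map (head G) c)" by simp
  then have "distinct (map (tail G) c)" using hd mset_eq_imp_distinct_iff by blast
  then show ?thesis using assms by (auto simp: distinct_map inj_on_def)
qed

lemma cycle_verts_on_closed:
  assumes "pre_digraph.cycle G c" "v \<in> cycle_verts G c"
  shows "on_closed v"
proof -
  obtain u where u: "awalk u c u" "c \<noteq> []" using assms(1) by (auto simp: cycle_def)
  have v: "v \<in> set (awalk_verts u c)"
    using assms(2) awalk_verts_arc1 by (auto simp: cycle_verts_def)
  have "u \<rightarrow>\<^sup>+ u" using u by (auto simp: reachable1_awalk)
  moreover have "u \<rightarrow>\<^sup>* v" "v \<rightarrow>\<^sup>* u"
    using awalk_verts_reachable_from[OF u(1) v] awalk_verts_reachable_to[OF u(1) v] by auto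
  ultimately show ?thesis unfolding on_closed_reachable1
    by (meson reachable_reachable1_trans reachable1_reachable_trans)
qed

lemma no_exit_unique_edge:
  assumes "pre_digraph.cycle G c" "\<not> has_exit G c" "v \<in> cycle_verts G c"
    "e \<in> out_arcs G v" "e' \<in> out_arcs G v"
  shows "e = e'"
  using assms cycle_edge_unique[OF assms(1), of e e'] by (auto simp: has_exit_def out_arcs_def)

lemma closed_walk_start: "awalk v c v \<Longrightarrow> c \<noteq> [] \<Longrightarrow> v \<in> cycle_verts G c"
  by (cases c) (auto simp: awalk_Cons_iff cycle_verts_def)

text \<open>The cycle through \<open>v\<close> has one edge at \<open>v\<close>, and any further
  edge would be an exit. Rotating the cycle by this edge gives a closed walk at its head.\<close>

lemma on_closed_out_arcs:
  assumes "no_exit_graph G" "on_closed v"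
  obtains e where "out_arcs G v = {e}" "on_closed (head G e)" "head G e \<rightarrow>\<^sup>* v"
proof -
  obtain c where c: "pre_digraph.cycle G c" "awalk v c v" using assms(2) on_closed_imp_cycle by blast
  then have "c \<noteq> []" by (auto simp: cycle_def)
  then obtain e es where ce: "c = e # es" by (cases c) auto
  have e: "e \<in> out_arcs G v" and w: "awalk (head G e) es v"
    using c(2) ce by (auto simp: awalk_Cons_iff)
  have "out_arcs G v = {e}"
    using no_exit_unique_edge[OF c(1)] assms(1) c closed_walk_start[OF c(2) \<open>c \<noteq> []\<close>] e
    by (auto simp: no_exit_graph_def)
  moreover have "awalk (head G e) (es @ [e]) (head G e)"
    using w e by (intro awalk_appendI[of _ _ v]) (auto simp: awalk_simps)
  then have "on_closed (head G e)" by (auto simp: on_closed_def)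
  ultimately show ?thesis using that w by (auto simp: reachable_awalk)
qed

lemma inf_path_awalk:
  assumes "inf_path G f" "i \<le> j"
  shows "awalk (tail G (f i)) (map f [i..<j]) (tail G (f j))"
  using assms(2)
proof (induction j rule: dec_induct)
  case base
  then show ?case using assms(1) by (auto simp: awalk_Nil_iff inf_path_def)
next
  case (step j)
  have "awalk (tail G (f j)) [f j] (tail G (f (Suc j)))"
    using assms(1) by (auto simp: awalk_simps inf_path_def)
  then show ?case using step by (auto intro: awalk_appendI)
qed

text \<open>Induction on \<open>k\<close>: the tail of the next edge is a vertex of
  \<open>c\<close>, where \<open>det\<close> leaves only the edge of \<open>c\<close>. The index is
  taken modulo the length because the closed walk starts over.\<close>

lemma closed_walk_follow:
  assumes "inf_path G f" "awalk (tail G (f i)) c (tail G (f i))" "c \<noteq> []"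
    and det: "\<And>v e e'. v \<in> cycle_verts G c \<Longrightarrow> e \<in> out_arcs G v \<Longrightarrow> e' \<in> out_arcs G v \<Longrightarrow> e = e'"
  shows "f (i + k) = c ! (k mod length c)"
proof (induction k)
  case 0
  show ?case
    using assms det[of "tail G (f i)" "f i" "c ! 0"] closed_walk_start[OF assms(2,3)]
    by (cases c) (auto simp: awalk_Cons_iff inf_path_def)
next
  case (Suc k)
  let ?l = "length c"
  have "tail G (f (i + Suc k)) = head G (c ! (k mod ?l))"
    using Suc assms(1) by (metis add_Suc_right inf_path_def)
  also have "\<dots> = tail G (c ! (Suc k mod ?l))"
    using closed_walk_nth[OF assms(2,3), of "k mod ?l"] assms(3) by (simp add: mod_Suc_eq)
  finally have t: "tail G (f (i + Suc k)) = tail G (c ! (Suc k mod ?l))" .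
  have "Suc k mod ?l < ?l" using assms(3) by simp
  then have c: "c ! (Suc k mod ?l) \<in> set c" "c ! (Suc k mod ?l) \<in> arcs G"
    using awalk_nth_tail[OF assms(2)] by auto
  show ?case
    using det[of "tail G (c ! (Suc k mod ?l))" "f (i + Suc k)" "c ! (Suc k mod ?l)"] c t assms(1)
    by (auto simp: cycle_verts_def inf_path_def)
qed

text \<open>The segment between the two visits is a closed walk, so the vertex is on a cycle, and
  without exits the path has no choice but to follow that cycle from \<open>i\<close> on.\<close>

lemma inf_path_repeat:
  assumes "no_exit_graph G" "inf_path G f" "i < j" "tail G (f i) = tail G (f j)"
  obtains c where "pre_digraph.cycle G c" "inf_path_ends_in f c"
proof -
  have "awalk (tail G (f i)) (map f [i..<j]) (tail G (f i))"
    using inf_path_awalk[OF assms(2), of i j] assms(3,4) by simp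
  then have "on_closed (tail G (f i))" using assms(3) unfolding on_closed_def
    by (intro exI[of _ "map f [i..<j]"]) auto
  then obtain c where c: "pre_digraph.cycle G c" "awalk (tail G (f i)) c (tail G (f i))"
    using on_closed_imp_cycle by blast
  have "\<not> has_exit G c" using assms(1) c by (auto simp: no_exit_graph_def)
  then have "f (i + k) = c ! (k mod length c)" for k
    using c closed_walk_follow[OF assms(2) c(2)] no_exit_unique_edge[OF c(1)]
    by (metis cycle_def)
  then show ?thesis using that c by (auto simp: inf_path_ends_in_def)
qed

text \<open>One turn of \<open>c\<close> after position \<open>n\<close> brings back the same edge,
  so this segment is a closed walk.\<close>

lemma inf_path_ends_on_closed:
  assumes "inf_path G f" "pre_digraph.cycle G c" "inf_path_ends_in f c"
  obtains n where "\<And>k. f (n + k) = c ! (k mod length c)" "on_closed (tail G (f n))"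
proof -
  obtain n where n: "\<And>k. f (n + k) = c ! (k mod length c)"
    using assms(3) by (auto simp: inf_path_ends_in_def)
  have l: "length c > 0" using assms(2) by (auto simp: cycle_def)
  have "f n = f (n + length c)" using n[of 0] n[of "length c"] by simp
  then have "awalk (tail G (f n)) (map f [n..<n + length c]) (tail G (f n))"
    using inf_path_awalk[OF assms(1), of n "n + length c"] by simp
  then have "on_closed (tail G (f n))" using l unfolding on_closed_def
    by (intro exI[of _ "map f [n..<n + length c]"]) auto
  then show ?thesis using that n by blast
qed

lemma infinite_path_from:
  assumes "\<And>v. v \<in> verts G \<Longrightarrow> out_arcs G v \<noteq> {}" "v \<in> verts G"
  obtains f where "inf_path G f" "tail G (f 0) = v"
proof -
  define nxt where "nxt = (\<lambda>u. SOME e. e \<in> out_arcs G u)"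
  have nxt: "nxt u \<in> arcs G" "tail G (nxt u) = u" if "u \<in> verts G" for u
    using some_in_eq[of "out_arcs G u"] assms(1)[OF that] by (auto simp: nxt_def)
  define u where "u = rec_nat v (\<lambda>_ x. head G (nxt x))"
  have u: "u 0 = v" "\<And>i. u (Suc i) = head G (nxt (u i))" by (auto simp: u_def)
  have uv: "u i \<in> verts G" for i
    by (induction i) (use u assms(2) nxt in auto)
  show ?thesis
    by (rule that[of "\<lambda>i. nxt (u i)"]) (use nxt uv u in \<open>auto simp: inf_path_def\<close>)
qed

lemma cycle_power_path:
  assumes "awalk u c u" "c \<noteq> []"
  shows "inf_path G (\<lambda>k. c ! (k mod length c))"
  unfolding inf_path_def
proof
  fix i
  have "i mod length c < length c" using assms by simp
  then show "c ! (i mod length c) \<in> arcs G \<and>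
      head G (c ! (i mod length c)) = tail G (c ! (Suc i mod length c))"
    using closed_walk_nth[OF assms, of "i mod length c"] awalk_nth_tail[OF assms(1)]
    by (simp add: mod_Suc_eq)
qed

text \<open>The cycle with no exits in which the path \<open>ccc\<dots>\<close> ends has the same edges as \<open>c\<close>.\<close>

lemma no_exit_graphI:
  assumes "\<And>f. inf_path G f \<Longrightarrow> \<exists>c. pre_digraph.cycle G c \<and> \<not> has_exit G c \<and> inf_path_ends_in f c"
  shows "no_exit_graph G"
  unfolding no_exit_graph_def
proof (intro allI impI)
  fix c assume c: "pre_digraph.cycle G c"
  then obtain u where u: "awalk u c u" "c \<noteq> []" by (auto simp: cycle_def)
  let ?l = "length c"
  define f where "f = (\<lambda>k. c ! (k mod ?l))"
  have f: "inf_path G f" unfolding f_def by (rule cycle_power_path[OF u])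
  obtain d where d: "pre_digraph.cycle G d" "\<not> has_exit G d" "inf_path_ends_in f d"
    using assms[OF f] by blast
  then obtain n where n: "\<And>k. f (n + k) = d ! (k mod length d)"
    by (auto simp: inf_path_ends_in_def)
  have dl: "length d > 0" using d(1) by (auto simp: cycle_def)
  have "set d \<subseteq> set c"
  proof
    fix e assume "e \<in> set d"
    then obtain k where k: "k < length d" "e = d ! k" by (auto simp: in_set_conv_nth)
    then have "e = f (n + k)" using n[of k] by simp
    then show "e \<in> set c" using u by (auto simp: f_def)
  qed
  moreover have "set c \<subseteq> set d"
  proof
    fix e assume "e \<in> set c"
    then obtain j where j: "j < ?l" "e = c ! j" by (auto simp: in_set_conv_nth)
    \<comment> \<open>The position \<open>j + n * ?l\<close> carries the edge \<open>c ! j\<close>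
      and is at least \<open>n\<close>. It is written as \<open>n\<close> plus an offset so that the
      description of \<open>f\<close> by \<open>d\<close> applies; this bound keeps the natural
      subtraction exact.\<close>
    have "n \<le> n * ?l" using u by (cases c) simp_all
    then have "n + (n * ?l - n + j) = j + n * ?l" by linarith
    then have "e = f (n + (n * ?l - n + j))" using j by (simp add: f_def del: add_diff_assoc)
    then show "e \<in> set d" using n dl by auto
  qed
  ultimately show "\<not> has_exit G c" using d(2) by (auto simp: has_exit_def cycle_verts_def)
qed

end


section \<open>Return vertices of cycles\<close>

locale tame_graph = wf_digraph +
  assumes regular: "v \<in> verts G \<Longrightarrow> regular G v"
    and no_exit: "no_exit_graph G"
    and ends: "inf_path G f \<Longrightarrow> \<exists>c. pre_digraph.cycle G c \<and> inf_path_ends_in f c"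
begin

text \<open>\<open>base\<close> chooses one vertex on each cycle.\<close>

definition base :: "'a \<Rightarrow> 'a" where
  "base v = (SOME w. v \<rightarrow>\<^sup>* w \<and> w \<rightarrow>\<^sup>* v)"

definition Bases :: "'a set" where
  "Bases = base ` {v. on_closed v}"

lemma base_reachable:
  assumes "on_closed v"
  shows "v \<rightarrow>\<^sup>* base v" "base v \<rightarrow>\<^sup>* v"
proof -
  have "v \<rightarrow>\<^sup>* v \<and> v \<rightarrow>\<^sup>* v" using on_closed_in_verts[OF assms] by auto
  from someI[of "\<lambda>w. v \<rightarrow>\<^sup>* w \<and> w \<rightarrow>\<^sup>* v", OF this]
  show "v \<rightarrow>\<^sup>* base v" "base v \<rightarrow>\<^sup>* v" unfolding base_def by auto
qed

text \<open>Mutually reachable vertices satisfy equivalent predicates, so the choice operator picks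
  the same vertex for both. Hence the base depends on the cycle and not on the vertex of it.\<close>

lemma base_eq: "u \<rightarrow>\<^sup>* v \<Longrightarrow> v \<rightarrow>\<^sup>* u \<Longrightarrow> base u = base v"
  unfolding base_def by (rule arg_cong[where f=Eps]) (auto intro: reachable_trans)

lemma base_idem: "on_closed v \<Longrightarrow> base (base v) = base v"
  using base_eq base_reachable by metis

text \<open>Edges at a vertex on a closed walk are forced, so a walk that starts there never leaves
  the cycle and can always be completed back to its start.\<close>

lemma on_closed_walk:
  assumes "awalk v p w" "on_closed v"
  shows "on_closed w \<and> w \<rightarrow>\<^sup>* v"
  using assms
proof (induction p arbitrary: v)
  case Nil
  then show ?case by (auto simp: awalk_Nil_iff)
next
  case (Cons e p)
  obtain e' where e': "out_arcs G v = {e'}" "on_closed (head G e')" "head G e' \<rightarrow>\<^sup>* v"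
    using on_closed_out_arcs[OF no_exit Cons.prems(2)] .
  have e: "e \<in> out_arcs G v" "awalk (head G e) p w" using Cons.prems(1) by (auto simp: awalk_Cons_iff)
  have "e = e'" using e(1) e'(1) by blast
  then have "on_closed w \<and> w \<rightarrow>\<^sup>* head G e'" using Cons.IH e(2) e'(2) by blast
  then show ?case using e'(3) reachable_trans by blast
qed

lemma Bases_on_closed: "b \<in> Bases \<Longrightarrow> on_closed b"
  unfolding Bases_def using base_reachable(1) on_closed_walk by (fastforce simp: reachable_awalk)

lemma Bases_in_verts: "b \<in> Bases \<Longrightarrow> b \<in> verts G"
  by (simp add: Bases_on_closed on_closed_in_verts)

lemma base_Bases: "b \<in> Bases \<Longrightarrow> base b = b"
  by (auto simp: Bases_def base_idem)

definition non_base_step :: "('a \<times> 'a) set" where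
  "non_base_step = {(head G e, tail G e) | e. e \<in> arcs G \<and> tail G e \<notin> Bases}"

text \<open>A descending chain is an infinite path that avoids base vertices. It ends in a cycle,
  from where it is forced along every walk, in particular along the walk to the base vertex of that
  cycle.\<close>

lemma wf_non_base_step: "wf non_base_step"
  unfolding wf_iff_no_infinite_down_chain
proof
  assume "\<exists>s. \<forall>i. (s (Suc i), s i) \<in> non_base_step"
  then obtain s where "\<forall>i. \<exists>e. s (Suc i) = head G e \<and> s i = tail G e \<and> e \<in> arcs G \<and> tail G e \<notin> Bases"
    unfolding non_base_step_def by blast
  then obtain f where f: "\<And>i. s (Suc i) = head G (f i) \<and> s i = tail G (f i) \<and> f i \<in> arcs G \<and>
      tail G (f i) \<notin> Bases"
    by metis
  then have ip: "inf_path G f" unfolding inf_path_def by metis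
  obtain c n where n: "on_closed (tail G (f n))"
    using ends[OF ip] inf_path_ends_on_closed[OF ip] by metis
  have follow: "tail G (f (m + length p)) = w" if "awalk (tail G (f m)) p w" "on_closed (tail G (f m))"
    for m p w
    using that
  proof (induction p arbitrary: m)
    case Nil
    then show ?case by (auto simp: awalk_Nil_iff)
  next
    case (Cons e p)
    obtain e' where e': "out_arcs G (tail G (f m)) = {e'}" "on_closed (head G e')"
      using on_closed_out_arcs[OF no_exit Cons.prems(2)] .
    have e: "e \<in> out_arcs G (tail G (f m))" "awalk (head G e) p w"
      using Cons.prems(1) by (auto simp: awalk_Cons_iff)
    have "f m \<in> out_arcs G (tail G (f m))" using f[of m] by simp
    then have "e = e'" "awalk (head G e) p w" "f m = e'" using e e'(1) by blast+
    moreover have "tail G (f (Suc m)) = head G (f m)" using ip by (simp add: inf_path_def)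
    ultimately show ?case using Cons.IH[of "Suc m"] e' by simp
  qed
  obtain p where "awalk (tail G (f n)) p (base (tail G (f n)))"
    using base_reachable(1)[OF n] by (auto simp: reachable_awalk)
  from follow[OF this n] have "tail G (f (n + length p)) \<in> Bases" using n by (auto simp: Bases_def)
  then show False using f by blast
qed

lemma vertex_induct [consumes 1, case_names base step]:
  assumes "v \<in> verts G"
    and "\<And>v. v \<in> Bases \<Longrightarrow> P v"
    and "\<And>v. v \<in> verts G \<Longrightarrow> v \<notin> Bases \<Longrightarrow> (\<And>e. e \<in> out_arcs G v \<Longrightarrow> P (head G e)) \<Longrightarrow> P v"
  shows "P v"
  using wf_non_base_step assms(1)
proof (induction v rule: wf_induct_rule)
  case (less v)
  show ?case
  proof (cases "v \<in> Bases")
    case False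
    then have "(head G e, v) \<in> non_base_step" if "e \<in> out_arcs G v" for e
      using that by (auto simp: non_base_step_def)
    then show ?thesis using assms(3)[OF less.prems False] less.IH by auto
  qed (rule assms(2))
qed

lemma finite_out: "v \<in> verts G \<Longrightarrow> finite (out_arcs G v)"
  and out_nonempty: "v \<in> verts G \<Longrightarrow> out_arcs G v \<noteq> {}"
  using regular by (auto simp: regular_def)

text \<open>Walks stopped at the first base vertex. The end vertex is recorded because the empty
  walk does not determine it.\<close>

definition base_walks :: "'a \<Rightarrow> ('b list \<times> 'a) set" where
  "base_walks v = {(p, b). b \<in> Bases \<and> awalk v p b \<and> (\<forall>e \<in> set p. tail G e \<notin> Bases)}"

lemma base_walks_base: "b \<in> Bases \<Longrightarrow> base_walks b = {([], b)}"
proof -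
  assume b: "b \<in> Bases"
  have "p = []" if "awalk b p b'" "\<forall>e \<in> set p. tail G e \<notin> Bases" for p b'
    using that b by (cases p) (auto simp: awalk_Cons_iff)
  then show ?thesis using b Bases_in_verts[OF b]
    by (fastforce simp: base_walks_def awalk_Nil_iff)
qed

lemma base_walks_step:
  assumes "v \<notin> Bases"
  shows "base_walks v = (\<Union>e \<in> out_arcs G v. (\<lambda>(p, b). (e # p, b)) ` base_walks (head G e))"
    (is "_ = ?R")
proof
  show "base_walks v \<subseteq> ?R"
  proof
    fix x assume x: "x \<in> base_walks v"
    obtain p b where xp: "x = (p, b)" by (cases x)
    then obtain e q where "p = e # q"
      using x assms by (cases p) (auto simp: base_walks_def awalk_Nil_iff)
    then show "x \<in> ?R" using x xp by (force simp: base_walks_def awalk_Cons_iff)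
  qed
  show "?R \<subseteq> base_walks v" using assms by (auto simp: base_walks_def awalk_Cons_iff)
qed

text \<open>Koenig's lemma in inductive form: each vertex emits finitely many edges and the
  induction is well-founded.\<close>

lemma finite_base_walks: "v \<in> verts G \<Longrightarrow> finite (base_walks v)"
  by (induction v rule: vertex_induct)
    (auto simp: base_walks_base base_walks_step finite_out)

lemma base_walks_nonempty: "v \<in> verts G \<Longrightarrow> base_walks v \<noteq> {}"
proof (induction v rule: vertex_induct)
  case (step v)
  obtain e where "e \<in> out_arcs G v" using out_nonempty[OF step.hyps(1)] by blast
  then show ?case using step by (auto simp: base_walks_step)
qed (simp add: base_walks_base)

text \<open>There is a single edge to follow at each step, and all vertices of the cycle share their
  base vertex, so the walk to it is unique.\<close>

lemma base_walks_on_closed: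
  assumes "on_closed v"
  shows "\<exists>q. base_walks v = {(q, base v)}"
  using on_closed_in_verts[OF assms] assms
proof (induction v rule: vertex_induct)
  case (base v)
  then show ?case by (simp add: base_walks_base base_Bases)
next
  case (step v)
  obtain e where e: "out_arcs G v = {e}" "on_closed (head G e)" "head G e \<rightarrow>\<^sup>* v"
    using on_closed_out_arcs[OF no_exit step.prems] .
  have "v \<rightarrow>\<^sup>* head G e"
    using e(1) by (metis awalk_Cons_iff awalk_Nil_iff head_in_verts in_out_arcs_conv insertI1 reachable_awalk)
  then have "base (head G e) = base v" using base_eq e by blast
  then show ?case using step.IH[of e] e step.hyps by (auto simp: base_walks_step)
qed

definition base_edge :: "'a \<Rightarrow> 'b" where
  "base_edge b = (THE e. out_arcs G b = {e})"

text \<open>At \<open>b\<close> itself \<open>base_walks\<close> stops at once. The cycle is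
  therefore obtained from its first edge and the only base walk of the head of this edge.\<close>

definition base_return :: "'a \<Rightarrow> 'b list" where
  "base_return b = (THE q. base_walks (head G (base_edge b)) = {(q, b)})"

lemma base_out_arcs: "b \<in> Bases \<Longrightarrow> out_arcs G b = {base_edge b}"
  and base_return: "b \<in> Bases \<Longrightarrow> base_walks (head G (base_edge b)) = {(base_return b, b)}"
proof -
  assume b: "b \<in> Bases"
  obtain e where e: "out_arcs G b = {e}" "on_closed (head G e)" "head G e \<rightarrow>\<^sup>* b"
    using on_closed_out_arcs[OF no_exit Bases_on_closed[OF b]] .
  have be: "base_edge b = e" using e(1) by (simp add: base_edge_def)
  then show "out_arcs G b = {base_edge b}" using e by simp
  have "b \<rightarrow>\<^sup>* head G e"
    using e(1) by (metis awalk_Cons_iff awalk_Nil_iff head_in_verts in_out_arcs_conv insertI1 reachable_awalk)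
  then have "base (head G e) = b" using base_eq e base_Bases[OF b] by metis
  then obtain q where "base_walks (head G e) = {(q, b)}" using base_walks_on_closed[OF e(2)] by metis
  then show "base_walks (head G (base_edge b)) = {(base_return b, b)}"
    by (simp add: be base_return_def)
qed

definition base_cycle :: "'a \<Rightarrow> 'b list" where
  "base_cycle b = base_edge b # base_return b"

definition period :: "'a \<Rightarrow> nat" where
  "period b = length (base_cycle b)"

lemma period_pos: "period b > 0"
  by (simp add: period_def base_cycle_def)

lemma base_edge_in: "b \<in> Bases \<Longrightarrow> base_edge b \<in> arcs G \<and> tail G (base_edge b) = b"
  using base_out_arcs[of b] by (metis in_out_arcs_conv insertI1)

lemma base_return_walk: "b \<in> Bases \<Longrightarrow> awalk (head G (base_edge b)) (base_return b) b \<and>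
    (\<forall>e \<in> set (base_return b). tail G e \<notin> Bases)"
  using base_return[of b] by (auto simp: base_walks_def)

lemma base_cycle_walk: "b \<in> Bases \<Longrightarrow> awalk b (base_cycle b) b"
  using base_edge_in[of b] base_return_walk[of b] by (auto simp: base_cycle_def awalk_Cons_iff)

end


section \<open>A cancellative invariant of the congruence\<close>

lemma free_gamma_empty [simp]: "{#} \<in> free_gamma E"
  by (simp add: free_gamma_def)

lemma free_gamma_add [simp]: "a + b \<in> free_gamma E \<longleftrightarrow> a \<in> free_gamma E \<and> b \<in> free_gamma E"
  by (auto simp: free_gamma_def)

lemma free_gamma_add_mset [simp]:
  "add_mset (m, g) a \<in> free_gamma E \<longleftrightarrow> g \<in> gens E \<and> a \<in> free_gamma E"
  by (auto simp: free_gamma_def)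

lemma shift_add: "shift n (a + b) = shift n a + shift n b"
  by (simp add: shift_def)

lemma shift_free_gamma [simp]: "shift n a \<in> free_gamma E \<longleftrightarrow> a \<in> free_gamma E"
  by (simp add: free_gamma_def shift_def image_image case_prod_beta)

text \<open>\<open>level_coeff E k m v j w\<close> is the coefficient of \<open>x ^ j w\<close> after \<open>k\<close> rounds of (A1) applied to
  \<open>x ^ m v\<close>; sinks and infinite emitters are left alone.\<close>

primrec level_coeff :: "('v, 'e) pre_digraph \<Rightarrow> nat \<Rightarrow> int \<Rightarrow> 'v \<Rightarrow> int \<Rightarrow> 'v \<Rightarrow> int" where
  "level_coeff E 0 m v j w = of_bool (m = j \<and> v = w)"
| "level_coeff E (Suc k) m v j w =
    (if regular E v then \<Sum>e\<in>out_arcs E v. level_coeff E k (m + 1) (head E e) j w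
     else of_bool (m = j \<and> v = w))"

text \<open>In the Grothendieck group \<open>q_Z\<close> is the difference of \<open>v\<close> and the ranges of the edges in \<open>Z\<close>.\<close>

fun gen_coeff :: "('v, 'e) pre_digraph \<Rightarrow> int \<Rightarrow> int \<times> ('v, 'e) gen \<Rightarrow> int \<Rightarrow> 'v \<Rightarrow> int" where
  "gen_coeff E N (m, Proper v) j w = level_coeff E (nat (N - m)) m v j w"
| "gen_coeff E N (m, Improper v Z) j w = level_coeff E (nat (N - m)) m v j w
    - (\<Sum>e\<in>Z. level_coeff E (nat (N - (m + 1))) (m + 1) (head E e) j w)"

definition sum_coeff :: "('v, 'e) pre_digraph \<Rightarrow> int \<Rightarrow> ('v, 'e) formal_sum \<Rightarrow> int \<Rightarrow> 'v \<Rightarrow> int" where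
  "sum_coeff E N a j w = (\<Sum>x\<in>#a. gen_coeff E N x j w)"

lemma sum_coeff_add: "sum_coeff E N (a + b) j w = sum_coeff E N a j w + sum_coeff E N b j w"
  by (simp add: sum_coeff_def)

lemma sum_coeff_add_mset:
  "sum_coeff E N (add_mset x a) j w = gen_coeff E N x j w + sum_coeff E N a j w"
  by (simp add: sum_coeff_def)

lemma sum_coeff_single: "sum_coeff E N {#x#} j w = gen_coeff E N x j w"
  by (simp add: sum_coeff_def)

lemma sum_coeff_range_sum:
  "sum_coeff E N (range_sum E m Z) j w = (\<Sum>e\<in>Z. level_coeff E (nat (N - m)) m (head E e) j w)"
  by (simp add: sum_coeff_def range_sum_def sum_unfold_sum_mset multiset.map_comp comp_def)

text \<open>\<open>x ^ m v\<close> undergoes \<open>N - m\<close> rounds, so that everything is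
  expanded up to the absolute exponent \<open>N\<close>. (A1) anticipates one of these rounds, which
  must be available; (A2) and (A3) hold for every \<open>N\<close>, since the coefficients of
  \<open>q_Z\<close> are defined as the difference that (A2) prescribes.\<close>

lemma arrow1_sum_coeff:
  assumes "arrow1 E a b"
  shows "\<exists>N0. \<forall>N\<ge>N0. \<forall>j w. sum_coeff E N a j w = sum_coeff E N b j w"
  using assms
proof cases
  case (A1 a v m)
  have "nat (N - m) = Suc (nat (N - (m + 1)))" if "N \<ge> m + 1" for N using that by simp
  then show ?thesis using A1
    by (intro exI[of _ "m + 1"]) (simp add: sum_coeff_add sum_coeff_add_mset sum_coeff_range_sum)
next
  case (A2 a v Z m)
  then show ?thesis
    by (simp add: sum_coeff_add sum_coeff_add_mset sum_coeff_range_sum)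
next
  case (A3 a v Z W m)
  then have "sum f W = sum f Z + sum f (W - Z)" for f :: "'b \<Rightarrow> int"
    using sum.subset_diff[of Z W f] by auto
  then show ?thesis using A3
    by (simp add: sum_coeff_add sum_coeff_add_mset sum_coeff_range_sum)
qed

lemma level_coeff_shift:
  "level_coeff E k (n + m) v j w = level_coeff E k m v (j - n) w"
proof (induction k arbitrary: m v)
  case (Suc k)
  then show ?case using Suc.IH[of "m + 1"] by (simp add: add.assoc algebra_simps)
qed auto

lemma gen_coeff_shift:
  "gen_coeff E N (n + m, g) j w = gen_coeff E (N - n) (m, g) (j - n) w"
  by (cases g) (simp_all add: add.assoc level_coeff_shift diff_diff_eq)

lemma sum_coeff_shift: "sum_coeff E N (shift n a) j w = sum_coeff E (N - n) a (j - n) w"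
  by (simp add: sum_coeff_def shift_def multiset.map_comp comp_def case_prod_beta gen_coeff_shift)

text \<open>Finitely many steps lead from \<open>a\<close> to \<open>b\<close>, so thresholds can be
  combined by maxima; shifting by \<open>n\<close> moves a threshold by \<open>n\<close>.\<close>

lemma sim_sum_coeff:
  assumes "(a, b) \<in> sim E"
  shows "\<exists>N0. \<forall>N\<ge>N0. \<forall>j w. sum_coeff E N a j w = sum_coeff E N b j w"
  using assms
proof induction
  case (sim_arrow a b)
  then have "(arrow1 E)\<^sup>*\<^sup>* a b" by (simp add: arrow_def)
  then show ?case
  proof induction
    case (step b c)
    obtain N0 where "\<forall>N\<ge>N0. \<forall>j w. sum_coeff E N a j w = sum_coeff E N b j w" using step.IH by blast
    moreover obtain N1 where "\<forall>N\<ge>N1. \<forall>j w. sum_coeff E N b j w = sum_coeff E N c j w"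
      using arrow1_sum_coeff[OF step.hyps(2)] by blast
    ultimately show ?case by (intro exI[of _ "max N0 N1"]) simp
  qed simp
next
  case (sim_trans a b c)
  obtain N0 where "\<forall>N\<ge>N0. \<forall>j w. sum_coeff E N a j w = sum_coeff E N b j w" using sim_trans.IH by blast
  moreover obtain N1 where "\<forall>N\<ge>N1. \<forall>j w. sum_coeff E N b j w = sum_coeff E N c j w"
    using sim_trans.IH by blast
  ultimately show ?case by (intro exI[of _ "max N0 N1"]) simp
next
  case (sim_add a b c d)
  obtain N0 where "\<forall>N\<ge>N0. \<forall>j w. sum_coeff E N a j w = sum_coeff E N b j w" using sim_add.IH by blast
  moreover obtain N1 where "\<forall>N\<ge>N1. \<forall>j w. sum_coeff E N c j w = sum_coeff E N d j w"
    using sim_add.IH by blast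
  ultimately show ?case by (intro exI[of _ "max N0 N1"]) (simp add: sum_coeff_add)
next
  case (sim_shift a b n)
  obtain N0 where "\<forall>N\<ge>N0. \<forall>j w. sum_coeff E N a j w = sum_coeff E N b j w"
    using sim_shift.IH by blast
  then show ?case by (intro exI[of _ "N0 + n"]) (simp add: sum_coeff_shift)
qed fastforce+

text \<open>Equality of \<open>x ^ n a\<close> and \<open>a\<close> in the Grothendieck group for
  some positive \<open>n\<close>, expressed in the monoid.\<close>

definition stably_periodic :: "('v, 'e) pre_digraph \<Rightarrow> ('v, 'e) formal_sum \<Rightarrow> bool" where
  "stably_periodic E a \<longleftrightarrow> (\<exists>n>0. \<exists>k. (a + k, shift n a + k) \<in> sim E)"

text \<open>The arrow rules require only the common summand on the left side to lie in the free
  monoid; on the right sides, heads of edges have to be vertices.\<close>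

lemma sim_free_gamma:
  assumes "wf_digraph E" "(a, b) \<in> sim E"
  shows "a \<in> free_gamma E \<and> b \<in> free_gamma E"
proof -
  have rs: "range_sum E m Z \<in> free_gamma E" if "Z \<subseteq> arcs E" for m Z
  proof -
    have "set_mset (mset_set Z) \<subseteq> Z" by (cases "finite Z") auto
    then have "e \<in> arcs E" if "e \<in># mset_set Z" for e using that \<open>Z \<subseteq> arcs E\<close> by blast
    then show ?thesis using wf_digraph.head_in_verts[OF assms(1)]
      by (auto simp: range_sum_def free_gamma_def gens_def)
  qed
  have step: "b \<in> free_gamma E" if "arrow1 E a b" for a b
    using that
  proof cases
    case (A1 a v m)
    have "out_arcs E v \<subseteq> arcs E" by (auto simp: out_arcs_def)
    then show ?thesis using A1(2,3) rs by simp
  next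
    case (A2 a v Z m)
    have "Z \<subseteq> arcs E" using A2(7) by (auto simp: out_arcs_def)
    moreover have "Improper v Z \<in> gens E" using A2(4-7) by (auto simp: gens_def)
    ultimately show ?thesis using A2(2,3) rs by simp
  next
    case (A3 a v Z W m)
    have "W - Z \<subseteq> arcs E" using A3(8) by (auto simp: out_arcs_def)
    moreover have "Improper v W \<in> gens E" using A3(4-8) by (auto simp: gens_def)
    ultimately show ?thesis using A3(2,3) rs by simp
  qed
  have star: "b \<in> free_gamma E" if "(arrow1 E)\<^sup>*\<^sup>* a b" "a \<in> free_gamma E" for a b
    using that by induction (auto intro: step)
  show ?thesis using assms(2)
    by (induction rule: sim.induct) (auto simp: arrow_def star)
qed

lemma periodic_imp_stably_periodic: "periodic E a \<Longrightarrow> stably_periodic E a"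
  unfolding periodic_def stably_periodic_def by (metis add.right_neutral)

text \<open>The summand \<open>k\<close> cancels because the coefficients are integers. Expanding up
  to the absolute exponent \<open>n + N\<close> takes \<open>n + N\<close> rounds for
  \<open>v\<close> but only \<open>N\<close> rounds for \<open>x ^ n v\<close>.\<close>

lemma stably_periodic_level_coeff:
  assumes "stably_periodic E (vertex_elem v)"
  obtains n N0 :: nat where "n > 0"
    "\<And>N j w. N \<ge> N0 \<Longrightarrow> level_coeff E (n + N) 0 v j w = level_coeff E N 0 v (j - int n) w"
proof -
  obtain n k where n: "n > 0" "(vertex_elem v + k, shift n (vertex_elem v) + k) \<in> sim E"
    using assms by (auto simp: stably_periodic_def)
  obtain N0 where N0: "\<forall>N\<ge>N0. \<forall>j w. sum_coeff E N (vertex_elem v + k) j w =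
      sum_coeff E N (shift n (vertex_elem v) + k) j w"
    using sim_sum_coeff[OF n(2)] by blast
  have "level_coeff E (nat n + N) 0 v j w = level_coeff E N 0 v (j - int (nat n)) w"
    if "N \<ge> nat N0" for N j w
  proof -
    have "n + int N \<ge> N0" using that n(1) by linarith
    then have "sum_coeff E (n + int N) (vertex_elem v) j w =
        sum_coeff E (n + int N) (shift n (vertex_elem v)) j w"
      using N0 by (simp add: sum_coeff_add)
    then show ?thesis using n(1)
      by (simp add: sum_coeff_shift vertex_elem_def sum_coeff_single nat_add_distrib)
  qed
  then show ?thesis using that[of "nat n" "nat N0"] n(1) by simp
qed

context wf_digraph
begin

text \<open>A vertex that is not regular is never expanded: its coefficient stays at exponent 0,
  whatever the number of rounds, while periodicity would move it to exponent
  \<open>n\<close>.\<close>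

lemma stably_periodic_regular:
  assumes "stably_periodic G (vertex_elem v)" "v \<in> verts G"
  shows "regular G v"
proof (rule ccontr)
  assume v: "\<not> regular G v"
  obtain n N0 :: nat where n: "n > 0"
    "\<And>N j w. N \<ge> N0 \<Longrightarrow> level_coeff G (n + N) 0 v j w = level_coeff G N 0 v (j - int n) w"
    using stably_periodic_level_coeff[OF assms(1)] by metis
  have "level_coeff G k 0 v j v = of_bool (j = 0)" for k j
    using v by (cases k) auto
  then show False using n(2)[of N0 0 v] n(1) by simp
qed

section \<open>Counting walks when every vertex is regular\<close>

primrec walk_count :: "nat \<Rightarrow> 'a \<Rightarrow> int" where
  "walk_count 0 v = 1"
| "walk_count (Suc k) v = (\<Sum>e\<in>out_arcs G v. walk_count k (head G e))"

context
  assumes reg: "\<And>v. v \<in> verts G \<Longrightarrow> regular G v"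
begin

lemma level_coeff_nonneg: "level_coeff G k m v j w \<ge> 0"
  by (induction k arbitrary: m v) (auto intro!: sum_nonneg)

text \<open>With all vertices regular, \<open>k\<close> rounds consume exactly \<open>k\<close>
  edges, so the coefficient of \<open>w\<close> counts the walks of length \<open>k\<close> from
  \<open>v\<close> to \<open>w\<close>; only whether it vanishes is recorded.\<close>

lemma level_coeff_pos_iff:
  "v \<in> verts G \<Longrightarrow> level_coeff G k m v (m + int k) w > 0 \<longleftrightarrow> (\<exists>p. awalk v p w \<and> length p = k)"
proof (induction k arbitrary: m v)
  case 0
  then show ?case by (auto simp: awalk_Nil_iff)
next
  case (Suc k)
  have fin: "finite (out_arcs G v)" using reg[OF Suc.prems] by (simp add: regular_def)
  have "level_coeff G (Suc k) m v (m + int (Suc k)) w > 0 \<longleftrightarrow>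
      (\<exists>e\<in>out_arcs G v. level_coeff G k (m + 1) (head G e) ((m + 1) + int k) w > 0)"
    using reg[OF Suc.prems] fin level_coeff_nonneg
    by (simp add: sum_nonneg_eq_0_iff less_le sum_nonneg add_ac)
  also have "\<dots> \<longleftrightarrow> (\<exists>e\<in>out_arcs G v. \<exists>p. awalk (head G e) p w \<and> length p = k)"
    using Suc.IH by (intro bex_cong) auto
  also have "\<dots> \<longleftrightarrow> (\<exists>p. awalk v p w \<and> length p = Suc k)"
  proof
    assume "\<exists>e\<in>out_arcs G v. \<exists>p. awalk (head G e) p w \<and> length p = k"
    then obtain e p where "e \<in> out_arcs G v" "awalk (head G e) p w" "length p = k" by blast
    then show "\<exists>p. awalk v p w \<and> length p = Suc k"
      by (intro exI[of _ "e # p"]) (auto simp: awalk_Cons_iff)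
  next
    assume "\<exists>p. awalk v p w \<and> length p = Suc k"
    then obtain e p where "e \<in> out_arcs G v" "awalk (head G e) p w" "length p = k"
      by (auto simp: awalk_Cons_iff length_Suc_conv)
    then show "\<exists>e\<in>out_arcs G v. \<exists>p. awalk (head G e) p w \<and> length p = k" by blast
  qed
  finally show ?case .
qed

text \<open>Summing over the ends \<open>w\<close> turns coefficients into the number of all walks.
  The support is given as a set \<open>S\<close> that may be enlarged, so that sums with different
  supports can be compared over one index set.\<close>

lemma walk_count_sum:
  "v \<in> verts G \<Longrightarrow> \<exists>S. finite S \<and> (\<forall>T m. finite T \<longrightarrow> S \<subseteq> T \<longrightarrow>
     (\<Sum>w\<in>T. level_coeff G k m v (m + int k) w) = walk_count k v)"
proof (induction k arbitrary: v)
  case 0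
  have "(\<Sum>w\<in>T. level_coeff G 0 m v (m + int 0) w) = 1" if "finite T" "{v} \<subseteq> T" for T m
    using that by (simp add: of_bool_def)
  then show ?case by (intro exI[of _ "{v}"]) simp
next
  case (Suc k)
  have fin: "finite (out_arcs G v)" using reg[OF Suc.prems] by (simp add: regular_def)
  have "\<forall>e\<in>out_arcs G v. \<exists>S. finite S \<and> (\<forall>T m. finite T \<longrightarrow> S \<subseteq> T \<longrightarrow>
     (\<Sum>w\<in>T. level_coeff G k m (head G e) (m + int k) w) = walk_count k (head G e))"
    using Suc.IH by auto
  then obtain S where S: "\<And>e. e \<in> out_arcs G v \<Longrightarrow> finite (S e)"
    "\<And>e T m. e \<in> out_arcs G v \<Longrightarrow> finite T \<Longrightarrow> S e \<subseteq> T \<Longrightarrow>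
     (\<Sum>w\<in>T. level_coeff G k m (head G e) (m + int k) w) = walk_count k (head G e)"
    by metis
  have "(\<Sum>w\<in>T. level_coeff G (Suc k) m v (m + int (Suc k)) w) = walk_count (Suc k) v"
    if "finite T" "(\<Union>e\<in>out_arcs G v. S e) \<subseteq> T" for T m
  proof -
    have "(\<Sum>w\<in>T. level_coeff G (Suc k) m v (m + int (Suc k)) w) =
        (\<Sum>w\<in>T. \<Sum>e\<in>out_arcs G v. level_coeff G k (m + 1) (head G e) ((m + 1) + int k) w)"
      using reg[OF Suc.prems] by (simp add: add_ac)
    also have "\<dots> = (\<Sum>e\<in>out_arcs G v. \<Sum>w\<in>T. level_coeff G k (m + 1) (head G e) ((m + 1) + int k) w)"
      by (rule sum.swap)
    also have "\<dots> = (\<Sum>e\<in>out_arcs G v. walk_count k (head G e))"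
      using that by (intro sum.cong HOL.refl S(2)) blast+
    finally show ?thesis by simp
  qed
  then show ?case using fin S(1) by (intro exI[of _ "\<Union>e\<in>out_arcs G v. S e"]) auto
qed

lemma walk_count_pos: "v \<in> verts G \<Longrightarrow> walk_count k v \<ge> 1"
proof (induction k arbitrary: v)
  case (Suc k)
  then obtain e where e: "e \<in> out_arcs G v" "finite (out_arcs G v)"
    using reg[OF Suc.prems] unfolding regular_def by blast
  have "walk_count k (head G e) \<le> (\<Sum>e\<in>out_arcs G v. walk_count k (head G e))"
    using e Suc.IH by (intro member_le_sum) (auto intro: order_trans[of 0 1])
  then show ?case using Suc.IH[of "head G e"] e by auto
qed simp

text \<open>Prefixing \<open>p\<close> turns distinct walks of length \<open>k\<close> from
  \<open>w\<close> into distinct walks of length \<open>k + length p\<close> from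
  \<open>u\<close>.\<close>

lemma walk_count_walk: "awalk u p w \<Longrightarrow> walk_count k w \<le> walk_count (k + length p) u"
proof (induction p arbitrary: u)
  case (Cons e p)
  have u: "u \<in> verts G" "e \<in> out_arcs G u" "finite (out_arcs G u)"
    using Cons.prems reg[of u] by (auto simp: awalk_Cons_iff regular_def)
  have "walk_count (k + length p) (head G e) \<le> (\<Sum>e\<in>out_arcs G u. walk_count (k + length p) (head G e))"
    using u walk_count_pos by (intro member_le_sum) (auto intro: order_trans[of 0 1])
  then show ?case using Cons by (fastforce simp: awalk_Cons_iff)
qed (simp add: awalk_Nil_iff)

text \<open>A second edge at a vertex on a closed walk \<open>c\<close> makes the number of walks
  grow: each further turn of \<open>c\<close> adds at least one walk. Periodicity makes the same
  number constant along steps of \<open>n\<close>.\<close>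

lemma stably_periodic_unique_edge:
  assumes "stably_periodic G (vertex_elem v)" "on_closed v" "e \<in> out_arcs G v" "e' \<in> out_arcs G v"
  shows "e = e'"
proof (rule ccontr)
  assume ne: "e \<noteq> e'"
  have v: "v \<in> verts G" using assms(2) by (rule on_closed_in_verts)
  have fin: "finite (out_arcs G v)" using reg[OF v] by (simp add: regular_def)
  obtain c where c: "awalk v c v" "c \<noteq> []" using assms(2) by (auto simp: on_closed_def)
  then obtain a as where ca: "c = a # as" by (cases c) auto
  have a: "a \<in> out_arcs G v" "awalk (head G a) as v" using c ca by (auto simp: awalk_Cons_iff)
  \<comment> \<open>One of \<open>e\<close> and \<open>e'\<close> differs from the first edge of
    \<open>c\<close>.\<close>
  obtain b where b: "b \<in> out_arcs G v" "b \<noteq> a" using ne assms by metis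
  let ?l = "length c"
  have grow1: "walk_count (k + ?l) v \<ge> walk_count k v + 1" for k
  proof -
    let ?s = "\<lambda>e. walk_count (k + length as) (head G e)"
    have "sum ?s {a, b} \<le> sum ?s (out_arcs G v)"
      using a b fin walk_count_pos by (intro sum_mono2) (auto intro: order_trans[of 0 1])
    moreover have "sum ?s {a, b} = ?s a + ?s b" using b by auto
    moreover have "?s a \<ge> walk_count k v" using walk_count_walk[OF a(2)] .
    moreover have "?s b \<ge> 1" using walk_count_pos b by auto
    ultimately show ?thesis using ca by simp
  qed
  have grow: "walk_count (k + i * ?l) v \<ge> walk_count k v + int i" for k i
  proof (induction i)
    case (Suc i)
    have eq: "k + Suc i * ?l = (k + i * ?l) + ?l" by simp
    show ?case unfolding eq using grow1[of "k + i * ?l"] Suc by simp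
  qed simp
  obtain n N0 :: nat where n: "n > 0"
    "\<And>N j w. N \<ge> N0 \<Longrightarrow> level_coeff G (n + N) 0 v j w = level_coeff G N 0 v (j - int n) w"
    using stably_periodic_level_coeff[OF assms(1)] by metis
  have per1: "walk_count (n + N) v = walk_count N v" if "N \<ge> N0" for N
  proof -
    obtain S where S: "finite S" "\<And>T m. finite T \<Longrightarrow> S \<subseteq> T \<Longrightarrow>
       (\<Sum>w\<in>T. level_coeff G (n + N) m v (m + int (n + N)) w) = walk_count (n + N) v"
      using walk_count_sum[OF v] by metis
    obtain S' where S': "finite S'" "\<And>T m. finite T \<Longrightarrow> S' \<subseteq> T \<Longrightarrow>
       (\<Sum>w\<in>T. level_coeff G N m v (m + int N) w) = walk_count N v"
      using walk_count_sum[OF v] by metis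
    have "walk_count (n + N) v = (\<Sum>w\<in>S \<union> S'. level_coeff G (n + N) 0 v (0 + int (n + N)) w)"
      by (rule S(2)[symmetric]) (use S S' in auto)
    also have "\<dots> = (\<Sum>w\<in>S \<union> S'. level_coeff G N 0 v (0 + int N) w)"
      using n(2)[OF that] by simp
    also have "\<dots> = walk_count N v"
      by (rule S'(2)) (use S S' in auto)
    finally show ?thesis .
  qed
  have per: "walk_count (N0 + i * n) v = walk_count N0 v" for i
  proof (induction i)
    case (Suc i)
    have eq: "N0 + Suc i * n = n + (N0 + i * n)" by simp
    show ?case unfolding eq using per1[of "N0 + i * n"] Suc by simp
  qed simp
  \<comment> \<open>The length \<open>N0 + n * ?l\<close> occurs in both progressions: as
    \<open>n\<close> turns of \<open>c\<close> and as \<open>?l\<close> steps of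
    \<open>n\<close>.\<close>
  show False using grow[of N0 n] per[of ?l] n(1) by (simp add: mult.commute)
qed

end

text \<open>If the walk lengths realising a given end vertex can be lowered by a fixed \<open>n > 0\<close>, then only
  finitely many vertices are reachable, so an infinite path has to repeat a vertex.\<close>

lemma inf_path_ends_if_lowering:
  assumes fin: "\<And>v. v \<in> verts G \<Longrightarrow> finite (out_arcs G v)" and nx: "no_exit_graph G"
    and low: "\<And>v. v \<in> verts G \<Longrightarrow> \<exists>n>0. \<exists>N0. \<forall>p w. awalk v p w \<and> length p \<ge> N0 \<longrightarrow>
      (\<exists>q. awalk v q w \<and> length q + n = length p)"
    and f: "inf_path G f"
  shows "\<exists>c. pre_digraph.cycle G c \<and> inf_path_ends_in f c"
proof (rule ccontr)
  assume no: "\<not> ?thesis"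
  then have inj: "inj (\<lambda>i. tail G (f i))"
    unfolding inj_def by (metis inf_path_repeat[OF nx f] linorder_neqE_nat)
  let ?v = "tail G (f 0)"
  have v: "?v \<in> verts G" using f by (simp add: inf_path_def)
  obtain n N0 :: nat where n: "n > 0" "\<And>p w. awalk ?v p w \<Longrightarrow> length p \<ge> N0 \<Longrightarrow>
      \<exists>q. awalk ?v q w \<and> length q + n = length p"
    using low[OF v] by metis
  have finw: "finite {p. length p = k \<and> (\<exists>w. awalk u p w)}" if "u \<in> verts G" for k u
    using that
  proof (induction k arbitrary: u)
    case (Suc k)
    have "{p. length p = Suc k \<and> (\<exists>w. awalk u p w)} \<subseteq>
        (\<Union>e\<in>out_arcs G u. (#) e ` {p. length p = k \<and> (\<exists>w. awalk (head G e) p w)})"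
    proof
      fix p assume "p \<in> {p. length p = Suc k \<and> (\<exists>w. awalk u p w)}"
      then obtain e q w where "p = e # q" "length q = k" "e \<in> out_arcs G u" "awalk (head G e) q w"
        by (auto simp: length_Suc_conv awalk_Cons_iff)
      then show "p \<in> (\<Union>e\<in>out_arcs G u. (#) e ` {p. length p = k \<and> (\<exists>w. awalk (head G e) p w)})"
        by blast
    qed
    moreover have "finite \<dots>" using Suc fin by auto
    ultimately show ?case by (rule finite_subset)
  qed simp
  \<comment> \<open>The ends of short walks form a finite set, and repeated lowering brings the end
    of every walk into it. An infinite path without repetitions has no room there.\<close>
  define D where "D = {w. \<exists>q. awalk ?v q w \<and> length q < N0}"
  have "D \<subseteq> (\<lambda>q. awlast ?v q) ` (\<Union>k<N0. {p. length p = k \<and> (\<exists>w. awalk ?v p w)})"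
  proof
    fix w assume "w \<in> D"
    then obtain q where q: "awalk ?v q w" "length q < N0" by (auto simp: D_def)
    then have "w = awlast ?v q" by blast
    then show "w \<in> (\<lambda>q. awlast ?v q) ` (\<Union>k<N0. {p. length p = k \<and> (\<exists>w. awalk ?v p w)})"
      using q by blast
  qed
  then have "finite D" by (rule finite_subset) (use finw[OF v] in auto)
  moreover have inD: "w \<in> D" if "awalk ?v p w" for p w
    using that
  proof (induction "length p" arbitrary: p rule: less_induct)
    case less
    show ?case
    proof (cases "length p < N0")
      case False
      then obtain q where "awalk ?v q w" "length q + n = length p" using n(2)[OF less.prems] by auto
      then show ?thesis using less.hyps[of q] n(1) by simp
    qed (use less.prems in \<open>auto simp: D_def\<close>)
  qed
  have "range (\<lambda>i. tail G (f i)) \<subseteq> D" using inD inf_path_awalk[OF f] by blast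
  ultimately show False using inj by (metis finite_subset finite_imageD infinite_UNIV_nat)
qed

lemma tame_graphI:
  assumes "\<And>v. v \<in> verts G \<Longrightarrow> stably_periodic G (vertex_elem v)"
  shows "tame_graph G"
proof -
  have reg: "regular G v" if "v \<in> verts G" for v
    using stably_periodic_regular[OF assms[OF that] that] .
  have nx: "no_exit_graph G"
    unfolding no_exit_graph_def has_exit_def
  proof (intro allI impI notI, elim bexE)
    fix c v e assume c: "pre_digraph.cycle G c" "v \<in> cycle_verts G c" "e \<in> out_arcs G v" "e \<notin> set c"
    obtain e' where e': "e' \<in> set c" "tail G e' = v" using c(2) by (auto simp: cycle_verts_def)
    have "e' \<in> arcs G" using e' c(1) by (auto simp: cycle_def)
    then have "e = e'"
      using stably_periodic_unique_edge[OF reg assms cycle_verts_on_closed[OF c(1,2)] c(3)] e'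
        on_closed_in_verts[OF cycle_verts_on_closed[OF c(1,2)]] by auto
    then show False using c e' by simp
  qed
  \<comment> \<open>A walk of length \<open>n + N\<close> makes a coefficient positive; by
    periodicity the corresponding coefficient after \<open>N\<close> rounds is positive too and
    comes from a walk of length \<open>N\<close> with the same end.\<close>
  have low: "\<exists>n>0. \<exists>N0. \<forall>p w. awalk v p w \<and> length p \<ge> N0 \<longrightarrow>
      (\<exists>q. awalk v q w \<and> length q + n = length p)" if v: "v \<in> verts G" for v
  proof -
    obtain n N0 :: nat where n: "n > 0"
      "\<And>N j w. N \<ge> N0 \<Longrightarrow> level_coeff G (n + N) 0 v j w = level_coeff G N 0 v (j - int n) w"
      using stably_periodic_level_coeff[OF assms[OF v]] by metis
    have "\<exists>q. awalk v q w \<and> length q + n = length p" if p: "awalk v p w" "length p \<ge> n + N0" for p w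
    proof -
      define N where "N = length p - n"
      have N: "length p = n + N" "N \<ge> N0" using p by (auto simp: N_def)
      have "level_coeff G (n + N) 0 v (0 + int (n + N)) w > 0"
        using p N level_coeff_pos_iff[OF reg v, of "n + N" 0 w] by auto
      then have "level_coeff G N 0 v (0 + int N) w > 0" using n(2)[OF N(2)] by simp
      then show ?thesis using level_coeff_pos_iff[OF reg v, of N 0 w] N by auto
    qed
    then show ?thesis using n(1) by blast
  qed
  show ?thesis
    using reg nx inf_path_ends_if_lowering[OF _ nx low]
    by unfold_locales (auto simp: regular_def)
qed

end


section \<open>The graph monoid\<close>

lemma the_elem_image_class:
  assumes "r = {(x, y). x \<in> C \<and> y \<in> C \<and> F x = F y}" "x \<in> C"
  shows "the_elem (F ` (r `` {x})) = F x"
proof -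
  have "F ` (r `` {x}) = {F x}" using assms by auto
  then show ?thesis by simp
qed

text \<open>The quotient by the kernel of \<open>F\<close> is identified with the image of
  \<open>F\<close>; used with normal forms for the graph monoid and with formal differences for its
  group completion.\<close>

lemma bij_betw_quotient:
  assumes "r = {(x, y). x \<in> C \<and> y \<in> C \<and> F x = F y}"
  shows "bij_betw (\<lambda>X. the_elem (F ` X)) (C // r) (F ` C)"
  unfolding bij_betw_def
proof
  show "inj_on (\<lambda>X. the_elem (F ` X)) (C // r)"
  proof (rule inj_onI)
    fix X Y assume X: "X \<in> C // r" and Y: "Y \<in> C // r" and eq: "the_elem (F ` X) = the_elem (F ` Y)"
    obtain x where x: "x \<in> C" "X = r `` {x}" using X by (auto elim: quotientE)
    obtain y where y: "y \<in> C" "Y = r `` {y}" using Y by (auto elim: quotientE)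
    have "F x = F y" using eq x y the_elem_image_class[OF assms] by simp
    then show "X = Y" using x y assms by auto
  qed
  show "(\<lambda>X. the_elem (F ` X)) ` (C // r) = F ` C"
  proof -
    have "C // r = (\<lambda>x. r `` {x}) ` C" by (auto simp: quotient_def)
    then show ?thesis
      using the_elem_image_class[OF assms] by (simp add: image_image cong: image_cong_simp)
  qed
qed

context wf_digraph
begin

lemma sim_subset: "sim G \<subseteq> free_gamma G \<times> free_gamma G"
  using sim_free_gamma[OF wf_digraph] by auto

abbreviation sim_class :: "('a, 'b) formal_sum \<Rightarrow> ('a, 'b) formal_sum set" where
  "sim_class a \<equiv> sim G `` {a}"

lemma sim_class_eq_iff:
  assumes "a \<in> free_gamma G" "b \<in> free_gamma G"
  shows "sim_class a = sim_class b \<longleftrightarrow> (a, b) \<in> sim G"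
proof
  assume "sim_class a = sim_class b"
  then show "(a, b) \<in> sim G" using sim_refl[OF assms(2)] by blast
next
  assume ab: "(a, b) \<in> sim G"
  show "sim_class a = sim_class b"
    using sim_trans[OF ab] sim_trans[OF sim_sym[OF ab]] by blast
qed

lemma sim_class_carrier [simp]: "a \<in> free_gamma G \<Longrightarrow> sim_class a \<in> carrier (graph_monoid G)"
  by (auto simp: graph_monoid_def quotientI)

lemma graph_monoid_carrierE:
  assumes "X \<in> carrier (graph_monoid G)"
  obtains a where "a \<in> free_gamma G" "X = sim_class a"
proof -
  have "X \<in> free_gamma G // sim G" using assms by (simp add: graph_monoid_def)
  then show thesis by (rule quotientE) (rule that)
qed

lemma graph_monoid_mult:
  assumes "a \<in> free_gamma G" "b \<in> free_gamma G"
  shows "sim_class a \<otimes>\<^bsub>graph_monoid G\<^esub> sim_class b = sim_class (a + b)"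
proof -
  have "sim G `` {x + y | x y. x \<in> sim_class a \<and> y \<in> sim_class b} = sim_class (a + b)"
  proof
    show "sim G `` {x + y | x y. x \<in> sim_class a \<and> y \<in> sim_class b} \<subseteq> sim_class (a + b)"
      by (auto intro: sim_trans sim_add)
    have "a \<in> sim_class a" "b \<in> sim_class b" using assms by (auto intro: sim_refl)
    then show "sim_class (a + b) \<subseteq> sim G `` {x + y | x y. x \<in> sim_class a \<and> y \<in> sim_class b}"
      by blast
  qed
  then show ?thesis by (simp add: graph_monoid_def)
qed

lemma graph_monoid_act_class:
  assumes "a \<in> free_gamma G"
  shows "graph_monoid_act G n (sim_class a) = sim_class (shift n a)"
proof -
  have "sim G `` (shift n ` sim_class a) = sim_class (shift n a)"
  proof
    show "sim G `` (shift n ` sim_class a) \<subseteq> sim_class (shift n a)"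
      by (auto intro: sim_trans sim_shift)
    have "a \<in> sim_class a" using assms by (auto intro: sim_refl)
    then show "sim_class (shift n a) \<subseteq> sim G `` (shift n ` sim_class a)"
      by blast
  qed
  then show ?thesis by (simp add: graph_monoid_act_def)
qed

lemma graph_monoid_one: "\<one>\<^bsub>graph_monoid G\<^esub> = sim_class {#}"
  by (simp add: graph_monoid_def)

lemma comm_monoid_graph_monoid: "comm_monoid (graph_monoid G)"
proof (rule comm_monoidI)
  fix X Y Z assume "X \<in> carrier (graph_monoid G)" "Y \<in> carrier (graph_monoid G)"
    "Z \<in> carrier (graph_monoid G)"
  then obtain a b c where abc: "a \<in> free_gamma G" "b \<in> free_gamma G" "c \<in> free_gamma G"
    and "X = sim_class a" "Y = sim_class b" "Z = sim_class c"
    by (metis graph_monoid_carrierE)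
  then show "X \<otimes>\<^bsub>graph_monoid G\<^esub> Y \<otimes>\<^bsub>graph_monoid G\<^esub> Z =
      X \<otimes>\<^bsub>graph_monoid G\<^esub> (Y \<otimes>\<^bsub>graph_monoid G\<^esub> Z)"
    by (simp add: graph_monoid_mult add.assoc)
next
  fix X Y assume "X \<in> carrier (graph_monoid G)" "Y \<in> carrier (graph_monoid G)"
  then obtain a b where "a \<in> free_gamma G" "b \<in> free_gamma G" "X = sim_class a" "Y = sim_class b"
    by (metis graph_monoid_carrierE)
  then show "X \<otimes>\<^bsub>graph_monoid G\<^esub> Y \<in> carrier (graph_monoid G)"
    "X \<otimes>\<^bsub>graph_monoid G\<^esub> Y = Y \<otimes>\<^bsub>graph_monoid G\<^esub> X"
    by (simp_all add: graph_monoid_mult add.commute)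
next
  fix X assume "X \<in> carrier (graph_monoid G)"
  then obtain a where "a \<in> free_gamma G" "X = sim_class a" by (metis graph_monoid_carrierE)
  then show "\<one>\<^bsub>graph_monoid G\<^esub> \<otimes>\<^bsub>graph_monoid G\<^esub> X = X"
    by (simp add: graph_monoid_mult graph_monoid_one)
qed (simp add: graph_monoid_one)

lemma graph_monoid_act_hom: "graph_monoid_act G n \<in> hom (graph_monoid G) (graph_monoid G)"
proof (rule homI)
  fix X assume "X \<in> carrier (graph_monoid G)"
  then obtain a where "a \<in> free_gamma G" "X = sim_class a" by (metis graph_monoid_carrierE)
  then show "graph_monoid_act G n X \<in> carrier (graph_monoid G)"
    by (simp add: graph_monoid_act_class)
next
  fix X Y assume "X \<in> carrier (graph_monoid G)" "Y \<in> carrier (graph_monoid G)"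
  then obtain a b where "a \<in> free_gamma G" "b \<in> free_gamma G" "X = sim_class a" "Y = sim_class b"
    by (metis graph_monoid_carrierE)
  then show "graph_monoid_act G n (X \<otimes>\<^bsub>graph_monoid G\<^esub> Y) =
      graph_monoid_act G n X \<otimes>\<^bsub>graph_monoid G\<^esub> graph_monoid_act G n Y"
    by (simp add: graph_monoid_act_class graph_monoid_mult shift_add)
qed

end


section \<open>Periodicity of direct sums\<close>

lemma cyc_shift_multiple: "k < n \<Longrightarrow> int n dvd m \<Longrightarrow> cyc_shift n m k = k"
  by (auto simp: cyc_shift_def)

text \<open>The product of the moduli over the finite support is a common period; off the support
  the entry is the neutral element \<open>z i\<close>, which every shift fixes. The action is kept
  abstract to cover multisets as well as free abelian groups.\<close>

lemma sum_act_periodic: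
  assumes fin: "finite {i \<in> I. f i \<noteq> z i}" and ext: "f \<in> extensional I"
    and pos: "\<And>i. i \<in> I \<Longrightarrow> n i > 0"
    and z: "\<And>i m. i \<in> I \<Longrightarrow> act i m (z i) = z i"
    and per: "\<And>i m. i \<in> I \<Longrightarrow> int (n i) dvd m \<Longrightarrow> act i m (f i) = f i"
  obtains m :: int where "m > 0" "sum_act I act m f = f"
proof -
  let ?S = "{i \<in> I. f i \<noteq> z i}"
  let ?m = "int (\<Prod>i\<in>?S. n i)"
  have "act i ?m (f i) = f i" if i: "i \<in> I" for i
  proof (cases "f i = z i")
    case False
    then have "n i dvd (\<Prod>i\<in>?S. n i)" using fin i by (intro dvd_prodI) auto
    then have "int (n i) dvd ?m" by (simp only: of_nat_dvd_iff)
    then show ?thesis by (rule per[OF i])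
  qed (use z[OF i] in simp)
  then have "sum_act I act ?m f = f"
    using ext by (auto simp: sum_act_def extensional_def)
  moreover have "?m > 0" using pos by (auto intro!: prod_pos)
  ultimately show ?thesis using that by blast
qed

context wf_digraph
begin

lemma periodic_if_cyclic_sum:
  assumes iso: "gamma_isomorphic (graph_monoid G) (graph_monoid_act G)
      (sum_monoid I (\<lambda>i. cyc_monoid (n i))) (sum_act I (\<lambda>i. cyc_monoid_act (n i)))"
    and pos: "\<And>i. i \<in> I \<Longrightarrow> n i > 0" and a: "a \<in> free_gamma G"
  shows "periodic G a"
proof -
  let ?N = "sum_monoid I (\<lambda>i. cyc_monoid (n i))"
  obtain h where h: "h \<in> iso (graph_monoid G) ?N"
    "\<And>m X. X \<in> carrier (graph_monoid G) \<Longrightarrow>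
       h (graph_monoid_act G m X) = sum_act I (\<lambda>i. cyc_monoid_act (n i)) m (h X)"
    using iso by (auto simp: gamma_isomorphic_def)
  define f where "f = h (sim_class a)"
  have "f \<in> carrier ?N" using h(1) a by (auto simp: f_def iso_def hom_def Pi_iff)
  then have f: "f \<in> (\<Pi>\<^sub>E i\<in>I. {A. set_mset A \<subseteq> {..<n i}})" "finite {i \<in> I. f i \<noteq> {#}}"
    by (auto simp: sum_monoid_def cyc_monoid_def)
  have per: "cyc_monoid_act (n i) m (f i) = f i" if i: "i \<in> I" and d: "int (n i) dvd m" for i m
  proof -
    have "k < n i" if "k \<in># f i" for k using f(1) i that by (auto simp: PiE_iff)
    then show ?thesis unfolding cyc_monoid_act_def using cyc_shift_multiple[OF _ d]
      by (intro multiset.map_ident_strong) auto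
  qed
  obtain m where m: "m > 0" "sum_act I (\<lambda>i. cyc_monoid_act (n i)) m f = f"
    by (rule sum_act_periodic[of I f "\<lambda>_. {#}" n "\<lambda>i. cyc_monoid_act (n i)"])
      (use f pos per in \<open>auto simp: cyc_monoid_act_def PiE_def\<close>)
  have "h (sim_class (shift m a)) = h (sim_class a)"
    using h(2)[of "sim_class a" m] a m by (simp add: graph_monoid_act_class f_def)
  then have "sim_class (shift m a) = sim_class a"
    using h(1) a by (auto simp: iso_def bij_betw_def inj_on_def)
  then show ?thesis using a m(1) sim_class_eq_iff[of a "shift m a"] by (auto simp: periodic_def)
qed

end


section \<open>Group completion\<close>

text \<open>Fixes the record type to plain \<open>'m monoid\<close>, the type on which
  \<open>groth_rel\<close> and \<open>groth_group\<close> are defined.\<close>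

locale comm_monoid_record = comm_monoid M for M :: "'m monoid" (structure)
begin

text \<open>Without cancellation in \<open>M\<close> the middle pair has to be absorbed into the
  witness, which becomes \<open>d \<otimes> k \<otimes> l\<close>.\<close>

lemma groth_rel_trans:
  assumes "((a, b), (c, d)) \<in> groth_rel M" "((c, d), (e, f)) \<in> groth_rel M"
  shows "((a, b), (e, f)) \<in> groth_rel M"
proof -
  obtain k l where k: "k \<in> carrier M" "a \<otimes> d \<otimes> k = c \<otimes> b \<otimes> k"
    and l: "l \<in> carrier M" "c \<otimes> f \<otimes> l = e \<otimes> d \<otimes> l"
    using assms by (auto simp: groth_rel_def)
  have c: "a \<in> carrier M" "b \<in> carrier M" "c \<in> carrier M" "d \<in> carrier M" "e \<in> carrier M"
    "f \<in> carrier M" using assms by (auto simp: groth_rel_def)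
  have "a \<otimes> f \<otimes> (d \<otimes> k \<otimes> l) = (a \<otimes> d \<otimes> k) \<otimes> (f \<otimes> l)"
    using c k(1) l(1) by (simp add: m_ac)
  also have "\<dots> = (c \<otimes> f \<otimes> l) \<otimes> (b \<otimes> k)" using c k l(1) by (simp add: m_ac)
  also have "\<dots> = e \<otimes> b \<otimes> (d \<otimes> k \<otimes> l)" using c k(1) l by (simp add: m_ac)
  finally show ?thesis using c k(1) l(1) by (auto simp: groth_rel_def)
qed

lemma trans_groth_rel: "Relation.trans (groth_rel M)"
proof (rule transI)
  fix x y z assume "(x, y) \<in> groth_rel M" "(y, z) \<in> groth_rel M"
  then show "(x, z) \<in> groth_rel M"
    using groth_rel_trans[of "fst x" "snd x" "fst y" "snd y" "fst z" "snd z"] by simp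
qed

lemma groth_rel_refl: "a \<in> carrier M \<Longrightarrow> b \<in> carrier M \<Longrightarrow> ((a, b), (a, b)) \<in> groth_rel M"
  by (auto simp: groth_rel_def)

lemma groth_rel_act:
  assumes "act \<in> hom M M" "((a, b), (c, d)) \<in> groth_rel M"
  shows "((act a, act b), (act c, act d)) \<in> groth_rel M"
proof -
  obtain k where k: "k \<in> carrier M" "a \<otimes> d \<otimes> k = c \<otimes> b \<otimes> k"
    and c: "a \<in> carrier M" "b \<in> carrier M" "c \<in> carrier M" "d \<in> carrier M"
    using assms by (auto simp: groth_rel_def)
  have "act a \<otimes> act d \<otimes> act k = act (a \<otimes> d \<otimes> k)" "act c \<otimes> act b \<otimes> act k = act (c \<otimes> b \<otimes> k)"
    using assms(1) k(1) c by (simp_all add: hom_mult)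
  then have "act a \<otimes> act d \<otimes> act k = act c \<otimes> act b \<otimes> act k" using k(2) by simp
  moreover have "act x \<in> carrier M" if "x \<in> carrier M" for x
    using assms(1) that by (rule hom_in_carrier)
  ultimately show ?thesis using k(1) c unfolding groth_rel_def by blast
qed

lemma groth_act_class:
  assumes "act n \<in> hom M M" "a \<in> carrier M" "b \<in> carrier M"
  shows "groth_act M act n (groth_rel M `` {(a, b)}) = groth_rel M `` {(act n a, act n b)}"
proof -
  have "groth_rel M `` (map_prod (act n) (act n) ` (groth_rel M `` {(a, b)})) =
      groth_rel M `` {(act n a, act n b)}" (is "?L = ?R")
  proof
    show "?L \<subseteq> ?R"
    proof
      fix t assume "t \<in> ?L"
      then obtain c d where "((a, b), (c, d)) \<in> groth_rel M" "((act n c, act n d), t) \<in> groth_rel M"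
        by auto
      then have "((act n a, act n b), t) \<in> groth_rel M"
        using transD[OF trans_groth_rel groth_rel_act[OF assms(1)]] by blast
      then show "t \<in> ?R" by blast
    qed
    show "?R \<subseteq> ?L" using groth_rel_refl[OF assms(2,3)] by auto
  qed
  then show ?thesis by (simp add: groth_act_def)
qed

text \<open>The witnesses for the two factors multiply to a witness for the product, so all products
  of representatives fall into one class.\<close>

lemma groth_mult_class:
  assumes "a \<in> carrier M" "b \<in> carrier M" "c \<in> carrier M" "d \<in> carrier M"
  shows "groth_rel M `` {(a, b)} \<otimes>\<^bsub>groth_group M\<^esub> groth_rel M `` {(c, d)} =
    groth_rel M `` {(a \<otimes> c, b \<otimes> d)}"
proof -
  let ?P = "{(x \<otimes> u, y \<otimes> v) | x y u v.
      (x, y) \<in> groth_rel M `` {(a, b)} \<and> (u, v) \<in> groth_rel M `` {(c, d)}}"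
  have "((a \<otimes> c, b \<otimes> d), z) \<in> groth_rel M" if "z \<in> ?P" for z
  proof -
    from that obtain x y u v where z: "z = (x \<otimes> u, y \<otimes> v)"
      "((a, b), (x, y)) \<in> groth_rel M" "((c, d), (u, v)) \<in> groth_rel M" by auto
    then obtain k l where k: "k \<in> carrier M" "a \<otimes> y \<otimes> k = x \<otimes> b \<otimes> k"
      and l: "l \<in> carrier M" "c \<otimes> v \<otimes> l = u \<otimes> d \<otimes> l" by (auto simp: groth_rel_def)
    have c: "x \<in> carrier M" "y \<in> carrier M" "u \<in> carrier M" "v \<in> carrier M"
      using z by (auto simp: groth_rel_def)
    have "(a \<otimes> c) \<otimes> (y \<otimes> v) \<otimes> (k \<otimes> l) = (a \<otimes> y \<otimes> k) \<otimes> (c \<otimes> v \<otimes> l)"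
      using assms c k(1) l(1) by (simp add: m_ac)
    also have "\<dots> = (x \<otimes> b \<otimes> k) \<otimes> (u \<otimes> d \<otimes> l)" using k l by simp
    also have "\<dots> = (x \<otimes> u) \<otimes> (b \<otimes> d) \<otimes> (k \<otimes> l)"
      using assms c k(1) l(1) by (simp add: m_ac)
    finally show ?thesis using assms c k(1) l(1) z(1) by (auto simp: groth_rel_def)
  qed
  moreover have "(a \<otimes> c, b \<otimes> d) \<in> ?P" using groth_rel_refl assms by blast
  ultimately have "groth_rel M `` ?P = groth_rel M `` {(a \<otimes> c, b \<otimes> d)}"
    using trans_groth_rel unfolding trans_def by (intro equalityI subsetI) blast+
  then show ?thesis by (simp add: groth_group_def)
qed

end

context wf_digraph
begin

text \<open>The isomorphism turns the periodicity of finitely supported families into equality of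
  classes of formal differences. Unfolding \<open>groth_rel\<close> leaves an additional summand
  \<open>K\<close>, so only stable periodicity results.\<close>

lemma stably_periodic_if_cyclic_sum_group:
  assumes iso: "gamma_isomorphic (groth_group (graph_monoid G))
      (groth_act (graph_monoid G) (graph_monoid_act G))
      (sum_group I (\<lambda>i. cyc_group (n i))) (sum_act I (\<lambda>i. cyc_group_act (n i)))"
    and pos: "\<And>i. i \<in> I \<Longrightarrow> n i > 0" and a: "a \<in> free_gamma G"
  shows "stably_periodic G a"
proof -
  let ?N = "sum_group I (\<lambda>i. cyc_group (n i))" and ?M = "graph_monoid G"
  interpret M: comm_monoid_record ?M
    by (simp add: comm_monoid_record_def comm_monoid_graph_monoid)
  obtain h where h: "h \<in> iso (groth_group ?M) ?N"
    "\<And>m X. X \<in> carrier (groth_group ?M) \<Longrightarrow> h (groth_act ?M (graph_monoid_act G) m X) =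
       sum_act I (\<lambda>i. cyc_group_act (n i)) m (h X)"
    using iso by (auto simp: gamma_isomorphic_def)
  define cl where "cl = (\<lambda>x y. groth_rel ?M `` {(sim_class x, sim_class y)})"
  have cl_carrier: "cl x y \<in> carrier (groth_group ?M)"
    if "x \<in> free_gamma G" "y \<in> free_gamma G" for x y
    using that by (auto simp: cl_def groth_group_def intro!: quotientI)
  define f where "f = h (cl a {#})"
  have "f \<in> carrier ?N"
    using h(1) cl_carrier[OF a free_gamma_empty] by (auto simp: f_def iso_def hom_def Pi_iff)
  then have f: "f \<in> (\<Pi>\<^sub>E i\<in>I. {c. Poly_Mapping.keys c \<subseteq> {..<n i}})" "finite {i \<in> I. f i \<noteq> 0}"
    by (simp_all add: cyc_group_def carrier_sum_group) (auto simp: free_Abelian_group_def)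
  have per: "cyc_group_act (n i) m (f i) = f i" if i: "i \<in> I" and d: "int (n i) dvd m" for i m
  proof -
    have "frag_extend (\<lambda>k. frag_of (cyc_shift (n i) m k)) (f i) = frag_extend frag_of (f i)"
      using f(1) i cyc_shift_multiple[OF _ d] by (intro frag_extend_eq) (auto simp: PiE_iff subset_iff)
    then show ?thesis by (simp add: cyc_group_act_def frag_expansion[symmetric])
  qed
  have ext: "f \<in> extensional I" using f(1) by (simp add: PiE_def)
  have zero: "cyc_group_act (n i) m 0 = 0" for i m by (simp add: cyc_group_act_def)
  obtain m where m: "m > 0" "sum_act I (\<lambda>i. cyc_group_act (n i)) m f = f"
    using sum_act_periodic[of I f "\<lambda>_. 0" n "\<lambda>i. cyc_group_act (n i)", OF f(2) ext pos zero per]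
    by blast
  have "groth_act ?M (graph_monoid_act G) m (cl a {#}) = cl (shift m a) {#}"
    using M.groth_act_class[OF graph_monoid_act_hom] a
    by (simp add: cl_def graph_monoid_act_class) (simp add: shift_def)
  then have "h (cl (shift m a) {#}) = h (cl a {#})"
    using h(2)[OF cl_carrier[OF a free_gamma_empty], of m] m(2) by (simp add: f_def)
  then have "cl (shift m a) {#} = cl a {#}"
    using h(1) cl_carrier a by (auto simp: iso_def bij_betw_def inj_on_def)
  moreover have "(sim_class a, sim_class {#}) \<in> cl a {#}"
    using M.groth_rel_refl a by (simp add: cl_def)
  ultimately have "((sim_class (shift m a), sim_class {#}), (sim_class a, sim_class {#})) \<in> groth_rel ?M"
    by (auto simp: cl_def)
  then obtain K where K: "K \<in> carrier ?M"
    "sim_class (shift m a) \<otimes>\<^bsub>?M\<^esub> sim_class {#} \<otimes>\<^bsub>?M\<^esub> K = sim_class a \<otimes>\<^bsub>?M\<^esub> sim_class {#} \<otimes>\<^bsub>?M\<^esub> K"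
    by (auto simp: groth_rel_def)
  obtain k where k: "k \<in> free_gamma G" "K = sim_class k" using K(1) by (rule graph_monoid_carrierE)
  have "sim_class (shift m a + k) = sim_class (a + k)"
    using K(2) k a by (simp add: graph_monoid_mult)
  then have "(a + k, shift m a + k) \<in> sim G"
    using sim_class_eq_iff[of "a + k" "shift m a + k"] a k by simp
  then show ?thesis using m(1) by (auto simp: stably_periodic_def)
qed

end

section \<open>Group completion of a direct sum of cyclic monoids\<close>

definition mset_frag :: "'a multiset \<Rightarrow> 'a \<Rightarrow>\<^sub>0 int" where
  "mset_frag A = (\<Sum>x\<in>#A. frag_of x)"

lemma mset_frag_simps [simp]: "mset_frag {#} = 0" "mset_frag {#x#} = frag_of x"
    "mset_frag (A + B) = mset_frag A + mset_frag B"
  by (simp_all add: mset_frag_def)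

lemma lookup_mset_frag: "Poly_Mapping.lookup (mset_frag A) x = int (count A x)"
  by (induction A) (auto simp: mset_frag_def lookup_add lookup_frag_of)

lemma mset_frag_inj: "mset_frag A = mset_frag B \<longleftrightarrow> A = B"
  by (metis lookup_mset_frag multiset_eqI of_nat_eq_iff)

lemma keys_mset_frag: "Poly_Mapping.keys (mset_frag A) = set_mset A"
  by (auto simp: in_keys_iff lookup_mset_frag)

lemma mset_frag_diff_surj:
  assumes "Poly_Mapping.keys c \<subseteq> S"
  shows "\<exists>A B. set_mset A \<subseteq> S \<and> set_mset B \<subseteq> S \<and> c = mset_frag A - mset_frag B"
  using assms
proof (rule free_Abelian_group_induct)
  show "\<exists>A B. set_mset A \<subseteq> S \<and> set_mset B \<subseteq> S \<and> 0 = mset_frag A - mset_frag B"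
    by (rule exI[of _ "{#}"], rule exI[of _ "{#}"]) simp
next
  fix x y
  assume "\<exists>A B. set_mset A \<subseteq> S \<and> set_mset B \<subseteq> S \<and> x = mset_frag A - mset_frag B"
    "\<exists>A B. set_mset A \<subseteq> S \<and> set_mset B \<subseteq> S \<and> y = mset_frag A - mset_frag B"
  then obtain A B C D where "set_mset A \<subseteq> S" "set_mset B \<subseteq> S" "set_mset C \<subseteq> S" "set_mset D \<subseteq> S"
    "x = mset_frag A - mset_frag B" "y = mset_frag C - mset_frag D" by blast
  then show "\<exists>A B. set_mset A \<subseteq> S \<and> set_mset B \<subseteq> S \<and> x - y = mset_frag A - mset_frag B"
    by (intro exI[of _ "A + D"] exI[of _ "B + C"]) simp
next
  fix s assume "s \<in> S"
  then show "\<exists>A B. set_mset A \<subseteq> S \<and> set_mset B \<subseteq> S \<and> frag_of s = mset_frag A - mset_frag B"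
    by (intro exI[of _ "{#s#}"] exI[of _ "{#}"]) simp
qed

lemma cyc_group_act_mset_frag:
  "cyc_group_act n m (mset_frag A) = mset_frag (cyc_monoid_act n m A)"
  by (induction A) (simp_all add: cyc_group_act_def cyc_monoid_act_def mset_frag_def frag_extend_add)

text \<open>A formal difference goes to the family of differences of free abelian group elements;
  cancellation of multisets shows that \<open>groth_rel\<close> is exactly the kernel of this map.
  The injection \<open>j\<close> renames the indices, since the group is to be indexed by another
  type than the monoid.\<close>

lemma gamma_isomorphic_groth:
  fixes M :: "'a monoid"
  assumes M: "comm_monoid M" and act: "\<And>m. act m \<in> hom M M"
    and iso: "gamma_isomorphic M act
      (sum_monoid I (\<lambda>i. cyc_monoid (n i))) (sum_act I (\<lambda>i. cyc_monoid_act (n i)))"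
    and j: "inj_on j I"
  shows "gamma_isomorphic (groth_group M) (groth_act M act)
      (sum_group (j ` I) (\<lambda>i. cyc_group (n (inv_into I j i))))
      (sum_act (j ` I) (\<lambda>i. cyc_group_act (n (inv_into I j i))))"
proof -
  interpret comm_monoid_record M by (simp add: comm_monoid_record_def M)
  let ?N = "sum_monoid I (\<lambda>i. cyc_monoid (n i))"
  let ?J = "j ` I" and ?k = "inv_into I j"
  let ?H = "sum_group ?J (\<lambda>i. cyc_group (n (?k i)))"
  obtain h where h: "h \<in> iso M ?N"
    "\<And>m x. x \<in> carrier M \<Longrightarrow> h (act m x) = sum_act I (\<lambda>i. cyc_monoid_act (n i)) m (h x)"
    using iso by (auto simp: gamma_isomorphic_def)
  have kI: "?k i \<in> I" if "i \<in> ?J" for i using that by (rule inv_into_into)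
  have carrier_N: "f \<in> carrier ?N \<longleftrightarrow> f \<in> (\<Pi>\<^sub>E i\<in>I. {A. set_mset A \<subseteq> {..<n i}}) \<and>
      finite {i \<in> I. f i \<noteq> {#}}" for f
    by (auto simp: sum_monoid_def cyc_monoid_def)
  have h_carrier: "h x \<in> carrier ?N" if "x \<in> carrier M" for x
    using h(1) that by (auto simp: iso_def hom_def Pi_iff)
  have h_inj: "h x = h y \<longleftrightarrow> x = y" if "x \<in> carrier M" "y \<in> carrier M" for x y
    using h(1) that by (auto simp: iso_def bij_betw_def inj_on_def)
  have h_mult: "h (x \<otimes>\<^bsub>M\<^esub> y) i = h x i + h y i"
    if "x \<in> carrier M" "y \<in> carrier M" "i \<in> I" for x y i
    using h(1) that by (auto simp: iso_def hom_def sum_monoid_def cyc_monoid_def)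
  have h_eqI: "x = y" if "x \<in> carrier M" "y \<in> carrier M" "\<And>i. i \<in> I \<Longrightarrow> h x i = h y i" for x y
  proof -
    have "h x = h y"
      by (rule PiE_ext[of _ I "\<lambda>i. {A. set_mset A \<subseteq> {..<n i}}"])
        (use h_carrier[OF that(1)] h_carrier[OF that(2)] that(3) carrier_N in auto)
    then show ?thesis using h_inj that by simp
  qed
  define F where "F = (\<lambda>(x, y). \<lambda>i\<in>?J. mset_frag (h x (?k i)) - mset_frag (h y (?k i)))"
  have rel: "groth_rel M = {(p, q). p \<in> carrier M \<times> carrier M \<and> q \<in> carrier M \<times> carrier M \<and> F p = F q}"
  proof -
    have "(\<exists>z\<in>carrier M. a \<otimes>\<^bsub>M\<^esub> d \<otimes>\<^bsub>M\<^esub> z = c \<otimes>\<^bsub>M\<^esub> b \<otimes>\<^bsub>M\<^esub> z) \<longleftrightarrow> F (a, b) = F (c, d)"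
      if abcd: "a \<in> carrier M" "b \<in> carrier M" "c \<in> carrier M" "d \<in> carrier M" for a b c d
    proof
      assume "\<exists>z\<in>carrier M. a \<otimes>\<^bsub>M\<^esub> d \<otimes>\<^bsub>M\<^esub> z = c \<otimes>\<^bsub>M\<^esub> b \<otimes>\<^bsub>M\<^esub> z"
      then obtain z where z: "z \<in> carrier M" "a \<otimes>\<^bsub>M\<^esub> d \<otimes>\<^bsub>M\<^esub> z = c \<otimes>\<^bsub>M\<^esub> b \<otimes>\<^bsub>M\<^esub> z" by blast
      have "mset_frag (h a i) - mset_frag (h b i) = mset_frag (h c i) - mset_frag (h d i)"
        if i: "i \<in> I" for i
      proof -
        have "h a i + h d i + h z i = h c i + h b i + h z i"
          using arg_cong[OF z(2), of "\<lambda>x. h x i"] abcd z(1) i by (simp add: h_mult)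
        then have "mset_frag (h a i + h d i) = mset_frag (h c i + h b i)" by simp
        then have "mset_frag (h a i) + mset_frag (h d i) = mset_frag (h c i) + mset_frag (h b i)"
          unfolding mset_frag_simps .
        then show ?thesis by (simp add: algebra_simps)
      qed
      then show "F (a, b) = F (c, d)" using kI by (auto simp: F_def)
    next
      assume eq: "F (a, b) = F (c, d)"
      have "h (a \<otimes>\<^bsub>M\<^esub> d) i = h (c \<otimes>\<^bsub>M\<^esub> b) i" if i: "i \<in> I" for i
      proof -
        have "?k (j i) = i" using j i by simp
        then have "mset_frag (h a i) - mset_frag (h b i) = mset_frag (h c i) - mset_frag (h d i)"
          using fun_cong[OF eq, of "j i"] i by (simp add: F_def)
        then have "mset_frag (h a i) + mset_frag (h d i) = mset_frag (h c i) + mset_frag (h b i)"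
          by (simp add: algebra_simps)
        then have "mset_frag (h a i + h d i) = mset_frag (h c i + h b i)" by simp
        then show ?thesis using abcd i by (simp only: mset_frag_inj h_mult)
      qed
      then have "a \<otimes>\<^bsub>M\<^esub> d = c \<otimes>\<^bsub>M\<^esub> b" using abcd by (intro h_eqI) auto
      then show "\<exists>z\<in>carrier M. a \<otimes>\<^bsub>M\<^esub> d \<otimes>\<^bsub>M\<^esub> z = c \<otimes>\<^bsub>M\<^esub> b \<otimes>\<^bsub>M\<^esub> z"
        by (intro bexI[of _ "\<one>\<^bsub>M\<^esub>"]) simp_all
    qed
    then show ?thesis unfolding groth_rel_def by blast
  qed
  have carrier_H: "f \<in> carrier ?H \<longleftrightarrow> f \<in> (\<Pi>\<^sub>E i\<in>?J. {c. Poly_Mapping.keys c \<subseteq> {..<n (?k i)}}) \<and>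
      finite {i \<in> ?J. f i \<noteq> 0}" for f
    by (simp add: cyc_group_def carrier_sum_group) (auto simp: free_Abelian_group_def)
  have F_carrier: "F (x, y) \<in> carrier ?H" if xy: "x \<in> carrier M" "y \<in> carrier M" for x y
  proof -
    have hx: "set_mset (h x i) \<subseteq> {..<n i}" "set_mset (h y i) \<subseteq> {..<n i}" if "i \<in> I" for i
      using h_carrier xy that by (auto simp: carrier_N PiE_iff)
    have "finite {i \<in> I. h x i \<noteq> {#}}" "finite {i \<in> I. h y i \<noteq> {#}}"
      using h_carrier xy by (auto simp: carrier_N)
    then have "finite (j ` ({i \<in> I. h x i \<noteq> {#}} \<union> {i \<in> I. h y i \<noteq> {#}}))" by blast
    moreover have "{i \<in> ?J. F (x, y) i \<noteq> 0} \<subseteq> j ` ({i \<in> I. h x i \<noteq> {#}} \<union> {i \<in> I. h y i \<noteq> {#}})"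
      using j by (auto simp: F_def inj_on_def)
    ultimately have "finite {i \<in> ?J. F (x, y) i \<noteq> 0}" by (rule finite_subset[rotated])
    moreover have "Poly_Mapping.keys (mset_frag (h x i) - mset_frag (h y i)) \<subseteq> {..<n i}" if "i \<in> I" for i
      using keys_diff[of "mset_frag (h x i)" "mset_frag (h y i)"] hx[OF that]
      by (auto simp: keys_mset_frag)
    ultimately show ?thesis using kI by (auto simp: carrier_H F_def)
  qed
  have F_surj: "\<exists>x\<in>carrier M. \<exists>y\<in>carrier M. F (x, y) = f" if f: "f \<in> carrier ?H" for f
  proof -
    \<comment> \<open>Zero components are given empty multisets, which keeps both families finitely
      supported.\<close>
    define Q where "Q = (\<lambda>i P. set_mset (fst P) \<subseteq> {..<n i} \<and> set_mset (snd P) \<subseteq> {..<n i} \<and>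
        f (j i) = mset_frag (fst P) - mset_frag (snd P) \<and> (f (j i) = 0 \<longrightarrow> P = ({#}, {#})))"
    have "\<exists>P. Q i P" if i: "i \<in> I" for i
    proof (cases "f (j i) = 0")
      case True
      then show ?thesis by (intro exI[of _ "({#}, {#})"]) (simp add: Q_def)
    next
      case False
      have "Poly_Mapping.keys (f (j i)) \<subseteq> {..<n i}"
        using f i j by (auto simp: carrier_H PiE_iff)
      then obtain A B where "set_mset A \<subseteq> {..<n i}" "set_mset B \<subseteq> {..<n i}"
        "f (j i) = mset_frag A - mset_frag B"
        using mset_frag_diff_surj by blast
      then show ?thesis using False by (intro exI[of _ "(A, B)"]) (simp add: Q_def)
    qed
    then have "\<forall>i\<in>I. \<exists>P. Q i P" by blast
    then obtain P where P: "\<forall>i\<in>I. Q i (P i)" by (rule bchoice[THEN exE])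
    define A B where "A = (\<lambda>i. fst (P i))" and "B = (\<lambda>i. snd (P i))"
    have AB: "set_mset (A i) \<subseteq> {..<n i}" "set_mset (B i) \<subseteq> {..<n i}"
      "f (j i) = mset_frag (A i) - mset_frag (B i)"
      "f (j i) = 0 \<Longrightarrow> A i = {#}" "f (j i) = 0 \<Longrightarrow> B i = {#}" if "i \<in> I" for i
    proof -
      note Pi = bspec[OF P that, unfolded Q_def]
      show "set_mset (A i) \<subseteq> {..<n i}" using Pi unfolding A_def by (rule conjunct1)
      show "set_mset (B i) \<subseteq> {..<n i}" using Pi unfolding B_def by (elim conjE)
      show "f (j i) = mset_frag (A i) - mset_frag (B i)" using Pi unfolding A_def B_def by (elim conjE)
      assume "f (j i) = 0"
      then have "P i = ({#}, {#})" using Pi by (elim conjE) (rule mp)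
      then show "A i = {#}" "B i = {#}" by (simp_all add: A_def B_def)
    qed
    have "finite (?k ` {i \<in> ?J. f i \<noteq> 0})" using f by (auto simp: carrier_H)
    moreover have "{i \<in> I. f (j i) \<noteq> 0} \<subseteq> ?k ` {i \<in> ?J. f i \<noteq> 0}" using j by force
    ultimately have fin: "finite {i \<in> I. f (j i) \<noteq> 0}" by (rule finite_subset[rotated])
    have "finite {i \<in> I. A i \<noteq> {#}}" "finite {i \<in> I. B i \<noteq> {#}}"
      by (rule finite_subset[OF _ fin]; use AB in blast)+
    then have "(\<lambda>i\<in>I. A i) \<in> carrier ?N" "(\<lambda>i\<in>I. B i) \<in> carrier ?N"
      using AB(1,2) by (simp_all add: carrier_N PiE_iff cong: conj_cong)
    moreover have "carrier ?N = h ` carrier M" using h(1) by (simp add: iso_def bij_betw_def)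
    ultimately obtain x y where xy: "x \<in> carrier M" "y \<in> carrier M"
      "h x = (\<lambda>i\<in>I. A i)" "h y = (\<lambda>i\<in>I. B i)" by (metis imageE)
    have "F (x, y) i = f i" for i
    proof (cases "i \<in> ?J")
      case True
      then have "f (j (?k i)) = mset_frag (A (?k i)) - mset_frag (B (?k i))" using AB(3) kI by blast
      then show ?thesis using True kI by (simp add: F_def xy f_inv_into_f)
    next
      case False
      then show ?thesis using f by (simp add: F_def carrier_H PiE_def extensional_def)
    qed
    then show ?thesis using xy by blast
  qed
  let ?h = "\<lambda>X. the_elem (F ` X)"
  have h_class: "?h (groth_rel M `` {(x, y)}) = F (x, y)" if "x \<in> carrier M" "y \<in> carrier M" for x y
    using the_elem_image_class[OF rel] that by simp
  have classE: "\<exists>x\<in>carrier M. \<exists>y\<in>carrier M. X = groth_rel M `` {(x, y)}"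
    if "X \<in> carrier (groth_group M)" for X
    using that by (auto simp: groth_group_def elim!: quotientE)
  have "F ` (carrier M \<times> carrier M) = carrier ?H"
    using F_carrier F_surj by force
  then have bij: "bij_betw ?h (carrier (groth_group M)) (carrier ?H)"
    using bij_betw_quotient[OF rel] by (simp add: groth_group_def)
  have hom: "?h \<in> hom (groth_group M) ?H"
  proof (rule homI)
    fix X assume "X \<in> carrier (groth_group M)"
    then show "?h X \<in> carrier ?H" using bij by (auto simp: bij_betw_def)
  next
    fix X Y assume "X \<in> carrier (groth_group M)" "Y \<in> carrier (groth_group M)"
    then obtain x y u v where xy: "x \<in> carrier M" "y \<in> carrier M" "u \<in> carrier M" "v \<in> carrier M"
      and X: "X = groth_rel M `` {(x, y)}" "Y = groth_rel M `` {(u, v)}" using classE by metis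
    have "F (x \<otimes>\<^bsub>M\<^esub> u, y \<otimes>\<^bsub>M\<^esub> v) = F (x, y) \<otimes>\<^bsub>?H\<^esub> F (u, v)"
      using xy kI by (auto simp: F_def h_mult cyc_group_def)
    then show "?h (X \<otimes>\<^bsub>groth_group M\<^esub> Y) = ?h X \<otimes>\<^bsub>?H\<^esub> ?h Y"
      using xy by (simp add: X groth_mult_class h_class)
  qed
  have equivariant: "?h (groth_act M act m X) = sum_act ?J (\<lambda>i. cyc_group_act (n (?k i))) m (?h X)"
    if X_carrier: "X \<in> carrier (groth_group M)" for m X
  proof -
    obtain x y where xy: "x \<in> carrier M" "y \<in> carrier M" and X: "X = groth_rel M `` {(x, y)}"
      using classE[OF X_carrier] by blast
    have axy: "act m x \<in> carrier M" "act m y \<in> carrier M"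
      using act[of m] xy by (auto simp: hom_def Pi_iff)
    have "F (act m x, act m y) = sum_act ?J (\<lambda>i. cyc_group_act (n (?k i))) m (F (x, y))"
    proof
      fix i
      have "cyc_group_act N m (a - b) = cyc_group_act N m a - cyc_group_act N m b" for N a b
        by (simp add: cyc_group_act_def frag_extend_diff)
      then show "F (act m x, act m y) i = sum_act ?J (\<lambda>i. cyc_group_act (n (?k i))) m (F (x, y)) i"
        using xy kI by (auto simp: F_def sum_act_def h(2) cyc_group_act_mset_frag)
    qed
    then show ?thesis using xy axy act by (simp add: X groth_act_class h_class)
  qed
  show ?thesis unfolding gamma_isomorphic_def
  proof (intro bexI allI ballI)
    show "?h \<in> iso (groth_group M) ?H" using hom bij by (simp add: iso_def)
  qed (rule equivariant)
qed


section \<open>Normal forms in the graph monoid\<close>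

lemma filter_mset_sum: "finite A \<Longrightarrow> filter_mset P (sum f A) = (\<Sum>x\<in>A. filter_mset P (f x))"
  by (induction A rule: finite_induct) auto

lemma image_mset_sum: "finite A \<Longrightarrow> image_mset g (sum f A) = (\<Sum>x\<in>A. image_mset g (f x))"
  by (induction A rule: finite_induct) auto

lemma in_sum_mset_iff: "finite A \<Longrightarrow> x \<in># sum f A \<longleftrightarrow> (\<exists>a\<in>A. x \<in># f a)"
  by (induction A rule: finite_induct) auto

lemma range_sum_conv:
  assumes "finite Z"
  shows "range_sum E m Z = (\<Sum>e\<in>Z. {#(m, Proper (head E e))#})"
  using assms unfolding range_sum_def
  by (induction Z rule: finite_induct) auto

lemma sim_sum:
  assumes "finite A" "\<And>x. x \<in> A \<Longrightarrow> (f x, g x) \<in> sim E"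
  shows "(sum f A, sum g A) \<in> sim E"
  using assms by (induction A rule: finite_induct) (auto intro: sim_refl sim_add)

context tame_graph
begin

lemma not_inf_emitter: "\<not> inf_emitter G v"
  using regular by (auto simp: inf_emitter_def regular_def)

lemma gens_eq: "gens G = Proper ` verts G"
  by (auto simp: gens_def not_inf_emitter)

text \<open>The reduction of the exponent comes from \<open>x ^ period b b \<sim> b\<close>.\<close>

definition walk_term :: "int \<Rightarrow> 'b list \<times> 'a \<Rightarrow> (int \<times> 'a) multiset" where
  "walk_term m w = {#((m + int (length (fst w))) mod int (period (snd w)), snd w)#}"

definition expand :: "int \<times> ('a, 'b) gen \<Rightarrow> (int \<times> 'a) multiset" where
  "expand x = sum (walk_term (fst x)) (base_walks (gen_base (snd x)))"

definition normal_form :: "('a, 'b) formal_sum \<Rightarrow> (int \<times> 'a) multiset" where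
  "normal_form a = (\<Sum>x\<in>#a. expand x)"

lemma normal_form_add: "normal_form (a + b) = normal_form a + normal_form b"
  by (simp add: normal_form_def)

lemma sum_base_walks_step:
  assumes "v \<in> verts G" "v \<notin> Bases"
  shows "sum f (base_walks v) = (\<Sum>e\<in>out_arcs G v. \<Sum>w\<in>base_walks (head G e). f (e # fst w, snd w))"
proof -
  have "sum f (base_walks v) =
      (\<Sum>e\<in>out_arcs G v. sum f ((\<lambda>(p, b). (e # p, b)) ` base_walks (head G e)))"
    unfolding base_walks_step[OF assms(2)]
    using assms(1) finite_out finite_base_walks by (intro sum.UNION_disjoint) auto
  also have "\<dots> = (\<Sum>e\<in>out_arcs G v. \<Sum>w\<in>base_walks (head G e). f (e # fst w, snd w))"
  proof (rule sum.cong[OF HOL.refl])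
    fix e
    have "inj_on (\<lambda>w. (e # fst w, snd w)) (base_walks (head G e))"
      by (auto simp: inj_on_def prod_eq_iff)
    then show "sum f ((\<lambda>(p, b). (e # p, b)) ` base_walks (head G e)) =
        (\<Sum>w\<in>base_walks (head G e). f (e # fst w, snd w))"
      by (simp add: sum.reindex case_prod_unfold)
  qed
  finally show ?thesis .
qed

text \<open>At a non-base vertex the base walks are those of the next vertices, prolonged by one
  edge. At a base vertex the only edge leads once round the cycle, and the resulting
  \<open>period v\<close> in the exponent is removed by the reduction.\<close>

lemma expand_step:
  assumes v: "v \<in> verts G"
  shows "expand (m, Proper v) = (\<Sum>e\<in>out_arcs G v. expand (m + 1, Proper (head G e)))"
proof (cases "v \<in> Bases")
  case False
  have "walk_term m (e # fst w, snd w) = walk_term (m + 1) w" for e w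
    by (simp add: walk_term_def add_ac)
  then show ?thesis using sum_base_walks_step[OF v False, of "walk_term m"] by (simp add: expand_def)
next
  case True
  have eq: "m + 1 + int (length (base_return v)) = m + int (period v)"
    by (simp add: period_def base_cycle_def)
  have "(m + 1 + int (length (base_return v))) mod int (period v) = m mod int (period v)"
    unfolding eq by simp
  then show ?thesis using base_walks_base[OF True] base_out_arcs[OF True] base_return[OF True]
    by (simp add: expand_def walk_term_def)
qed

lemma normal_form_range_sum:
  "finite Z \<Longrightarrow> normal_form (range_sum G m Z) = (\<Sum>e\<in>Z. expand (m, Proper (head G e)))"
  unfolding normal_form_def range_sum_def by (induction Z rule: finite_induct) auto

lemma arrow1_normal_form: "arrow1 G a b \<Longrightarrow> normal_form a = normal_form b"
proof (induction rule: arrow1.induct)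
  case (A1 a v m)
  then have "v \<in> verts G" "finite (out_arcs G v)" by (auto simp: regular_def)
  then have "normal_form {#(m, Proper v)#} = normal_form (range_sum G (m + 1) (out_arcs G v))"
    using expand_step[of v m] normal_form_range_sum by (simp add: normal_form_def)
  then show ?case by (simp only: normal_form_add)
qed (simp_all add: not_inf_emitter)

definition rotate_nf :: "int \<Rightarrow> int \<times> 'a \<Rightarrow> int \<times> 'a" where
  "rotate_nf n x = ((fst x + n) mod int (period (snd x)), snd x)"

lemma normal_form_shift: "normal_form (shift n a) = image_mset (rotate_nf n) (normal_form a)"
proof -
  have walk: "walk_term (n + m) w = image_mset (rotate_nf n) (walk_term m w)" for m w
    by (simp add: walk_term_def rotate_nf_def mod_simps add_ac)
  \<comment> \<open>Outside the graph there are no base walks, so the sum over them is finite at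
    every vertex.\<close>
  have "finite (base_walks v)" if "v \<notin> verts G" for v
  proof -
    have "base_walks v = {}" using that by (auto simp: base_walks_def)
    then show ?thesis by simp
  qed
  then have "finite (base_walks v)" for v using finite_base_walks by blast
  then have "expand (n + m, g) = image_mset (rotate_nf n) (expand (m, g))" for m g
    by (auto simp: expand_def walk image_mset_sum)
  then show ?thesis by (induction a) (auto simp: normal_form_def shift_def)
qed

lemma sim_normal_form: "(a, b) \<in> sim G \<Longrightarrow> normal_form a = normal_form b"
proof (induction rule: sim.induct)
  case (sim_arrow a b)
  then have "(arrow1 G)\<^sup>*\<^sup>* a b" by (simp add: arrow_def)
  then show ?case by induction (auto dest: arrow1_normal_form)
qed (simp_all add: normal_form_add normal_form_shift)

definition of_normal_form :: "(int \<times> 'a) multiset \<Rightarrow> ('a, 'b) formal_sum" where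
  "of_normal_form N = image_mset (map_prod id Proper) N"

lemma sim_step:
  assumes v: "v \<in> verts G"
  shows "({#(m, Proper v)#}, \<Sum>e\<in>out_arcs G v. {#(m + 1, Proper (head G e))#}) \<in> sim G"
proof -
  have "arrow1 G ({#} + {#(m, Proper v)#}) ({#} + range_sum G (m + 1) (out_arcs G v))"
    by (rule arrow1.A1) (use regular[OF v] in auto)
  then have "arrow G {#(m, Proper v)#} (range_sum G (m + 1) (out_arcs G v))"
    using v by (auto simp: arrow_def gens_eq)
  then show ?thesis using sim_arrow range_sum_conv[OF finite_out[OF v]] by metis
qed

text \<open>Iterated (A1): non-base vertices are replaced until only base vertices are left, which
  terminates by the well-founded induction.\<close>

lemma sim_base_walks:
  "v \<in> verts G \<Longrightarrow>
    ({#(m, Proper v)#}, \<Sum>w\<in>base_walks v. {#(m + int (length (fst w)), Proper (snd w))#}) \<in> sim G"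
proof (induction v arbitrary: m rule: vertex_induct)
  case (base v)
  then show ?case using Bases_in_verts[OF base]
    by (auto simp: base_walks_base gens_eq intro!: sim_refl)
next
  case (step v)
  have A: "(\<Sum>e\<in>out_arcs G v. {#(m + 1, Proper (head G e))#}, \<Sum>e\<in>out_arcs G v.
      \<Sum>w\<in>base_walks (head G e). {#(m + 1 + int (length (fst w)), Proper (snd w))#}) \<in> sim G"
    by (rule sim_sum) (use step.IH finite_out[OF step.hyps(1)] in auto)
  have eq: "(\<Sum>w\<in>base_walks v. {#(m + int (length (fst w)), Proper (snd w))#}) =
      (\<Sum>e\<in>out_arcs G v. \<Sum>w\<in>base_walks (head G e). {#(m + 1 + int (length (fst w)), Proper (snd w))#})"
    by (subst sum_base_walks_step[OF step.hyps]) (simp add: add_ac)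
  show ?case unfolding eq by (rule sim_trans[OF sim_step[OF step.hyps(1)] A])
qed

text \<open>One turn round the cycle of \<open>b\<close>: (A1) at \<open>b\<close>, followed by the
  expansion of the next vertex, whose only base walk returns to \<open>b\<close>.\<close>

lemma sim_period:
  assumes b: "b \<in> Bases"
  shows "({#(m, Proper b)#}, {#(m + int (period b), Proper b)#}) \<in> sim G"
proof -
  have "({#(m, Proper b)#}, {#(m + 1, Proper (head G (base_edge b)))#}) \<in> sim G"
    using sim_step[OF Bases_in_verts[OF b], of m] by (simp add: base_out_arcs[OF b])
  moreover have "({#(m + 1, Proper (head G (base_edge b)))#}, {#(m + int (period b), Proper b)#}) \<in> sim G"
    using sim_base_walks[of "head G (base_edge b)" "m + 1"] base_edge_in[OF b] base_return[OF b]
    by (simp add: period_def base_cycle_def add_ac)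
  ultimately show ?thesis by (rule sim_trans)
qed

lemma sim_mod_period:
  assumes b: "b \<in> Bases"
  shows "({#(m, Proper b)#}, {#(m mod int (period b), Proper b)#}) \<in> sim G"
proof -
  \<comment> \<open>\<open>up\<close> adds natural multiples of the period only; the sign of the
    quotient decides from which of the two exponents it starts.\<close>
  have up: "({#(m, Proper b)#}, {#(m + int k * int (period b), Proper b)#}) \<in> sim G" for m k
  proof (induction k)
    case 0
    then show ?case using Bases_in_verts[OF b] by (auto simp: gens_eq intro: sim_refl)
  next
    case (Suc k)
    have eq: "m + int k * int (period b) + int (period b) = m + int (Suc k) * int (period b)"
      by (simp add: algebra_simps)
    show ?case using sim_trans[OF Suc sim_period[OF b]] unfolding eq .
  qed
  let ?q = "m div int (period b)"
  have m: "m = m mod int (period b) + ?q * int (period b)" by simp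
  show ?thesis
  proof (cases "?q \<ge> 0")
    case True
    then have "m mod int (period b) + int (nat ?q) * int (period b) = m" by simp
    then show ?thesis using sim_sym[OF up[of "m mod int (period b)" "nat ?q"]] by simp
  next
    case False
    then have "m + int (nat (- ?q)) * int (period b) = m mod int (period b)"
      by (simp add: minus_div_mult_eq_mod)
    then show ?thesis using up[of m "nat (- ?q)"] by simp
  qed
qed

lemma sim_of_normal_form:
  assumes "a \<in> free_gamma G"
  shows "(a, of_normal_form (normal_form a)) \<in> sim G"
  using assms
proof (induction a)
  case empty
  then show ?case by (simp add: normal_form_def of_normal_form_def sim_refl)
next
  case (add x a)
  obtain m v where x: "x = (m, Proper v)" "v \<in> verts G"
    using add.prems by (cases x) (auto simp: gens_eq)
  have fin: "finite (base_walks v)" by (rule finite_base_walks[OF x(2)])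
  have A: "({#x#}, \<Sum>w\<in>base_walks v. {#(m + int (length (fst w)), Proper (snd w))#}) \<in> sim G"
    using sim_base_walks[OF x(2)] by (simp add: x)
  have B: "(\<Sum>w\<in>base_walks v. {#(m + int (length (fst w)), Proper (snd w))#},
      \<Sum>w\<in>base_walks v. {#((m + int (length (fst w))) mod int (period (snd w)), Proper (snd w))#}) \<in> sim G"
    by (rule sim_sum[OF fin], rule sim_mod_period) (auto simp: base_walks_def)
  have C: "(\<Sum>w\<in>base_walks v. {#((m + int (length (fst w))) mod int (period (snd w)), Proper (snd w))#}) =
      of_normal_form (expand x)"
    using fin by (simp add: of_normal_form_def expand_def x image_mset_sum walk_term_def)
  have "({#x#}, of_normal_form (expand x)) \<in> sim G" using sim_trans[OF A B] unfolding C .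
  moreover have "(a, of_normal_form (normal_form a)) \<in> sim G"
    using add by (cases x) auto
  ultimately have "({#x#} + a, of_normal_form (expand x) + of_normal_form (normal_form a)) \<in> sim G"
    by (rule sim_add)
  then show ?case by (simp add: normal_form_def of_normal_form_def)
qed

definition normal_sums :: "(int \<times> 'a) multiset set" where
  "normal_sums = {N. \<forall>(k, b) \<in> set_mset N. b \<in> Bases \<and> 0 \<le> k \<and> k < int (period b)}"

lemma normal_form_in: "a \<in> free_gamma G \<Longrightarrow> normal_form a \<in> normal_sums"
proof (induction a)
  case empty
  then show ?case by (simp add: normal_form_def normal_sums_def)
next
  case (add x a)
  obtain m v where x: "x = (m, Proper v)" "v \<in> verts G"
    using add.prems by (cases x) (auto simp: gens_eq)
  have "expand x \<in> normal_sums"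
    using finite_base_walks[OF x(2)] period_pos
    by (auto simp: expand_def x walk_term_def normal_sums_def in_sum_mset_iff base_walks_def)
  moreover have "normal_form a \<in> normal_sums" using add by (cases x) auto
  ultimately show ?case by (auto simp: normal_form_def normal_sums_def)
qed

lemma of_normal_form_in: "N \<in> normal_sums \<Longrightarrow> of_normal_form N \<in> free_gamma G"
  by (auto simp: normal_sums_def of_normal_form_def free_gamma_def gens_eq Bases_in_verts)

lemma normal_form_of_normal_form: "N \<in> normal_sums \<Longrightarrow> normal_form (of_normal_form N) = N"
proof (induction N)
  case (add x N)
  then have "N \<in> normal_sums" "expand (map_prod id Proper x) = {#x#}"
    by (auto simp: normal_sums_def expand_def base_walks_base walk_term_def split: prod.splits)
  then show ?case using add.IH by (simp add: normal_form_def of_normal_form_def)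
qed (simp add: normal_form_def of_normal_form_def)

lemma normal_form_image: "normal_form ` free_gamma G = normal_sums"
  using normal_form_in normal_form_of_normal_form of_normal_form_in by force

text \<open>Invariance gives one inclusion. For the other, both elements are congruent to the formal
  sum rebuilt from their common normal form.\<close>

lemma sim_iff_normal_form:
  "sim G = {(a, b). a \<in> free_gamma G \<and> b \<in> free_gamma G \<and> normal_form a = normal_form b}"
proof -
  have "(a, b) \<in> sim G" if "a \<in> free_gamma G" "b \<in> free_gamma G" "normal_form a = normal_form b" for a b
    using sim_of_normal_form[OF that(1)] sim_sym[OF sim_of_normal_form[OF that(2)]] that(3) sim_trans
    by metis
  then show ?thesis using sim_normal_form sim_subset by auto
qed

text \<open>The direct sum is indexed by the element type of the monoid, so a base vertex has to
  appear as a set of formal sums. A singleton, instead of the class of \<open>b\<close> under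
  \<open>sim\<close>, makes injectivity immediate.\<close>

definition base_index :: "'a \<Rightarrow> ('a, 'b) formal_sum set" where
  "base_index b = {vertex_elem b}"

lemma base_index_inj: "base_index b = base_index b' \<longleftrightarrow> b = b'"
  by (simp add: base_index_def vertex_elem_def)

definition index_base :: "('a, 'b) formal_sum set \<Rightarrow> 'a" where
  "index_base i = (THE b. i = base_index b)"

lemma index_base [simp]: "index_base (base_index b) = b"
  by (simp add: index_base_def base_index_inj)

definition component_of :: "(int \<times> 'a) multiset \<Rightarrow> 'a \<Rightarrow> nat multiset" where
  "component_of N b = image_mset (nat \<circ> fst) (filter_mset (\<lambda>x. snd x = b) N)"

definition to_family :: "(int \<times> 'a) multiset \<Rightarrow> ('a, 'b) formal_sum set \<Rightarrow> nat multiset" where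
  "to_family N = (\<lambda>i\<in>base_index ` Bases. component_of N (index_base i))"

abbreviation base_sum :: "(('a, 'b) formal_sum set \<Rightarrow> nat multiset) monoid" where
  "base_sum \<equiv> sum_monoid (base_index ` Bases) (\<lambda>i. cyc_monoid (period (index_base i)))"

text \<open>The passage to natural numbers loses nothing, since exponents in normal sums are
  nonnegative.\<close>

lemma component_of_inverse:
  assumes "N \<in> normal_sums"
  shows "image_mset (\<lambda>k. (int k, b)) (component_of N b) = filter_mset (\<lambda>x. snd x = b) N"
proof -
  have "image_mset ((\<lambda>k. (int k, b)) \<circ> (nat \<circ> fst)) (filter_mset (\<lambda>x. snd x = b) N) =
      filter_mset (\<lambda>x. snd x = b) N"
    using assms by (intro multiset.map_ident_strong) (auto simp: normal_sums_def)
  then show ?thesis by (simp add: component_of_def multiset.map_comp)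
qed

lemma to_family_inj: "inj_on to_family normal_sums"
proof (rule inj_onI)
  fix N N' assume N: "N \<in> normal_sums" "N' \<in> normal_sums" and eq: "to_family N = to_family N'"
  have "count N (k, b) = count N' (k, b)" for k b
  proof (cases "b \<in> Bases")
    case True
    then have "component_of N b = component_of N' b"
      using fun_cong[OF eq, of "base_index b"] by (simp add: to_family_def)
    then have "filter_mset (\<lambda>x. snd x = b) N = filter_mset (\<lambda>x. snd x = b) N'"
      using component_of_inverse N by metis
    then have "count (filter_mset (\<lambda>x. snd x = b) N) (k, b) = count (filter_mset (\<lambda>x. snd x = b) N') (k, b)"
      by simp
    then show ?thesis by simp
  next
    case False
    then have "(k, b) \<notin># N" "(k, b) \<notin># N'" using N by (auto simp: normal_sums_def)
    then show ?thesis by (simp add: not_in_iff)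
  qed
  then show "N = N'" by (auto intro: multiset_eqI)
qed

lemma base_sum_carrier: "f \<in> carrier base_sum \<longleftrightarrow>
    f \<in> extensional (base_index ` Bases) \<and> (\<forall>b\<in>Bases. set_mset (f (base_index b)) \<subseteq> {..<period b}) \<and>
    finite {b \<in> Bases. f (base_index b) \<noteq> {#}}"
proof -
  have inj: "inj_on base_index A" for A by (auto simp: inj_on_def base_index_inj)
  have "{i \<in> base_index ` Bases. f i \<noteq> {#}} = base_index ` {b \<in> Bases. f (base_index b) \<noteq> {#}}" by auto
  then have "finite {i \<in> base_index ` Bases. f i \<noteq> {#}} \<longleftrightarrow> finite {b \<in> Bases. f (base_index b) \<noteq> {#}}"
    by (simp only: finite_image_iff[OF inj])
  then show ?thesis by (auto simp: sum_monoid_def cyc_monoid_def PiE_iff)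
qed

lemma to_family_carrier:
  assumes "N \<in> normal_sums"
  shows "to_family N \<in> carrier base_sum"
proof -
  have "{b \<in> Bases. to_family N (base_index b) \<noteq> {#}} \<subseteq> snd ` set_mset N"
    by (force simp: to_family_def component_of_def simp flip: set_mset_eq_empty_iff)
  then have "finite {b \<in> Bases. to_family N (base_index b) \<noteq> {#}}" by (rule finite_subset) simp
  moreover have "k < period b" if "k \<in># component_of N b" for k b
    using that assms by (auto simp: component_of_def normal_sums_def)
  ultimately show ?thesis by (auto simp: base_sum_carrier to_family_def)
qed

lemma to_family_surj:
  assumes f: "f \<in> carrier base_sum"
  shows "\<exists>N\<in>normal_sums. to_family N = f"
proof -
  let ?S = "{b \<in> Bases. f (base_index b) \<noteq> {#}}"
  let ?g = "\<lambda>b. image_mset (\<lambda>k. (int k, b)) (f (base_index b))"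
  have fin: "finite ?S" and lt: "\<And>b k. b \<in> Bases \<Longrightarrow> k \<in># f (base_index b) \<Longrightarrow> k < period b"
    and ext: "f \<in> extensional (base_index ` Bases)"
    using f by (auto simp: base_sum_carrier)
  define N where "N = (\<Sum>b\<in>?S. ?g b)"
  have N: "N \<in> normal_sums"
    using lt by (auto simp: normal_sums_def N_def in_sum_mset_iff[OF fin])
  have comp: "component_of N b = f (base_index b)" if b: "b \<in> Bases" for b
  proof -
    have "filter_mset (\<lambda>x. snd x = b) (?g b') = (if b' = b then ?g b' else {#})" for b'
      by (cases "b' = b") (simp_all add: filter_mset_image_mset comp_def)
    then have "filter_mset (\<lambda>x. snd x = b) N = (\<Sum>b'\<in>?S. if b' = b then ?g b' else {#})"
      by (simp add: N_def filter_mset_sum[OF fin])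
    also have "\<dots> = (if b \<in> ?S then ?g b else {#})" by (rule sum.delta[OF fin])
    also have "\<dots> = ?g b" using b by auto
    finally have "component_of N b = image_mset (nat \<circ> fst) (?g b)" by (simp add: component_of_def)
    also have "\<dots> = f (base_index b)" by (simp add: multiset.map_comp comp_def)
    finally show ?thesis .
  qed
  have "to_family N i = f i" for i
    using comp ext by (cases "i \<in> base_index ` Bases") (auto simp: to_family_def extensional_def)
  then show ?thesis using N by auto
qed

lemma to_family_rotate:
  assumes N: "N \<in> normal_sums"
  shows "to_family (image_mset (rotate_nf n) N) =
    sum_act (base_index ` Bases) (\<lambda>i. cyc_monoid_act (period (index_base i))) n (to_family N)"
proof -
  have "component_of (image_mset (rotate_nf n) N) b = cyc_monoid_act (period b) n (component_of N b)" for b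
  proof -
    have "component_of (image_mset (rotate_nf n) N) b =
        image_mset (nat \<circ> fst \<circ> rotate_nf n) (filter_mset (\<lambda>x. snd x = b) N)"
      by (simp add: component_of_def filter_mset_image_mset rotate_nf_def comp_def multiset.map_comp)
    also have "\<dots> = image_mset (cyc_shift (period b) n \<circ> (nat \<circ> fst)) (filter_mset (\<lambda>x. snd x = b) N)"
      using N by (intro image_mset_cong) (auto simp: normal_sums_def rotate_nf_def cyc_shift_def)
    also have "\<dots> = cyc_monoid_act (period b) n (component_of N b)"
      by (simp add: component_of_def cyc_monoid_act_def multiset.map_comp)
    finally show ?thesis .
  qed
  then show ?thesis by (auto simp: to_family_def sum_act_def)
qed

theorem graph_monoid_cyclic_sum:
  "gamma_isomorphic (graph_monoid G) (graph_monoid_act G) base_sum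
    (sum_act (base_index ` Bases) (\<lambda>i. cyc_monoid_act (period (index_base i))))"
proof -
  define nf where "nf X = the_elem (normal_form ` X)" for X
  have nf_class: "nf (sim_class a) = normal_form a" if "a \<in> free_gamma G" for a
    unfolding nf_def by (rule the_elem_image_class[OF sim_iff_normal_form that])
  have "bij_betw nf (carrier (graph_monoid G)) normal_sums"
    using bij_betw_quotient[OF sim_iff_normal_form] unfolding normal_form_image nf_def
    by (simp add: graph_monoid_def)
  moreover have "bij_betw to_family normal_sums (carrier base_sum)"
    unfolding bij_betw_def using to_family_inj to_family_carrier to_family_surj by blast
  ultimately have bij: "bij_betw (to_family \<circ> nf) (carrier (graph_monoid G)) (carrier base_sum)"
    by (rule bij_betw_trans)
  show ?thesis unfolding gamma_isomorphic_def iso_def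
  proof (intro bexI[of _ "to_family \<circ> nf"] CollectI conjI allI ballI homI bij)
    fix X assume "X \<in> carrier (graph_monoid G)"
    then show "(to_family \<circ> nf) X \<in> carrier base_sum" using bij by (auto simp: bij_betw_def)
  next
    fix X Y assume "X \<in> carrier (graph_monoid G)" "Y \<in> carrier (graph_monoid G)"
    then obtain a b where ab: "a \<in> free_gamma G" "b \<in> free_gamma G"
      and X: "X = sim_class a" "Y = sim_class b" by (metis graph_monoid_carrierE)
    have "to_family (N + N') = to_family N \<otimes>\<^bsub>base_sum\<^esub> to_family N'" for N N'
      by (auto simp: to_family_def component_of_def sum_monoid_def cyc_monoid_def)
    then show "(to_family \<circ> nf) (X \<otimes>\<^bsub>graph_monoid G\<^esub> Y) = (to_family \<circ> nf) X \<otimes>\<^bsub>base_sum\<^esub> (to_family \<circ> nf) Y"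
      using ab by (simp add: X graph_monoid_mult nf_class normal_form_add)
  next
    fix n X assume "X \<in> carrier (graph_monoid G)"
    then obtain a where a: "a \<in> free_gamma G" "X = sim_class a" by (rule graph_monoid_carrierE)
    then show "(to_family \<circ> nf) (graph_monoid_act G n X) =
        sum_act (base_index ` Bases) (\<lambda>i. cyc_monoid_act (period (index_base i))) n ((to_family \<circ> nf) X)"
      by (simp add: graph_monoid_act_class nf_class normal_form_shift to_family_rotate normal_form_in)
  qed
qed

end


section \<open>Graph-theoretic characterisations\<close>

context wf_digraph
begin

lemma tame_graph_iff:
  "tame_graph G \<longleftrightarrow> row_finite G \<and> no_exit_graph G \<and> \<not> (\<exists>v. sink G v) \<and>
    (\<forall>f. inf_path G f \<longrightarrow> (\<exists>c. pre_digraph.cycle G c \<and> inf_path_ends_in f c))" (is "_ = ?R")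
proof
  assume "tame_graph G"
  then interpret tame_graph G .
  show ?R
    using regular no_exit ends
    by (fastforce simp: row_finite_def inf_emitter_def sink_def regular_def)
next
  assume ?R
  then show "tame_graph G"
    by unfold_locales (auto simp: row_finite_def inf_emitter_def sink_def regular_def)
qed

text \<open>Forwards, the path is prolonged to an infinite path, which is cut where it has reached a
  cycle. Backwards, regularity comes from the trivial paths, and the absence of exits from the
  infinite paths that run round a cycle forever.\<close>

lemma tame_graph_iff_paths:
  "tame_graph G \<longleftrightarrow>
    (\<forall>u p w. awalk u p w \<longrightarrow>
       (\<exists>q z. awalk u (p @ q) z \<and>
          (\<exists>c. pre_digraph.cycle G c \<and> \<not> has_exit G c \<and> z \<in> cycle_verts G c) \<and>
          (\<forall>y \<in> set (awalk_verts u (p @ q)). regular G y))) \<and>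
    (\<forall>f. inf_path G f \<longrightarrow>
       (\<exists>c. pre_digraph.cycle G c \<and> \<not> has_exit G c \<and> inf_path_ends_in f c))"
  (is "_ \<longleftrightarrow> ?P \<and> ?I")
proof
  assume "tame_graph G"
  then interpret tame_graph G .
  have ?I using ends no_exit unfolding no_exit_graph_def by blast
  moreover have ?P
  proof (intro allI impI)
    fix u p w assume p: "awalk u p w"
    then have "w \<in> verts G" by (rule awalk_last_in_verts)
    then obtain f where f: "inf_path G f" "tail G (f 0) = w"
      using infinite_path_from[OF out_nonempty] by blast
    obtain n where n: "on_closed (tail G (f n))"
      using ends[OF f(1)] inf_path_ends_on_closed[OF f(1)] by metis
    then obtain c where c: "pre_digraph.cycle G c" "awalk (tail G (f n)) c (tail G (f n))"
      by (rule on_closed_imp_cycle)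
    have q: "awalk u (p @ map f [0..<n]) (tail G (f n))"
      using awalk_appendI[OF p] inf_path_awalk[OF f(1), of 0 n] f(2) by simp
    have "\<not> has_exit G c" "tail G (f n) \<in> cycle_verts G c"
      using no_exit c closed_walk_start[OF c(2)] by (auto simp: no_exit_graph_def cycle_def)
    moreover have "\<forall>y \<in> set (awalk_verts u (p @ map f [0..<n])). regular G y"
      using q regular by blast
    ultimately show "\<exists>q z. awalk u (p @ q) z \<and>
          (\<exists>c. pre_digraph.cycle G c \<and> \<not> has_exit G c \<and> z \<in> cycle_verts G c) \<and>
          (\<forall>y \<in> set (awalk_verts u (p @ q)). regular G y)"
      using q c(1) by blast
  qed
  ultimately show "?P \<and> ?I" by blast
next
  assume PI: "?P \<and> ?I"
  have "regular G v" if v: "v \<in> verts G" for v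
  proof -
    have "awalk v [] v" using v by (simp add: awalk_Nil_iff)
    then obtain q z where "awalk v ([] @ q) z" "\<forall>y \<in> set (awalk_verts v ([] @ q)). regular G y"
      using PI by blast
    then show ?thesis using hd_in_awalk_verts(1) by blast
  qed
  moreover have "no_exit_graph G" using PI by (intro no_exit_graphI) blast
  ultimately show "tame_graph G" using PI by unfold_locales blast+
qed

text \<open>The paths starting at \<open>v\<close> form a finite tree which branches completely at
  regular vertices, so \<open>f\<close> can leave it only at the end of one of its branches.\<close>

lemma set_arrow_meets_inf_path:
  assumes reg: "\<And>v. v \<in> verts G \<Longrightarrow> regular G v"
    and arrow: "set_arrow G {Proper v} W" and W: "W \<subseteq> Proper ` verts G"
    and f: "inf_path G f" "tail G (f 0) = v"
  obtains n where "Proper (tail G (f n)) \<in> W"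
proof -
  from arrow[unfolded set_arrow_def, THEN conjunct2, THEN conjunct2, THEN conjunct2,
      THEN conjunct2, THEN conjunct2, THEN conjunct2]
  obtain gs hs I p where A: "set gs = {Proper v} \<and> set hs = W \<and>
        inj_on I {..<length gs} \<and> partition_on {..<length hs} (I ` {..<length gs}) \<and>
        (\<forall>i < length gs. \<forall>j \<in> I i.
           connects_by G (gs ! i) (p i j) (hs ! j) \<and>
           (\<forall>q v. prefix q (p i j) \<and> awalk (gen_base (gs ! i)) q v \<longrightarrow>
              (let P = (\<lambda>q. next_edges G v q (p i ` I i)) in
                (regular G v \<and> P q \<noteq> {} \<longrightarrow> P q = out_arcs G v) \<and>
                (inf_emitter G v \<and> P q \<noteq> {} \<longrightarrow>
                   (\<exists>j' \<in> I i. \<exists>Z. hs ! j' = Improper v Z \<and> P q \<subseteq> Z)) \<and>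
                (inf_emitter G v \<longrightarrow>
                   (\<forall>Z. hs ! j = Improper v Z \<longrightarrow> P (p i j) \<subseteq> Z)))))"
    by (elim exE) (rule that)
  have gs: "set gs = {Proper v}" using A by (elim conjE)
  have hs: "set hs = W" using A by (elim conjE)
  have part: "partition_on {..<length hs} (I ` {..<length gs})" using A by (elim conjE)
  note B = A[THEN conjunct2, THEN conjunct2, THEN conjunct2, THEN conjunct2, rule_format]
  have conn: "connects_by G (gs ! i) (p i j) (hs ! j)" if "i < length gs" "j \<in> I i" for i j
    by (rule B[OF that, THEN conjunct1])
  have full: "next_edges G y q (p i ` I i) = out_arcs G y"
    if ij: "i < length gs" "j \<in> I i" and q: "prefix q (p i j)" "awalk (gen_base (gs ! i)) q y"
      and ne: "regular G y" "next_edges G y q (p i ` I i) \<noteq> {}" for i j q y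
    by (rule B[OF ij, THEN conjunct2, rule_format, OF conjI[OF q], unfolded Let_def,
        THEN conjunct1, rule_format, OF conjI[OF ne]])
  have l: "0 < length gs" using gs by (cases gs) auto
  \<comment> \<open>All entries of \<open>gs\<close> are \<open>Proper v\<close>, and the paths
    indexed by \<open>I 0\<close> alone already have to meet \<open>f\<close>.\<close>
  then have g0: "gs ! 0 = Proper v" using gs nth_mem by blast
  have "{} \<notin> I ` {..<length gs}" "\<Union> (I ` {..<length gs}) = {..<length hs}"
    using part by (auto simp: partition_on_def)
  then have I0: "I 0 \<noteq> {}" "I 0 \<subseteq> {..<length hs}" using l by auto
  let ?S = "p 0 ` I 0"
  define Q where "Q n \<longleftrightarrow> (\<exists>r\<in>?S. prefix (map f [0..<n]) r)" for n
  have fin: "finite ?S" using I0(2) finite_subset by blast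
  have "n \<le> Max (length ` ?S)" if Qn: "Q n" for n
  proof -
    obtain r where r: "r \<in> ?S" "prefix (map f [0..<n]) r" using Qn by (auto simp: Q_def)
    have "length r \<le> Max (length ` ?S)" using r(1) fin by (intro Max_ge) auto
    then show ?thesis using prefix_length_le[OF r(2)] by simp
  qed
  moreover have "Q 0" using I0 by (auto simp: Q_def)
  \<comment> \<open>The longest initial segment of \<open>f\<close> along which some path of
    \<open>?S\<close> runs; it exists because \<open>?S\<close> is finite.\<close>
  ultimately obtain N where N: "Q N" "\<not> Q (Suc N)"
    by (metis not_less_eq_eq le_refl nat_induct)
  let ?q = "map f [0..<N]" and ?y = "tail G (f N)"
  obtain j where j: "j \<in> I 0" "prefix ?q (p 0 j)" using N(1) by (auto simp: Q_def)
  have q: "awalk v ?q ?y" using inf_path_awalk[OF f(1), of 0 N] f(2) by simp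
  have y: "regular G ?y" using q reg by blast
  have fN: "f N \<in> out_arcs G ?y" using f(1) by (simp add: inf_path_def)
  \<comment> \<open>If some path went on from here, the condition at regular vertices would let
    every edge at \<open>?y\<close>, hence also \<open>f N\<close>, follow on some path, against the
    choice of \<open>N\<close>.\<close>
  have none: "next_edges G ?y ?q ?S = {}"
  proof (rule ccontr)
    assume "next_edges G ?y ?q ?S \<noteq> {}"
    then have "f N \<in> next_edges G ?y ?q ?S"
      using full[OF l j, of ?y] q y g0 fN by simp
    then have "Q (Suc N)" by (auto simp: next_edges_def Q_def)
    then show False using N(2) by simp
  qed
  have walk: "awalk v (p 0 j) (gen_base (hs ! j))"
    using conn[OF l j(1)] g0 by (simp add: connects_by_def)
  have "p 0 j = ?q"
  proof (rule ccontr)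
    assume "p 0 j \<noteq> ?q"
    then obtain e r where r: "p 0 j = ?q @ e # r"
      using j(2) by (metis append_Nil2 neq_Nil_conv prefixE)
    then have "awalk (awlast v ?q) (e # r) (gen_base (hs ! j))" using walk by simp
    moreover have "awlast v ?q = ?y" using q by blast
    ultimately have "e \<in> next_edges G ?y ?q ?S"
      using j(1) r by (force simp: next_edges_def awalk_Cons_iff)
    then show False using none by simp
  qed
  then have "gen_base (hs ! j) = ?y" using walk q by (metis awalkE')
  moreover have "hs ! j \<in> W" using hs j(1) I0(2) by auto
  ultimately show ?thesis using that W by fastforce
qed

text \<open>An infinite path meets \<open>V\<close>, whose elements are all core vertices. The cycle
  through the vertex it meets is a core cycle, hence without exits, and the path is captured by
  it.\<close>

lemma tame_graph_if_set_arrow: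
  assumes "\<forall>v \<in> verts G. \<exists>V. set_arrow_A1 G {Proper v} V \<and> stationary G V \<and> core G V = V \<and>
       (\<forall>c. core_cycle G V c \<longrightarrow> \<not> has_exit G c)"
  shows "tame_graph G"
proof -
  have reg: "regular G v" if "v \<in> verts G" for v
    using assms that by (fastforce simp: set_arrow_A1_def)
  have ends: "\<exists>c. pre_digraph.cycle G c \<and> \<not> has_exit G c \<and> inf_path_ends_in f c"
    if f: "inf_path G f" for f
  proof -
    have "tail G (f 0) \<in> verts G" using f by (simp add: inf_path_def)
    then obtain V where V: "set_arrow G {Proper (tail G (f 0))} V" "V \<subseteq> Proper ` verts G"
      "core G V = V" "\<And>c. core_cycle G V c \<Longrightarrow> \<not> has_exit G c"
      using assms by (auto simp: set_arrow_A1_def)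
    obtain n where n: "Proper (tail G (f n)) \<in> V"
      using set_arrow_meets_inf_path[OF reg V(1,2) f] by blast
    let ?y = "tail G (f n)"
    have "on_cycle G (Proper ?y)" using n V(3) by (auto simp: core_def)
    then have "on_closed ?y" by (auto simp: on_cycle_def connects_by_def on_closed_def)
    then obtain c where c: "pre_digraph.cycle G c" "awalk ?y c ?y" by (rule on_closed_imp_cycle)
    have "connects_by G (Proper ?y) (rotate 0 c) (Proper ?y)"
      using c(2) by (auto simp: connects_by_def gens_def)
    then have "core_cycle G V c"
      using c(1) n V(3) unfolding core_cycle_def cycle_contains_def by blast
    then have ne: "\<not> has_exit G c" by (rule V(4))
    have "c \<noteq> []" using c(1) by (auto simp: cycle_def)
    then have "f (n + k) = c ! (k mod length c)" for k
      using closed_walk_follow[OF f c(2)] no_exit_unique_edge[OF c(1) ne] by blast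
    then show ?thesis using c(1) ne by (auto simp: inf_path_ends_in_def)
  qed
  show ?thesis
    using reg ends no_exit_graphI[OF ends] by unfold_locales blast+
qed

end

context tame_graph
begin

text \<open>The base walks from \<open>v\<close> serve as paths, all belonging to the single start
  vertex. They form a complete tree: where one of them continues with an edge, every other edge at
  the same vertex can be continued to a base walk as well.\<close>

lemma set_arrow_base_walks:
  assumes v: "v \<in> verts G"
  shows "set_arrow_A1 G {Proper v} (Proper ` snd ` base_walks v)"
proof -
  obtain ws where ws: "set ws = base_walks v" using finite_list[OF finite_base_walks[OF v]] by blast
  let ?W = "Proper ` snd ` base_walks v" and ?n = "length ws"
  let ?p = "\<lambda>(i::nat) j. fst (ws ! j)" and ?I = "\<lambda>i::nat. {..<?n}"
  let ?hs = "map (Proper \<circ> snd) ws" and ?gs = "[Proper v]"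
  have n: "?n > 0" using ws base_walks_nonempty[OF v] by (cases ws) auto
  have S: "?p i ` ?I i = fst ` base_walks v" for i
    unfolding ws[symmetric] by (force simp: in_set_conv_nth image_iff)
  have W: "?W \<subseteq> Proper ` verts G" by (auto simp: base_walks_def Bases_in_verts)
  have conn: "connects_by G (?gs ! 0) (?p 0 j) (?hs ! j)" if j: "j < ?n" for j
  proof -
    have "ws ! j \<in> base_walks v" using ws j nth_mem by blast
    then show ?thesis using j v
      by (auto simp: connects_by_def gens_def base_walks_def Bases_in_verts)
  qed
  have full: "next_edges G y q (fst ` base_walks v) = out_arcs G y"
    if ne: "next_edges G y q (fst ` base_walks v) \<noteq> {}" and q: "awalk v q y" for q y
  proof
    show "next_edges G y q (fst ` base_walks v) \<subseteq> out_arcs G y" by (auto simp: next_edges_def)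
    obtain e r b where e: "e \<in> out_arcs G y" and rb: "(r, b) \<in> base_walks v" "prefix (q @ [e]) r"
      using ne by (auto simp: next_edges_def)
    have tails: "\<forall>e\<in>set (q @ [e]). tail G e \<notin> Bases"
      using rb set_mono_prefix[OF rb(2)] by (auto simp: base_walks_def)
    show "out_arcs G y \<subseteq> next_edges G y q (fst ` base_walks v)"
    proof
      fix e' assume e': "e' \<in> out_arcs G y"
      then obtain r' b' where r': "(r', b') \<in> base_walks (head G e')"
        using base_walks_nonempty[of "head G e'"] by auto
      have "awalk v (q @ e' # r') b'"
        by (rule awalk_appendI[OF q])
          (use e' r' in \<open>auto simp: awalk_Cons_iff base_walks_def\<close>)
      \<comment> \<open>The common tail is not a base vertex because \<open>e\<close> lies on the
        base walk \<open>r\<close>; so \<open>e'\<close> may be used on a base walk too.\<close>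
      moreover have "tail G e' = tail G e" using e e' by simp
      ultimately have "(q @ e' # r', b') \<in> base_walks v"
        using r' tails by (auto simp: base_walks_def)
      moreover have "prefix (q @ [e']) (q @ e' # r')" by (simp add: prefix_def)
      ultimately show "e' \<in> next_edges G y q (fst ` base_walks v)"
        using e' by (force simp: next_edges_def)
    qed
  qed
  have ni: "\<not> inf_emitter G y" for y
    using regular by (auto simp: inf_emitter_def regular_def)
  have "set_arrow G {Proper v} ?W"
    unfolding set_arrow_def
  proof (intro conjI)
    show "\<exists>gs hs I p. set gs = {Proper v} \<and> set hs = ?W \<and>
        inj_on I {..<length gs} \<and> partition_on {..<length hs} (I ` {..<length gs}) \<and>
        (\<forall>i < length gs. \<forall>j \<in> I i.
           connects_by G (gs ! i) (p i j) (hs ! j) \<and>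
           (\<forall>q v. prefix q (p i j) \<and> awalk (gen_base (gs ! i)) q v \<longrightarrow>
              (let P = (\<lambda>q. next_edges G v q (p i ` I i)) in
                (regular G v \<and> P q \<noteq> {} \<longrightarrow> P q = out_arcs G v) \<and>
                (inf_emitter G v \<and> P q \<noteq> {} \<longrightarrow>
                   (\<exists>j' \<in> I i. \<exists>Z. hs ! j' = Improper v Z \<and> P q \<subseteq> Z)) \<and>
                (inf_emitter G v \<longrightarrow>
                   (\<forall>Z. hs ! j = Improper v Z \<longrightarrow> P (p i j) \<subseteq> Z)))))"
    proof (rule exI[of _ ?gs], rule exI[of _ ?hs], rule exI[of _ ?I], rule exI[of _ ?p],
        intro conjI allI impI ballI)
      show "partition_on {..<length ?hs} (?I ` {..<length ?gs})"
        using n by (auto simp: partition_on_def disjoint_def)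
      show "set ?hs = ?W" using ws by (simp add: image_image image_comp)
      show "inj_on ?I {..<length ?gs}" by (auto simp: inj_on_def)
      fix i j assume ij: "i < length ?gs" "j \<in> ?I i"
      then show "connects_by G (?gs ! i) (?p i j) (?hs ! j)" using conn by simp
      fix q y assume q: "prefix q (?p i j) \<and> awalk (gen_base (?gs ! i)) q y"
      show "let P = \<lambda>q. next_edges G y q (?p i ` ?I i)
         in (regular G y \<and> P q \<noteq> {} \<longrightarrow> P q = out_arcs G y) \<and>
            (inf_emitter G y \<and> P q \<noteq> {} \<longrightarrow> (\<exists>j'\<in>?I i. \<exists>Z. ?hs ! j' = Improper y Z \<and> P q \<subseteq> Z)) \<and>
            (inf_emitter G y \<longrightarrow> (\<forall>Z. ?hs ! j = Improper y Z \<longrightarrow> P (?p i j) \<subseteq> Z))"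
        unfolding Let_def S using full[of y q] q ij(1) ni by simp
    qed simp
  qed (use v W finite_base_walks[OF v] base_walks_nonempty[OF v] in \<open>auto simp: gens_def\<close>)
  then show ?thesis using W regular[OF v] by (simp add: set_arrow_A1_def)
qed

lemma set_arrow_characterisation:
  "\<forall>v \<in> verts G. \<exists>V. set_arrow_A1 G {Proper v} V \<and> stationary G V \<and> core G V = V \<and>
       (\<forall>c. core_cycle G V c \<longrightarrow> \<not> has_exit G c)"
proof
  fix v assume v: "v \<in> verts G"
  let ?V = "Proper ` snd ` base_walks v :: ('a, 'b) gen set"
  have on: "on_cycle G (Proper b :: ('a, 'b) gen)" if "b \<in> Bases" for b
    using base_cycle_walk[OF that] Bases_in_verts[OF that]
    by (auto simp: on_cycle_def connects_by_def gens_def base_cycle_def)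
  have "stationary G ?V"
    using on finite_base_walks[OF v] base_walks_nonempty[OF v] Bases_in_verts
    by (auto simp: stationary_def gens_def base_walks_def)
  moreover have "core G ?V = ?V" using on by (auto simp: core_def base_walks_def)
  moreover have "\<forall>c. core_cycle G ?V c \<longrightarrow> \<not> has_exit G c"
    using no_exit by (auto simp: core_cycle_def no_exit_graph_def)
  ultimately show "\<exists>V. set_arrow_A1 G {Proper v} V \<and> stationary G V \<and> core G V = V \<and>
       (\<forall>c. core_cycle G V c \<longrightarrow> \<not> has_exit G c)"
    using set_arrow_base_walks[OF v] by blast
qed

end


section \<open>Algebras without unit\<close>

text \<open>With infinitely many vertices the Leavitt path algebra has no unit, so the algebra laws
  are collected without one.\<close>

locale nonunital_algebra = field K + A: abelian_group A
  for K :: "'k ring" and A :: "('k, 'a) graded_algebra" +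
  assumes mult_closed [simp]: "x \<in> carrier A \<Longrightarrow> y \<in> carrier A \<Longrightarrow> x \<otimes>\<^bsub>A\<^esub> y \<in> carrier A"
    and mult_assoc: "x \<in> carrier A \<Longrightarrow> y \<in> carrier A \<Longrightarrow> z \<in> carrier A \<Longrightarrow>
      (x \<otimes>\<^bsub>A\<^esub> y) \<otimes>\<^bsub>A\<^esub> z = x \<otimes>\<^bsub>A\<^esub> (y \<otimes>\<^bsub>A\<^esub> z)"
    and mult_add: "x \<in> carrier A \<Longrightarrow> y \<in> carrier A \<Longrightarrow> z \<in> carrier A \<Longrightarrow>
      x \<otimes>\<^bsub>A\<^esub> (y \<oplus>\<^bsub>A\<^esub> z) = x \<otimes>\<^bsub>A\<^esub> y \<oplus>\<^bsub>A\<^esub> x \<otimes>\<^bsub>A\<^esub> z"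
    and add_mult: "x \<in> carrier A \<Longrightarrow> y \<in> carrier A \<Longrightarrow> z \<in> carrier A \<Longrightarrow>
      (x \<oplus>\<^bsub>A\<^esub> y) \<otimes>\<^bsub>A\<^esub> z = x \<otimes>\<^bsub>A\<^esub> z \<oplus>\<^bsub>A\<^esub> y \<otimes>\<^bsub>A\<^esub> z"
    and smult_closed [simp]: "a \<in> carrier K \<Longrightarrow> x \<in> carrier A \<Longrightarrow> a \<odot>\<^bsub>A\<^esub> x \<in> carrier A"
    and smult_add: "a \<in> carrier K \<Longrightarrow> x \<in> carrier A \<Longrightarrow> y \<in> carrier A \<Longrightarrow>
      a \<odot>\<^bsub>A\<^esub> (x \<oplus>\<^bsub>A\<^esub> y) = a \<odot>\<^bsub>A\<^esub> x \<oplus>\<^bsub>A\<^esub> a \<odot>\<^bsub>A\<^esub> y"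
    and add_smult: "a \<in> carrier K \<Longrightarrow> b \<in> carrier K \<Longrightarrow> x \<in> carrier A \<Longrightarrow>
      (a \<oplus>\<^bsub>K\<^esub> b) \<odot>\<^bsub>A\<^esub> x = a \<odot>\<^bsub>A\<^esub> x \<oplus>\<^bsub>A\<^esub> b \<odot>\<^bsub>A\<^esub> x"
    and smult_smult: "a \<in> carrier K \<Longrightarrow> b \<in> carrier K \<Longrightarrow> x \<in> carrier A \<Longrightarrow>
      (a \<otimes>\<^bsub>K\<^esub> b) \<odot>\<^bsub>A\<^esub> x = a \<odot>\<^bsub>A\<^esub> (b \<odot>\<^bsub>A\<^esub> x)"
    and one_smult [simp]: "x \<in> carrier A \<Longrightarrow> \<one>\<^bsub>K\<^esub> \<odot>\<^bsub>A\<^esub> x = x"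
    and smult_mult: "a \<in> carrier K \<Longrightarrow> x \<in> carrier A \<Longrightarrow> y \<in> carrier A \<Longrightarrow>
      (a \<odot>\<^bsub>A\<^esub> x) \<otimes>\<^bsub>A\<^esub> y = a \<odot>\<^bsub>A\<^esub> (x \<otimes>\<^bsub>A\<^esub> y)"
    and mult_smult: "a \<in> carrier K \<Longrightarrow> x \<in> carrier A \<Longrightarrow> y \<in> carrier A \<Longrightarrow>
      x \<otimes>\<^bsub>A\<^esub> (a \<odot>\<^bsub>A\<^esub> y) = a \<odot>\<^bsub>A\<^esub> (x \<otimes>\<^bsub>A\<^esub> y)"
begin

text \<open>An element equal to its own double is zero. With \<open>f\<close> a multiplication by a
  fixed element this yields the zero laws below.\<close>

lemma additive_zero:
  assumes "f \<zero>\<^bsub>A\<^esub> \<in> carrier A" "f (\<zero>\<^bsub>A\<^esub> \<oplus>\<^bsub>A\<^esub> \<zero>\<^bsub>A\<^esub>) = f \<zero>\<^bsub>A\<^esub> \<oplus>\<^bsub>A\<^esub> f \<zero>\<^bsub>A\<^esub>"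
  shows "f \<zero>\<^bsub>A\<^esub> = \<zero>\<^bsub>A\<^esub>"
proof -
  have "f \<zero>\<^bsub>A\<^esub> \<oplus>\<^bsub>A\<^esub> f \<zero>\<^bsub>A\<^esub> = f \<zero>\<^bsub>A\<^esub>" using assms by simp
  then show ?thesis using assms(1) A.add.l_cancel_one by blast
qed

lemma zero_mult [simp]: "x \<in> carrier A \<Longrightarrow> \<zero>\<^bsub>A\<^esub> \<otimes>\<^bsub>A\<^esub> x = \<zero>\<^bsub>A\<^esub>"
  \<comment> \<open>The unit laws of addition are switched off so that
    \<open>\<zero> \<oplus> \<zero>\<close> survives until distributivity has been applied.\<close>
  by (rule additive_zero[of "\<lambda>y. y \<otimes>\<^bsub>A\<^esub> x"]) (simp_all add: add_mult del: A.add.l_one A.add.r_one A.l_zero A.r_zero)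

lemma mult_zero [simp]: "x \<in> carrier A \<Longrightarrow> x \<otimes>\<^bsub>A\<^esub> \<zero>\<^bsub>A\<^esub> = \<zero>\<^bsub>A\<^esub>"
  by (rule additive_zero[of "\<lambda>y. x \<otimes>\<^bsub>A\<^esub> y"]) (simp_all add: mult_add del: A.add.l_one A.add.r_one A.l_zero A.r_zero)

lemma smult_zero [simp]: "a \<in> carrier K \<Longrightarrow> a \<odot>\<^bsub>A\<^esub> \<zero>\<^bsub>A\<^esub> = \<zero>\<^bsub>A\<^esub>"
  by (rule additive_zero[of "\<lambda>y. a \<odot>\<^bsub>A\<^esub> y"]) (simp_all add: smult_add del: A.add.l_one A.add.r_one A.l_zero A.r_zero)

lemma zero_smult [simp]:
  assumes "x \<in> carrier A"
  shows "\<zero>\<^bsub>K\<^esub> \<odot>\<^bsub>A\<^esub> x = \<zero>\<^bsub>A\<^esub>"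
proof -
  have "\<zero>\<^bsub>K\<^esub> \<odot>\<^bsub>A\<^esub> x \<oplus>\<^bsub>A\<^esub> \<zero>\<^bsub>K\<^esub> \<odot>\<^bsub>A\<^esub> x = \<zero>\<^bsub>K\<^esub> \<odot>\<^bsub>A\<^esub> x"
    using add_smult[of "\<zero>\<^bsub>K\<^esub>" "\<zero>\<^bsub>K\<^esub>" x] assms by simp
  then show ?thesis using A.add.l_cancel_one smult_closed[OF zero_closed assms] by blast
qed

lemma finsum_mult:
  assumes "finite S" "\<And>i. i \<in> S \<Longrightarrow> f i \<in> carrier A" "y \<in> carrier A"
  shows "(\<Oplus>\<^bsub>A\<^esub>i\<in>S. f i) \<otimes>\<^bsub>A\<^esub> y = (\<Oplus>\<^bsub>A\<^esub>i\<in>S. f i \<otimes>\<^bsub>A\<^esub> y)"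
  using assms(1,2)
proof (induction S rule: finite_induct)
  case (insert a S)
  then have "f \<in> S \<rightarrow> carrier A" "f a \<in> carrier A" "(\<lambda>i. f i \<otimes>\<^bsub>A\<^esub> y) \<in> S \<rightarrow> carrier A"
    using assms(3) by auto
  then show ?case using insert assms(3) by (simp add: A.finsum_insert add_mult)
qed (use assms(3) in simp)

lemma mult_finsum:
  assumes "finite S" "\<And>i. i \<in> S \<Longrightarrow> f i \<in> carrier A" "y \<in> carrier A"
  shows "y \<otimes>\<^bsub>A\<^esub> (\<Oplus>\<^bsub>A\<^esub>i\<in>S. f i) = (\<Oplus>\<^bsub>A\<^esub>i\<in>S. y \<otimes>\<^bsub>A\<^esub> f i)"
  using assms(1,2)
proof (induction S rule: finite_induct)
  case (insert a S)
  then have "f \<in> S \<rightarrow> carrier A" "f a \<in> carrier A" "(\<lambda>i. y \<otimes>\<^bsub>A\<^esub> f i) \<in> S \<rightarrow> carrier A"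
    using assms(3) by auto
  then show ?case using insert assms(3) by (simp add: A.finsum_insert mult_add)
qed (use assms(3) in simp)

lemma smult_finsum:
  assumes "finite S" "\<And>i. i \<in> S \<Longrightarrow> f i \<in> carrier A" "a \<in> carrier K"
  shows "a \<odot>\<^bsub>A\<^esub> (\<Oplus>\<^bsub>A\<^esub>i\<in>S. f i) = (\<Oplus>\<^bsub>A\<^esub>i\<in>S. a \<odot>\<^bsub>A\<^esub> f i)"
  using assms(1,2)
proof (induction S rule: finite_induct)
  case (insert x S)
  then have "f \<in> S \<rightarrow> carrier A" "f x \<in> carrier A" "(\<lambda>i. a \<odot>\<^bsub>A\<^esub> f i) \<in> S \<rightarrow> carrier A"
    using assms(3) by auto
  then show ?case using insert assms(3) by (simp add: A.finsum_insert smult_add)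
qed (use assms(3) in simp)

end


section \<open>The Leavitt path algebra\<close>

lemma lsum_closed: "set ts \<subseteq> lterms K E \<Longrightarrow> lsum ts \<in> lterms K E"
  by (induction ts) (auto simp: lsum_def intro: lterms.intros)

locale leavitt_path = wf_digraph G + field K
  for G :: "('v, 'e) pre_digraph" and K :: "'k ring"
begin

abbreviation "L \<equiv> leavitt K G"
abbreviation "T \<equiv> lterms K G"

abbreviation cl :: "('k, 'v, 'e) lterm \<Rightarrow> ('k, 'v, 'e) lterm set" where
  "cl t \<equiv> lpa_rel K G `` {t}"

lemma lpa_rel_in_lterms: "(s, t) \<in> lpa_rel K G \<Longrightarrow> s \<in> T \<and> t \<in> T"
proof (induction rule: lpa_rel.induct)
  case (CK2 v es)
  have "set (map (\<lambda>e. LMult (Edge e) (Ghost e)) es) \<subseteq> T"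
    using CK2 by (auto simp: out_arcs_def intro!: lterms.intros)
  then have "lsum (map (\<lambda>e. LMult (Edge e) (Ghost e)) es) \<in> T" by (rule lsum_closed)
  then show ?case using CK2(1) by (simp add: regular_def lterms.intros)
qed (auto intro!: lterms.intros)

lemma cl_eq_iff:
  assumes "s \<in> T" "t \<in> T"
  shows "cl s = cl t \<longleftrightarrow> (s, t) \<in> lpa_rel K G"
proof
  assume "cl s = cl t"
  then show "(s, t) \<in> lpa_rel K G" using lpa_rel.refl[OF assms(2)] by blast
next
  assume st: "(s, t) \<in> lpa_rel K G"
  show "cl s = cl t"
    using lpa_rel.trans[OF st] lpa_rel.trans[OF lpa_rel.sym[OF st]] by blast
qed

lemma cl_eqI: "(s, t) \<in> lpa_rel K G \<Longrightarrow> cl s = cl t"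
  using cl_eq_iff lpa_rel_in_lterms by blast

lemma cl_self: "t \<in> T \<Longrightarrow> t \<in> cl t"
  by (auto intro: lpa_rel.refl)

lemma cl_carrier [simp]: "t \<in> T \<Longrightarrow> cl t \<in> carrier L"
  by (auto simp: leavitt_def intro: quotientI)

lemma carrierE:
  assumes "X \<in> carrier L"
  obtains t where "t \<in> T" "X = cl t"
proof -
  have "X \<in> T // lpa_rel K G" using assms by (simp add: leavitt_def)
  then show thesis by (rule quotientE) (rule that)
qed

lemma cl_zero: "\<zero>\<^bsub>L\<^esub> = cl LZero"
  by (simp add: leavitt_def)

text \<open>The operations of \<open>leavitt\<close> saturate a set of results; if all results are
  congruent to one of them, the saturation is its class.\<close>

lemma class_image_eq:
  assumes "\<And>x. x \<in> S \<Longrightarrow> (x, t) \<in> lpa_rel K G" "t \<in> S"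
  shows "lpa_rel K G `` S = cl t"
proof
  show "lpa_rel K G `` S \<subseteq> cl t"
    using assms(1) lpa_rel.trans lpa_rel.sym by blast
  show "cl t \<subseteq> lpa_rel K G `` S" using assms(2) by blast
qed

lemma cl_add:
  assumes "s \<in> T" "t \<in> T"
  shows "cl s \<oplus>\<^bsub>L\<^esub> cl t = cl (LAdd s t)"
proof -
  have "lpa_rel K G `` {LAdd s' t' | s' t'. s' \<in> cl s \<and> t' \<in> cl t} = cl (LAdd s t)"
  proof (rule class_image_eq)
    show "LAdd s t \<in> {LAdd s' t' | s' t'. s' \<in> cl s \<and> t' \<in> cl t}" using assms cl_self by blast
    fix x assume "x \<in> {LAdd s' t' | s' t'. s' \<in> cl s \<and> t' \<in> cl t}"
    then show "(x, LAdd s t) \<in> lpa_rel K G" using lpa_rel.sym[OF lpa_rel.cong_add] assms by blast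
  qed
  then show ?thesis by (simp add: leavitt_def)
qed

lemma cl_mult:
  assumes "s \<in> T" "t \<in> T"
  shows "cl s \<otimes>\<^bsub>L\<^esub> cl t = cl (LMult s t)"
proof -
  have "lpa_rel K G `` {LMult s' t' | s' t'. s' \<in> cl s \<and> t' \<in> cl t} = cl (LMult s t)"
  proof (rule class_image_eq)
    show "LMult s t \<in> {LMult s' t' | s' t'. s' \<in> cl s \<and> t' \<in> cl t}" using assms cl_self by blast
    fix x assume "x \<in> {LMult s' t' | s' t'. s' \<in> cl s \<and> t' \<in> cl t}"
    then show "(x, LMult s t) \<in> lpa_rel K G" using lpa_rel.sym[OF lpa_rel.cong_mult] assms by blast
  qed
  then show ?thesis by (simp add: leavitt_def)
qed

lemma cl_smult:
  assumes "a \<in> carrier K" "t \<in> T"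
  shows "a \<odot>\<^bsub>L\<^esub> cl t = cl (LScale a t)"
proof -
  have "lpa_rel K G `` (LScale a ` cl t) = cl (LScale a t)"
  proof (rule class_image_eq)
    show "LScale a t \<in> (LScale a ` cl t)" using assms cl_self by blast
    fix x assume "x \<in> (LScale a ` cl t)"
    then obtain t' where "x = LScale a t'" "(t, t') \<in> lpa_rel K G" by blast
    then show "(x, LScale a t) \<in> lpa_rel K G"
      using lpa_rel.sym[OF lpa_rel.cong_scale[OF assms(1)]] by simp
  qed
  then show ?thesis by (simp add: leavitt_def)
qed

lemmas cl_ops = cl_add cl_mult cl_smult lterms.intros

lemma leavitt_nonunital_algebra: "nonunital_algebra K L"
proof (intro nonunital_algebra.intro nonunital_algebra_axioms.intro abelian_groupI)
  show "field K" by (rule field_axioms)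
  show "\<zero>\<^bsub>L\<^esub> \<in> carrier L" by (simp add: cl_zero lterms.intros)
next
  fix X assume "X \<in> carrier L"
  then obtain t where t: "t \<in> T" "X = cl t" by (rule carrierE)
  show "\<zero>\<^bsub>L\<^esub> \<oplus>\<^bsub>L\<^esub> X = X"
    using t by (simp add: cl_zero cl_ops) (rule cl_eqI, rule lpa_rel.add_zero)
  show "\<one>\<^bsub>K\<^esub> \<odot>\<^bsub>L\<^esub> X = X"
    using t by (simp add: cl_ops) (rule cl_eqI, rule lpa_rel.scale_one)
  have m: "\<ominus>\<^bsub>K\<^esub> \<one>\<^bsub>K\<^esub> \<in> carrier K" by simp
  \<comment> \<open>The negative of a class is its multiple by the scalar -1.\<close>
  have "(LAdd (LScale (\<ominus>\<^bsub>K\<^esub> \<one>\<^bsub>K\<^esub>) t) t, LZero) \<in> lpa_rel K G"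
  proof -
    have "(LAdd (LScale (\<ominus>\<^bsub>K\<^esub> \<one>\<^bsub>K\<^esub>) t) t, LAdd (LScale (\<ominus>\<^bsub>K\<^esub> \<one>\<^bsub>K\<^esub>) t) (LScale \<one>\<^bsub>K\<^esub> t)) \<in> lpa_rel K G"
      using t m by (intro lpa_rel.cong_add lpa_rel.refl lpa_rel.sym[OF lpa_rel.scale_one] lterms.intros)
    moreover have "(LScale (\<ominus>\<^bsub>K\<^esub> \<one>\<^bsub>K\<^esub> \<oplus>\<^bsub>K\<^esub> \<one>\<^bsub>K\<^esub>) t, LAdd (LScale (\<ominus>\<^bsub>K\<^esub> \<one>\<^bsub>K\<^esub>) t) (LScale \<one>\<^bsub>K\<^esub> t)) \<in> lpa_rel K G"
      using t m by (intro lpa_rel.scale_add_left) auto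
    moreover have "(LScale (\<ominus>\<^bsub>K\<^esub> \<one>\<^bsub>K\<^esub> \<oplus>\<^bsub>K\<^esub> \<one>\<^bsub>K\<^esub>) t, LZero) \<in> lpa_rel K G"
      using lpa_rel.scale_zero[OF t(1)] by (simp add: l_neg)
    ultimately show ?thesis by (meson lpa_rel.sym lpa_rel.trans)
  qed
  then have "cl (LScale (\<ominus>\<^bsub>K\<^esub> \<one>\<^bsub>K\<^esub>) t) \<oplus>\<^bsub>L\<^esub> X = \<zero>\<^bsub>L\<^esub>"
    using cl_eqI t m by (simp add: cl_zero cl_ops)
  moreover have "cl (LScale (\<ominus>\<^bsub>K\<^esub> \<one>\<^bsub>K\<^esub>) t) \<in> carrier L" using t m by (simp add: lterms.intros)
  ultimately show "\<exists>Y\<in>carrier L. Y \<oplus>\<^bsub>L\<^esub> X = \<zero>\<^bsub>L\<^esub>" by blast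
next
  fix X Y assume "X \<in> carrier L" "Y \<in> carrier L"
  then obtain s t where st: "s \<in> T" "X = cl s" "t \<in> T" "Y = cl t" by (metis carrierE)
  show "X \<oplus>\<^bsub>L\<^esub> Y \<in> carrier L" "X \<otimes>\<^bsub>L\<^esub> Y \<in> carrier L"
    using st by (simp_all add: cl_ops)
  show "X \<oplus>\<^bsub>L\<^esub> Y = Y \<oplus>\<^bsub>L\<^esub> X"
    using st by (simp add: cl_ops) (rule cl_eqI, rule lpa_rel.add_comm)
next
  fix X Y Z assume "X \<in> carrier L" "Y \<in> carrier L" "Z \<in> carrier L"
  then obtain s t u where st: "s \<in> T" "X = cl s" "t \<in> T" "Y = cl t" "u \<in> T" "Z = cl u"
    by (metis carrierE)
  show "X \<oplus>\<^bsub>L\<^esub> Y \<oplus>\<^bsub>L\<^esub> Z = X \<oplus>\<^bsub>L\<^esub> (Y \<oplus>\<^bsub>L\<^esub> Z)"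
    using st by (simp add: cl_ops) (rule cl_eqI, rule lpa_rel.add_assoc)
  show "X \<otimes>\<^bsub>L\<^esub> Y \<otimes>\<^bsub>L\<^esub> Z = X \<otimes>\<^bsub>L\<^esub> (Y \<otimes>\<^bsub>L\<^esub> Z)"
    using st by (simp add: cl_ops) (rule cl_eqI, rule lpa_rel.mult_assoc)
  show "X \<otimes>\<^bsub>L\<^esub> (Y \<oplus>\<^bsub>L\<^esub> Z) = X \<otimes>\<^bsub>L\<^esub> Y \<oplus>\<^bsub>L\<^esub> X \<otimes>\<^bsub>L\<^esub> Z"
    using st by (simp add: cl_ops) (rule cl_eqI, rule lpa_rel.distrib_left)
  show "(X \<oplus>\<^bsub>L\<^esub> Y) \<otimes>\<^bsub>L\<^esub> Z = X \<otimes>\<^bsub>L\<^esub> Z \<oplus>\<^bsub>L\<^esub> Y \<otimes>\<^bsub>L\<^esub> Z"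
    using st by (simp add: cl_ops) (rule cl_eqI, rule lpa_rel.distrib_right)
next
  fix a X assume a: "a \<in> carrier K" and "X \<in> carrier L"
  then obtain t where t: "t \<in> T" "X = cl t" using carrierE by blast
  show "a \<odot>\<^bsub>L\<^esub> X \<in> carrier L" using a t by (simp add: cl_ops)
  fix b assume b: "b \<in> carrier K"
  show "(a \<oplus>\<^bsub>K\<^esub> b) \<odot>\<^bsub>L\<^esub> X = a \<odot>\<^bsub>L\<^esub> X \<oplus>\<^bsub>L\<^esub> b \<odot>\<^bsub>L\<^esub> X"
    using a b t by (simp add: cl_ops) (rule cl_eqI, rule lpa_rel.scale_add_left)
  show "(a \<otimes>\<^bsub>K\<^esub> b) \<odot>\<^bsub>L\<^esub> X = a \<odot>\<^bsub>L\<^esub> (b \<odot>\<^bsub>L\<^esub> X)"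
    using a b t by (simp add: cl_ops) (rule cl_eqI, rule lpa_rel.scale_scale)
next
  fix a X Y assume a: "a \<in> carrier K" and "X \<in> carrier L" "Y \<in> carrier L"
  then obtain s t where st: "s \<in> T" "X = cl s" "t \<in> T" "Y = cl t" by (metis carrierE)
  show "a \<odot>\<^bsub>L\<^esub> (X \<oplus>\<^bsub>L\<^esub> Y) = a \<odot>\<^bsub>L\<^esub> X \<oplus>\<^bsub>L\<^esub> a \<odot>\<^bsub>L\<^esub> Y"
    using a st by (simp add: cl_ops) (rule cl_eqI, rule lpa_rel.scale_add_right)
  show "(a \<odot>\<^bsub>L\<^esub> X) \<otimes>\<^bsub>L\<^esub> Y = a \<odot>\<^bsub>L\<^esub> (X \<otimes>\<^bsub>L\<^esub> Y)"
    using a st by (simp add: cl_ops) (rule cl_eqI, rule lpa_rel.scale_mult_left)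
  show "X \<otimes>\<^bsub>L\<^esub> (a \<odot>\<^bsub>L\<^esub> Y) = a \<odot>\<^bsub>L\<^esub> (X \<otimes>\<^bsub>L\<^esub> Y)"
    using a st by (simp add: cl_ops) (rule cl_eqI, rule lpa_rel.scale_mult_right)
qed

end

sublocale leavitt_path \<subseteq> LA: nonunital_algebra K L
  by (rule leavitt_nonunital_algebra)


subsection \<open>Walks as elements\<close>

context leavitt_path
begin

abbreviation lmult (infixl \<open>\<cdot>\<close> 70) where
  "x \<cdot> y \<equiv> x \<otimes>\<^bsub>L\<^esub> y"

lemma generator_closed [simp]:
  "v \<in> verts G \<Longrightarrow> cl (Vert v) \<in> carrier L"
  "e \<in> arcs G \<Longrightarrow> cl (Edge e) \<in> carrier L"
  "e \<in> arcs G \<Longrightarrow> cl (Ghost e) \<in> carrier L"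
  by (simp_all add: lterms.intros)

lemma vert_vert:
  assumes "u \<in> verts G" "v \<in> verts G"
  shows "cl (Vert u) \<cdot> cl (Vert v) = (if u = v then cl (Vert v) else \<zero>\<^bsub>L\<^esub>)"
  using assms cl_eqI[OF lpa_rel.vertex_idem[of v G K]] cl_eqI[OF lpa_rel.vertex_orth[of u G v K]]
  by (auto simp: cl_ops cl_zero)

lemma edge_units:
  assumes "e \<in> arcs G"
  shows "cl (Vert (tail G e)) \<cdot> cl (Edge e) = cl (Edge e)"
    "cl (Edge e) \<cdot> cl (Vert (head G e)) = cl (Edge e)"
    "cl (Vert (head G e)) \<cdot> cl (Ghost e) = cl (Ghost e)"
    "cl (Ghost e) \<cdot> cl (Vert (tail G e)) = cl (Ghost e)"
  using assms cl_eqI[OF lpa_rel.source_edge[OF assms, of K]] cl_eqI[OF lpa_rel.edge_range[OF assms, of K]]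
    cl_eqI[OF lpa_rel.range_ghost[OF assms, of K]] cl_eqI[OF lpa_rel.ghost_source[OF assms, of K]]
  by (simp_all add: cl_ops)

lemma ghost_edge:
  assumes "e \<in> arcs G" "f \<in> arcs G"
  shows "cl (Ghost e) \<cdot> cl (Edge f) = (if e = f then cl (Vert (head G e)) else \<zero>\<^bsub>L\<^esub>)"
  using assms cl_eqI[OF lpa_rel.CK1[OF assms(1), of K]] cl_eqI[OF lpa_rel.CK1_orth[of e G f K]]
  by (auto simp: cl_ops cl_zero)

lemma cl_lsum:
  "distinct xs \<Longrightarrow> (\<And>x. x \<in> set xs \<Longrightarrow> h x \<in> T) \<Longrightarrow>
    cl (lsum (map h xs)) = (\<Oplus>\<^bsub>L\<^esub>x\<in>set xs. cl (h x))"
proof (induction xs)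
  case Nil
  then show ?case by (simp add: lsum_def cl_zero)
next
  case (Cons x xs)
  have T: "h x \<in> T" "lsum (map h xs) \<in> T" using Cons.prems by (auto intro!: lsum_closed)
  have "cl (lsum (map h (x # xs))) = cl (h x) \<oplus>\<^bsub>L\<^esub> cl (lsum (map h xs))"
    using cl_add[OF T] by (simp add: lsum_def)
  also have "\<dots> = (\<Oplus>\<^bsub>L\<^esub>x\<in>set (x # xs). cl (h x))"
    using Cons T(1) by (simp add: LA.A.finsum_insert Pi_iff)
  finally show ?case .
qed

lemma vert_CK2:
  assumes "regular G v"
  shows "cl (Vert v) = (\<Oplus>\<^bsub>L\<^esub>e\<in>out_arcs G v. cl (Edge e) \<cdot> cl (Ghost e))"
proof -
  obtain es where es: "set es = out_arcs G v" "distinct es"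
    using finite_distinct_list assms by (auto simp: regular_def)
  have e: "e \<in> arcs G" if "e \<in> set es" for e using that es by (auto simp: out_arcs_def)
  have "cl (Vert v) = cl (lsum (map (\<lambda>e. LMult (Edge e) (Ghost e)) es))"
    by (rule cl_eqI, rule lpa_rel.CK2[OF assms es(2,1)])
  also have "\<dots> = (\<Oplus>\<^bsub>L\<^esub>e\<in>set es. cl (LMult (Edge e) (Ghost e)))"
    by (rule cl_lsum[OF es(2)]) (simp add: lterms.intros e)
  also have "\<dots> = (\<Oplus>\<^bsub>L\<^esub>e\<in>out_arcs G v. cl (Edge e) \<cdot> cl (Ghost e))"
    unfolding es(1)[symmetric] by (rule LA.A.finsum_cong') (auto simp: cl_ops e)
  finally show ?thesis .
qed

text \<open>Every product is closed by the vertex \<open>w\<close>, which makes the recursion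
  uniform; \<open>path_term\<close> ends in its last edge instead, and the two agree by the unit
  laws of edges.\<close>

primrec walk_elem :: "'e list \<Rightarrow> 'v \<Rightarrow> ('k, 'v, 'e) lterm set" where
  "walk_elem [] w = cl (Vert w)"
| "walk_elem (e # p) w = cl (Edge e) \<cdot> walk_elem p w"

primrec ghost_elem :: "'e list \<Rightarrow> 'v \<Rightarrow> ('k, 'v, 'e) lterm set" where
  "ghost_elem [] w = cl (Vert w)"
| "ghost_elem (e # p) w = ghost_elem p w \<cdot> cl (Ghost e)"

lemma walk_elem_closed [simp]: "awalk u p w \<Longrightarrow> walk_elem p w \<in> carrier L"
  by (induction p arbitrary: u) (auto simp: awalk_Cons_iff awalk_Nil_iff simp del: cl_carrier)

lemma ghost_elem_closed [simp]: "awalk u p w \<Longrightarrow> ghost_elem p w \<in> carrier L"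
  by (induction p arbitrary: u) (auto simp: awalk_Cons_iff awalk_Nil_iff simp del: cl_carrier)

lemma vert_walk:
  assumes "awalk u p w"
  shows "cl (Vert u) \<cdot> walk_elem p w = walk_elem p w"
proof (cases p)
  case (Cons e q)
  then have e: "e \<in> arcs G" "u = tail G e" "awalk (head G e) q w"
    using assms by (auto simp: awalk_Cons_iff)
  have "cl (Vert u) \<cdot> walk_elem p w = (cl (Vert u) \<cdot> cl (Edge e)) \<cdot> walk_elem q w"
    using e Cons by (simp add: LA.mult_assoc[OF _ _ walk_elem_closed[OF e(3)]] del: cl_carrier)
  then show ?thesis using e Cons by (simp add: edge_units)
qed (use assms in \<open>auto simp: awalk_Nil_iff vert_vert\<close>)

lemma ghost_vert:
  assumes "awalk u p w"
  shows "ghost_elem p w \<cdot> cl (Vert u) = ghost_elem p w"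
proof (cases p)
  case (Cons e q)
  then have e: "e \<in> arcs G" "u = tail G e" "awalk (head G e) q w"
    using assms by (auto simp: awalk_Cons_iff)
  have "ghost_elem p w \<cdot> cl (Vert u) = ghost_elem q w \<cdot> (cl (Ghost e) \<cdot> cl (Vert u))"
    using e Cons by (simp add: LA.mult_assoc[OF ghost_elem_closed[OF e(3)]] del: cl_carrier)
  then show ?thesis using e Cons by (simp add: edge_units)
qed (use assms in \<open>auto simp: awalk_Nil_iff vert_vert\<close>)

lemma walk_elem_append:
  assumes "awalk u p x" "awalk x q w"
  shows "walk_elem (p @ q) w = walk_elem p x \<cdot> walk_elem q w"
  using assms(1)
proof (induction p arbitrary: u)
  case Nil
  then show ?case using vert_walk[OF assms(2)] by (simp add: awalk_Nil_iff)
next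
  case (Cons e p)
  then have e: "e \<in> arcs G" "awalk (head G e) p x" by (auto simp: awalk_Cons_iff)
  then show ?case using Cons.IH[OF e(2)]
    by (simp add: LA.mult_assoc[OF _ walk_elem_closed[OF e(2)] walk_elem_closed[OF assms(2)]])
qed

lemma ghost_elem_append:
  assumes "awalk u p x" "awalk x q w"
  shows "ghost_elem (p @ q) w = ghost_elem q w \<cdot> ghost_elem p x"
  using assms(1)
proof (induction p arbitrary: u)
  case Nil
  then show ?case using ghost_vert[OF assms(2)] by (simp add: awalk_Nil_iff)
next
  case (Cons e p)
  then have e: "e \<in> arcs G" "awalk (head G e) p x" by (auto simp: awalk_Cons_iff)
  then show ?case using Cons.IH[OF e(2)]
    by (simp add: LA.mult_assoc[OF ghost_elem_closed[OF assms(2)] ghost_elem_closed[OF e(2)]])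
qed

lemma vert_ghost: "awalk u p w \<Longrightarrow> cl (Vert w) \<cdot> ghost_elem p w = ghost_elem p w"
  using ghost_elem_append[of u p w "[]" w] by (auto simp: awalk_Nil_iff)

lemma ghost_walk_step:
  assumes "e \<in> arcs G" "f \<in> arcs G" "awalk (head G e) q w" "awalk (head G f) p w'"
  shows "ghost_elem (e # q) w \<cdot> walk_elem (f # p) w' =
    (if e = f then ghost_elem q w \<cdot> walk_elem p w' else \<zero>\<^bsub>L\<^esub>)"
proof -
  have "ghost_elem (e # q) w \<cdot> walk_elem (f # p) w' =
      ghost_elem q w \<cdot> ((cl (Ghost e) \<cdot> cl (Edge f)) \<cdot> walk_elem p w')"
    using assms by (simp add: LA.mult_assoc[OF ghost_elem_closed[OF assms(3)]]
      LA.mult_assoc[OF _ _ walk_elem_closed[OF assms(4)]] walk_elem_closed[OF assms(4)] del: cl_carrier)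
  then show ?thesis
    using assms vert_walk[OF assms(4)] walk_elem_closed[OF assms(4)] ghost_elem_closed[OF assms(3)]
    by (simp add: ghost_edge)
qed

lemma ghost_walk: "awalk u q w \<Longrightarrow> ghost_elem q w \<cdot> walk_elem q w = cl (Vert w)"
proof (induction q arbitrary: u)
  case (Cons e q)
  then have "e \<in> arcs G" "awalk (head G e) q w" by (auto simp: awalk_Cons_iff)
  then show ?case using Cons.IH ghost_walk_step[of e e q w q w] by simp
qed (auto simp: awalk_Nil_iff vert_vert)

text \<open>Common initial edges cancel by (CK1), and the first pair of different edges gives zero.
  Neither walk is exhausted before, since neither is a prefix of the other.\<close>

lemma ghost_walk_incomparable:
  "awalk u q w \<Longrightarrow> awalk u' p w' \<Longrightarrow> \<not> prefix p q \<Longrightarrow> \<not> prefix q p \<Longrightarrow>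
    ghost_elem q w \<cdot> walk_elem p w' = \<zero>\<^bsub>L\<^esub>"
proof (induction q arbitrary: p u u')
  case (Cons e q)
  then obtain f p' where p: "p = f # p'" by (cases p) auto
  have e: "e \<in> arcs G" "f \<in> arcs G" "awalk (head G e) q w" "awalk (head G f) p' w'"
    using Cons.prems p by (auto simp: awalk_Cons_iff)
  show ?case unfolding p ghost_walk_step[OF e]
    using Cons.IH[OF e(3,4)] Cons.prems(3,4) p by auto
qed simp

definition walk_monomial :: "'e list \<Rightarrow> 'e list \<Rightarrow> 'v \<Rightarrow> ('k, 'v, 'e) lterm set" where
  "walk_monomial p q w = walk_elem p w \<cdot> ghost_elem q w"

lemma walk_monomial_closed [simp]:
  "awalk u p w \<Longrightarrow> awalk u' q w \<Longrightarrow> walk_monomial p q w \<in> carrier L"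
  by (simp add: walk_monomial_def)

lemma walk_monomial_mult_same:
  assumes "awalk u p w" "awalk u' q w" "awalk u'' r w"
  shows "walk_monomial p q w \<cdot> walk_monomial q r w = walk_monomial p r w"
proof -
  note c = walk_elem_closed[OF assms(1)] ghost_elem_closed[OF assms(2)]
    walk_elem_closed[OF assms(2)] ghost_elem_closed[OF assms(3)]
  have "walk_monomial p q w \<cdot> walk_monomial q r w =
      walk_elem p w \<cdot> ((ghost_elem q w \<cdot> walk_elem q w) \<cdot> ghost_elem r w)"
    using c by (simp add: walk_monomial_def LA.mult_assoc)
  also have "\<dots> = walk_monomial p r w"
    using assms by (simp add: ghost_walk vert_ghost walk_monomial_def)
  finally show ?thesis .
qed

lemma walk_monomial_mult_incomparable:
  assumes "awalk u p w" "awalk u' q w" "awalk v q' w'" "awalk v' r w'" "\<not> prefix q q'" "\<not> prefix q' q"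
  shows "walk_monomial p q w \<cdot> walk_monomial q' r w' = \<zero>\<^bsub>L\<^esub>"
proof -
  note c = walk_elem_closed[OF assms(1)] ghost_elem_closed[OF assms(2)]
    walk_elem_closed[OF assms(3)] ghost_elem_closed[OF assms(4)]
  have "walk_monomial p q w \<cdot> walk_monomial q' r w' =
      walk_elem p w \<cdot> ((ghost_elem q w \<cdot> walk_elem q' w') \<cdot> ghost_elem r w')"
    using c by (simp add: walk_monomial_def LA.mult_assoc)
  also have "\<dots> = \<zero>\<^bsub>L\<^esub>"
    using ghost_walk_incomparable[OF assms(2,3,6,5)] c by simp
  finally show ?thesis .
qed

text \<open>(CK2) for \<open>v\<close> is inserted between \<open>p\<close> and \<open>q*\<close>:
  each summand prolongs both walks by the same edge, so the degree stays the same.\<close>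

lemma walk_monomial_step:
  assumes p: "awalk u p v" and q: "awalk u' q v" and v: "regular G v"
  shows "walk_monomial p q v = (\<Oplus>\<^bsub>L\<^esub>e\<in>out_arcs G v. walk_monomial (p @ [e]) (q @ [e]) (head G e))"
proof -
  have fin: "finite (out_arcs G v)" using v by (simp add: regular_def)
  note c = walk_elem_closed[OF p] ghost_elem_closed[OF q]
  have e: "cl (Edge e) \<in> carrier L" "cl (Ghost e) \<in> carrier L" if "e \<in> out_arcs G v" for e
    using that by (auto simp del: cl_carrier)
  have "walk_monomial p q v = walk_elem p v \<cdot> (cl (Vert v) \<cdot> ghost_elem q v)"
    using vert_ghost[OF q] by (simp add: walk_monomial_def)
  also have "cl (Vert v) \<cdot> ghost_elem q v =
      (\<Oplus>\<^bsub>L\<^esub>e\<in>out_arcs G v. cl (Edge e) \<cdot> cl (Ghost e) \<cdot> ghost_elem q v)"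
    unfolding vert_CK2[OF v] using e c by (intro LA.finsum_mult[OF fin]) auto
  also have "walk_elem p v \<cdot> \<dots> =
      (\<Oplus>\<^bsub>L\<^esub>e\<in>out_arcs G v. walk_elem p v \<cdot> (cl (Edge e) \<cdot> cl (Ghost e) \<cdot> ghost_elem q v))"
    using e c by (intro LA.mult_finsum[OF fin]) auto
  also have "\<dots> = (\<Oplus>\<^bsub>L\<^esub>e\<in>out_arcs G v. walk_monomial (p @ [e]) (q @ [e]) (head G e))"
  proof (rule LA.A.finsum_cong')
    have w: "awalk v [e] (head G e)" if "e \<in> out_arcs G v" for e
      using that by (auto simp: awalk_Cons_iff awalk_Nil_iff)
    then show "(\<lambda>e. walk_monomial (p @ [e]) (q @ [e]) (head G e)) \<in> out_arcs G v \<rightarrow> carrier L"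
      using p q by (auto intro!: walk_monomial_closed awalk_appendI simp del: awalk_append_iff)
    fix i assume i: "i \<in> out_arcs G v"
    then have ia: "i \<in> arcs G" by simp
    have "walk_monomial (p @ [i]) (q @ [i]) (head G i) = (walk_elem p v \<cdot> cl (Edge i)) \<cdot> (cl (Ghost i) \<cdot> ghost_elem q v)"
      using walk_elem_append[OF p w[OF i]] ghost_elem_append[OF q w[OF i]] ia
      by (simp add: walk_monomial_def edge_units)
    then show "walk_elem p v \<cdot> (cl (Edge i) \<cdot> cl (Ghost i) \<cdot> ghost_elem q v) =
        walk_monomial (p @ [i]) (q @ [i]) (head G i)"
      using e[OF i] c by (simp add: LA.mult_assoc)
  qed simp
  finally show ?thesis .
qed

text \<open>\<open>path_term\<close> and \<open>ghost_term\<close> use their first argument only for the trivial path.\<close>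

lemma path_term: "awalk u p w \<Longrightarrow> (p = [] \<Longrightarrow> u = u') \<Longrightarrow>
    path_term u' p \<in> T \<and> cl (path_term u' p) = walk_elem p w"
proof (induction u' p arbitrary: u rule: path_term.induct)
  case (1 u')
  then show ?case by (auto simp: awalk_Nil_iff lterms.intros)
next
  case (2 u' e)
  then have "e \<in> arcs G" "w = head G e" by (auto simp: awalk_Cons_iff awalk_Nil_iff)
  then show ?case by (simp add: edge_units lterms.intros)
next
  case (3 u' e f p)
  have e: "e \<in> arcs G" "awalk (head G e) (f # p) w"
    using 3(2) by (auto simp: awalk_Cons_iff)
  have IH: "path_term u' (f # p) \<in> T" "cl (path_term u' (f # p)) = walk_elem (f # p) w"
    using 3(1)[OF e(2)] by auto
  have "cl (LMult (Edge e) (path_term u' (f # p))) = cl (Edge e) \<cdot> walk_elem (f # p) w"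
    using cl_mult[of "Edge e" "path_term u' (f # p)"] e(1) IH by (simp add: lterms.intros)
  then show ?case using e(1) IH(1) by (simp add: lterms.intros)
qed

lemma ghost_term: "awalk u p w \<Longrightarrow> (p = [] \<Longrightarrow> u = u') \<Longrightarrow>
    ghost_term u' p \<in> T \<and> cl (ghost_term u' p) = ghost_elem p w"
proof (induction u' p arbitrary: u rule: ghost_term.induct)
  case (1 u')
  then show ?case by (auto simp: awalk_Nil_iff lterms.intros)
next
  case (2 u' e)
  then have "e \<in> arcs G" "w = head G e" by (auto simp: awalk_Cons_iff awalk_Nil_iff)
  then show ?case by (simp add: edge_units lterms.intros)
next
  case (3 u' e f p)
  have e: "e \<in> arcs G" "awalk (head G e) (f # p) w"
    using 3(2) by (auto simp: awalk_Cons_iff)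
  have IH: "ghost_term u' (f # p) \<in> T" "cl (ghost_term u' (f # p)) = ghost_elem (f # p) w"
    using 3(1)[OF e(2)] by auto
  have "cl (LMult (ghost_term u' (f # p)) (Ghost e)) = ghost_elem (f # p) w \<cdot> cl (Ghost e)"
    using cl_mult[of "ghost_term u' (f # p)" "Ghost e"] e(1) IH by (simp add: lterms.intros)
  then show ?case using e(1) IH(1) by (simp add: lterms.intros)
qed

lemma monomial_term:
  assumes "awalk u p w" "awalk u' q w"
  shows "LMult (path_term u p) (ghost_term u' q) \<in> T"
    "cl (LMult (path_term u p) (ghost_term u' q)) = walk_monomial p q w"
  using path_term[OF assms(1), of u] ghost_term[OF assms(2), of u']
  by (auto simp: walk_monomial_def lterms.intros simp flip: cl_mult)

subsection \<open>Homogeneous components\<close>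

lemma homogeneous_in_lterms: "t \<in> lpa_homogeneous K G d \<Longrightarrow> t \<in> T"
  by (induction rule: lpa_homogeneous.induct) (auto intro: lterms.intros monomial_term)

lemma component_leavitt: "component L d = cl ` lpa_homogeneous K G d"
  by (simp add: leavitt_def)

lemma component_carrier: "X \<in> component L d \<Longrightarrow> X \<in> carrier L"
  using homogeneous_in_lterms by (auto simp: component_leavitt)

lemma component_zero [simp]: "\<zero>\<^bsub>L\<^esub> \<in> component L d"
  by (simp add: component_leavitt cl_zero lpa_homogeneous.intros)

lemma component_add: "X \<in> component L d \<Longrightarrow> Y \<in> component L d \<Longrightarrow> X \<oplus>\<^bsub>L\<^esub> Y \<in> component L d"
  unfolding component_leavitt
  by (auto simp: cl_add homogeneous_in_lterms intro!: imageI lpa_homogeneous.intros)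

lemma component_smult: "a \<in> carrier K \<Longrightarrow> X \<in> component L d \<Longrightarrow> a \<odot>\<^bsub>L\<^esub> X \<in> component L d"
  unfolding component_leavitt
  by (auto simp: cl_smult homogeneous_in_lterms intro!: imageI lpa_homogeneous.intros)

lemma component_monomial:
  assumes "awalk u p w" "awalk u' q w" "int (length p) - int (length q) = d"
  shows "walk_monomial p q w \<in> component L d"
  using lpa_homogeneous.intros(1)[OF assms] monomial_term(2)[OF assms(1,2)]
  unfolding component_leavitt by blast

lemma component_finsum:
  "finite S \<Longrightarrow> (\<And>i. i \<in> S \<Longrightarrow> f i \<in> component L d) \<Longrightarrow> (\<Oplus>\<^bsub>L\<^esub>i\<in>S. f i) \<in> component L d"
proof (induction S rule: finite_induct)
  case (insert a S)
  then show ?case using component_carrier by (subst LA.A.finsum_insert) (auto intro!: component_add)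
qed simp

text \<open>Induction principle for a homogeneous component, the linear span of the monomials
  \<open>p q*\<close> of degree \<open>d\<close>.\<close>

lemma component_subset:
  assumes "\<And>u p w u' q. awalk u p w \<Longrightarrow> awalk u' q w \<Longrightarrow> int (length p) - int (length q) = d \<Longrightarrow>
      walk_monomial p q w \<in> S"
    and "\<zero>\<^bsub>L\<^esub> \<in> S" "\<And>X Y. X \<in> S \<Longrightarrow> Y \<in> S \<Longrightarrow> X \<oplus>\<^bsub>L\<^esub> Y \<in> S"
    "\<And>a X. a \<in> carrier K \<Longrightarrow> X \<in> S \<Longrightarrow> a \<odot>\<^bsub>L\<^esub> X \<in> S"
  shows "component L d \<subseteq> S"
proof -
  have "cl t \<in> S" if "t \<in> lpa_homogeneous K G d" for t
    using that
  proof (induction rule: lpa_homogeneous.induct)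
    case (1 u p w u' q)
    then show ?case using assms(1) monomial_term(2) by simp
  next
    case 2
    then show ?case using assms(2) by (simp add: cl_zero)
  next
    case (3 s t)
    then show ?case using assms(3)[OF 3(3,4)] cl_add[of s t] homogeneous_in_lterms by simp
  next
    case (4 a t)
    then show ?case using assms(4)[OF 4(1,3)] cl_smult[of a t] homogeneous_in_lterms by simp
  qed
  then show ?thesis by (auto simp: component_leavitt)
qed

end


section \<open>A representation on boundary paths\<close>

text \<open>Infinite paths, together with finite paths that end at a vertex that is not regular;
  \<open>None\<close> marks the end, and the values after it are arbitrary. Stopping at a regular
  vertex is excluded because (CK2) must act as the identity there.\<close>

coinductive boundary_path :: "('v, 'e) pre_digraph \<Rightarrow> 'v \<Rightarrow> (nat \<Rightarrow> 'e option) \<Rightarrow> bool"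
  for E :: "('v, 'e) pre_digraph" where
  stop: "\<lbrakk>v \<in> verts E; \<not> regular E v; g 0 = None\<rbrakk> \<Longrightarrow> boundary_path E v g"
| step: "\<lbrakk>e \<in> arcs E; tail E e = v; g 0 = Some e; boundary_path E (head E e) (\<lambda>i. g (Suc i))\<rbrakk> \<Longrightarrow>
    boundary_path E v g"

primrec prepend :: "'e list \<Rightarrow> (nat \<Rightarrow> 'e option) \<Rightarrow> nat \<Rightarrow> 'e option" where
  "prepend [] g = g"
| "prepend (e # p) g = case_nat (Some e) (prepend p g)"

lemma prepend_append: "prepend (p @ q) g = prepend p (prepend q g)"
  by (induction p) auto

lemma case_nat_eq_iff: "case_nat a f = case_nat b g \<longleftrightarrow> a = b \<and> f = g"
proof
  assume eq: "case_nat a f = case_nat b g"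
  have "f i = g i" for i using fun_cong[OF eq, of "Suc i"] by simp
  then show "a = b \<and> f = g" using fun_cong[OF eq, of 0] by auto
qed simp

lemma case_nat_unfold: "g 0 = a \<Longrightarrow> case_nat a (\<lambda>i. g (Suc i)) = g"
  by (rule ext) (simp split: nat.split)

lemma prepend_eq_le:
  "prepend p g = prepend q h \<Longrightarrow> length p \<le> length q \<Longrightarrow> \<exists>r. q = p @ r \<and> g = prepend r h"
proof (induction p arbitrary: q)
  case (Cons e p)
  then obtain f q' where q: "q = f # q'" by (cases q) auto
  then show ?case using Cons by (auto simp: case_nat_eq_iff)
qed auto

lemma prepend_cancel: "prepend p g = prepend p h \<longleftrightarrow> g = h"
  by (induction p) (auto simp: case_nat_eq_iff)

lemma (in wf_digraph) boundary_path_Cons: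
  "e \<in> arcs G \<Longrightarrow> boundary_path G (tail G e) (case_nat (Some e) g) \<longleftrightarrow> boundary_path G (head G e) g"
proof
  assume "e \<in> arcs G" "boundary_path G (tail G e) (case_nat (Some e) g)"
  from this(2) show "boundary_path G (head G e) g" by cases auto
qed (auto intro: boundary_path.step)

lemma (in wf_digraph) boundary_path_prepend:
  "awalk u p w \<Longrightarrow> boundary_path G w g \<Longrightarrow> boundary_path G u (prepend p g)"
  by (induction p arbitrary: u) (auto simp: awalk_Cons_iff awalk_Nil_iff boundary_path_Cons)

text \<open>A chosen edge is followed at each vertex until a vertex that is not regular is reached,
  if ever.\<close>

lemma (in wf_digraph) boundary_path_exists:
  assumes "v \<in> verts G"
  obtains g where "boundary_path G v g"
proof -
  define nxt where "nxt v = (if regular G v then Some (SOME e. e \<in> out_arcs G v) else None)" for v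
  define st where "st x = (case nxt x of None \<Rightarrow> x | Some e \<Rightarrow> head G e)" for x
  define u where "u v i = (st ^^ i) v" for v i
  have nxt: "e \<in> arcs G \<and> tail G e = v" if "nxt v = Some e" for v e
  proof -
    have "e = (SOME e. e \<in> out_arcs G v)" "out_arcs G v \<noteq> {}"
      using that by (auto simp: nxt_def regular_def split: if_splits)
    then have "e \<in> out_arcs G v" using some_in_eq by metis
    then show ?thesis by simp
  qed
  have "boundary_path G v (\<lambda>i. nxt (u v i))"
    using assms
  proof (coinduction arbitrary: v)
    case boundary_path
    show ?case
    proof (cases "nxt v")
      case None
      then show ?thesis using boundary_path by (auto simp: nxt_def u_def split: if_splits)
    next
      case (Some e)
      have "st v = head G e" using Some by (simp add: st_def)
      then have "u v (Suc i) = u (head G e) i" for i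
        by (simp add: u_def funpow_swap1)
      then show ?thesis using Some nxt[OF Some] by (auto simp: u_def)
    qed
  qed
  then show ?thesis by (rule that)
qed

lemma (in wf_digraph) boundary_path_inf_path:
  assumes "inf_path G f"
  shows "boundary_path G (tail G (f 0)) (\<lambda>i. Some (f i))"
  using assms
proof (coinduction arbitrary: f)
  case boundary_path
  then have "inf_path G (\<lambda>i. f (Suc i))" "head G (f 0) = tail G (f (Suc 0))" "f 0 \<in> arcs G"
    by (auto simp: inf_path_def)
  then show ?case by auto
qed

text \<open>A state is a boundary path with its source and an integer which records the degree.\<close>

type_synonym ('v, 'e) path_state = "'v \<times> (nat \<Rightarrow> 'e option) \<times> int"

context leavitt_path
begin

text \<open>On the indicator function of a state, \<open>Edge e\<close> prepends \<open>e\<close> to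
  the path and raises the integer by one, and \<open>Ghost e\<close> undoes this. Acting on
  functions of states, without a finiteness condition, keeps the formulas pointwise.\<close>

primrec path_action ::
  "('k, 'v, 'e) lterm \<Rightarrow> (('v, 'e) path_state \<Rightarrow> 'k) \<Rightarrow> ('v, 'e) path_state \<Rightarrow> 'k" where
  "path_action (Vert v) f = (\<lambda>(u, g, m). if boundary_path G u g \<and> u = v then f (u, g, m) else \<zero>\<^bsub>K\<^esub>)"
| "path_action (Edge e) f = (\<lambda>(u, g, m). if boundary_path G u g \<and> g 0 = Some e
     then f (head G e, \<lambda>i. g (Suc i), m - 1) else \<zero>\<^bsub>K\<^esub>)"
| "path_action (Ghost e) f = (\<lambda>(u, g, m). if boundary_path G u g \<and> u = head G e
     then f (tail G e, case_nat (Some e) g, m + 1) else \<zero>\<^bsub>K\<^esub>)"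
| "path_action LZero f = (\<lambda>_. \<zero>\<^bsub>K\<^esub>)"
| "path_action (LAdd s t) f = (\<lambda>x. path_action s f x \<oplus>\<^bsub>K\<^esub> path_action t f x)"
| "path_action (LMult s t) f = path_action s (path_action t f)"
| "path_action (LScale a t) f = (\<lambda>x. a \<otimes>\<^bsub>K\<^esub> path_action t f x)"

definition path_functions :: "(('v, 'e) path_state \<Rightarrow> 'k) set" where
  "path_functions = {f. \<forall>u g m. f (u, g, m) \<in> carrier K \<and> (\<not> boundary_path G u g \<longrightarrow> f (u, g, m) = \<zero>\<^bsub>K\<^esub>)}"

lemma path_functions_closed: "f \<in> path_functions \<Longrightarrow> f x \<in> carrier K"
  by (cases x) (auto simp: path_functions_def)

lemma path_functions_add: "f \<in> path_functions \<Longrightarrow> g \<in> path_functions \<Longrightarrow>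
    (\<lambda>x. f x \<oplus>\<^bsub>K\<^esub> g x) \<in> path_functions"
  by (auto simp: path_functions_def)

lemma path_functions_scale: "a \<in> carrier K \<Longrightarrow> f \<in> path_functions \<Longrightarrow>
    (\<lambda>x. a \<otimes>\<^bsub>K\<^esub> f x) \<in> path_functions"
  by (auto simp: path_functions_def)

lemma path_action_closed: "t \<in> T \<Longrightarrow> f \<in> path_functions \<Longrightarrow> path_action t f \<in> path_functions"
proof (induction t arbitrary: f rule: lterms.induct)
  case (5 s t)
  then show ?case using path_functions_add by simp
next
  case (7 a t)
  then show ?case using path_functions_scale by simp
qed (auto simp: path_functions_def)

lemma path_action_add:
  "t \<in> T \<Longrightarrow> f \<in> path_functions \<Longrightarrow> g \<in> path_functions \<Longrightarrow>
    path_action t (\<lambda>x. f x \<oplus>\<^bsub>K\<^esub> g x) = (\<lambda>x. path_action t f x \<oplus>\<^bsub>K\<^esub> path_action t g x)"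
proof (induction t arbitrary: f g rule: lterms.induct)
  case (5 s t)
  have c: "path_action s f x \<in> carrier K" "path_action s g x \<in> carrier K"
    "path_action t f x \<in> carrier K" "path_action t g x \<in> carrier K" for x
    using 5 path_action_closed path_functions_closed by auto
  show ?case using 5 c by (simp add: a_ac)
next
  case (6 s t)
  then show ?case using path_action_closed by simp
next
  case (7 a t)
  have c: "path_action t f x \<in> carrier K" "path_action t g x \<in> carrier K" for x
    using 7 path_action_closed path_functions_closed by auto
  show ?case using 7 c by (simp add: r_distr)
qed (auto simp: fun_eq_iff)

lemma path_action_scale:
  "t \<in> T \<Longrightarrow> a \<in> carrier K \<Longrightarrow> f \<in> path_functions \<Longrightarrow>
    path_action t (\<lambda>x. a \<otimes>\<^bsub>K\<^esub> f x) = (\<lambda>x. a \<otimes>\<^bsub>K\<^esub> path_action t f x)"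
proof (induction t arbitrary: f rule: lterms.induct)
  case (5 s t)
  have c: "path_action s f x \<in> carrier K" "path_action t f x \<in> carrier K" for x
    using 5 path_action_closed path_functions_closed by auto
  show ?case using 5 c by (simp add: r_distr)
next
  case (6 s t)
  then show ?case using path_action_closed by simp
next
  case (7 b t)
  have c: "path_action t f x \<in> carrier K" for x
    using 7 path_action_closed path_functions_closed by auto
  show ?case using 7 c by (simp add: m_lcomm)
qed (auto simp: fun_eq_iff)

lemma path_action_lsum:
  assumes "\<And>e. e \<in> set es \<Longrightarrow> path_action (h e) f x = (if e = a then y else \<zero>\<^bsub>K\<^esub>)"
    "distinct es" "y \<in> carrier K"
  shows "path_action (lsum (map h es)) f x = (if a \<in> set es then y else \<zero>\<^bsub>K\<^esub>)"
  using assms by (induction es) (auto simp: lsum_def)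

text \<open>The algebra laws reduce to closure and linearity of the action, the graph relations to a
  comparison of states. (CK2) holds because a boundary path at a regular vertex starts with exactly
  one edge, so exactly one summand contributes.\<close>

lemma path_action_rel:
  "(s, t) \<in> lpa_rel K G \<Longrightarrow> f \<in> path_functions \<Longrightarrow> path_action s f = path_action t f"
proof (induction arbitrary: f rule: lpa_rel.induct)
  case (cong_mult s s' t t')
  then show ?case using path_action_closed lpa_rel_in_lterms by simp
next
  case (add_assoc s t u)
  have "path_action s f x \<in> carrier K" "path_action t f x \<in> carrier K" "path_action u f x \<in> carrier K" for x
    using add_assoc path_action_closed path_functions_closed by auto
  then show ?case by (simp add: a_assoc)
next
  case (add_comm s t)
  have "path_action s f x \<in> carrier K" "path_action t f x \<in> carrier K" for x
    using add_comm path_action_closed path_functions_closed by auto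
  then show ?case by (simp add: a_comm)
next
  case (add_zero t)
  have "path_action t f x \<in> carrier K" for x
    using add_zero path_action_closed path_functions_closed by auto
  then show ?case by simp
next
  case (scale_zero t)
  have "path_action t f x \<in> carrier K" for x
    using scale_zero path_action_closed path_functions_closed by auto
  then show ?case by simp
next
  case (scale_one t)
  have "path_action t f x \<in> carrier K" for x
    using scale_one path_action_closed path_functions_closed by auto
  then show ?case by simp
next
  case (scale_scale a b t)
  have "path_action t f x \<in> carrier K" for x
    using scale_scale path_action_closed path_functions_closed by auto
  then show ?case using scale_scale by (simp add: m_assoc)
next
  case (scale_add_left a b t)
  have "path_action t f x \<in> carrier K" for x
    using scale_add_left path_action_closed path_functions_closed by auto
  then show ?case using scale_add_left by (simp add: l_distr)
next
  case (scale_add_right a s t)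
  have "path_action s f x \<in> carrier K" "path_action t f x \<in> carrier K" for x
    using scale_add_right path_action_closed path_functions_closed by auto
  then show ?case using scale_add_right by (simp add: r_distr)
next
  case (distrib_left s t u)
  then show ?case using path_action_closed path_action_add by simp
next
  case (scale_mult_right a s t)
  then show ?case using path_action_closed path_action_scale by simp
next
  case (vertex_idem v)
  then show ?case by (auto simp: fun_eq_iff)
next
  case (vertex_orth v w)
  then show ?case by (auto simp: fun_eq_iff)
next
  case (source_edge e)
  have "u = tail G e" if "boundary_path G u g" "g 0 = Some e" for u g
    using that by (auto elim: boundary_path.cases)
  then show ?case by (auto simp: fun_eq_iff)
next
  case (edge_range e)
  have "boundary_path G (head G e) (\<lambda>i. g (Suc i))" if "boundary_path G u g" "g 0 = Some e" for u g
    using that by (auto elim: boundary_path.cases)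
  then show ?case by (auto simp: fun_eq_iff)
next
  case (range_ghost e)
  then show ?case by (auto simp: fun_eq_iff)
next
  case (ghost_source e)
  then show ?case by (auto simp: fun_eq_iff boundary_path_Cons)
next
  case (CK1_orth e e')
  then show ?case by (auto simp: fun_eq_iff)
next
  case (CK1 e)
  then show ?case by (auto simp: fun_eq_iff boundary_path_Cons)
next
  case (CK2 v es)
  show ?case
  proof
    fix x :: "('v, 'e) path_state"
    obtain u g m where x: "x = (u, g, m)" by (cases x)
    let ?h = "\<lambda>e. LMult (Edge e) (Ghost e)"
    show "path_action (Vert v) f x = path_action (lsum (map ?h es)) f x"
    proof (cases "boundary_path G u g \<and> g 0 \<noteq> None")
      case False
      \<comment> \<open>No summand contributes in this case; \<open>undefined\<close> merely fills
        the place of the distinguished edge.\<close>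
      have "path_action (?h e) f x = (if e = undefined then \<zero>\<^bsub>K\<^esub> else \<zero>\<^bsub>K\<^esub>)" for e
        using False by (auto simp: x)
      then have "path_action (lsum (map ?h es)) f x = \<zero>\<^bsub>K\<^esub>"
        using path_action_lsum[of es ?h f x undefined "\<zero>\<^bsub>K\<^esub>"] CK2 by simp
      \<comment> \<open>A boundary path that stops at once starts at a vertex that is not regular,
        hence not at \<open>v\<close>.\<close>
      moreover have "path_action (Vert v) f x = \<zero>\<^bsub>K\<^esub>"
        using False CK2(1) by (auto simp: x elim: boundary_path.cases)
      ultimately show ?thesis by simp
    next
      case True
      then obtain a where a: "g 0 = Some a" by auto
      have b: "a \<in> arcs G" "tail G a = u" "boundary_path G (head G a) (\<lambda>i. g (Suc i))"
        using True a by (auto elim: boundary_path.cases)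
      have "path_action (?h e) f x = (if e = a then f x else \<zero>\<^bsub>K\<^esub>)" for e
        using True a b by (auto simp: x case_nat_unfold)
      then have "path_action (lsum (map ?h es)) f x = (if a \<in> set es then f x else \<zero>\<^bsub>K\<^esub>)"
        using CK2 path_functions_closed by (intro path_action_lsum) auto
      moreover have "a \<in> set es \<longleftrightarrow> u = v" using CK2(3) b by auto
      ultimately show ?thesis using True by (simp add: x)
    qed
  qed
qed (simp_all add: fun_eq_iff)

section \<open>The representation on classes of terms\<close>

definition rep :: "('k, 'v, 'e) lterm set \<Rightarrow> (('v, 'e) path_state \<Rightarrow> 'k) \<Rightarrow> ('v, 'e) path_state \<Rightarrow> 'k" where
  "rep X = path_action (SOME t. t \<in> X)"

text \<open>On \<open>path_functions\<close> congruent terms act alike, so the result is independent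
  of the representative chosen in \<open>rep\<close>.\<close>

lemma rep_cl:
  assumes "t \<in> T" "f \<in> path_functions"
  shows "rep (cl t) f = path_action t f"
proof -
  have "(SOME s. s \<in> cl t) \<in> cl t" using cl_self[OF assms(1)] by (rule someI)
  then have "(t, SOME s. s \<in> cl t) \<in> lpa_rel K G" by blast
  then show ?thesis unfolding rep_def by (rule path_action_rel[OF _ assms(2), symmetric])
qed

lemma rep_closed:
  assumes "X \<in> carrier L" "f \<in> path_functions"
  shows "rep X f \<in> path_functions"
proof -
  obtain t where "t \<in> T" "X = cl t" using assms(1) by (rule carrierE)
  then show ?thesis using rep_cl path_action_closed assms(2) by simp
qed

lemma rep_zero: "f \<in> path_functions \<Longrightarrow> rep \<zero>\<^bsub>L\<^esub> f x = \<zero>\<^bsub>K\<^esub>"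
  by (simp add: cl_zero rep_cl lterms.intros)

lemma rep_add:
  assumes "X \<in> carrier L" "Y \<in> carrier L" "f \<in> path_functions"
  shows "rep (X \<oplus>\<^bsub>L\<^esub> Y) f x = rep X f x \<oplus>\<^bsub>K\<^esub> rep Y f x"
proof -
  obtain s t where "s \<in> T" "X = cl s" "t \<in> T" "Y = cl t" using assms(1,2) carrierE by metis
  then show ?thesis using assms(3) by (simp add: cl_add rep_cl lterms.intros)
qed

lemma rep_mult:
  assumes "X \<in> carrier L" "Y \<in> carrier L" "f \<in> path_functions"
  shows "rep (X \<cdot> Y) f = rep X (rep Y f)"
proof -
  obtain s t where st: "s \<in> T" "X = cl s" "t \<in> T" "Y = cl t" using assms(1,2) carrierE by metis
  then show ?thesis using assms(3) path_action_closed[OF st(3) assms(3)]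
    by (simp add: cl_mult rep_cl lterms.intros)
qed

lemma rep_smult:
  assumes "a \<in> carrier K" "X \<in> carrier L" "f \<in> path_functions"
  shows "rep (a \<odot>\<^bsub>L\<^esub> X) f x = a \<otimes>\<^bsub>K\<^esub> rep X f x"
proof -
  obtain t where "t \<in> T" "X = cl t" using assms(2) by (rule carrierE)
  then show ?thesis using assms by (simp add: cl_smult rep_cl lterms.intros)
qed

lemma rep_finsum:
  assumes f: "f \<in> path_functions"
  shows "finite S \<Longrightarrow> (\<And>i. i \<in> S \<Longrightarrow> X i \<in> carrier L) \<Longrightarrow>
    rep (\<Oplus>\<^bsub>L\<^esub>i\<in>S. X i) f x = (\<Oplus>\<^bsub>K\<^esub>i\<in>S. rep (X i) f x)"
proof (induction S rule: finite_induct)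
  case empty
  then show ?case using f by (simp add: rep_zero)
next
  case (insert a S)
  have "rep (X i) f x \<in> carrier K" if "i \<in> insert a S" for i
    using rep_closed[OF _ f] insert.prems that path_functions_closed by blast
  then show ?case using insert f
    by (simp add: LA.A.finsum_insert finsum_insert rep_add Pi_iff)
qed

lemma rep_walk:
  assumes "f \<in> path_functions"
  shows "awalk u p w \<Longrightarrow> boundary_path G w g \<Longrightarrow>
      rep (walk_elem p w) f (u, prepend p g, m) = f (w, g, m - int (length p))"
proof (induction p arbitrary: u m)
  case Nil
  then show ?case using assms by (auto simp: awalk_Nil_iff rep_cl lterms.intros)
next
  case (Cons e p)
  then have e: "e \<in> arcs G" "u = tail G e" "awalk (head G e) p w" by (auto simp: awalk_Cons_iff)
  have b: "boundary_path G (head G e) (prepend p g)"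
    using boundary_path_prepend[OF e(3)] Cons.prems(2) .
  have "rep (walk_elem (e # p) w) f = path_action (Edge e) (rep (walk_elem p w) f)"
    using e assms rep_closed[OF walk_elem_closed[OF e(3)] assms]
    by (simp add: rep_mult[OF _ walk_elem_closed[OF e(3)]] rep_cl lterms.intros)
  then show ?case using Cons.IH[OF e(3) Cons.prems(2)] e b by (simp add: boundary_path_Cons diff_diff_eq)
qed

lemma rep_walk_support:
  assumes "f \<in> path_functions"
  shows "awalk u p w \<Longrightarrow> rep (walk_elem p w) f (y, g, m) \<noteq> \<zero>\<^bsub>K\<^esub> \<Longrightarrow>
      y = u \<and> (\<exists>h. g = prepend p h \<and> boundary_path G w h)"
proof (induction p arbitrary: u y g m)
  case Nil
  then show ?case using assms by (auto simp: awalk_Nil_iff rep_cl lterms.intros split: if_splits)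
next
  case (Cons e p)
  then have e: "e \<in> arcs G" "u = tail G e" "awalk (head G e) p w" by (auto simp: awalk_Cons_iff)
  have "rep (walk_elem (e # p) w) f = path_action (Edge e) (rep (walk_elem p w) f)"
    using e assms rep_closed[OF walk_elem_closed[OF e(3)] assms]
    by (simp add: rep_mult[OF _ walk_elem_closed[OF e(3)]] rep_cl lterms.intros)
  then have g: "boundary_path G y g" "g 0 = Some e"
    "rep (walk_elem p w) f (head G e, \<lambda>i. g (Suc i), m - 1) \<noteq> \<zero>\<^bsub>K\<^esub>"
    using Cons.prems(2) by (auto split: if_splits)
  then obtain h where "(\<lambda>i. g (Suc i)) = prepend p h" "boundary_path G w h"
    using Cons.IH[OF e(3)] by blast
  moreover have "y = u" using g e by (auto elim: boundary_path.cases)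
  moreover have "g = prepend (e # p) h"
    using case_nat_unfold[of g "Some e"] g(2) calculation(1) by simp
  ultimately show ?case by blast
qed

text \<open>The function is generalised in the induction because the ghost of the first edge is
  applied to it before the rest of \<open>q*\<close> acts.\<close>

lemma rep_ghost:
  assumes "f \<in> path_functions"
  shows "awalk u q w \<Longrightarrow> rep (ghost_elem q w) f (y, g, m) =
      (if y = w \<and> boundary_path G w g then f (u, prepend q g, m + int (length q)) else \<zero>\<^bsub>K\<^esub>)"
  using assms
proof (induction q arbitrary: u f)
  case Nil
  then show ?case by (auto simp: awalk_Nil_iff rep_cl lterms.intros)
next
  case (Cons e q)
  then have e: "e \<in> arcs G" "u = tail G e" "awalk (head G e) q w" by (auto simp: awalk_Cons_iff)
  have G: "path_action (Ghost e) f \<in> path_functions"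
    by (rule path_action_closed) (use e Cons.prems in \<open>auto intro: lterms.intros\<close>)
  have "rep (ghost_elem (e # q) w) f = rep (ghost_elem q w) (path_action (Ghost e) f)"
    using e Cons.prems by (simp add: rep_mult[OF ghost_elem_closed[OF e(3)]] rep_cl lterms.intros)
  then show ?case using Cons.IH[OF e(3) G] boundary_path_prepend[OF e(3)] e by (auto simp: add_ac)
qed

lemma rep_monomial:
  assumes "f \<in> path_functions" "awalk u p w" "awalk u' q w" "boundary_path G w g"
  shows "rep (walk_monomial p q w) f (u, prepend p g, m) =
    f (u', prepend q g, m - int (length p) + int (length q))"
  using assms rep_closed[OF ghost_elem_closed[OF assms(3)] assms(1)]
  by (simp add: walk_monomial_def rep_mult[OF walk_elem_closed[OF assms(2)] ghost_elem_closed[OF assms(3)]]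
      rep_walk rep_ghost[OF assms(1,3)])

lemma rep_monomial_support:
  assumes "f \<in> path_functions" "awalk u p w" "awalk u' q w"
    and "rep (walk_monomial p q w) f (y, g, m) \<noteq> \<zero>\<^bsub>K\<^esub>"
  obtains h where "y = u" "g = prepend p h" "boundary_path G w h"
proof -
  have "rep (walk_elem p w) (rep (ghost_elem q w) f) (y, g, m) \<noteq> \<zero>\<^bsub>K\<^esub>"
    using assms(4) rep_mult[OF walk_elem_closed[OF assms(2)] ghost_elem_closed[OF assms(3)] assms(1)]
    by (simp add: walk_monomial_def)
  then show ?thesis
    using rep_walk_support[OF rep_closed[OF ghost_elem_closed[OF assms(3)] assms(1)] assms(2)] that
    by blast
qed

text \<open>A homogeneous element of degree \<open>d\<close> only relates boundary paths which agree after removing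
  initial walks \<open>p\<close> and \<open>q\<close> whose lengths differ by \<open>d\<close>.\<close>

definition tail_shift :: "int \<Rightarrow> nat \<Rightarrow> (('v, 'e) path_state \<Rightarrow> 'k) \<Rightarrow> ('v, 'e) path_state \<Rightarrow> bool" where
  "tail_shift d M f = (\<lambda>(y, g, m). \<exists>p q w h u'. awalk y p w \<and> awalk u' q w \<and>
    int (length p) - int (length q) = d \<and> length p \<le> M \<and> g = prepend p h \<and>
    boundary_path G w h \<and> f (u', prepend q h, m - d) \<noteq> \<zero>\<^bsub>K\<^esub>)"

lemma tail_shift_mono:
  assumes "tail_shift d M f x" "M \<le> N"
  shows "tail_shift d N f x"
proof -
  obtain y g m where x: "x = (y, g, m)" by (cases x)
  then obtain p q w h u' where "awalk y p w" "awalk u' q w" "int (length p) - int (length q) = d"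
    "length p \<le> M" "g = prepend p h" "boundary_path G w h" "f (u', prepend q h, m - d) \<noteq> \<zero>\<^bsub>K\<^esub>"
    using assms(1) by (auto simp: tail_shift_def)
  then show ?thesis unfolding x tail_shift_def using assms(2) order_trans by blast
qed

text \<open>For a monomial \<open>p q*\<close> the bound is the length of \<open>p\<close>, and a
  sum takes the maximum over its finitely many terms. That \<open>M\<close> is uniform in
  \<open>f\<close> and \<open>x\<close> is what later allows all long walks to be lowered by the
  same amount.\<close>

lemma homogeneous_support:
  assumes "X \<in> component L d"
  shows "\<exists>M. \<forall>f\<in>path_functions. \<forall>x. rep X f x \<noteq> \<zero>\<^bsub>K\<^esub> \<longrightarrow> tail_shift d M f x" (is "\<exists>M. ?P M X")
proof -
  let ?S = "{X \<in> carrier L. \<exists>M. ?P M X}"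
  have "component L d \<subseteq> ?S"
  proof (rule component_subset)
    fix u p w u' q assume w: "awalk u p w" "awalk u' q w" and d: "int (length p) - int (length q) = d"
    have "?P (length p) (walk_monomial p q w)"
    proof (intro ballI allI impI)
      fix f x assume f: "f \<in> path_functions" and nz: "rep (walk_monomial p q w) f x \<noteq> \<zero>\<^bsub>K\<^esub>"
      obtain y g m where x: "x = (y, g, m)" by (cases x)
      obtain h where h: "y = u" "g = prepend p h" "boundary_path G w h"
        using rep_monomial_support[OF f w nz[unfolded x]] .
      have eq: "m - int (length p) + int (length q) = m - d" using d by simp
      have "f (u', prepend q h, m - d) \<noteq> \<zero>\<^bsub>K\<^esub>"
        using nz h rep_monomial[OF f w h(3), of m, unfolded eq] by (simp add: x)
      then show "tail_shift d (length p) f x" unfolding x tail_shift_def using w d h by blast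
    qed
    then show "walk_monomial p q w \<in> ?S" using walk_monomial_closed[OF w] by blast
  next
    show "\<zero>\<^bsub>L\<^esub> \<in> ?S" using rep_zero by simp
  next
    fix X Y assume X: "X \<in> ?S" and Y: "Y \<in> ?S"
    obtain M N where MN: "?P M X" "?P N Y" using X Y by blast
    have "?P (max M N) (X \<oplus>\<^bsub>L\<^esub> Y)"
    proof (intro ballI allI impI)
      fix f x assume f: "f \<in> path_functions" and nz: "rep (X \<oplus>\<^bsub>L\<^esub> Y) f x \<noteq> \<zero>\<^bsub>K\<^esub>"
      have "rep X f x \<noteq> \<zero>\<^bsub>K\<^esub> \<or> rep Y f x \<noteq> \<zero>\<^bsub>K\<^esub>"
        using nz rep_add[of X Y f x] X Y f by auto
      then have "tail_shift d M f x \<or> tail_shift d N f x" using MN f by blast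
      then show "tail_shift d (max M N) f x"
        using tail_shift_mono[of d M f x "max M N"] tail_shift_mono[of d N f x "max M N"] by auto
    qed
    moreover have "X \<oplus>\<^bsub>L\<^esub> Y \<in> carrier L" using X Y by simp
    ultimately show "X \<oplus>\<^bsub>L\<^esub> Y \<in> ?S" by blast
  next
    fix a X assume a: "a \<in> carrier K" and X: "X \<in> ?S"
    obtain M where M: "?P M X" using X by blast
    have "?P M (a \<odot>\<^bsub>L\<^esub> X)"
    proof (intro ballI allI impI)
      fix f x assume f: "f \<in> path_functions" and nz: "rep (a \<odot>\<^bsub>L\<^esub> X) f x \<noteq> \<zero>\<^bsub>K\<^esub>"
      have "rep X f x \<noteq> \<zero>\<^bsub>K\<^esub>" using nz rep_smult[of a X f x] a X f by auto
      then show "tail_shift d M f x" using M f by blast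
    qed
    moreover have "a \<odot>\<^bsub>L\<^esub> X \<in> carrier L" using X a by simp
    ultimately show "a \<odot>\<^bsub>L\<^esub> X \<in> ?S" by blast
  qed
  then show ?thesis using assms by blast
qed

end


section \<open>Direct sums of matrix algebras over Laurent polynomials\<close>

lemma (in abelian_monoid) finsum_superset:
  assumes "finite B" "A \<subseteq> B" "\<And>i. i \<in> B - A \<Longrightarrow> f i = \<zero>" "\<And>i. i \<in> B \<Longrightarrow> f i \<in> carrier G"
  shows "finsum G f A = finsum G f B"
  using assms by (intro add.finprod_mono_neutral_cong_left) auto

lemma (in abelian_monoid) finsum_all_zero: "(\<And>i. i \<in> A \<Longrightarrow> f i = \<zero>) \<Longrightarrow> finsum G f A = \<zero>"
  using finsum_cong'[of A A "\<lambda>_. \<zero>" f] by simp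

text \<open>More unknowns than equations: Gaussian elimination of one equation at a time.\<close>

lemma (in field) nontrivial_solution:
  assumes "finite S" "finite T" "card S < card T"
    "\<And>t s. t \<in> T \<Longrightarrow> s \<in> S \<Longrightarrow> a t s \<in> carrier R"
  shows "\<exists>c. (\<forall>t\<in>T. c t \<in> carrier R) \<and> (\<exists>t\<in>T. c t \<noteq> \<zero>) \<and> (\<forall>s\<in>S. (\<Oplus>t\<in>T. c t \<otimes> a t s) = \<zero>)"
  using assms
proof (induction S arbitrary: T a rule: finite_induct)
  case empty
  then obtain t where "t \<in> T" by fastforce
  then show ?case by (intro exI[of _ "\<lambda>_. \<one>"]) auto
next
  case (insert s S)
  have ac: "a t r \<in> carrier R" if "t \<in> T" "r \<in> insert s S" for t r using insert.prems that by blast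
  show ?case
  proof (cases "\<forall>t\<in>T. a t s = \<zero>")
    case True
    have card: "card S < card T" using insert by simp
    have "\<exists>c. (\<forall>t\<in>T. c t \<in> carrier R) \<and> (\<exists>t\<in>T. c t \<noteq> \<zero>) \<and>
        (\<forall>r\<in>S. (\<Oplus>t\<in>T. c t \<otimes> a t r) = \<zero>)"
      by (rule insert.IH[OF insert.prems(1) card]) (simp add: ac)
    then obtain c where c: "\<forall>t\<in>T. c t \<in> carrier R" "\<exists>t\<in>T. c t \<noteq> \<zero>"
      "\<forall>r\<in>S. (\<Oplus>t\<in>T. c t \<otimes> a t r) = \<zero>" by blast
    have "(\<Oplus>t\<in>T. c t \<otimes> a t s) = \<zero>" using True c(1) by (intro finsum_all_zero) auto
    then show ?thesis using c by blast
  next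
    case False
    then obtain t0 where t0: "t0 \<in> T" "a t0 s \<noteq> \<zero>" by blast
    have p: "a t0 s \<in> Units R" using t0 ac field_Units by auto
    \<comment> \<open>\<open>q t\<close> is the multiplier with which the pivot \<open>t0\<close>
      cancels the coefficient of \<open>t\<close> in equation \<open>s\<close>.\<close>
    define q where "q t = \<ominus> (a t s \<otimes> inv (a t0 s))" for t
    have qc: "q t \<in> carrier R" if "t \<in> T" for t using ac p that by (auto simp: q_def)
    define b where "b t r = a t r \<oplus> q t \<otimes> a t0 r" for t r
    let ?T = "T - {t0}"
    have fin: "finite ?T" using insert.prems by simp
    have bc: "b t r \<in> carrier R" if "t \<in> T" "r \<in> insert s S" for t r
      using ac qc t0 that by (auto simp: b_def)
    have bs: "b t s = \<zero>" if "t \<in> T" for t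
    proof -
      have "q t \<otimes> a t0 s = \<ominus> (a t s \<otimes> (inv (a t0 s) \<otimes> a t0 s))"
        using that ac[of t s] ac[of t0 s] t0 p by (simp add: q_def l_minus m_assoc)
      then show ?thesis using that ac[of t s] p by (simp add: b_def r_neg)
    qed
    have card: "card S < card ?T" using insert t0(1) by simp
    have "\<exists>c. (\<forall>t\<in>?T. c t \<in> carrier R) \<and> (\<exists>t\<in>?T. c t \<noteq> \<zero>) \<and>
        (\<forall>r\<in>S. (\<Oplus>t\<in>?T. c t \<otimes> b t r) = \<zero>)"
      by (rule insert.IH[OF fin card]) (simp add: bc)
    then obtain c where c: "\<forall>t\<in>?T. c t \<in> carrier R" "\<exists>t\<in>?T. c t \<noteq> \<zero>"
      "\<forall>r\<in>S. (\<Oplus>t\<in>?T. c t \<otimes> b t r) = \<zero>" by blast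
    have cs: "(\<Oplus>t\<in>?T. c t \<otimes> b t r) = \<zero>" if "r \<in> insert s S" for r
    proof (cases "r = s")
      case True
      then show ?thesis using bs c(1) by (intro finsum_all_zero) auto
    qed (use c that in auto)
    \<comment> \<open>A solution of the reduced system is completed at \<open>t0\<close> by the
      value that turns each original sum into the reduced one.\<close>
    define d where "d t = (if t = t0 then (\<Oplus>t\<in>?T. c t \<otimes> q t) else c t)" for t
    have dc: "d t \<in> carrier R" if "t \<in> T" for t
      using c(1) qc that by (auto simp: d_def intro!: finsum_closed)
    have "(\<Oplus>t\<in>T. d t \<otimes> a t r) = \<zero>" if r: "r \<in> insert s S" for r
    proof -
      have cq: "(\<lambda>t. c t \<otimes> q t) \<in> ?T \<rightarrow> carrier R" and ca: "(\<lambda>t. c t \<otimes> a t r) \<in> ?T \<rightarrow> carrier R"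
        and cqa: "(\<lambda>t. c t \<otimes> q t \<otimes> a t0 r) \<in> ?T \<rightarrow> carrier R"
        using c(1) qc ac r t0 by auto
      have "(\<Oplus>t\<in>T. d t \<otimes> a t r) = (\<Oplus>t\<in>insert t0 ?T. d t \<otimes> a t r)"
        using t0(1) by (simp add: insert_absorb)
      also have "\<dots> = d t0 \<otimes> a t0 r \<oplus> (\<Oplus>t\<in>?T. d t \<otimes> a t r)"
        using dc ac r t0 fin by (intro finsum_insert) auto
      also have "(\<Oplus>t\<in>?T. d t \<otimes> a t r) = (\<Oplus>t\<in>?T. c t \<otimes> a t r)"
        using ca by (intro finsum_cong') (auto simp: d_def)
      also have "d t0 \<otimes> a t0 r = (\<Oplus>t\<in>?T. c t \<otimes> q t \<otimes> a t0 r)"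
        using finsum_ldistr[OF fin _ cq, of "a t0 r"] ac t0 r by (simp add: d_def)
      also have "\<dots> \<oplus> (\<Oplus>t\<in>?T. c t \<otimes> a t r) = (\<Oplus>t\<in>?T. c t \<otimes> q t \<otimes> a t0 r \<oplus> c t \<otimes> a t r)"
        using cqa ca by (intro finsum_addf[symmetric])
      also have "\<dots> = (\<Oplus>t\<in>?T. c t \<otimes> b t r)"
      proof (rule finsum_cong')
        fix t assume t: "t \<in> ?T"
        then have x: "c t \<in> carrier R" "q t \<in> carrier R" "a t r \<in> carrier R" "a t0 r \<in> carrier R"
          using c(1) qc ac r t0 by auto
        then show "c t \<otimes> q t \<otimes> a t0 r \<oplus> c t \<otimes> a t r = c t \<otimes> b t r"
          by (simp add: b_def r_distr m_assoc a_comm)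
      qed (use c(1) bc r in auto)
      finally show ?thesis using cs[OF r] by simp
    qed
    moreover have "\<exists>t\<in>T. d t \<noteq> \<zero>" using c(2) by (auto simp: d_def)
    ultimately show ?thesis using dc by blast
  qed
qed

locale matrix_sum = field K for K :: "'k ring" +
  fixes I :: "'i set" and n :: "'i \<Rightarrow> nat" and \<mu> :: "'i \<Rightarrow> 'm set" and \<gamma> :: "'i \<Rightarrow> 'm \<Rightarrow> int"
begin

abbreviation "Lau d \<equiv> laurent_algebra K d"
abbreviation "MS \<equiv> sum_algebra I (\<lambda>i. matrix_algebra (Lau (n i)) (\<mu> i) (\<gamma> i))"

lemma laurent_carrier: "a \<in> carrier (Lau d) \<longleftrightarrow> (\<forall>k. a k \<in> carrier K) \<and>
    finite {k. a k \<noteq> \<zero>\<^bsub>K\<^esub>} \<and> (\<forall>k. a k \<noteq> \<zero>\<^bsub>K\<^esub> \<longrightarrow> int d dvd k)"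
  by (simp add: laurent_algebra_def)

lemma laurent_ops: "\<zero>\<^bsub>Lau d\<^esub> = (\<lambda>k. \<zero>\<^bsub>K\<^esub>)" "a \<oplus>\<^bsub>Lau d\<^esub> b = (\<lambda>k. a k \<oplus>\<^bsub>K\<^esub> b k)"
  "c \<odot>\<^bsub>Lau d\<^esub> a = (\<lambda>k. c \<otimes>\<^bsub>K\<^esub> a k)"
  by (simp_all add: laurent_algebra_def)

lemma laurent_abelian_group: "abelian_group (Lau d)"
proof (rule abelian_groupI)
  fix a b assume a: "a \<in> carrier (Lau d)" and b: "b \<in> carrier (Lau d)"
  have "{k. a k \<oplus>\<^bsub>K\<^esub> b k \<noteq> \<zero>\<^bsub>K\<^esub>} \<subseteq> {k. a k \<noteq> \<zero>\<^bsub>K\<^esub>} \<union> {k. b k \<noteq> \<zero>\<^bsub>K\<^esub>}"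
    using a b by (auto simp: laurent_carrier)
  then have "finite {k. a k \<oplus>\<^bsub>K\<^esub> b k \<noteq> \<zero>\<^bsub>K\<^esub>}"
    by (rule finite_subset) (use a b in \<open>auto simp: laurent_carrier\<close>)
  moreover have "int d dvd k" if "a k \<oplus>\<^bsub>K\<^esub> b k \<noteq> \<zero>\<^bsub>K\<^esub>" for k
  proof -
    have "a k \<noteq> \<zero>\<^bsub>K\<^esub> \<or> b k \<noteq> \<zero>\<^bsub>K\<^esub>" using that by auto
    then show ?thesis using a b by (auto simp: laurent_carrier)
  qed
  ultimately show "a \<oplus>\<^bsub>Lau d\<^esub> b \<in> carrier (Lau d)" using a b by (auto simp: laurent_carrier laurent_ops)
  show "a \<oplus>\<^bsub>Lau d\<^esub> b = b \<oplus>\<^bsub>Lau d\<^esub> a"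
    using a b by (simp add: laurent_carrier laurent_ops a_comm)
next
  fix a assume a: "a \<in> carrier (Lau d)"
  have "(\<lambda>k. \<ominus>\<^bsub>K\<^esub> a k) \<in> carrier (Lau d)"
    using a by (auto simp: laurent_carrier elim!: rev_finite_subset)
  moreover have "(\<lambda>k. \<ominus>\<^bsub>K\<^esub> a k) \<oplus>\<^bsub>Lau d\<^esub> a = \<zero>\<^bsub>Lau d\<^esub>"
    using a by (simp add: laurent_carrier laurent_ops l_neg)
  ultimately show "\<exists>b\<in>carrier (Lau d). b \<oplus>\<^bsub>Lau d\<^esub> a = \<zero>\<^bsub>Lau d\<^esub>" by blast
qed (auto simp: laurent_carrier laurent_ops a_assoc)

lemma laurent_finsum:
  assumes "finite S" "\<And>x. x \<in> S \<Longrightarrow> f x \<in> carrier (Lau d)"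
  shows "(\<Oplus>\<^bsub>Lau d\<^esub>x\<in>S. f x) k = (\<Oplus>\<^bsub>K\<^esub>x\<in>S. f x k)"
proof -
  interpret A: abelian_group "Lau d" by (rule laurent_abelian_group)
  show ?thesis using assms
  proof (induction S rule: finite_induct)
    case (insert a S)
    then show ?case
      by (simp add: A.finsum_insert finsum_insert Pi_iff laurent_ops) (simp add: laurent_carrier)
  qed (simp add: laurent_ops)
qed

lemma laurent_mult:
  assumes "finite Z" "\<And>j. a j \<noteq> \<zero>\<^bsub>K\<^esub> \<Longrightarrow> j \<in> Z" "\<And>j. a j \<in> carrier K" "\<And>j. b j \<in> carrier K"
  shows "(a \<otimes>\<^bsub>Lau d\<^esub> b) k = (\<Oplus>\<^bsub>K\<^esub>j\<in>Z. a j \<otimes>\<^bsub>K\<^esub> b (k - j))"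
proof -
  have "(\<Oplus>\<^bsub>K\<^esub>j\<in>{j. a j \<noteq> \<zero>\<^bsub>K\<^esub>}. a j \<otimes>\<^bsub>K\<^esub> b (k - j)) = (\<Oplus>\<^bsub>K\<^esub>j\<in>Z. a j \<otimes>\<^bsub>K\<^esub> b (k - j))"
    by (rule finsum_superset) (use assms in auto)
  then show ?thesis by (simp add: laurent_algebra_def)
qed

lemma laurent_mult_closed:
  assumes a: "a \<in> carrier (Lau d)" and b: "b \<in> carrier (Lau d)"
  shows "a \<otimes>\<^bsub>Lau d\<^esub> b \<in> carrier (Lau d)"
proof -
  let ?A = "{j. a j \<noteq> \<zero>\<^bsub>K\<^esub>}" and ?B = "{j. b j \<noteq> \<zero>\<^bsub>K\<^esub>}"
  have fin: "finite ?A" "finite ?B" and c: "\<And>j. a j \<in> carrier K" "\<And>j. b j \<in> carrier K"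
    using a b by (auto simp: laurent_carrier)
  have m: "(a \<otimes>\<^bsub>Lau d\<^esub> b) k = (\<Oplus>\<^bsub>K\<^esub>j\<in>?A. a j \<otimes>\<^bsub>K\<^esub> b (k - j))" for k
    by (rule laurent_mult[OF fin(1)]) (use c in auto)
  have ex: "\<exists>j\<in>?A. k - j \<in> ?B" if "(a \<otimes>\<^bsub>Lau d\<^esub> b) k \<noteq> \<zero>\<^bsub>K\<^esub>" for k
  proof (rule ccontr)
    assume "\<not> ?thesis"
    then have "(\<Oplus>\<^bsub>K\<^esub>j\<in>?A. a j \<otimes>\<^bsub>K\<^esub> b (k - j)) = \<zero>\<^bsub>K\<^esub>"
      using c by (intro finsum_all_zero) auto
    then show False using that m by simp
  qed
  have "{k. (a \<otimes>\<^bsub>Lau d\<^esub> b) k \<noteq> \<zero>\<^bsub>K\<^esub>} \<subseteq> (\<lambda>(i, j). i + j) ` (?A \<times> ?B)"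
  proof
    fix k assume "k \<in> {k. (a \<otimes>\<^bsub>Lau d\<^esub> b) k \<noteq> \<zero>\<^bsub>K\<^esub>}"
    then obtain j where "j \<in> ?A" "k - j \<in> ?B" using ex by blast
    then have "(j, k - j) \<in> ?A \<times> ?B" "k = (\<lambda>(i, j). i + j) (j, k - j)" by auto
    then show "k \<in> (\<lambda>(i, j). i + j) ` (?A \<times> ?B)" by (rule rev_image_eqI)
  qed
  then have "finite {k. (a \<otimes>\<^bsub>Lau d\<^esub> b) k \<noteq> \<zero>\<^bsub>K\<^esub>}" by (rule finite_subset) (use fin in auto)
  moreover have "int d dvd k" if k: "(a \<otimes>\<^bsub>Lau d\<^esub> b) k \<noteq> \<zero>\<^bsub>K\<^esub>" for k
  proof -
    obtain j where "j \<in> ?A" "k - j \<in> ?B" using ex[OF k] by blast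
    then have "int d dvd j" "int d dvd (k - j)" using a b by (auto simp: laurent_carrier)
    then have "int d dvd (k - j) + j" by (rule dvd_add[rotated])
    then show ?thesis by simp
  qed
  moreover have "(a \<otimes>\<^bsub>Lau d\<^esub> b) k \<in> carrier K" for k
    unfolding m using c by (intro finsum_closed) auto
  ultimately show ?thesis by (simp add: laurent_carrier)
qed

definition coeff_support :: "('i \<Rightarrow> 'm \<Rightarrow> 'm \<Rightarrow> int \<Rightarrow> 'k) \<Rightarrow> ('i \<times> 'm \<times> 'm \<times> int) set" where
  "coeff_support f = {(i, \<alpha>, \<beta>, k). i \<in> I \<and> f i \<alpha> \<beta> k \<noteq> \<zero>\<^bsub>K\<^esub>}"

text \<open>Finitely many nonzero blocks, finitely many nonzero entries in each and finitely many
  coefficients in each entry amount to one finite support, so elements can be treated as finitely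
  supported functions of \<open>(i, \<alpha>, \<beta>, k)\<close>.\<close>

lemma MS_carrier: "f \<in> carrier MS \<longleftrightarrow> f \<in> extensional I \<and>
    (\<forall>i\<in>I. \<forall>\<alpha> \<beta> k. f i \<alpha> \<beta> k \<in> carrier K) \<and>
    (\<forall>(i, \<alpha>, \<beta>, k) \<in> coeff_support f. \<alpha> \<in> \<mu> i \<and> \<beta> \<in> \<mu> i \<and> int (n i) dvd k) \<and>
    finite (coeff_support f)" (is "_ \<longleftrightarrow> ?R")
proof
  assume f: "f \<in> carrier MS"
  have ext: "f \<in> extensional I" and fI: "finite {i \<in> I. f i \<noteq> (\<lambda>\<alpha> \<beta> k. \<zero>\<^bsub>K\<^esub>)}"
    and ent: "\<And>i \<alpha> \<beta>. i \<in> I \<Longrightarrow> \<alpha> \<in> \<mu> i \<Longrightarrow> \<beta> \<in> \<mu> i \<Longrightarrow> f i \<alpha> \<beta> \<in> carrier (Lau (n i))"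
    and off: "\<And>i \<alpha> \<beta>. i \<in> I \<Longrightarrow> \<not> (\<alpha> \<in> \<mu> i \<and> \<beta> \<in> \<mu> i) \<Longrightarrow> f i \<alpha> \<beta> = (\<lambda>k. \<zero>\<^bsub>K\<^esub>)"
    and fM: "\<And>i. i \<in> I \<Longrightarrow> finite {(\<alpha>, \<beta>). f i \<alpha> \<beta> \<noteq> (\<lambda>k. \<zero>\<^bsub>K\<^esub>)}"
    using f by (auto simp: sum_algebra_def matrix_algebra_def Let_def laurent_ops PiE_iff)
  have all: "f i \<alpha> \<beta> \<in> carrier (Lau (n i))" if "i \<in> I" for i \<alpha> \<beta>
    using ent[OF that] off[OF that] by (cases "\<alpha> \<in> \<mu> i \<and> \<beta> \<in> \<mu> i") (auto simp: laurent_carrier)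
  have "coeff_support f \<subseteq> (\<Union>i\<in>{i \<in> I. f i \<noteq> (\<lambda>\<alpha> \<beta> k. \<zero>\<^bsub>K\<^esub>)}.
      \<Union>(\<alpha>, \<beta>)\<in>{(\<alpha>, \<beta>). f i \<alpha> \<beta> \<noteq> (\<lambda>k. \<zero>\<^bsub>K\<^esub>)}. (\<lambda>k. (i, \<alpha>, \<beta>, k)) ` {k. f i \<alpha> \<beta> k \<noteq> \<zero>\<^bsub>K\<^esub>})" (is "_ \<subseteq> ?U")
  proof
    fix x assume "x \<in> coeff_support f"
    then obtain i \<alpha> \<beta> k where x: "x = (i, \<alpha>, \<beta>, k)" "i \<in> I" "f i \<alpha> \<beta> k \<noteq> \<zero>\<^bsub>K\<^esub>"
      by (auto simp: coeff_support_def)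
    then have "f i \<noteq> (\<lambda>\<alpha> \<beta> k. \<zero>\<^bsub>K\<^esub>)" "f i \<alpha> \<beta> \<noteq> (\<lambda>k. \<zero>\<^bsub>K\<^esub>)" by metis+
    then show "x \<in> ?U" using x by blast
  qed
  moreover have "finite ?U" using fI fM all by (auto simp: laurent_carrier)
  ultimately have "finite (coeff_support f)" by (rule finite_subset)
  moreover have "\<alpha> \<in> \<mu> i \<and> \<beta> \<in> \<mu> i \<and> int (n i) dvd k" if "(i, \<alpha>, \<beta>, k) \<in> coeff_support f" for i \<alpha> \<beta> k
  proof -
    have x: "i \<in> I" "f i \<alpha> \<beta> k \<noteq> \<zero>\<^bsub>K\<^esub>" using that by (auto simp: coeff_support_def)
    then have "f i \<alpha> \<beta> \<noteq> (\<lambda>k. \<zero>\<^bsub>K\<^esub>)" by metis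
    then have "\<alpha> \<in> \<mu> i \<and> \<beta> \<in> \<mu> i" using off[OF x(1)] by blast
    then show ?thesis using all[OF x(1)] x(2) by (simp add: laurent_carrier)
  qed
  moreover have "f i \<alpha> \<beta> k \<in> carrier K" if "i \<in> I" for i \<alpha> \<beta> k
    using all[OF that] by (simp add: laurent_carrier)
  ultimately show ?R using ext by blast
next
  assume R: ?R
  have fin: "finite (coeff_support f)" using R by blast
  have sup: "\<alpha> \<in> \<mu> i \<and> \<beta> \<in> \<mu> i \<and> int (n i) dvd k" if "i \<in> I" "f i \<alpha> \<beta> k \<noteq> \<zero>\<^bsub>K\<^esub>" for i \<alpha> \<beta> k
    using R that by (auto simp: coeff_support_def)
  have ent: "f i \<alpha> \<beta> \<in> carrier (Lau (n i))" if i: "i \<in> I" for i \<alpha> \<beta>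
  proof -
    have "{k. f i \<alpha> \<beta> k \<noteq> \<zero>\<^bsub>K\<^esub>} \<subseteq> (\<lambda>(i, \<alpha>, \<beta>, k). k) ` coeff_support f"
      using i by (force simp: coeff_support_def image_iff)
    then have "finite {k. f i \<alpha> \<beta> k \<noteq> \<zero>\<^bsub>K\<^esub>}" by (rule finite_subset) (use fin in auto)
    then show ?thesis using R i sup by (auto simp: laurent_carrier)
  qed
  have "f i \<in> carrier (matrix_algebra (Lau (n i)) (\<mu> i) (\<gamma> i))" if i: "i \<in> I" for i
  proof -
    have "{(\<alpha>, \<beta>). f i \<alpha> \<beta> \<noteq> (\<lambda>k. \<zero>\<^bsub>K\<^esub>)} \<subseteq> (\<lambda>(i, \<alpha>, \<beta>, k). (\<alpha>, \<beta>)) ` coeff_support f"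
      using i by (force simp: coeff_support_def image_iff fun_eq_iff)
    then have "finite {(\<alpha>, \<beta>). f i \<alpha> \<beta> \<noteq> (\<lambda>k. \<zero>\<^bsub>K\<^esub>)}" by (rule finite_subset) (use fin in auto)
    moreover have "f i \<alpha> \<beta> = (\<lambda>k. \<zero>\<^bsub>K\<^esub>)" if "\<not> (\<alpha> \<in> \<mu> i \<and> \<beta> \<in> \<mu> i)" for \<alpha> \<beta>
      using sup[OF i] that by blast
    ultimately show ?thesis using ent[OF i] by (auto simp: matrix_algebra_def Let_def laurent_ops)
  qed
  moreover have "{i \<in> I. f i \<noteq> (\<lambda>\<alpha> \<beta> k. \<zero>\<^bsub>K\<^esub>)} \<subseteq> fst ` coeff_support f"
    by (force simp: coeff_support_def fun_eq_iff)
  then have "finite {i \<in> I. f i \<noteq> (\<lambda>\<alpha> \<beta> k. \<zero>\<^bsub>K\<^esub>)}" by (rule finite_subset) (use fin in auto)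
  ultimately show "f \<in> carrier MS"
    using R by (auto simp: sum_algebra_def Let_def PiE_iff) (simp add: matrix_algebra_def Let_def laurent_ops)
qed

lemma MS_closed: "f \<in> carrier MS \<Longrightarrow> i \<in> I \<Longrightarrow> f i \<alpha> \<beta> k \<in> carrier K"
  by (simp add: MS_carrier)

lemma MS_support:
  "f \<in> carrier MS \<Longrightarrow> i \<in> I \<Longrightarrow> f i \<alpha> \<beta> k \<noteq> \<zero>\<^bsub>K\<^esub> \<Longrightarrow> \<alpha> \<in> \<mu> i \<and> \<beta> \<in> \<mu> i \<and> int (n i) dvd k"
  by (auto simp: MS_carrier coeff_support_def)

lemma MS_finite: "f \<in> carrier MS \<Longrightarrow> finite (coeff_support f)"
  by (simp add: MS_carrier)

lemma MS_eqI:
  assumes "f \<in> carrier MS" "g \<in> carrier MS" "\<And>i \<alpha> \<beta> k. i \<in> I \<Longrightarrow> f i \<alpha> \<beta> k = g i \<alpha> \<beta> k"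
  shows "f = g"
proof
  fix i show "f i = g i"
    using assms by (cases "i \<in> I") (auto simp: MS_carrier extensional_def fun_eq_iff)
qed

lemma MS_zero: "\<zero>\<^bsub>MS\<^esub> = (\<lambda>i\<in>I. \<lambda>\<alpha> \<beta> k. \<zero>\<^bsub>K\<^esub>)"
  by (simp add: sum_algebra_def matrix_algebra_def Let_def laurent_ops)

lemma MS_add: "f \<oplus>\<^bsub>MS\<^esub> g = (\<lambda>i\<in>I. \<lambda>\<alpha> \<beta> k. f i \<alpha> \<beta> k \<oplus>\<^bsub>K\<^esub> g i \<alpha> \<beta> k)"
  by (simp add: sum_algebra_def matrix_algebra_def Let_def laurent_ops)

lemma MS_smult: "c \<odot>\<^bsub>MS\<^esub> f = (\<lambda>i\<in>I. \<lambda>\<alpha> \<beta> k. c \<otimes>\<^bsub>K\<^esub> f i \<alpha> \<beta> k)"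
  by (simp add: sum_algebra_def matrix_algebra_def Let_def laurent_ops)

lemma MS_add_closed:
  assumes "f \<in> carrier MS" "g \<in> carrier MS"
  shows "f \<oplus>\<^bsub>MS\<^esub> g \<in> carrier MS"
proof -
  have sub: "coeff_support (f \<oplus>\<^bsub>MS\<^esub> g) \<subseteq> coeff_support f \<union> coeff_support g"
    by (auto simp: coeff_support_def MS_add)
  show ?thesis unfolding MS_carrier[of "f \<oplus>\<^bsub>MS\<^esub> g"]
  proof (intro conjI)
    show "finite (coeff_support (f \<oplus>\<^bsub>MS\<^esub> g))"
      using finite_subset[OF sub] MS_finite assms by blast
    show "\<forall>(i, \<alpha>, \<beta>, k) \<in> coeff_support (f \<oplus>\<^bsub>MS\<^esub> g). \<alpha> \<in> \<mu> i \<and> \<beta> \<in> \<mu> i \<and> int (n i) dvd k"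
      using assms sub unfolding MS_carrier by blast
  qed (use assms in \<open>simp_all add: MS_add MS_closed\<close>)
qed

lemma MS_mult_ext: "f \<otimes>\<^bsub>MS\<^esub> g \<in> extensional I"
  by (simp add: sum_algebra_def Let_def)

text \<open>The sums run over arbitrary finite sets that contain the support of the row, so that
  several products can be expanded over the same sets.\<close>

lemma MS_mult:
  assumes f: "f \<in> carrier MS" and g: "g \<in> carrier MS" and i: "i \<in> I"
    and S: "finite S" "S \<subseteq> \<mu> i" and Z: "finite Z"
    and sup: "\<And>\<kappa> j. f i \<alpha> \<kappa> j \<noteq> \<zero>\<^bsub>K\<^esub> \<Longrightarrow> \<kappa> \<in> S \<and> j \<in> Z"
  shows "(f \<otimes>\<^bsub>MS\<^esub> g) i \<alpha> \<beta> k = (\<Oplus>\<^bsub>K\<^esub>\<kappa>\<in>S. \<Oplus>\<^bsub>K\<^esub>j\<in>Z. f i \<alpha> \<kappa> j \<otimes>\<^bsub>K\<^esub> g i \<kappa> \<beta> (k - j))"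
proof -
  have ent: "h i \<alpha> \<beta> \<in> carrier (Lau (n i))" if "h \<in> carrier MS" for h \<alpha> \<beta>
  proof -
    have "{k. h i \<alpha> \<beta> k \<noteq> \<zero>\<^bsub>K\<^esub>} \<subseteq> (\<lambda>(i, \<alpha>, \<beta>, k). k) ` coeff_support h"
      using i by (force simp: coeff_support_def image_iff)
    then have "finite {k. h i \<alpha> \<beta> k \<noteq> \<zero>\<^bsub>K\<^esub>}" by (rule finite_subset) (use MS_finite[OF that] in auto)
    then show ?thesis using MS_closed[OF that i] MS_support[OF that i] by (auto simp: laurent_carrier)
  qed
  have cl: "f i \<alpha> \<kappa> \<otimes>\<^bsub>Lau (n i)\<^esub> g i \<kappa> \<beta> \<in> carrier (Lau (n i))" for \<kappa>
    using laurent_mult_closed ent f g by blast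
  have fin: "finite {\<kappa> \<in> \<mu> i. f i \<alpha> \<kappa> \<noteq> (\<lambda>k. \<zero>\<^bsub>K\<^esub>)}"
  proof (rule finite_subset[OF _ S(1)])
    show "{\<kappa> \<in> \<mu> i. f i \<alpha> \<kappa> \<noteq> (\<lambda>k. \<zero>\<^bsub>K\<^esub>)} \<subseteq> S" using sup by (auto simp: fun_eq_iff)
  qed
  have "(f \<otimes>\<^bsub>MS\<^esub> g) i \<alpha> \<beta> k = (\<Oplus>\<^bsub>Lau (n i)\<^esub>\<kappa>\<in>{\<kappa> \<in> \<mu> i. f i \<alpha> \<kappa> \<noteq> (\<lambda>k. \<zero>\<^bsub>K\<^esub>)}. f i \<alpha> \<kappa> \<otimes>\<^bsub>Lau (n i)\<^esub> g i \<kappa> \<beta>) k"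
    using i by (simp add: sum_algebra_def matrix_algebra_def Let_def laurent_ops)
  also have "\<dots> = (\<Oplus>\<^bsub>K\<^esub>\<kappa>\<in>{\<kappa> \<in> \<mu> i. f i \<alpha> \<kappa> \<noteq> (\<lambda>k. \<zero>\<^bsub>K\<^esub>)}. (f i \<alpha> \<kappa> \<otimes>\<^bsub>Lau (n i)\<^esub> g i \<kappa> \<beta>) k)"
    by (rule laurent_finsum[OF fin cl])
  also have "\<dots> = (\<Oplus>\<^bsub>K\<^esub>\<kappa>\<in>{\<kappa> \<in> \<mu> i. f i \<alpha> \<kappa> \<noteq> (\<lambda>k. \<zero>\<^bsub>K\<^esub>)}. \<Oplus>\<^bsub>K\<^esub>j\<in>Z. f i \<alpha> \<kappa> j \<otimes>\<^bsub>K\<^esub> g i \<kappa> \<beta> (k - j))"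
    using sup MS_closed[OF f i] MS_closed[OF g i]
    by (intro finsum_cong' laurent_mult[OF Z]) (auto intro!: finsum_closed)
  also have "\<dots> = (\<Oplus>\<^bsub>K\<^esub>\<kappa>\<in>S. \<Oplus>\<^bsub>K\<^esub>j\<in>Z. f i \<alpha> \<kappa> j \<otimes>\<^bsub>K\<^esub> g i \<kappa> \<beta> (k - j))"
  proof (rule finsum_superset[OF S(1)])
    show "{\<kappa> \<in> \<mu> i. f i \<alpha> \<kappa> \<noteq> (\<lambda>k. \<zero>\<^bsub>K\<^esub>)} \<subseteq> S" using sup by (auto simp: fun_eq_iff)
    fix \<kappa> assume "\<kappa> \<in> S - {\<kappa> \<in> \<mu> i. f i \<alpha> \<kappa> \<noteq> (\<lambda>k. \<zero>\<^bsub>K\<^esub>)}"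
    then have "f i \<alpha> \<kappa> j = \<zero>\<^bsub>K\<^esub>" for j using S(2) by (auto simp: fun_eq_iff)
    then show "(\<Oplus>\<^bsub>K\<^esub>j\<in>Z. f i \<alpha> \<kappa> j \<otimes>\<^bsub>K\<^esub> g i \<kappa> \<beta> (k - j)) = \<zero>\<^bsub>K\<^esub>"
      using MS_closed[OF g i] by (intro finsum_all_zero) simp
  qed (use MS_closed[OF f i] MS_closed[OF g i] in \<open>auto intro!: finsum_closed\<close>)
  finally show ?thesis .
qed

lemma MS_component: "f \<in> component MS d \<longleftrightarrow> f \<in> carrier MS \<and>
    (\<forall>(i, \<alpha>, \<beta>, k) \<in> coeff_support f. k = d + \<gamma> i \<beta> - \<gamma> i \<alpha>)" (is "_ \<longleftrightarrow> ?R")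
proof -
  have m: "f i \<in> carrier (matrix_algebra (Lau (n i)) (\<mu> i) (\<gamma> i))" if "f \<in> carrier MS" "i \<in> I" for i
    using that by (auto simp: sum_algebra_def Let_def PiE_iff)
  have l: "f i \<alpha> \<beta> \<in> carrier (Lau (n i))" if "f \<in> carrier MS" "i \<in> I" "\<alpha> \<in> \<mu> i" "\<beta> \<in> \<mu> i" for i \<alpha> \<beta>
    using m[OF that(1,2)] that(3,4) by (auto simp: matrix_algebra_def Let_def)
  have "f \<in> component MS d \<longleftrightarrow> f \<in> carrier MS \<and> (\<forall>i\<in>I. \<forall>\<alpha>\<in>\<mu> i. \<forall>\<beta>\<in>\<mu> i. \<forall>k. f i \<alpha> \<beta> k \<noteq> \<zero>\<^bsub>K\<^esub> \<longrightarrow>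
      k = d + \<gamma> i \<beta> - \<gamma> i \<alpha>)"
  proof -
    have c: "f \<in> component MS d \<longleftrightarrow> f \<in> carrier MS \<and>
        (\<forall>i\<in>I. f i \<in> component (matrix_algebra (Lau (n i)) (\<mu> i) (\<gamma> i)) d)"
      by (simp add: sum_algebra_def Let_def)
    have d: "A \<in> component (matrix_algebra (Lau e) M g) d \<longleftrightarrow> A \<in> carrier (matrix_algebra (Lau e) M g) \<and>
        (\<forall>\<alpha>\<in>M. \<forall>\<beta>\<in>M. A \<alpha> \<beta> \<in> component (Lau e) (d + g \<beta> - g \<alpha>))" for A e M g
      by (simp add: matrix_algebra_def Let_def)
    have e: "a \<in> component (Lau e) x \<longleftrightarrow> a \<in> carrier (Lau e) \<and> (\<forall>k. a k \<noteq> \<zero>\<^bsub>K\<^esub> \<longrightarrow> k = x)" for a e x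
      by (simp add: laurent_algebra_def Let_def)
    show ?thesis unfolding c d e using m l by blast
  qed
  also have "\<dots> \<longleftrightarrow> ?R"
  proof (rule conj_cong[OF HOL.refl])
    assume f: "f \<in> carrier MS"
    show "(\<forall>i\<in>I. \<forall>\<alpha>\<in>\<mu> i. \<forall>\<beta>\<in>\<mu> i. \<forall>k. f i \<alpha> \<beta> k \<noteq> \<zero>\<^bsub>K\<^esub> \<longrightarrow> k = d + \<gamma> i \<beta> - \<gamma> i \<alpha>) \<longleftrightarrow>
        (\<forall>(i, \<alpha>, \<beta>, k) \<in> coeff_support f. k = d + \<gamma> i \<beta> - \<gamma> i \<alpha>)"
      using MS_support[OF f] unfolding coeff_support_def by auto
  qed
  finally show ?thesis .
qed

lemma MS_mult_zero:
  assumes f: "f \<in> carrier MS" and g: "g \<in> carrier MS" and i: "i \<in> I" and nz: "(f \<otimes>\<^bsub>MS\<^esub> g) i \<alpha> \<beta> k \<noteq> \<zero>\<^bsub>K\<^esub>"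
  shows "\<exists>\<kappa> j. f i \<alpha> \<kappa> j \<noteq> \<zero>\<^bsub>K\<^esub> \<and> g i \<kappa> \<beta> (k - j) \<noteq> \<zero>\<^bsub>K\<^esub>"
proof (rule ccontr)
  assume no: "\<not> ?thesis"
  let ?S = "(\<lambda>(i, \<alpha>, \<beta>, k). \<beta>) ` {x \<in> coeff_support f. fst x = i}"
  let ?Z = "(\<lambda>(i, \<alpha>, \<beta>, k). k) ` coeff_support f"
  have "(f \<otimes>\<^bsub>MS\<^esub> g) i \<alpha> \<beta> k = (\<Oplus>\<^bsub>K\<^esub>\<kappa>\<in>?S. \<Oplus>\<^bsub>K\<^esub>j\<in>?Z. f i \<alpha> \<kappa> j \<otimes>\<^bsub>K\<^esub> g i \<kappa> \<beta> (k - j))"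
  proof (rule MS_mult[OF f g i])
    show "finite ?S" "finite ?Z" using MS_finite[OF f] by auto
    show "?S \<subseteq> \<mu> i" using MS_support[OF f i] by (auto simp: coeff_support_def)
    show "\<kappa> \<in> ?S \<and> j \<in> ?Z" if "f i \<alpha> \<kappa> j \<noteq> \<zero>\<^bsub>K\<^esub>" for \<kappa> j
      using that i by (force simp: coeff_support_def image_iff)
  qed
  also have "\<dots> = \<zero>\<^bsub>K\<^esub>"
  proof (rule finsum_all_zero, rule finsum_all_zero)
    fix \<kappa> j
    have "f i \<alpha> \<kappa> j = \<zero>\<^bsub>K\<^esub> \<or> g i \<kappa> \<beta> (k - j) = \<zero>\<^bsub>K\<^esub>" using no by blast
    then show "f i \<alpha> \<kappa> j \<otimes>\<^bsub>K\<^esub> g i \<kappa> \<beta> (k - j) = \<zero>\<^bsub>K\<^esub>"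
      using MS_closed[OF f i] MS_closed[OF g i] by auto
  qed
  finally show False using nz by simp
qed

text \<open>Multiplication by \<open>x ^ d\<close> in every block.\<close>

definition degree_shift :: "int \<Rightarrow> ('i \<Rightarrow> 'm \<Rightarrow> 'm \<Rightarrow> int \<Rightarrow> 'k) \<Rightarrow> 'i \<Rightarrow> 'm \<Rightarrow> 'm \<Rightarrow> int \<Rightarrow> 'k" where
  "degree_shift d f = (\<lambda>i\<in>I. \<lambda>\<alpha> \<beta> k. f i \<alpha> \<beta> (k - d))"

lemma degree_shift_support:
  "coeff_support (degree_shift d f) = (\<lambda>(i, \<alpha>, \<beta>, k). (i, \<alpha>, \<beta>, k + d)) ` coeff_support f"
proof (rule equalityI)
  show "coeff_support (degree_shift d f) \<subseteq> (\<lambda>(i, \<alpha>, \<beta>, k). (i, \<alpha>, \<beta>, k + d)) ` coeff_support f"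
  proof
    fix x assume x: "x \<in> coeff_support (degree_shift d f)"
    obtain i \<alpha> \<beta> k where "x = (i, \<alpha>, \<beta>, k)" by (cases x)
    then show "x \<in> (\<lambda>(i, \<alpha>, \<beta>, k). (i, \<alpha>, \<beta>, k + d)) ` coeff_support f"
      using x by (intro image_eqI[of _ _ "(i, \<alpha>, \<beta>, k - d)"]) (auto simp: coeff_support_def degree_shift_def)
  qed
qed (auto simp: coeff_support_def degree_shift_def)

lemma degree_shift_closed:
  assumes f: "f \<in> carrier MS" and d: "\<And>i \<alpha> \<beta> k. (i, \<alpha>, \<beta>, k) \<in> coeff_support f \<Longrightarrow> int (n i) dvd d"
  shows "degree_shift d f \<in> carrier MS"
  unfolding MS_carrier degree_shift_support
  using f d MS_finite[OF f] by (auto simp: degree_shift_def MS_carrier)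

text \<open>The powers of \<open>x\<close> are central and can be collected; in coefficients this is
  the substitution of \<open>j + d\<close> for \<open>j\<close> in the inner sum.\<close>

lemma degree_shift_mult:
  assumes f: "f \<in> carrier MS" and g: "g \<in> carrier MS"
    and sf: "degree_shift d f \<in> carrier MS" and sg: "degree_shift e g \<in> carrier MS"
  shows "degree_shift d f \<otimes>\<^bsub>MS\<^esub> degree_shift e g = degree_shift (d + e) (f \<otimes>\<^bsub>MS\<^esub> g)"
proof
  fix i
  show "(degree_shift d f \<otimes>\<^bsub>MS\<^esub> degree_shift e g) i = degree_shift (d + e) (f \<otimes>\<^bsub>MS\<^esub> g) i"
  proof (cases "i \<in> I")
    case i: True
    let ?S = "(\<lambda>(i, \<alpha>, \<beta>, k). \<beta>) ` {x \<in> coeff_support f. fst x = i}"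
    let ?Z = "(\<lambda>(i, \<alpha>, \<beta>, k). k) ` coeff_support f"
    have fin: "finite ?S" "finite ?Z" using MS_finite[OF f] by auto
    have S: "?S \<subseteq> \<mu> i" using MS_support[OF f i] by (auto simp: coeff_support_def)
    have sup: "\<kappa> \<in> ?S \<and> j \<in> ?Z" if "f i \<alpha> \<kappa> j \<noteq> \<zero>\<^bsub>K\<^esub>" for \<alpha> \<kappa> j
      using that i by (force simp: coeff_support_def image_iff)
    have "(degree_shift d f \<otimes>\<^bsub>MS\<^esub> degree_shift e g) i \<alpha> \<beta> k = (f \<otimes>\<^bsub>MS\<^esub> g) i \<alpha> \<beta> (k - (d + e))" for \<alpha> \<beta> k
    proof -
      have "(degree_shift d f \<otimes>\<^bsub>MS\<^esub> degree_shift e g) i \<alpha> \<beta> k =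
          (\<Oplus>\<^bsub>K\<^esub>\<kappa>\<in>?S. \<Oplus>\<^bsub>K\<^esub>j\<in>(\<lambda>j. j + d) ` ?Z. degree_shift d f i \<alpha> \<kappa> j \<otimes>\<^bsub>K\<^esub> degree_shift e g i \<kappa> \<beta> (k - j))"
      proof (rule MS_mult[OF sf sg i fin(1) S])
        fix \<kappa> j assume "degree_shift d f i \<alpha> \<kappa> j \<noteq> \<zero>\<^bsub>K\<^esub>"
        then have "\<kappa> \<in> ?S" "j - d \<in> ?Z" using sup i by (auto simp: degree_shift_def)
        moreover have "j = (j - d) + d" by simp
        ultimately show "\<kappa> \<in> ?S \<and> j \<in> (\<lambda>j. j + d) ` ?Z" by (intro conjI image_eqI[of _ _ "j - d"])
      qed (rule finite_imageI[OF fin(2)])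
      also have "\<dots> = (\<Oplus>\<^bsub>K\<^esub>\<kappa>\<in>?S. \<Oplus>\<^bsub>K\<^esub>j\<in>?Z. f i \<alpha> \<kappa> j \<otimes>\<^bsub>K\<^esub> g i \<kappa> \<beta> (k - (d + e) - j))"
      proof (rule finsum_cong'[OF HOL.refl])
        fix \<kappa>
        have "inj_on (\<lambda>j. j + d) ?Z" by (auto simp: inj_on_def)
        moreover have "(\<lambda>j. degree_shift d f i \<alpha> \<kappa> j \<otimes>\<^bsub>K\<^esub> degree_shift e g i \<kappa> \<beta> (k - j)) \<in> (\<lambda>j. j + d) ` ?Z \<rightarrow> carrier K"
          using MS_closed[OF sf i] MS_closed[OF sg i] by auto
        ultimately have "(\<Oplus>\<^bsub>K\<^esub>j\<in>(\<lambda>j. j + d) ` ?Z. degree_shift d f i \<alpha> \<kappa> j \<otimes>\<^bsub>K\<^esub> degree_shift e g i \<kappa> \<beta> (k - j)) =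
            (\<Oplus>\<^bsub>K\<^esub>j\<in>?Z. degree_shift d f i \<alpha> \<kappa> (j + d) \<otimes>\<^bsub>K\<^esub> degree_shift e g i \<kappa> \<beta> (k - (j + d)))"
          by (rule finsum_reindex[rotated])
        then show "(\<Oplus>\<^bsub>K\<^esub>j\<in>(\<lambda>j. j + d) ` ?Z. degree_shift d f i \<alpha> \<kappa> j \<otimes>\<^bsub>K\<^esub> degree_shift e g i \<kappa> \<beta> (k - j)) =
            (\<Oplus>\<^bsub>K\<^esub>j\<in>?Z. f i \<alpha> \<kappa> j \<otimes>\<^bsub>K\<^esub> g i \<kappa> \<beta> (k - (d + e) - j))"
          using i by (simp add: degree_shift_def algebra_simps)
      qed (use MS_closed[OF f i] MS_closed[OF g i] in \<open>auto intro!: finsum_closed\<close>)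
      also have "\<dots> = (f \<otimes>\<^bsub>MS\<^esub> g) i \<alpha> \<beta> (k - (d + e))"
        by (rule MS_mult[OF f g i fin(1) S fin(2), symmetric]) (rule sup)
      finally show ?thesis .
    qed
    then show ?thesis using i by (simp add: degree_shift_def fun_eq_iff)
  next
    case False
    then show ?thesis using MS_mult_ext by (simp add: degree_shift_def extensional_def)
  qed
qed

end


section \<open>Periodicity of the graded Leavitt path algebra\<close>

context leavitt_path
begin

primrec lin_comb :: "(nat \<Rightarrow> 'k) \<Rightarrow> (nat \<Rightarrow> ('k, 'v, 'e) lterm set) \<Rightarrow> nat \<Rightarrow> ('k, 'v, 'e) lterm set" where
  "lin_comb c X 0 = \<zero>\<^bsub>L\<^esub>"
| "lin_comb c X (Suc m) = lin_comb c X m \<oplus>\<^bsub>L\<^esub> c m \<odot>\<^bsub>L\<^esub> X m"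

lemma lin_comb_closed:
  "(\<And>k. k < m \<Longrightarrow> c k \<in> carrier K) \<Longrightarrow> (\<And>k. k < m \<Longrightarrow> X k \<in> carrier L) \<Longrightarrow> lin_comb c X m \<in> carrier L"
  by (induction m) auto

text \<open>Stated for any linear functional, since it is applied both to evaluations of
  \<open>rep\<close> at a state and to matrix coefficients under the isomorphism.\<close>

lemma lin_comb_functional:
  assumes "\<And>x. x \<in> carrier L \<Longrightarrow> \<phi> x \<in> carrier K"
    "\<And>x y. x \<in> carrier L \<Longrightarrow> y \<in> carrier L \<Longrightarrow> \<phi> (x \<oplus>\<^bsub>L\<^esub> y) = \<phi> x \<oplus>\<^bsub>K\<^esub> \<phi> y"
    "\<And>a x. a \<in> carrier K \<Longrightarrow> x \<in> carrier L \<Longrightarrow> \<phi> (a \<odot>\<^bsub>L\<^esub> x) = a \<otimes>\<^bsub>K\<^esub> \<phi> x"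
    and "\<And>k. k < m \<Longrightarrow> c k \<in> carrier K" "\<And>k. k < m \<Longrightarrow> X k \<in> carrier L"
  shows "\<phi> (lin_comb c X m) = (\<Oplus>\<^bsub>K\<^esub>k\<in>{..<m}. c k \<otimes>\<^bsub>K\<^esub> \<phi> (X k))"
  using assms(4,5)
proof (induction m)
  case 0
  have "\<phi> \<zero>\<^bsub>L\<^esub> \<oplus>\<^bsub>K\<^esub> \<phi> \<zero>\<^bsub>L\<^esub> = \<phi> \<zero>\<^bsub>L\<^esub>" using assms(2)[of "\<zero>\<^bsub>L\<^esub>" "\<zero>\<^bsub>L\<^esub>"] by simp
  then have "\<phi> \<zero>\<^bsub>L\<^esub> = \<zero>\<^bsub>K\<^esub>" using assms(1)[of "\<zero>\<^bsub>L\<^esub>"] add.l_cancel_one by simp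
  then show ?case by simp
next
  case (Suc m)
  have cl: "c k \<otimes>\<^bsub>K\<^esub> \<phi> (X k) \<in> carrier K" if "k < Suc m" for k using Suc.prems assms(1) that by simp
  have "\<phi> (lin_comb c X (Suc m)) = (\<Oplus>\<^bsub>K\<^esub>k\<in>{..<m}. c k \<otimes>\<^bsub>K\<^esub> \<phi> (X k)) \<oplus>\<^bsub>K\<^esub> c m \<otimes>\<^bsub>K\<^esub> \<phi> (X m)"
    using Suc lin_comb_closed[of m c X] by (simp add: assms(2,3))
  also have "\<dots> = (\<Oplus>\<^bsub>K\<^esub>k\<in>insert m {..<m}. c k \<otimes>\<^bsub>K\<^esub> \<phi> (X k))"
    using cl by (subst finsum_insert) (auto simp: Pi_iff intro!: a_comm finsum_closed)
  finally show ?case by (simp add: lessThan_Suc)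
qed

text \<open>In the language of groupoids: each boundary path \<open>p h\<close> from
  \<open>v\<close> is tail equivalent, with lag \<open>n\<close>, to a boundary path
  \<open>q h\<close> from \<open>v\<close>, with a uniform bound on the part that is
  exchanged.\<close>

definition has_lag :: "'v \<Rightarrow> nat \<Rightarrow> nat \<Rightarrow> bool" where
  "has_lag v n M \<longleftrightarrow> (\<forall>g. boundary_path G v g \<longrightarrow> (\<exists>p q w h. awalk v p w \<and> awalk v q w \<and>
    length p = length q + n \<and> length p \<le> M \<and> g = prepend p h \<and> boundary_path G w h))"

lemma has_lagE:
  assumes "has_lag v n M" "boundary_path G v g"
  obtains p q w h where "awalk v p w" "awalk v q w" "length p = length q + n" "length p \<le> M"
    "g = prepend p h" "boundary_path G w h"
  using assms(1)[unfolded has_lag_def, rule_format, OF assms(2)] by (elim exE conjE) (rule that)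

text \<open>Evaluating \<open>Y Y' = v\<close> on the function that is 1 on all boundary paths shows
  that \<open>Y\<close> reaches each boundary path from \<open>v\<close>. The support of a
  homogeneous element provides \<open>p\<close> and \<open>q\<close>, and \<open>v Y' = Y'\<close>
  forces \<open>q\<close> to start at \<open>v\<close>.\<close>

lemma inv_homogeneous_imp_lag:
  assumes v: "v \<in> verts G" and Y: "Y \<in> component L (int n)" and Y': "Y' \<in> carrier L"
    and "cl (Vert v) \<cdot> Y' = Y'" "Y \<cdot> Y' = cl (Vert v)"
  obtains M where "has_lag v n M"
proof -
  obtain M where M: "\<And>f x. f \<in> path_functions \<Longrightarrow> rep Y f x \<noteq> \<zero>\<^bsub>K\<^esub> \<Longrightarrow> tail_shift (int n) M f x"
    using homogeneous_support[OF Y] by blast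
  define f :: "('v, 'e) path_state \<Rightarrow> 'k" where
    "f = (\<lambda>(u, g, m). if boundary_path G u g then \<one>\<^bsub>K\<^esub> else \<zero>\<^bsub>K\<^esub>)"
  have f: "f \<in> path_functions" by (auto simp: f_def path_functions_def)
  have Yc: "Y \<in> carrier L" using Y component_carrier by blast
  have vert: "rep (cl (Vert v)) h (u, g, m) = (if boundary_path G u g \<and> u = v then h (u, g, m) else \<zero>\<^bsub>K\<^esub>)"
    if "h \<in> path_functions" for h u g m
    using that v by (simp add: rep_cl lterms.intros)
  have "\<exists>p q w h. awalk v p w \<and> awalk v q w \<and>
      length p = length q + n \<and> length p \<le> M \<and> g = prepend p h \<and> boundary_path G w h"
    if g: "boundary_path G v g" for g
  proof -
    have "rep Y (rep Y' f) (v, g, 0) = rep (cl (Vert v)) f (v, g, 0)"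
      using rep_mult[OF Yc Y' f] assms(5) by simp
    also have "\<dots> = \<one>\<^bsub>K\<^esub>" using g vert[OF f] by (simp add: f_def)
    finally have "tail_shift (int n) M (rep Y' f) (v, g, 0)"
      using M[OF rep_closed[OF Y' f], of "(v, g, 0)"] by simp
    then obtain p q w h u' where pq: "awalk v p w" "awalk u' q w"
      "int (length p) - int (length q) = int n" "length p \<le> M" "g = prepend p h" "boundary_path G w h"
      "rep Y' f (u', prepend q h, 0 - int n) \<noteq> \<zero>\<^bsub>K\<^esub>"
      unfolding tail_shift_def by auto
    have "rep (cl (Vert v)) (rep Y' f) = rep Y' f"
      using rep_mult[OF _ Y' f, of "cl (Vert v)"] v assms(4) by simp
    then have "u' = v" using pq(7) vert[OF rep_closed[OF Y' f]] by (metis (full_types))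
    moreover have "length p = length q + n" using pq(3) by linarith
    ultimately show ?thesis using pq by blast
  qed
  then have "has_lag v n M" unfolding has_lag_def by (intro allI impI)
  then show ?thesis by (rule that)
qed

text \<open>If \<open>v\<close> is not regular, the trivial path is a boundary path from
  \<open>v\<close>; it has no initial walk of positive length to be exchanged.\<close>

lemma has_lag_imp_regular:
  assumes "v \<in> verts G" "n > 0" "has_lag v n M"
  shows "regular G v"
proof (rule ccontr)
  assume "\<not> regular G v"
  then have b: "boundary_path G v (\<lambda>_. None)" using assms(1) by (intro boundary_path.stop) auto
  obtain p q w h where "awalk v p w" "awalk v q w" "length p = length q + n" "length p \<le> M"
    and p: "(\<lambda>_. None) = prepend p h" by (rule has_lagE[OF assms(3) b])
  then obtain e p' where "p = e # p'" using assms(2) by (cases p) auto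
  then show False using fun_cong[OF p, of 0] by simp
qed

text \<open>A walk of length at least \<open>M\<close> is continued to a boundary path. The
  exchanged part \<open>p\<close> is short enough to lie inside \<open>P\<close>, and replacing it
  by \<open>q\<close> keeps the end.\<close>

lemma has_lag_imp_lowering:
  assumes "has_lag v n M"
    and P: "awalk v P z" "length P \<ge> M"
  shows "\<exists>Q. awalk v Q z \<and> length Q + n = length P"
proof -
  have "z \<in> verts G" using P(1) by blast
  then obtain g where "boundary_path G z g" by (rule boundary_path_exists)
  then have b: "boundary_path G v (prepend P g)" by (rule boundary_path_prepend[OF P(1)])
  obtain p q w h where pq: "awalk v p w" "awalk v q w" "length p = length q + n" "length p \<le> M"
    "prepend P g = prepend p h" by (rule has_lagE[OF assms(1) b])
  then obtain s where s: "P = p @ s" using prepend_eq_le[of p h P g] P(2) by auto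
  then have "awalk (awlast v p) s z" using P(1) by simp
  moreover have "awlast v p = w" using pq(1) by blast
  ultimately have "awalk v (q @ s) z" using awalk_appendI[OF pq(2)] by simp
  moreover have "length (q @ s) + n = length P" using s pq(3) by simp
  ultimately show ?thesis by blast
qed

text \<open>An exit \<open>e\<close> of a closed walk \<open>c\<close> yields infinitely many orthogonal idempotents
  \<open>c ^ k e (c ^ k e)*\<close> of degree \<open>0\<close>.\<close>

definition exit_walk :: "'e list \<Rightarrow> 'e \<Rightarrow> nat \<Rightarrow> 'e list" where
  "exit_walk c e k = concat (replicate k c) @ [e]"

lemma awalk_power: "awalk v c v \<Longrightarrow> awalk v (concat (replicate k c)) v"
proof (induction k)
  case 0
  then show ?case by (auto simp: awalk_Nil_iff)
next
  case (Suc k)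
  then show ?case by (auto intro: awalk_appendI simp del: awalk_append_iff)
qed

text \<open>\<open>c ^ i e\<close> and \<open>c ^ j e\<close> with different exponents part where
  one leaves by \<open>e\<close> and the other starts a further turn with
  \<open>hd c\<close>.\<close>

lemma exit_walk_prefix:
  assumes "c \<noteq> []" "hd c \<noteq> e" "prepend (exit_walk c e i) g = prepend (exit_walk c e j) h"
  shows "i = j"
  using assms(3)
proof (induction i arbitrary: j)
  case 0
  then show ?case using assms(1,2)
    by (cases j; cases c) (auto simp: exit_walk_def case_nat_eq_iff)
next
  case (Suc i)
  show ?case
  proof (cases j)
    case 0
    then show ?thesis using Suc.prems assms(1,2) by (cases c) (auto simp: exit_walk_def case_nat_eq_iff)
  next
    case (Suc j')
    then have "prepend (exit_walk c e i) g = prepend (exit_walk c e j') h"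
      using Suc.prems by (simp add: exit_walk_def prepend_append prepend_cancel)
    then show ?thesis using Suc.IH Suc by simp
  qed
qed

text \<open>Evaluated on a path that begins with \<open>c ^ j e\<close>, all idempotents but the
  \<open>j\<close>-th vanish, which isolates the coefficient \<open>ck j\<close>.\<close>

lemma exit_idempotents_independent:
  assumes c: "awalk v c v" "c \<noteq> []" and e: "e \<in> out_arcs G v" "hd c \<noteq> e"
    and ck: "\<And>k. k < m \<Longrightarrow> ck k \<in> carrier K"
    and zero: "lin_comb ck (\<lambda>k. walk_monomial (exit_walk c e k) (exit_walk c e k) (head G e)) m = \<zero>\<^bsub>L\<^esub>"
    and j: "j < m"
  shows "ck j = \<zero>\<^bsub>K\<^esub>"
proof -
  let ?P = "exit_walk c e"
  let ?X = "\<lambda>k. walk_monomial (?P k) (?P k) (head G e)"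
  have e': "e \<in> arcs G" "tail G e = v" using e by auto
  have w: "awalk v (?P k) (head G e)" for k
    unfolding exit_walk_def using e' by (intro awalk_appendI[OF awalk_power[OF c(1)]]) (auto simp: awalk_simps)
  have Xc: "?X k \<in> carrier L" for k using w by (rule walk_monomial_closed[OF _ w])
  obtain g where g: "boundary_path G (head G e) g"
    using boundary_path_exists[OF head_in_verts[OF e'(1)]] .
  define f :: "('v, 'e) path_state \<Rightarrow> 'k" where
    "f = (\<lambda>(u, g, m). if boundary_path G u g then \<one>\<^bsub>K\<^esub> else \<zero>\<^bsub>K\<^esub>)"
  have f: "f \<in> path_functions" by (auto simp: f_def path_functions_def)
  let ?x = "(v, prepend (?P j) g, 0)"
  have repX: "rep (?X k) f ?x = (if k = j then \<one>\<^bsub>K\<^esub> else \<zero>\<^bsub>K\<^esub>)" for k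
  proof (cases "k = j")
    case True
    then show ?thesis using rep_monomial[OF f w[of j] w[of j] g, of 0] boundary_path_prepend[OF w g]
      by (simp add: f_def)
  next
    case False
    have "rep (?X k) f ?x = \<zero>\<^bsub>K\<^esub>"
    proof (rule ccontr)
      assume "rep (?X k) f ?x \<noteq> \<zero>\<^bsub>K\<^esub>"
      then obtain h where "prepend (?P j) g = prepend (?P k) h"
        by (rule rep_monomial_support[OF f w w])
      then show False using exit_walk_prefix[OF c(2) e(2)] False by metis
    qed
    then show ?thesis using False by simp
  qed
  have "\<zero>\<^bsub>K\<^esub> = rep (lin_comb ck ?X m) f ?x" using zero rep_zero[OF f] by simp
  also have "\<dots> = (\<Oplus>\<^bsub>K\<^esub>k\<in>{..<m}. ck k \<otimes>\<^bsub>K\<^esub> rep (?X k) f ?x)"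
    by (rule lin_comb_functional[of "\<lambda>X. rep X f ?x"])
      (simp_all add: path_functions_closed[OF rep_closed[OF _ f]] rep_add[OF _ _ f] rep_smult[OF _ _ f] ck Xc)
  also have "\<dots> = (\<Oplus>\<^bsub>K\<^esub>k\<in>{..<m}. if j = k then ck k else \<zero>\<^bsub>K\<^esub>)"
    using ck by (intro finsum_cong') (auto simp: repX)
  also have "\<dots> = ck j"
    using ck j by (intro finsum_singleton) auto
  finally show ?thesis by simp
qed

text \<open>The isomorphism is used through the image \<open>u\<close> of a vertex, an idempotent
  with finite support: its finitely many blocks give a common period \<open>N\<close>, and its
  finitely many rows and columns bound the dimension of the degree 0 corner.\<close>

lemma tame_if_matrix_sum:
  fixes I :: "'i set" and \<mu> :: "'i \<Rightarrow> 'm set"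
  assumes pos: "\<And>i. i \<in> I \<Longrightarrow> n i > 0"
    and iso: "graded_isomorphic K L (sum_algebra I (\<lambda>i. matrix_algebra (laurent_algebra K (n i)) (\<mu> i) (\<gamma> i)))"
  shows "tame_graph G"
proof -
  interpret matrix_sum K I n \<mu> \<gamma> ..
  obtain h where bij: "bij_betw h (carrier L) (carrier MS)"
    and hom: "\<forall>a\<in>carrier L. \<forall>b\<in>carrier L. h (a \<oplus>\<^bsub>L\<^esub> b) = h a \<oplus>\<^bsub>MS\<^esub> h b"
      "\<forall>a\<in>carrier L. \<forall>b\<in>carrier L. h (a \<cdot> b) = h a \<otimes>\<^bsub>MS\<^esub> h b"
      "\<forall>k\<in>carrier K. \<forall>a\<in>carrier L. h (k \<odot>\<^bsub>L\<^esub> a) = k \<odot>\<^bsub>MS\<^esub> h a"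
      "\<forall>d. h ` component L d = component MS d"
    using iso unfolding graded_isomorphic_def by (elim exE conjE) (rule that)
  note hadd = hom(1)[rule_format] and hmult = hom(2)[rule_format] and hsmult = hom(3)[rule_format]
    and hcomp = hom(4)[rule_format]
  have hc: "h a \<in> carrier MS" if "a \<in> carrier L" for a using bij that by (auto simp: bij_betw_def)
  have hinj: "a = b" if "h a = h b" "a \<in> carrier L" "b \<in> carrier L" for a b
    using bij that by (auto simp: bij_betw_def inj_on_def)
  have vcomp: "cl (Vert v) \<in> component L 0" if "v \<in> verts G" for v
    using component_monomial[of v "[]" v v "[]" 0] that by (simp add: awalk_Nil_iff walk_monomial_def vert_vert)
  have shift: "\<exists>N>0. \<exists>M. has_lag v N M" if v: "v \<in> verts G" for v
  proof -
    define u where "u = h (cl (Vert v))"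
    have u: "u \<in> carrier MS" "u \<otimes>\<^bsub>MS\<^esub> u = u"
      using hc hmult[of "cl (Vert v)" "cl (Vert v)"] v by (simp_all add: u_def vert_vert)
    have u0: "u \<in> component MS 0" using hcomp[of 0] vcomp[OF v] by (auto simp: u_def)
    \<comment> \<open>A common multiple of the moduli of the blocks met by \<open>u\<close>, so that
      \<open>x ^ N\<close> and its inverse are available in each of them.\<close>
    define N where "N = (\<Prod>i\<in>fst ` coeff_support u. n i)"
    have fin: "finite (fst ` coeff_support u)" using MS_finite[OF u(1)] by simp
    have sub: "fst ` coeff_support u \<subseteq> I" by (auto simp: coeff_support_def)
    have N: "N > 0" unfolding N_def using sub pos by (intro prod_pos) auto
    have dvd: "int (n i) dvd int N" if "(i, \<alpha>, \<beta>, k) \<in> coeff_support u" for i \<alpha> \<beta> k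
    proof -
      have "i \<in> fst ` coeff_support u" using that by force
      then have "n i dvd N" unfolding N_def using fin by (intro dvd_prodI)
      then show ?thesis by simp
    qed
    \<comment> \<open>These are \<open>x ^ N u\<close> and \<open>x ^ (- N) u\<close>, inverse to
      each other in the corner of \<open>u\<close>.\<close>
    let ?y = "degree_shift (int N) u" and ?z = "degree_shift (- int N) u"
    have y: "?y \<in> carrier MS" by (rule degree_shift_closed[OF u(1) dvd])
    have z: "?z \<in> carrier MS" by (rule degree_shift_closed[OF u(1)]) (use dvd in simp)
    have s0: "degree_shift 0 u = u"
      using u(1) by (auto simp: degree_shift_def MS_carrier extensional_def fun_eq_iff)
    have yz: "?y \<otimes>\<^bsub>MS\<^esub> ?z = u" using degree_shift_mult[OF u(1) u(1) y z] u(2) s0 by simp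
    have uz: "u \<otimes>\<^bsub>MS\<^esub> ?z = ?z"
      using degree_shift_mult[OF u(1) u(1) _ z, of 0] u s0 by simp
    have "?y \<in> component MS (int N)"
      using u0 y unfolding MS_component degree_shift_support by auto
    then have "?y \<in> h ` component L (int N)" by (simp only: hcomp)
    then obtain Y where Y: "Y \<in> component L (int N)" "h Y = ?y" by (metis imageE)
    have "?z \<in> h ` carrier L" using bij z by (simp add: bij_betw_def)
    then obtain Z where Z: "Z \<in> carrier L" "h Z = ?z" by (metis imageE)
    have Yc: "Y \<in> carrier L" using Y component_carrier by blast
    have V: "cl (Vert v) \<in> carrier L" using v by simp
    have VZ: "cl (Vert v) \<cdot> Z = Z"
      by (rule hinj) (use hmult[OF V Z(1)] uz Z V in \<open>simp_all add: u_def\<close>)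
    have YZ: "Y \<cdot> Z = cl (Vert v)"
      by (rule hinj) (use hmult[OF Yc Z(1)] yz Z Y(2) Yc V in \<open>simp_all add: u_def\<close>)
    obtain M where "has_lag v N M" by (rule inv_homogeneous_imp_lag[OF v Y(1) Z(1) VZ YZ])
    then show ?thesis using N by blast
  qed
  have reg: "regular G v" if v: "v \<in> verts G" for v
    using shift[OF v] has_lag_imp_regular[OF v] by blast
  have unique: "hd c = e" if c: "awalk v c v" "c \<noteq> []" and e: "e \<in> out_arcs G v" for v c e
  proof (rule ccontr)
    assume ne: "hd c \<noteq> e"
    have v: "v \<in> verts G" using c(1) by blast
    let ?P = "exit_walk c e"
    let ?X = "\<lambda>k. walk_monomial (?P k) (?P k) (head G e)"
    have e': "e \<in> arcs G" "tail G e = v" using e by auto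
    have w: "awalk v (?P k) (head G e)" for k
      unfolding exit_walk_def using e' by (intro awalk_appendI[OF awalk_power[OF c(1)]]) (auto simp: awalk_simps)
    have Xc: "?X k \<in> carrier L" for k using w by (rule walk_monomial_closed[OF _ w])
    let ?V = "cl (Vert v)"
    have V: "?V \<in> carrier L" using v by simp
    have VX: "?V \<cdot> ?X k = ?X k" "?X k \<cdot> ?V = ?X k" for k
      using LA.mult_assoc[OF V walk_elem_closed[OF w] ghost_elem_closed[OF w], symmetric]
        LA.mult_assoc[OF walk_elem_closed[OF w] ghost_elem_closed[OF w] V] vert_walk[OF w] ghost_vert[OF w]
      by (simp_all add: walk_monomial_def)
    define u where "u = h ?V"
    have u: "u \<in> carrier MS" using hc V by (simp add: u_def)
    have X0: "h (?X k) \<in> component MS 0" for k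
      using hcomp[of 0] component_monomial[OF w[of k] w[of k], of 0] by auto
    \<comment> \<open>\<open>?V\<close> is a two-sided unit for the idempotents, so their images
      live in rows and columns met by \<open>u\<close>. Degree 0 then fixes the exponent, so
      \<open>S\<close> indexes all their coordinates.\<close>
    define S where "S = (\<lambda>((i, \<alpha>, _, _), (_, _, \<beta>, _)). (i, \<alpha>, \<beta>)) ` (coeff_support u \<times> coeff_support u)"
    have fin: "finite S" using MS_finite[OF u] by (simp add: S_def)
    have SX: "(i, \<alpha>, \<beta>) \<in> S \<and> k' = \<gamma> i \<beta> - \<gamma> i \<alpha>"
      if i: "i \<in> I" and nz: "h (?X k) i \<alpha> \<beta> k' \<noteq> \<zero>\<^bsub>K\<^esub>" for k i \<alpha> \<beta> k'
    proof -
      have uX: "u \<otimes>\<^bsub>MS\<^esub> h (?X k) = h (?X k)" "h (?X k) \<otimes>\<^bsub>MS\<^esub> u = h (?X k)"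
        using hmult[OF V Xc] hmult[OF Xc V] VX by (simp_all add: u_def)
      obtain \<kappa> j where 1: "u i \<alpha> \<kappa> j \<noteq> \<zero>\<^bsub>K\<^esub>"
        using MS_mult_zero[OF u hc[OF Xc] i, of k \<alpha> \<beta> k'] nz uX(1) by auto
      obtain \<kappa>' j' where 2: "u i \<kappa>' \<beta> j' \<noteq> \<zero>\<^bsub>K\<^esub>"
        using MS_mult_zero[OF hc[OF Xc] u i, of k \<alpha> \<beta> k'] nz uX(2) by auto
      have "((i, \<alpha>, \<kappa>, j), (i, \<kappa>', \<beta>, j')) \<in> coeff_support u \<times> coeff_support u"
        using 1 2 i by (simp add: coeff_support_def)
      then have "(i, \<alpha>, \<beta>) \<in> S" unfolding S_def by (rule rev_image_eqI) simp
      moreover have "(i, \<alpha>, \<beta>, k') \<in> coeff_support (h (?X k))" using i nz by (simp add: coeff_support_def)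
      then have "k' = 0 + \<gamma> i \<beta> - \<gamma> i \<alpha>" using X0[of k] unfolding MS_component by blast
      ultimately show ?thesis by simp
    qed
    have SI: "i \<in> I" if "(i, \<alpha>, \<beta>) \<in> S" for i \<alpha> \<beta> using that by (auto simp: S_def coeff_support_def)
    define \<phi> where "\<phi> = (\<lambda>(i, \<alpha>, \<beta>) x. h x i \<alpha> \<beta> (\<gamma> i \<beta> - \<gamma> i \<alpha>))"
    \<comment> \<open>One idempotent more than there are coordinates forces a linear
      relation.\<close>
    let ?m = "Suc (card S)"
    have \<phi>c: "\<phi> s x \<in> carrier K" if "s \<in> S" "x \<in> carrier L" for s x
      using that MS_closed[OF hc] SI by (cases s) (auto simp: \<phi>_def)
    have "\<exists>c. (\<forall>t\<in>{..<?m}. c t \<in> carrier K) \<and> (\<exists>t\<in>{..<?m}. c t \<noteq> \<zero>\<^bsub>K\<^esub>) \<and>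
        (\<forall>s\<in>S. (\<Oplus>\<^bsub>K\<^esub>t\<in>{..<?m}. c t \<otimes>\<^bsub>K\<^esub> \<phi> s (?X t)) = \<zero>\<^bsub>K\<^esub>)"
      by (rule nontrivial_solution[OF fin]) (use \<phi>c Xc in auto)
    then obtain c' where c': "\<forall>t<?m. c' t \<in> carrier K" "\<exists>t<?m. c' t \<noteq> \<zero>\<^bsub>K\<^esub>"
      "\<forall>s\<in>S. (\<Oplus>\<^bsub>K\<^esub>t\<in>{..<?m}. c' t \<otimes>\<^bsub>K\<^esub> \<phi> s (?X t)) = \<zero>\<^bsub>K\<^esub>" by auto
    have lc: "lin_comb c' ?X ?m \<in> carrier L" by (rule lin_comb_closed) (use c' Xc in auto)
    have coeff: "h (lin_comb c' ?X ?m) i \<alpha> \<beta> k = (\<Oplus>\<^bsub>K\<^esub>t\<in>{..<?m}. c' t \<otimes>\<^bsub>K\<^esub> h (?X t) i \<alpha> \<beta> k)"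
      if "i \<in> I" for i \<alpha> \<beta> k
      by (rule lin_comb_functional[of "\<lambda>x. h x i \<alpha> \<beta> k"])
        (use that MS_closed[OF hc] hadd hsmult c' Xc in \<open>auto simp: MS_add MS_smult\<close>)
    have "h (lin_comb c' ?X ?m) i \<alpha> \<beta> k = \<zero>\<^bsub>K\<^esub>" if i: "i \<in> I" for i \<alpha> \<beta> k
    proof (cases "(i, \<alpha>, \<beta>) \<in> S \<and> k = \<gamma> i \<beta> - \<gamma> i \<alpha>")
      case True
      then have "(\<Oplus>\<^bsub>K\<^esub>t\<in>{..<?m}. c' t \<otimes>\<^bsub>K\<^esub> \<phi> (i, \<alpha>, \<beta>) (?X t)) = \<zero>\<^bsub>K\<^esub>"
        using c'(3) by blast
      then show ?thesis using True coeff[OF i] by (simp add: \<phi>_def)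
    next
      case False
      then have "h (?X t) i \<alpha> \<beta> k = \<zero>\<^bsub>K\<^esub>" for t using SX[OF i] by blast
      then show ?thesis unfolding coeff[OF i] using c'(1) by (intro finsum_all_zero) auto
    qed
    \<comment> \<open>The linear combination of length 0 is zero, so its image is an empty
      sum.\<close>
    moreover have "h \<zero>\<^bsub>L\<^esub> i \<alpha> \<beta> k = \<zero>\<^bsub>K\<^esub>" if i: "i \<in> I" for i \<alpha> \<beta> k
      using lin_comb_functional[of "\<lambda>x. h x i \<alpha> \<beta> k" 0] that MS_closed[OF hc] hadd hsmult
      by (auto simp: MS_add MS_smult)
    ultimately have "h (lin_comb c' ?X ?m) = h \<zero>\<^bsub>L\<^esub>"
      using hc lc by (intro MS_eqI) auto
    then have "lin_comb c' ?X ?m = \<zero>\<^bsub>L\<^esub>" using lc by (intro hinj) auto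
    then have "c' t = \<zero>\<^bsub>K\<^esub>" if "t < ?m" for t
      using exit_idempotents_independent[OF c e ne _ _ that, of c'] c'(1) by simp
    then show False using c'(2) by blast
  qed
  have nx: "no_exit_graph G"
    unfolding no_exit_graph_def has_exit_def
  proof (intro allI impI notI, elim bexE)
    fix c v e assume c: "pre_digraph.cycle G c" "v \<in> cycle_verts G c" "e \<in> out_arcs G v" "e \<notin> set c"
    have oc: "on_closed v" by (rule cycle_verts_on_closed[OF c(1,2)])
    then obtain d where d: "awalk v d v" "d \<noteq> []" by (auto simp: on_closed_def)
    obtain e' where e': "e' \<in> set c" "tail G e' = v" using c(2) by (auto simp: cycle_verts_def)
    have "e' \<in> out_arcs G v" using e' c(1) by (auto simp: cycle_def)
    \<comment> \<open>Both edges equal the first edge of \<open>d\<close>.\<close>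
    then have "e' = e" using unique[OF d] c(3) by metis
    then show False using c(4) e'(1) by simp
  qed
  have low: "\<exists>N>0. \<exists>M. \<forall>p w. awalk v p w \<and> length p \<ge> M \<longrightarrow>
      (\<exists>q. awalk v q w \<and> length q + N = length p)" if v: "v \<in> verts G" for v
  proof -
    obtain N M where N: "N > 0" "has_lag v N M" using shift[OF v] by blast
    have "\<exists>q. awalk v q w \<and> length q + N = length p" if "awalk v p w" "length p \<ge> M" for p w
      by (rule has_lag_imp_lowering[OF N(2) that])
    then show ?thesis using N(1) by blast
  qed
  show ?thesis
    using reg nx inf_path_ends_if_lowering[OF _ nx low]
    by unfold_locales (auto simp: regular_def)
qed

end


section \<open>Monomials in direct sums of matrix algebras\<close>

context matrix_sum
begin

fun valid_index :: "'i \<times> 'm \<times> 'm \<times> int \<Rightarrow> bool" where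
  "valid_index (i, \<alpha>, \<beta>, k) \<longleftrightarrow> i \<in> I \<and> \<alpha> \<in> \<mu> i \<and> \<beta> \<in> \<mu> i \<and> int (n i) dvd k"

text \<open>The element \<open>c x ^ k\<close> times the matrix unit at
  \<open>(\<alpha>, \<beta>)\<close> in block \<open>i\<close>, for
  \<open>s = (i, \<alpha>, \<beta>, k)\<close>.\<close>

definition single :: "'i \<times> 'm \<times> 'm \<times> int \<Rightarrow> 'k \<Rightarrow> 'i \<Rightarrow> 'm \<Rightarrow> 'm \<Rightarrow> int \<Rightarrow> 'k" where
  "single s c = (\<lambda>i\<in>I. \<lambda>\<alpha> \<beta> k. if (i, \<alpha>, \<beta>, k) = s then c else \<zero>\<^bsub>K\<^esub>)"

lemma valid_support: "f \<in> carrier MS \<Longrightarrow> s \<in> coeff_support f \<Longrightarrow> valid_index s"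
  by (cases s) (auto simp: MS_carrier coeff_support_def)

lemma single_support: "coeff_support (single s c) \<subseteq> {s}"
  by (auto simp: coeff_support_def single_def split: if_splits)

lemma single_closed:
  assumes "valid_index s" "c \<in> carrier K"
  shows "single s c \<in> carrier MS"
proof -
  have "finite (coeff_support (single s c))" using finite_subset[OF single_support] by blast
  moreover have "\<forall>(i, \<alpha>, \<beta>, k) \<in> coeff_support (single s c). \<alpha> \<in> \<mu> i \<and> \<beta> \<in> \<mu> i \<and> int (n i) dvd k"
    using single_support[of s c] assms(1) by fastforce
  ultimately show ?thesis using assms(2) by (simp add: MS_carrier single_def)
qed

lemma MS_zero_closed: "\<zero>\<^bsub>MS\<^esub> \<in> carrier MS"
proof -
  have "coeff_support \<zero>\<^bsub>MS\<^esub> = {}" by (auto simp: coeff_support_def MS_zero)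
  then show ?thesis by (simp add: MS_carrier) (simp add: MS_zero)
qed

text \<open>One coefficient is split off at a time. The induction runs over a finite set that
  contains the support, because the support itself changes with \<open>f\<close>.\<close>

lemma MS_induct [consumes 1, case_names zero single add]:
  assumes "f \<in> carrier MS" and zero: "P \<zero>\<^bsub>MS\<^esub>"
    and single: "\<And>s c. valid_index s \<Longrightarrow> c \<in> carrier K \<Longrightarrow> P (single s c)"
    and add: "\<And>f g. f \<in> carrier MS \<Longrightarrow> g \<in> carrier MS \<Longrightarrow> P f \<Longrightarrow> P g \<Longrightarrow> P (f \<oplus>\<^bsub>MS\<^esub> g)"
  shows "P f"
proof -
  have "P f" if "finite A" "coeff_support f \<subseteq> A" "f \<in> carrier MS" for A f
    using that
  proof (induction A arbitrary: f rule: finite_induct)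
    case empty
    then have "f = \<zero>\<^bsub>MS\<^esub>"
      by (intro MS_eqI MS_zero_closed) (auto simp: MS_zero coeff_support_def)
    then show ?case using zero by simp
  next
    case (insert s A)
    show ?case
    proof (cases "s \<in> coeff_support f")
      case False
      then show ?thesis using insert by blast
    next
      case True
      obtain i \<alpha> \<beta> k where s: "s = (i, \<alpha>, \<beta>, k)" by (cases s)
      have v: "valid_index s" by (rule valid_support[OF insert.prems(2) True])
      define g where "g = (\<lambda>i\<in>I. \<lambda>\<alpha> \<beta> k. if (i, \<alpha>, \<beta>, k) = s then \<zero>\<^bsub>K\<^esub> else f i \<alpha> \<beta> k)"
      have gs: "coeff_support g = coeff_support f - {s}"
        by (auto simp: coeff_support_def g_def split: if_splits)
      have g: "g \<in> carrier MS"
        unfolding MS_carrier gs using insert.prems(2) by (auto simp: MS_carrier g_def)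
      have c: "f i \<alpha> \<beta> k \<in> carrier K" using MS_closed[OF insert.prems(2)] v by (simp add: s)
      have sc: "single s (f i \<alpha> \<beta> k) \<in> carrier MS" by (rule single_closed[OF v c])
      have "f = single s (f i \<alpha> \<beta> k) \<oplus>\<^bsub>MS\<^esub> g"
      proof (rule MS_eqI[OF insert.prems(2) MS_add_closed[OF sc g]])
        fix i' \<alpha>' \<beta>' k' assume "i' \<in> I"
        then show "f i' \<alpha>' \<beta>' k' = (single s (f i \<alpha> \<beta> k) \<oplus>\<^bsub>MS\<^esub> g) i' \<alpha>' \<beta>' k'"
          using MS_closed[OF insert.prems(2)] by (auto simp: MS_add single_def g_def s)
      qed
      moreover have "P g" using insert.IH[OF _ g] gs insert.prems(1) by blast
      ultimately show ?thesis using add[OF sc g single[OF v c]] by simp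
    qed
  qed
  then show ?thesis using assms(1) MS_finite by blast
qed

lemma MS_mult_closed:
  assumes f: "f \<in> carrier MS" and g: "g \<in> carrier MS"
  shows "f \<otimes>\<^bsub>MS\<^esub> g \<in> carrier MS"
proof -
  let ?c = "\<lambda>((i, \<alpha>, _, j), (_, _, \<beta>, l)). (i, \<alpha>, \<beta>, j + l)"
  have ex: "\<exists>\<kappa> j. (i, \<alpha>, \<kappa>, j) \<in> coeff_support f \<and> (i, \<kappa>, \<beta>, k - j) \<in> coeff_support g"
    if "(i, \<alpha>, \<beta>, k) \<in> coeff_support (f \<otimes>\<^bsub>MS\<^esub> g)" for i \<alpha> \<beta> k
    using that MS_mult_zero[OF f g, of i \<alpha> \<beta> k] by (auto simp: coeff_support_def)
  have "coeff_support (f \<otimes>\<^bsub>MS\<^esub> g) \<subseteq> ?c ` (coeff_support f \<times> coeff_support g)"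
  proof
    fix x assume x: "x \<in> coeff_support (f \<otimes>\<^bsub>MS\<^esub> g)"
    obtain i \<alpha> \<beta> k where xe: "x = (i, \<alpha>, \<beta>, k)" by (cases x)
    then obtain \<kappa> j where "(i, \<alpha>, \<kappa>, j) \<in> coeff_support f" "(i, \<kappa>, \<beta>, k - j) \<in> coeff_support g"
      using ex x by blast
    then have "((i, \<alpha>, \<kappa>, j), (i, \<kappa>, \<beta>, k - j)) \<in> coeff_support f \<times> coeff_support g" by blast
    then show "x \<in> ?c ` (coeff_support f \<times> coeff_support g)" by (rule rev_image_eqI) (simp add: xe)
  qed
  then have fin: "finite (coeff_support (f \<otimes>\<^bsub>MS\<^esub> g))"
    by (rule finite_subset) (use MS_finite[OF f] MS_finite[OF g] in simp)
  have val: "valid_index x" if x: "x \<in> coeff_support (f \<otimes>\<^bsub>MS\<^esub> g)" for x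
  proof -
    obtain i \<alpha> \<beta> k where xe: "x = (i, \<alpha>, \<beta>, k)" by (cases x)
    then obtain \<kappa> j where "(i, \<alpha>, \<kappa>, j) \<in> coeff_support f" "(i, \<kappa>, \<beta>, k - j) \<in> coeff_support g"
      using ex x by blast
    then have v: "valid_index (i, \<alpha>, \<kappa>, j)" "valid_index (i, \<kappa>, \<beta>, k - j)"
      using valid_support[OF f] valid_support[OF g] by blast+
    then have "int (n i) dvd j + (k - j)" by (intro dvd_add) auto
    then show ?thesis using v xe by simp
  qed
  have "(f \<otimes>\<^bsub>MS\<^esub> g) i \<alpha> \<beta> k \<in> carrier K" if i: "i \<in> I" for i \<alpha> \<beta> k
  proof -
    let ?S = "(\<lambda>(i, \<alpha>, \<beta>, k). \<beta>) ` {x \<in> coeff_support f. fst x = i}"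
    let ?Z = "(\<lambda>(i, \<alpha>, \<beta>, k). k) ` coeff_support f"
    have "(f \<otimes>\<^bsub>MS\<^esub> g) i \<alpha> \<beta> k = (\<Oplus>\<^bsub>K\<^esub>\<kappa>\<in>?S. \<Oplus>\<^bsub>K\<^esub>j\<in>?Z. f i \<alpha> \<kappa> j \<otimes>\<^bsub>K\<^esub> g i \<kappa> \<beta> (k - j))"
    proof (rule MS_mult[OF f g i])
      show "finite ?S" "finite ?Z" using MS_finite[OF f] by auto
      show "?S \<subseteq> \<mu> i" using MS_support[OF f i] by (auto simp: coeff_support_def)
      show "\<kappa> \<in> ?S \<and> j \<in> ?Z" if "f i \<alpha> \<kappa> j \<noteq> \<zero>\<^bsub>K\<^esub>" for \<kappa> j
        using that i by (force simp: coeff_support_def image_iff)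
    qed
    then show ?thesis using MS_closed[OF f i] MS_closed[OF g i] by (auto intro!: finsum_closed)
  qed
  moreover have "\<forall>(i, \<alpha>, \<beta>, k) \<in> coeff_support (f \<otimes>\<^bsub>MS\<^esub> g). \<alpha> \<in> \<mu> i \<and> \<beta> \<in> \<mu> i \<and> int (n i) dvd k"
    using val by force
  ultimately show ?thesis unfolding MS_carrier[of "f \<otimes>\<^bsub>MS\<^esub> g"] using fin MS_mult_ext by blast
qed

text \<open>All products are expanded over index sets taken from the union of the three supports,
  where distributivity holds summand by summand.\<close>

lemma MS_mult_add:
  assumes f: "f \<in> carrier MS" and g: "g \<in> carrier MS" and h: "h \<in> carrier MS"
  shows "f \<otimes>\<^bsub>MS\<^esub> (g \<oplus>\<^bsub>MS\<^esub> h) = f \<otimes>\<^bsub>MS\<^esub> g \<oplus>\<^bsub>MS\<^esub> f \<otimes>\<^bsub>MS\<^esub> h"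
    "(g \<oplus>\<^bsub>MS\<^esub> h) \<otimes>\<^bsub>MS\<^esub> f = g \<otimes>\<^bsub>MS\<^esub> f \<oplus>\<^bsub>MS\<^esub> h \<otimes>\<^bsub>MS\<^esub> f"
proof -
  have gh: "g \<oplus>\<^bsub>MS\<^esub> h \<in> carrier MS" by (rule MS_add_closed[OF g h])
  let ?A = "coeff_support f \<union> coeff_support g \<union> coeff_support h"
  have fin: "finite ?A" using MS_finite f g h by blast
  define S where "S i = (\<lambda>(i, \<alpha>, \<beta>, k). \<beta>) ` {x \<in> ?A. fst x = i}" for i
  define Z where "Z = (\<lambda>(i, \<alpha>, \<beta>, k). k) ` ?A"
  have fS: "finite (S i)" and fZ: "finite Z" for i using fin by (auto simp: S_def Z_def)
  have S: "S i \<subseteq> \<mu> i" for i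
    unfolding S_def using valid_support[OF f] valid_support[OF g] valid_support[OF h] by fastforce
  have mem: "\<kappa> \<in> S i \<and> j \<in> Z" if "(i, \<alpha>, \<kappa>, j) \<in> ?A" for i \<alpha> \<kappa> j
    using that by (force simp: image_iff S_def Z_def)
  have m: "(x \<otimes>\<^bsub>MS\<^esub> y) i \<alpha> \<beta> k = (\<Oplus>\<^bsub>K\<^esub>\<kappa>\<in>S i. \<Oplus>\<^bsub>K\<^esub>j\<in>Z. x i \<alpha> \<kappa> j \<otimes>\<^bsub>K\<^esub> y i \<kappa> \<beta> (k - j))"
    if "x \<in> carrier MS" "y \<in> carrier MS" "coeff_support x \<subseteq> ?A" "i \<in> I" for x y i \<alpha> \<beta> k
  proof (rule MS_mult[OF that(1,2,4) fS S fZ])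
    fix \<kappa> j assume "x i \<alpha> \<kappa> j \<noteq> \<zero>\<^bsub>K\<^esub>"
    then have "(i, \<alpha>, \<kappa>, j) \<in> ?A" using that(3,4) by (auto simp: coeff_support_def)
    then show "\<kappa> \<in> S i \<and> j \<in> Z" by (rule mem)
  qed
  have sgh: "coeff_support (g \<oplus>\<^bsub>MS\<^esub> h) \<subseteq> ?A"
    by (auto simp: coeff_support_def MS_add)
  have sf: "coeff_support f \<subseteq> ?A" and sg: "coeff_support g \<subseteq> ?A" and sh: "coeff_support h \<subseteq> ?A"
    by auto
  note c = MS_closed[OF f] MS_closed[OF g] MS_closed[OF h]
  have dist: "(\<Oplus>\<^bsub>K\<^esub>\<kappa>\<in>S i. \<Oplus>\<^bsub>K\<^esub>j\<in>Z. a \<kappa> j \<oplus>\<^bsub>K\<^esub> b \<kappa> j) =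
      (\<Oplus>\<^bsub>K\<^esub>\<kappa>\<in>S i. \<Oplus>\<^bsub>K\<^esub>j\<in>Z. a \<kappa> j) \<oplus>\<^bsub>K\<^esub> (\<Oplus>\<^bsub>K\<^esub>\<kappa>\<in>S i. \<Oplus>\<^bsub>K\<^esub>j\<in>Z. b \<kappa> j)"
    if "\<And>\<kappa> j. a \<kappa> j \<in> carrier K" "\<And>\<kappa> j. b \<kappa> j \<in> carrier K" for i and a b :: "'m \<Rightarrow> int \<Rightarrow> 'k"
    using that by (simp add: finsum_addf Pi_iff finsum_closed)
  show "f \<otimes>\<^bsub>MS\<^esub> (g \<oplus>\<^bsub>MS\<^esub> h) = f \<otimes>\<^bsub>MS\<^esub> g \<oplus>\<^bsub>MS\<^esub> f \<otimes>\<^bsub>MS\<^esub> h"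
  proof (rule MS_eqI)
    fix i \<alpha> \<beta> k assume i: "i \<in> I"
    have "(f \<otimes>\<^bsub>MS\<^esub> (g \<oplus>\<^bsub>MS\<^esub> h)) i \<alpha> \<beta> k = (\<Oplus>\<^bsub>K\<^esub>\<kappa>\<in>S i. \<Oplus>\<^bsub>K\<^esub>j\<in>Z.
        f i \<alpha> \<kappa> j \<otimes>\<^bsub>K\<^esub> g i \<kappa> \<beta> (k - j) \<oplus>\<^bsub>K\<^esub> f i \<alpha> \<kappa> j \<otimes>\<^bsub>K\<^esub> h i \<kappa> \<beta> (k - j))"
      unfolding m[OF f gh sf i] using i c by (simp add: MS_add r_distr)
    also have "\<dots> = (f \<otimes>\<^bsub>MS\<^esub> g \<oplus>\<^bsub>MS\<^esub> f \<otimes>\<^bsub>MS\<^esub> h) i \<alpha> \<beta> k"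
      unfolding MS_add[of "f \<otimes>\<^bsub>MS\<^esub> g"] using m[OF f g sf i] m[OF f h sf i] i c by (subst dist) simp_all
    finally show "(f \<otimes>\<^bsub>MS\<^esub> (g \<oplus>\<^bsub>MS\<^esub> h)) i \<alpha> \<beta> k = (f \<otimes>\<^bsub>MS\<^esub> g \<oplus>\<^bsub>MS\<^esub> f \<otimes>\<^bsub>MS\<^esub> h) i \<alpha> \<beta> k" .
  qed (use f g h gh in \<open>auto intro!: MS_mult_closed MS_add_closed\<close>)
  show "(g \<oplus>\<^bsub>MS\<^esub> h) \<otimes>\<^bsub>MS\<^esub> f = g \<otimes>\<^bsub>MS\<^esub> f \<oplus>\<^bsub>MS\<^esub> h \<otimes>\<^bsub>MS\<^esub> f"
  proof (rule MS_eqI)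
    fix i \<alpha> \<beta> k assume i: "i \<in> I"
    have "((g \<oplus>\<^bsub>MS\<^esub> h) \<otimes>\<^bsub>MS\<^esub> f) i \<alpha> \<beta> k = (\<Oplus>\<^bsub>K\<^esub>\<kappa>\<in>S i. \<Oplus>\<^bsub>K\<^esub>j\<in>Z.
        g i \<alpha> \<kappa> j \<otimes>\<^bsub>K\<^esub> f i \<kappa> \<beta> (k - j) \<oplus>\<^bsub>K\<^esub> h i \<alpha> \<kappa> j \<otimes>\<^bsub>K\<^esub> f i \<kappa> \<beta> (k - j))"
      unfolding m[OF gh f sgh i] using i c by (simp add: MS_add l_distr)
    also have "\<dots> = (g \<otimes>\<^bsub>MS\<^esub> f \<oplus>\<^bsub>MS\<^esub> h \<otimes>\<^bsub>MS\<^esub> f) i \<alpha> \<beta> k"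
      unfolding MS_add[of "g \<otimes>\<^bsub>MS\<^esub> f"] using m[OF g f sg i] m[OF h f sh i] i c by (subst dist) simp_all
    finally show "((g \<oplus>\<^bsub>MS\<^esub> h) \<otimes>\<^bsub>MS\<^esub> f) i \<alpha> \<beta> k = (g \<otimes>\<^bsub>MS\<^esub> f \<oplus>\<^bsub>MS\<^esub> h \<otimes>\<^bsub>MS\<^esub> f) i \<alpha> \<beta> k" .
  qed (use f g h gh in \<open>auto intro!: MS_mult_closed MS_add_closed\<close>)
qed

lemma MS_mult_zeros:
  assumes f: "f \<in> carrier MS"
  shows "f \<otimes>\<^bsub>MS\<^esub> \<zero>\<^bsub>MS\<^esub> = \<zero>\<^bsub>MS\<^esub>" "\<zero>\<^bsub>MS\<^esub> \<otimes>\<^bsub>MS\<^esub> f = \<zero>\<^bsub>MS\<^esub>"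
proof -
  have "(f \<otimes>\<^bsub>MS\<^esub> \<zero>\<^bsub>MS\<^esub>) i \<alpha> \<beta> k = \<zero>\<^bsub>K\<^esub>" "(\<zero>\<^bsub>MS\<^esub> \<otimes>\<^bsub>MS\<^esub> f) i \<alpha> \<beta> k = \<zero>\<^bsub>K\<^esub>" if i: "i \<in> I" for i \<alpha> \<beta> k
    using MS_mult_zero[OF f MS_zero_closed i, of \<alpha> \<beta> k] MS_mult_zero[OF MS_zero_closed f i, of \<alpha> \<beta> k] i
    by (auto simp: MS_zero)
  then show "f \<otimes>\<^bsub>MS\<^esub> \<zero>\<^bsub>MS\<^esub> = \<zero>\<^bsub>MS\<^esub>" "\<zero>\<^bsub>MS\<^esub> \<otimes>\<^bsub>MS\<^esub> f = \<zero>\<^bsub>MS\<^esub>"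
    using f MS_zero_closed by (auto intro!: MS_eqI MS_mult_closed simp: MS_zero)
qed

lemma single_mult:
  assumes s: "valid_index (i, \<alpha>, \<beta>, k)" and t: "valid_index (i', \<alpha>', \<beta>', k')"
    and c: "c \<in> carrier K" and d: "d \<in> carrier K"
  shows "single (i, \<alpha>, \<beta>, k) c \<otimes>\<^bsub>MS\<^esub> single (i', \<alpha>', \<beta>', k') d =
    (if i = i' \<and> \<beta> = \<alpha>' then single (i, \<alpha>, \<beta>', k + k') (c \<otimes>\<^bsub>K\<^esub> d) else \<zero>\<^bsub>MS\<^esub>)" (is "?L = ?R")
proof (rule MS_eqI)
  note sc = single_closed[OF s c] and td = single_closed[OF t d]
  show "?L \<in> carrier MS" by (rule MS_mult_closed[OF sc td])
  have "valid_index (i, \<alpha>, \<beta>', k + k')" if "i = i'" using s t that by simp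
  then show "?R \<in> carrier MS" using MS_zero_closed c d by (auto intro!: single_closed)
  fix i0 \<alpha>0 \<beta>0 k0 assume i0: "i0 \<in> I"
  show "?L i0 \<alpha>0 \<beta>0 k0 = ?R i0 \<alpha>0 \<beta>0 k0"
  proof (cases "i0 = i")
    case True
    have "?L i0 \<alpha>0 \<beta>0 k0 = (\<Oplus>\<^bsub>K\<^esub>\<kappa>\<in>{\<beta>}. \<Oplus>\<^bsub>K\<^esub>j\<in>{k}. single (i, \<alpha>, \<beta>, k) c i0 \<alpha>0 \<kappa> j \<otimes>\<^bsub>K\<^esub>
        single (i', \<alpha>', \<beta>', k') d i0 \<kappa> \<beta>0 (k0 - j))"
      by (rule MS_mult[OF sc td i0]) (use s i0 True in \<open>auto simp: single_def split: if_splits\<close>)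
    also have "\<dots> = single (i, \<alpha>, \<beta>, k) c i0 \<alpha>0 \<beta> k \<otimes>\<^bsub>K\<^esub> single (i', \<alpha>', \<beta>', k') d i0 \<beta> \<beta>0 (k0 - k)"
      using MS_closed[OF sc i0] MS_closed[OF td i0] by (simp add: finsum_insert)
    also have "\<dots> = ?R i0 \<alpha>0 \<beta>0 k0"
      using i0 True c d by (auto simp: single_def MS_zero)
    finally show ?thesis .
  next
    case False
    have "?L i0 \<alpha>0 \<beta>0 k0 = (\<Oplus>\<^bsub>K\<^esub>\<kappa>\<in>{}. \<Oplus>\<^bsub>K\<^esub>j\<in>{}. single (i, \<alpha>, \<beta>, k) c i0 \<alpha>0 \<kappa> j \<otimes>\<^bsub>K\<^esub>
        single (i', \<alpha>', \<beta>', k') d i0 \<kappa> \<beta>0 (k0 - j))"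
      by (rule MS_mult[OF sc td i0]) (use i0 False in \<open>auto simp: single_def split: if_splits\<close>)
    then show ?thesis using i0 False by (auto simp: single_def MS_zero)
  qed
qed

end


section \<open>Structure of the Leavitt path algebra\<close>

locale tame_leavitt = leavitt_path G K + tame_graph G
  for G :: "('v, 'e) pre_digraph" and K :: "'k ring"
begin

text \<open>A vertex on a cycle emits a single edge \<open>e\<close>, so (CK2) reduces to
  \<open>e e* = x\<close> there, and this telescopes along \<open>r\<close>.\<close>

lemma walk_unit:
  "awalk x r w \<Longrightarrow> on_closed x \<Longrightarrow> walk_elem r w \<cdot> ghost_elem r w = cl (Vert x)"
proof (induction r arbitrary: x)
  case Nil
  then show ?case by (auto simp: awalk_Nil_iff vert_vert)
next
  case (Cons e r)
  then have e: "e \<in> out_arcs G x" "e \<in> arcs G" "awalk (head G e) r w" by (auto simp: awalk_Cons_iff)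
  obtain e' where "out_arcs G x = {e'}" "on_closed (head G e')"
    using on_closed_out_arcs[OF no_exit Cons.prems(2)] .
  then have e': "out_arcs G x = {e}" "on_closed (head G e)" using e(1) by auto
  have x: "regular G x" using regular on_closed_in_verts[OF Cons.prems(2)] by blast
  note c = walk_elem_closed[OF e(3)] ghost_elem_closed[OF e(3)] generator_closed(2,3)[OF e(2)]
  have "walk_elem (e # r) w \<cdot> ghost_elem (e # r) w =
      cl (Edge e) \<cdot> ((walk_elem r w \<cdot> ghost_elem r w) \<cdot> cl (Ghost e))"
    using c by (simp add: LA.mult_assoc del: cl_carrier)
  also have "\<dots> = cl (Edge e) \<cdot> cl (Ghost e)"
    using Cons.IH[OF e(3) e'(2)] edge_units[OF e(2)] by simp
  also have "\<dots> = cl (Vert x)"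
    using vert_CK2[OF x] c by (simp add: e'(1) LA.A.finsum_insert del: cl_carrier)
  finally show ?case .
qed

text \<open>By \<open>r r* = x\<close> the common end \<open>r\<close> disappears. For powers of a
  cycle this means that only the difference of the two exponents counts.\<close>

lemma walk_monomial_append_closed:
  assumes p: "awalk u p x" and q: "awalk u' q x" and r: "awalk x r w" and x: "on_closed x"
  shows "walk_monomial (p @ r) (q @ r) w = walk_monomial p q x"
proof -
  note c = walk_elem_closed[OF p] ghost_elem_closed[OF q] walk_elem_closed[OF r] ghost_elem_closed[OF r]
  have "walk_monomial (p @ r) (q @ r) w =
      walk_elem p x \<cdot> ((walk_elem r w \<cdot> ghost_elem r w) \<cdot> ghost_elem q x)"
    unfolding walk_monomial_def walk_elem_append[OF p r] ghost_elem_append[OF q r]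
    using c by (simp add: LA.mult_assoc)
  then show ?thesis using walk_unit[OF r x] vert_ghost[OF q] by (simp add: walk_monomial_def)
qed

section \<open>Walks into a base vertex and powers of its cycle\<close>

definition base_power :: "'v \<Rightarrow> nat \<Rightarrow> 'e list" where
  "base_power b k = concat (replicate k (base_cycle b))"

lemma base_power_walk: "b \<in> Bases \<Longrightarrow> awalk b (base_power b k) b"
  unfolding base_power_def by (rule awalk_power[OF base_cycle_walk])

lemma base_power_length [simp]: "length (base_power b k) = k * period b"
  by (induction k) (auto simp: base_power_def period_def)

lemma base_power_add: "base_power b (j + k) = base_power b j @ base_power b k"
  by (simp add: base_power_def replicate_add)

lemma base_power_0 [simp]: "base_power b 0 = []"
  by (simp add: base_power_def)

text \<open>The counterpart of \<open>base_walks\<close> with the end fixed and the start free;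
  these walks index the rows of the block of \<open>b\<close>.\<close>

definition enters :: "'v \<Rightarrow> 'e list set" where
  "enters b = {p. \<exists>u. awalk u p b \<and> (\<forall>e \<in> set p. tail G e \<notin> Bases)}"

definition source :: "'v \<Rightarrow> 'e list \<Rightarrow> 'v" where
  "source b p = (if p = [] then b else tail G (hd p))"

lemma enters_walk: "p \<in> enters b \<Longrightarrow> awalk (source b p) p b"
  by (cases p) (auto simp: enters_def source_def awalk_Cons_iff awalk_Nil_iff)

lemma enters_power_walk:
  "b \<in> Bases \<Longrightarrow> p \<in> enters b \<Longrightarrow> awalk (source b p) (p @ base_power b k) b"
  by (rule awalk_appendI[OF enters_walk base_power_walk])

text \<open>Cutting at the first edge that leaves a base vertex recovers \<open>p\<close>, and this
  edge identifies \<open>b\<close>. At least one turn is needed for such an edge to be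
  present.\<close>

lemma enters_takeWhile:
  assumes "b \<in> Bases" "p \<in> enters b" "k > 0"
  shows "takeWhile (\<lambda>e. tail G e \<notin> Bases) (p @ base_power b k @ r) = p"
    "(p @ base_power b k @ r) ! length p = base_edge b" "length p < length (p @ base_power b k @ r)"
proof -
  obtain j where "k = Suc j" using assms(3) by (cases k) auto
  then have k: "base_power b k = base_edge b # base_return b @ base_power b j"
    by (simp add: base_power_def base_cycle_def)
  have "\<forall>e \<in> set p. tail G e \<notin> Bases" using assms(2) by (auto simp: enters_def)
  then show "takeWhile (\<lambda>e. tail G e \<notin> Bases) (p @ base_power b k @ r) = p"
    using base_edge_in[OF assms(1)] assms(1) by (simp add: k takeWhile_append2)
  show "(p @ base_power b k @ r) ! length p = base_edge b" by (simp add: k)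
  show "length p < length (p @ base_power b k @ r)" by (simp add: k)
qed

lemma enters_prefix:
  assumes b: "b \<in> Bases" "p \<in> enters b" "k > 0" and b': "b' \<in> Bases" "p' \<in> enters b'" "k' > 0"
    and eq: "p @ base_power b k @ r = p' @ base_power b' k'"
  shows "p = p' \<and> b = b'"
proof -
  have "p = p'"
    using enters_takeWhile(1)[OF b, of r] enters_takeWhile(1)[OF b', of "[]"] eq by simp
  moreover have "base_edge b = base_edge b'"
    using enters_takeWhile(2)[OF b, of r] enters_takeWhile(2)[OF b', of "[]"] eq calculation by simp
  ultimately show ?thesis using base_edge_in[OF b(1)] base_edge_in[OF b'(1)] by metis
qed

text \<open>An edge put in front of a decomposed walk either prolongs the entering part or, if it
  leaves a base vertex, completes one more turn of the cycle of \<open>b\<close>.\<close>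

lemma walk_decompose:
  assumes b: "b \<in> Bases" and p: "awalk u p b"
  obtains q k where "q \<in> enters b" "p = q @ base_power b k"
proof -
  have "\<exists>q k. q \<in> enters b \<and> p = q @ base_power b k"
    using p
  proof (induction p arbitrary: u)
    case Nil
    have "[] \<in> enters b" using Bases_in_verts[OF b] by (auto simp: enters_def awalk_Nil_iff)
    then show ?case by (intro exI[of _ "[]"] exI[of _ 0]) simp
  next
    case (Cons e p)
    have e: "e \<in> arcs G" "awalk (head G e) p b" using Cons.prems by (auto simp: awalk_Cons_iff)
    obtain q k where q: "q \<in> enters b" "p = q @ base_power b k" using Cons.IH[OF e(2)] by blast
    have qw: "awalk (head G e) q b"
    proof (cases q)
      case Nil
      have "awalk (head G e) (base_power b k) b" using e(2) q(2) Nil by simp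
      then have "head G e = b" using base_power_walk[OF b, of k] e(1) b awalk_ends by (metis awalk_Nil_iff)
      then show ?thesis using Nil Bases_in_verts[OF b] by (simp add: awalk_Nil_iff)
    next
      case (Cons f q')
      then have "source b q = head G e" using e(2) q(2) by (auto simp: awalk_Cons_iff source_def)
      then show ?thesis using enters_walk[OF q(1)] by simp
    qed
    show ?case
    proof (cases "tail G e \<in> Bases")
      case False
      have "awalk (tail G e) (e # q) b" using qw e(1) by (simp add: awalk_Cons_iff)
      then have "e # q \<in> enters b" using q(1) False by (auto simp: enters_def)
      then show ?thesis using q(2) by (intro exI[of _ "e # q"] exI[of _ k]) simp
    next
      \<comment> \<open>At a base vertex the edge is forced and \<open>q\<close> has to be the
        return walk, so \<open>e # q\<close> is a full turn and its start is
        \<open>b\<close>.\<close>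
      case True
      have "e \<in> out_arcs G (tail G e)" using e(1) by simp
      then have "e \<in> {base_edge (tail G e)}" unfolding base_out_arcs[OF True] .
      then have be: "base_edge (tail G e) = e" by (rule singletonD[THEN HOL.sym])
      have bw: "base_walks (head G e) = {(base_return (tail G e), tail G e)}"
        using base_return[OF True] be by simp
      have "(q, b) \<in> base_walks (head G e)"
        using qw q(1) b by (auto simp: base_walks_def enters_def)
      then have qb: "q = base_return (tail G e)" "tail G e = b" using bw by auto
      have "base_power b (Suc k) = base_edge b # base_return b @ base_power b k"
        by (simp add: base_power_def base_cycle_def)
      also have "base_edge b = e" using be qb(2) by simp
      also have "base_return b = q" using qb by simp
      finally have "e # p = [] @ base_power b (Suc k)" using q(2) by simp
      moreover have "[] \<in> enters b" using Bases_in_verts[OF b] by (auto simp: enters_def awalk_Nil_iff)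
      ultimately show ?thesis by blast
    qed
  qed
  then show ?thesis using that by blast
qed

text \<open>\<open>unit_monomial b p k q\<close> is \<open>p c ^ j q*\<close> where \<open>c\<close> is the cycle at \<open>b\<close> and \<open>k = j * period b\<close>.\<close>

definition unit_monomial :: "'v \<Rightarrow> 'e list \<Rightarrow> int \<Rightarrow> 'e list \<Rightarrow> ('k, 'v, 'e) lterm set" where
  "unit_monomial b p k q = walk_monomial (p @ base_power b (nat (k div int (period b))))
     (q @ base_power b (nat (- (k div int (period b))))) b"

text \<open>Since \<open>c ^ m (c ^ m)* = b\<close>, a common power on both sides cancels and only
  the difference of the exponents remains.\<close>

lemma unit_monomial_eq:
  assumes b: "b \<in> Bases" and p: "p \<in> enters b" and q: "q \<in> enters b"
    and k: "k = (int x - int y) * int (period b)"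
  shows "walk_monomial (p @ base_power b x) (q @ base_power b y) b = unit_monomial b p k q"
proof -
  have kd: "k div int (period b) = int x - int y" using k period_pos[of b] by simp
  let ?m = "min x y"
  have x: "x = (x - ?m) + ?m" "y = (y - ?m) + ?m" by auto
  have n: "nat (int x - int y) = x - ?m" "nat (- (int x - int y)) = y - ?m" by auto
  have "walk_monomial (p @ base_power b x) (q @ base_power b y) b =
      walk_monomial ((p @ base_power b (x - ?m)) @ base_power b ?m) ((q @ base_power b (y - ?m)) @ base_power b ?m) b"
    using base_power_add[of b "x - ?m" ?m] base_power_add[of b "y - ?m" ?m] x by simp
  also have "\<dots> = walk_monomial (p @ base_power b (x - ?m)) (q @ base_power b (y - ?m)) b"
    by (rule walk_monomial_append_closed[OF enters_power_walk[OF b p] enters_power_walk[OF b q]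
        base_power_walk[OF b] Bases_on_closed[OF b]])
  finally show ?thesis unfolding unit_monomial_def kd n .
qed

text \<open>Both powers of the cycle are inflated until the second is the prescribed
  \<open>Suc N\<close> and the first is positive, which the bound on \<open>\<bar>k\<bar>\<close>
  guarantees. Positive powers are what the comparison of walks by their first base vertex
  requires.\<close>

lemma unit_monomial_split:
  assumes b: "b \<in> Bases" and p: "p \<in> enters b" and q: "q \<in> enters b" and k: "int (period b) dvd k"
    and N: "int N \<ge> \<bar>k\<bar>"
  obtains x where "x > 0" "k = (int x - int (Suc N)) * int (period b)"
    "unit_monomial b p k q = walk_monomial (p @ base_power b x) (q @ base_power b (Suc N)) b"
proof -
  obtain j where j: "k = int (period b) * j" using k by (rule dvdE)
  have "\<bar>j\<bar> \<le> \<bar>k\<bar>" using period_pos[of b] by (simp add: j abs_mult mult_le_cancel_right1)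
  then have "j + int (Suc N) > 0" using N by linarith
  then have x: "nat (j + int (Suc N)) > 0" "k = (int (nat (j + int (Suc N))) - int (Suc N)) * int (period b)"
    using j by (auto simp: mult.commute)
  show ?thesis by (rule that[OF x unit_monomial_eq[OF b p q x(2), symmetric]])
qed

text \<open>The mirror image, for the right factor of a product: here the first power is
  prescribed.\<close>

lemma unit_monomial_split':
  assumes b: "b \<in> Bases" and p: "p \<in> enters b" and q: "q \<in> enters b" and k: "int (period b) dvd k"
    and N: "int N \<ge> \<bar>k\<bar>"
  obtains y where "y > 0" "k = (int (Suc N) - int y) * int (period b)"
    "unit_monomial b p k q = walk_monomial (p @ base_power b (Suc N)) (q @ base_power b y) b"
proof -
  obtain j where j: "k = int (period b) * j" using k by (rule dvdE)
  have "\<bar>j\<bar> \<le> \<bar>k\<bar>" using period_pos[of b] by (simp add: j abs_mult mult_le_cancel_right1)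
  then have "int (Suc N) - j > 0" using N by linarith
  then have y: "nat (int (Suc N) - j) > 0" "k = (int (Suc N) - int (nat (int (Suc N) - j))) * int (period b)"
    using j by (auto simp: mult.commute)
  show ?thesis by (rule that[OF y unit_monomial_eq[OF b p q y(2), symmetric]])
qed

lemma unit_monomial_closed:
  assumes "b \<in> Bases" "p \<in> enters b" "q \<in> enters b"
  shows "unit_monomial b p k q \<in> carrier L"
  unfolding unit_monomial_def
  by (rule walk_monomial_closed[OF enters_power_walk[OF assms(1,2)] enters_power_walk[OF assms(1,3)]])

lemma unit_monomial_component:
  assumes b: "b \<in> Bases" and p: "p \<in> enters b" and q: "q \<in> enters b" and k: "int (period b) dvd k"
  shows "unit_monomial b p k q \<in> component L (int (length p) + k - int (length q))"
proof -
  have N: "int (nat \<bar>k\<bar>) \<ge> \<bar>k\<bar>" by simp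
  obtain x where x: "k = (int x - int (Suc (nat \<bar>k\<bar>))) * int (period b)"
    "unit_monomial b p k q = walk_monomial (p @ base_power b x) (q @ base_power b (Suc (nat \<bar>k\<bar>))) b"
    using unit_monomial_split[OF b p q k N] by metis
  show ?thesis unfolding x(2)
    by (rule component_monomial[OF enters_power_walk[OF b p] enters_power_walk[OF b q]])
      (subst x(1), simp add: algebra_simps)
qed

text \<open>The factors are rewritten with the same power \<open>Suc N\<close> on the two middle
  walks. These either coincide or are incomparable as prefixes, so the product is a monomial or
  zero.\<close>

lemma unit_monomial_mult:
  assumes b: "b \<in> Bases" and p: "p \<in> enters b" and q: "q \<in> enters b" and k: "int (period b) dvd k"
    and b': "b' \<in> Bases" and p': "p' \<in> enters b'" and q': "q' \<in> enters b'" and k': "int (period b') dvd k'"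
  shows "unit_monomial b p k q \<cdot> unit_monomial b' p' k' q' =
    (if b = b' \<and> q = p' then unit_monomial b p (k + k') q' else \<zero>\<^bsub>L\<^esub>)"
proof -
  define N where "N = nat (max \<bar>k\<bar> \<bar>k'\<bar>)"
  have N: "int N \<ge> \<bar>k\<bar>" "int N \<ge> \<bar>k'\<bar>" by (auto simp: N_def)
  obtain x where x: "x > 0" "k = (int x - int (Suc N)) * int (period b)"
    "unit_monomial b p k q = walk_monomial (p @ base_power b x) (q @ base_power b (Suc N)) b"
    by (rule unit_monomial_split[OF b p q k N(1)])
  obtain y where y: "y > 0" "k' = (int (Suc N) - int y) * int (period b')"
    "unit_monomial b' p' k' q' = walk_monomial (p' @ base_power b' (Suc N)) (q' @ base_power b' y) b'"
    by (rule unit_monomial_split'[OF b' p' q' k' N(2)])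
  note w = enters_power_walk[OF b p] enters_power_walk[OF b q]
    enters_power_walk[OF b' p'] enters_power_walk[OF b' q']
  show ?thesis
  proof (cases "b = b' \<and> q = p'")
    case True
    have "k + k' = (int x - int y) * int (period b)" using x(2) y(2) True by (simp add: algebra_simps)
    then have "walk_monomial (p @ base_power b x) (q' @ base_power b y) b = unit_monomial b p (k + k') q'"
      using True q' by (intro unit_monomial_eq[OF b p]) auto
    moreover have "unit_monomial b p k q \<cdot> unit_monomial b' p' k' q' =
        walk_monomial (p @ base_power b x) (q' @ base_power b y) b"
      unfolding x(3) y(3)
      using True walk_monomial_mult_same[OF w(1) w(2), of "source b' q'" "q' @ base_power b' y"]
        enters_power_walk[OF b' q', of y] by (simp del: awalk_append_iff)
    ultimately show ?thesis using True by simp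
  next
    case False
    have "\<not> prefix (q @ base_power b (Suc N)) (p' @ base_power b' (Suc N))"
      using enters_prefix[OF b q _ b' p', of "Suc N" "Suc N"] False by (auto simp: prefix_def)
    moreover have "\<not> prefix (p' @ base_power b' (Suc N)) (q @ base_power b (Suc N))"
      using enters_prefix[OF b' p' _ b q, of "Suc N" "Suc N"] False by (auto simp: prefix_def)
    ultimately show ?thesis unfolding x(3) y(3) if_not_P[OF False]
      by (rule walk_monomial_mult_incomparable[OF w])
  qed
qed

lemma walk_monomial_unit:
  assumes b: "b \<in> Bases" and p: "awalk u p b" and q: "awalk u' q b"
  obtains p' q' k where "p' \<in> enters b" "q' \<in> enters b" "int (period b) dvd k"
    "int (length p) - int (length q) = int (length p') + k - int (length q')"
    "walk_monomial p q b = unit_monomial b p' k q'"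
proof -
  obtain p' x where x: "p' \<in> enters b" "p = p' @ base_power b x" by (rule walk_decompose[OF b p])
  obtain q' y where y: "q' \<in> enters b" "q = q' @ base_power b y" by (rule walk_decompose[OF b q])
  have "walk_monomial p q b = unit_monomial b p' ((int x - int y) * int (period b)) q'"
    unfolding x(2) y(2) by (rule unit_monomial_eq[OF b x(1) y(1) HOL.refl])
  moreover have "int (length p) - int (length q) =
      int (length p') + (int x - int y) * int (period b) - int (length q')"
    by (simp add: x(2) y(2) algebra_simps)
  moreover have "int (period b) dvd (int x - int y) * int (period b)" by simp
  ultimately show ?thesis using that x(1) y(1) by blast
qed

end


lemma prepend_nth: "prepend p g i = (if i < length p then Some (p ! i) else g (i - length p))"
  by (induction p arbitrary: i) (auto split: nat.split)

text \<open>The constructors display the edges in order, so the term determines the walk; this lets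
  walks be encoded by terms.\<close>

lemma path_term_inj: "path_term u p = path_term u q \<Longrightarrow> p = q"
proof (induction u p arbitrary: q rule: path_term.induct)
  case (1 u)
  then show ?case by (cases "(u, q)" rule: path_term.cases) auto
next
  case (2 u e)
  then show ?case by (cases "(u, q)" rule: path_term.cases) auto
next
  case (3 u e f p)
  then show ?case by (cases "(u, q)" rule: path_term.cases) auto
qed

text \<open>The map is constructed from the matrices to the algebra, where it is given on a basis.
  \<open>graded_isomorphic\<close> asks for the opposite direction, and passing to the inverse uses
  closure of the operations on \<open>B\<close>.\<close>

lemma graded_isomorphic_inverse:
  assumes bij: "bij_betw \<psi> (carrier B) (carrier A)"
    and closed: "\<And>x y. x \<in> carrier B \<Longrightarrow> y \<in> carrier B \<Longrightarrow> x \<oplus>\<^bsub>B\<^esub> y \<in> carrier B"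
      "\<And>x y. x \<in> carrier B \<Longrightarrow> y \<in> carrier B \<Longrightarrow> x \<otimes>\<^bsub>B\<^esub> y \<in> carrier B"
      "\<And>c x. c \<in> carrier K \<Longrightarrow> x \<in> carrier B \<Longrightarrow> c \<odot>\<^bsub>B\<^esub> x \<in> carrier B"
    and add: "\<And>x y. x \<in> carrier B \<Longrightarrow> y \<in> carrier B \<Longrightarrow> \<psi> (x \<oplus>\<^bsub>B\<^esub> y) = \<psi> x \<oplus>\<^bsub>A\<^esub> \<psi> y"
    and mult: "\<And>x y. x \<in> carrier B \<Longrightarrow> y \<in> carrier B \<Longrightarrow> \<psi> (x \<otimes>\<^bsub>B\<^esub> y) = \<psi> x \<otimes>\<^bsub>A\<^esub> \<psi> y"
    and smult: "\<And>c x. c \<in> carrier K \<Longrightarrow> x \<in> carrier B \<Longrightarrow> \<psi> (c \<odot>\<^bsub>B\<^esub> x) = c \<odot>\<^bsub>A\<^esub> \<psi> x"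
    and comp: "\<And>d. \<psi> ` component B d = component A d" "\<And>d. component B d \<subseteq> carrier B"
  shows "graded_isomorphic K A B"
proof -
  define h where "h = inv_into (carrier B) \<psi>"
  have inj: "inj_on \<psi> (carrier B)" and img: "\<psi> ` carrier B = carrier A"
    using bij by (auto simp: bij_betw_def)
  have hb: "h (\<psi> x) = x" if "x \<in> carrier B" for x
    unfolding h_def using inj that by (rule inv_into_f_f)
  have ex: "\<exists>x\<in>carrier B. a = \<psi> x" if "a \<in> carrier A" for a using that img by blast
  show ?thesis unfolding graded_isomorphic_def
  proof (intro exI[of _ h] conjI ballI allI)
    show "bij_betw h (carrier A) (carrier B)" unfolding h_def by (rule bij_betw_inv_into[OF bij])
  next
    fix a b assume "a \<in> carrier A" "b \<in> carrier A"
    then obtain x y where "x \<in> carrier B" "y \<in> carrier B" "a = \<psi> x" "b = \<psi> y" using ex by metis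
    then show "h (a \<oplus>\<^bsub>A\<^esub> b) = h a \<oplus>\<^bsub>B\<^esub> h b" "h (a \<otimes>\<^bsub>A\<^esub> b) = h a \<otimes>\<^bsub>B\<^esub> h b"
      using hb closed by (simp_all flip: add mult)
  next
    fix c a assume "c \<in> carrier K" "a \<in> carrier A"
    moreover then obtain x where "x \<in> carrier B" "a = \<psi> x" using ex by metis
    ultimately show "h (c \<odot>\<^bsub>A\<^esub> a) = c \<odot>\<^bsub>B\<^esub> h a" using hb closed by (simp flip: smult)
  next
    fix d
    have "h ` component A d = (\<lambda>x. h (\<psi> x)) ` component B d" by (simp add: image_image flip: comp(1))
    also have "\<dots> = (\<lambda>x. x) ` component B d" using hb comp(2)[of d] by (intro image_cong) auto
    finally show "h ` component A d = component B d" by simp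
  qed
qed

context tame_leavitt
begin

text \<open>The theorem fixes the type of the index sets, so base vertices and walks are encoded as singletons.\<close>

definition base_code :: "'v \<Rightarrow> ('k, 'v, 'e) lterm set" where
  "base_code b = {Vert b}"

definition walk_code :: "'v \<Rightarrow> 'e list \<Rightarrow> ('k, 'v, 'e) lterm set" where
  "walk_code b p = {path_term b p}"

definition blocks :: "('k, 'v, 'e) lterm set set" where
  "blocks = base_code ` Bases"

definition block_base :: "('k, 'v, 'e) lterm set \<Rightarrow> 'v" where
  "block_base i = (THE b. i = base_code b)"

definition rows :: "('k, 'v, 'e) lterm set \<Rightarrow> ('k, 'v, 'e) lterm set set" where
  "rows i = walk_code (block_base i) ` enters (block_base i)"

definition row_walk :: "('k, 'v, 'e) lterm set \<Rightarrow> ('k, 'v, 'e) lterm set \<Rightarrow> 'e list" where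
  "row_walk i \<alpha> = (THE p. \<alpha> = walk_code (block_base i) p)"

text \<open>In the grading of \<open>matrix_algebra\<close> this gives \<open>x ^ k\<close> in row
  \<open>p\<close> and column \<open>q\<close> the degree \<open>length p + k - length q\<close>,
  which is the degree of \<open>unit_monomial b p k q\<close>.\<close>

definition row_degree :: "('k, 'v, 'e) lterm set \<Rightarrow> ('k, 'v, 'e) lterm set \<Rightarrow> int" where
  "row_degree i \<alpha> = int (length (row_walk i \<alpha>))"

definition block_period :: "('k, 'v, 'e) lterm set \<Rightarrow> nat" where
  "block_period i = period (block_base i)"

lemma block_base [simp]: "block_base (base_code b) = b"
  by (simp add: block_base_def base_code_def)

lemma walk_code_inj: "walk_code b p = walk_code b q \<longleftrightarrow> p = q"
  using path_term_inj by (auto simp: walk_code_def)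

lemma row_walk [simp]: "row_walk (base_code b) (walk_code b p) = p"
  by (simp add: row_walk_def walk_code_inj)

sublocale M: matrix_sum K blocks block_period rows row_degree
  by unfold_locales

lemma block_cases:
  assumes "i \<in> blocks"
  obtains b where "b \<in> Bases" "i = base_code b"
  using assms by (auto simp: blocks_def)

lemma valid_index_cases:
  assumes "M.valid_index s"
  obtains b p q k where "b \<in> Bases" "p \<in> enters b" "q \<in> enters b" "int (period b) dvd k"
    "s = (base_code b, walk_code b p, walk_code b q, k)"
proof -
  obtain i \<alpha> \<beta> k where s: "s = (i, \<alpha>, \<beta>, k)" by (cases s)
  then have v: "i \<in> blocks" "\<alpha> \<in> rows i" "\<beta> \<in> rows i" "int (block_period i) dvd k" using assms by auto
  obtain b where b: "b \<in> Bases" "i = base_code b" by (rule block_cases[OF v(1)])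
  then show ?thesis using that v s by (auto simp: rows_def block_period_def)
qed

lemma valid_indexI:
  "b \<in> Bases \<Longrightarrow> p \<in> enters b \<Longrightarrow> q \<in> enters b \<Longrightarrow> int (period b) dvd k \<Longrightarrow>
    M.valid_index (base_code b, walk_code b p, walk_code b q, k)"
  unfolding M.valid_index.simps unfolding blocks_def rows_def block_period_def block_base by blast

fun index_elem :: "('k, 'v, 'e) lterm set \<times> ('k, 'v, 'e) lterm set \<times> ('k, 'v, 'e) lterm set \<times> int \<Rightarrow>
    ('k, 'v, 'e) lterm set" where
  "index_elem (i, \<alpha>, \<beta>, k) = unit_monomial (block_base i) (row_walk i \<alpha>) k (row_walk i \<beta>)"

lemma index_elem_closed:
  assumes "M.valid_index s"
  shows "index_elem s \<in> carrier L"
proof -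
  obtain b p q k where "b \<in> Bases" "p \<in> enters b" "q \<in> enters b"
    "s = (base_code b, walk_code b p, walk_code b q, k)" using valid_index_cases[OF assms] by metis
  then show ?thesis using unit_monomial_closed by simp
qed

lemma index_elem_mult:
  assumes s: "M.valid_index (i, \<alpha>, \<beta>, k)" and t: "M.valid_index (i', \<alpha>', \<beta>', k')"
  shows "index_elem (i, \<alpha>, \<beta>, k) \<cdot> index_elem (i', \<alpha>', \<beta>', k') =
    (if i = i' \<and> \<beta> = \<alpha>' then index_elem (i, \<alpha>, \<beta>', k + k') else \<zero>\<^bsub>L\<^esub>)"
proof -
  obtain b p q where b: "b \<in> Bases" "p \<in> enters b" "q \<in> enters b" "int (period b) dvd k"
    "i = base_code b" "\<alpha> = walk_code b p" "\<beta> = walk_code b q"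
    using valid_index_cases[OF s] by (metis prod.inject)
  obtain b' p' q' where b': "b' \<in> Bases" "p' \<in> enters b'" "q' \<in> enters b'" "int (period b') dvd k'"
    "i' = base_code b'" "\<alpha>' = walk_code b' p'" "\<beta>' = walk_code b' q'"
    using valid_index_cases[OF t] by (metis prod.inject)
  have "i = i' \<longleftrightarrow> b = b'" using b b' block_base by metis
  then show ?thesis using unit_monomial_mult[OF b(1-4) b'(1-4)] b b' by (auto simp: walk_code_inj)
qed

section \<open>The map from matrices to the Leavitt path algebra\<close>

fun coeff_at where "coeff_at f (i, \<alpha>, \<beta>, k) = f i \<alpha> \<beta> k"

lemma coeff_at_closed: "f \<in> carrier M.MS \<Longrightarrow> M.valid_index s \<Longrightarrow> coeff_at f s \<in> carrier K"
  by (cases s) (simp add: M.MS_closed)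

lemma coeff_at_support:
  "M.valid_index s \<Longrightarrow> s \<in> M.coeff_support f \<longleftrightarrow> coeff_at f s \<noteq> \<zero>\<^bsub>K\<^esub>"
  by (cases s) (simp add: M.coeff_support_def)

text \<open>Linear extension of the map that sends \<open>x ^ k\<close> times the matrix unit in row
  \<open>p\<close> and column \<open>q\<close> to \<open>p c ^ j q*\<close>, where \<open>k\<close>
  is \<open>j\<close> periods of the cycle \<open>c\<close>.\<close>

definition of_matrices where
  "of_matrices f = (\<Oplus>\<^bsub>L\<^esub>s\<in>M.coeff_support f. coeff_at f s \<odot>\<^bsub>L\<^esub> index_elem s)"

lemma of_matrices_superset:
  assumes f: "f \<in> carrier M.MS" and F: "finite F" "\<And>s. s \<in> F \<Longrightarrow> M.valid_index s" "M.coeff_support f \<subseteq> F"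
  shows "of_matrices f = (\<Oplus>\<^bsub>L\<^esub>s\<in>F. coeff_at f s \<odot>\<^bsub>L\<^esub> index_elem s)"
  unfolding of_matrices_def
  using coeff_at_support[of _ f] F index_elem_closed coeff_at_closed[OF f]
  by (intro LA.A.finsum_superset[OF F(1,3)]) auto

lemma of_matrices_closed: "f \<in> carrier M.MS \<Longrightarrow> of_matrices f \<in> carrier L"
  unfolding of_matrices_def using M.valid_support index_elem_closed coeff_at_closed
  by (intro LA.A.finsum_closed) auto

lemma of_matrices_add:
  assumes f: "f \<in> carrier M.MS" and g: "g \<in> carrier M.MS"
  shows "of_matrices (f \<oplus>\<^bsub>M.MS\<^esub> g) = of_matrices f \<oplus>\<^bsub>L\<^esub> of_matrices g"
proof -
  let ?F = "M.coeff_support f \<union> M.coeff_support g"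
  have fin: "finite ?F" using M.MS_finite f g by blast
  have val: "M.valid_index s" if "s \<in> ?F" for s using that M.valid_support f g by blast
  have c: "coeff_at f s \<in> carrier K" "coeff_at g s \<in> carrier K" "index_elem s \<in> carrier L"
    if "s \<in> ?F" for s
    using val[OF that] coeff_at_closed f g index_elem_closed by auto
  have sub: "M.coeff_support (f \<oplus>\<^bsub>M.MS\<^esub> g) \<subseteq> ?F"
    by (auto simp: M.coeff_support_def M.MS_add)
  have ca: "coeff_at (f \<oplus>\<^bsub>M.MS\<^esub> g) s = coeff_at f s \<oplus>\<^bsub>K\<^esub> coeff_at g s" if "s \<in> ?F" for s
    using val[OF that] by (cases s) (simp add: M.MS_add)
  have "of_matrices (f \<oplus>\<^bsub>M.MS\<^esub> g) = (\<Oplus>\<^bsub>L\<^esub>s\<in>?F. coeff_at (f \<oplus>\<^bsub>M.MS\<^esub> g) s \<odot>\<^bsub>L\<^esub> index_elem s)"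
    by (rule of_matrices_superset[OF M.MS_add_closed[OF f g] fin val sub])
  also have "\<dots> = (\<Oplus>\<^bsub>L\<^esub>s\<in>?F. coeff_at f s \<odot>\<^bsub>L\<^esub> index_elem s \<oplus>\<^bsub>L\<^esub> coeff_at g s \<odot>\<^bsub>L\<^esub> index_elem s)"
  proof (rule LA.A.finsum_cong'[OF HOL.refl])
    fix s assume s: "s \<in> ?F"
    show "coeff_at (f \<oplus>\<^bsub>M.MS\<^esub> g) s \<odot>\<^bsub>L\<^esub> index_elem s =
        coeff_at f s \<odot>\<^bsub>L\<^esub> index_elem s \<oplus>\<^bsub>L\<^esub> coeff_at g s \<odot>\<^bsub>L\<^esub> index_elem s"
      unfolding ca[OF s] by (rule LA.add_smult[OF c[OF s]])
  qed (use c in simp)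
  also have "\<dots> = (\<Oplus>\<^bsub>L\<^esub>s\<in>?F. coeff_at f s \<odot>\<^bsub>L\<^esub> index_elem s) \<oplus>\<^bsub>L\<^esub> (\<Oplus>\<^bsub>L\<^esub>s\<in>?F. coeff_at g s \<odot>\<^bsub>L\<^esub> index_elem s)"
    using c by (intro LA.A.finsum_addf) auto
  also have "\<dots> = of_matrices f \<oplus>\<^bsub>L\<^esub> of_matrices g"
    using of_matrices_superset[OF f fin val] of_matrices_superset[OF g fin val] by simp
  finally show ?thesis .
qed

lemma smult_support:
  assumes "f \<in> carrier M.MS" "c \<in> carrier K"
  shows "M.coeff_support (c \<odot>\<^bsub>M.MS\<^esub> f) \<subseteq> M.coeff_support f"
  using assms by (auto simp: M.coeff_support_def M.MS_smult)

lemma MS_smult_closed: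
  assumes f: "f \<in> carrier M.MS" and c: "c \<in> carrier K"
  shows "c \<odot>\<^bsub>M.MS\<^esub> f \<in> carrier M.MS"
  unfolding M.MS_carrier[of "c \<odot>\<^bsub>M.MS\<^esub> f"]
proof (intro conjI)
  show "finite (M.coeff_support (c \<odot>\<^bsub>M.MS\<^esub> f))"
    using finite_subset[OF smult_support[OF f c]] M.MS_finite[OF f] by blast
  show "\<forall>(i, \<alpha>, \<beta>, k) \<in> M.coeff_support (c \<odot>\<^bsub>M.MS\<^esub> f). \<alpha> \<in> rows i \<and> \<beta> \<in> rows i \<and> int (block_period i) dvd k"
    using smult_support[OF f c] f unfolding M.MS_carrier by blast
qed (use f c in \<open>simp_all add: M.MS_smult M.MS_closed\<close>)

lemma of_matrices_smult:
  assumes f: "f \<in> carrier M.MS" and c: "c \<in> carrier K"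
  shows "of_matrices (c \<odot>\<^bsub>M.MS\<^esub> f) = c \<odot>\<^bsub>L\<^esub> of_matrices f"
proof -
  let ?F = "M.coeff_support f"
  have fin: "finite ?F" by (rule M.MS_finite[OF f])
  have val: "M.valid_index s" if "s \<in> ?F" for s using that M.valid_support f by blast
  have cc: "coeff_at f s \<in> carrier K" "index_elem s \<in> carrier L" if "s \<in> ?F" for s
    using val[OF that] coeff_at_closed f index_elem_closed by auto
  have ca: "coeff_at (c \<odot>\<^bsub>M.MS\<^esub> f) s = c \<otimes>\<^bsub>K\<^esub> coeff_at f s" if "s \<in> ?F" for s
    using val[OF that] by (cases s) (simp add: M.MS_smult)
  have "of_matrices (c \<odot>\<^bsub>M.MS\<^esub> f) = (\<Oplus>\<^bsub>L\<^esub>s\<in>?F. coeff_at (c \<odot>\<^bsub>M.MS\<^esub> f) s \<odot>\<^bsub>L\<^esub> index_elem s)"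
    by (rule of_matrices_superset[OF MS_smult_closed[OF f c] fin val smult_support[OF f c]])
  also have "\<dots> = (\<Oplus>\<^bsub>L\<^esub>s\<in>?F. c \<odot>\<^bsub>L\<^esub> (coeff_at f s \<odot>\<^bsub>L\<^esub> index_elem s))"
    using c cc by (intro LA.A.finsum_cong') (auto simp: ca LA.smult_smult)
  also have "\<dots> = c \<odot>\<^bsub>L\<^esub> of_matrices f"
    unfolding of_matrices_def using c cc by (intro LA.smult_finsum[OF fin, symmetric]) auto
  finally show ?thesis .
qed

lemma of_matrices_single:
  assumes s: "M.valid_index s" and c: "c \<in> carrier K"
  shows "of_matrices (M.single s c) = c \<odot>\<^bsub>L\<^esub> index_elem s"
proof -
  have "of_matrices (M.single s c) = (\<Oplus>\<^bsub>L\<^esub>t\<in>{s}. coeff_at (M.single s c) t \<odot>\<^bsub>L\<^esub> index_elem t)"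
    by (rule of_matrices_superset[OF M.single_closed[OF s c]]) (use s M.single_support in auto)
  moreover have "coeff_at (M.single s c) s = c" using s by (cases s) (simp add: M.single_def)
  ultimately show ?thesis using c index_elem_closed[OF s] by (simp add: LA.A.finsum_insert)
qed

lemma of_matrices_zero: "of_matrices \<zero>\<^bsub>M.MS\<^esub> = \<zero>\<^bsub>L\<^esub>"
proof -
  have "M.coeff_support \<zero>\<^bsub>M.MS\<^esub> = {}" by (auto simp: M.coeff_support_def M.MS_zero)
  then show ?thesis by (simp add: of_matrices_def)
qed

lemma of_matrices_single_mult:
  assumes s: "M.valid_index s" and c: "c \<in> carrier K" and t: "M.valid_index t" and d: "d \<in> carrier K"
  shows "of_matrices (M.single s c \<otimes>\<^bsub>M.MS\<^esub> M.single t d) =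
    of_matrices (M.single s c) \<cdot> of_matrices (M.single t d)"
proof -
  obtain i \<alpha> \<beta> k where se: "s = (i, \<alpha>, \<beta>, k)" by (cases s)
  obtain i' \<alpha>' \<beta>' k' where te: "t = (i', \<alpha>', \<beta>', k')" by (cases t)
  have "of_matrices (M.single s c) \<cdot> of_matrices (M.single t d) =
      (c \<odot>\<^bsub>L\<^esub> index_elem s) \<cdot> (d \<odot>\<^bsub>L\<^esub> index_elem t)"
    by (simp only: of_matrices_single[OF s c] of_matrices_single[OF t d])
  also have "\<dots> = c \<odot>\<^bsub>L\<^esub> (index_elem s \<cdot> (d \<odot>\<^bsub>L\<^esub> index_elem t))"
    using c d index_elem_closed[OF s] index_elem_closed[OF t] by (simp only: LA.smult_mult LA.smult_closed)
  also have "\<dots> = c \<odot>\<^bsub>L\<^esub> (d \<odot>\<^bsub>L\<^esub> (index_elem s \<cdot> index_elem t))"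
    using d index_elem_closed[OF s] index_elem_closed[OF t] by (simp only: LA.mult_smult)
  also have "\<dots> = (c \<otimes>\<^bsub>K\<^esub> d) \<odot>\<^bsub>L\<^esub> (index_elem s \<cdot> index_elem t)"
    using c d index_elem_closed[OF s] index_elem_closed[OF t] by (simp only: LA.smult_smult LA.mult_closed)
  finally have R: "of_matrices (M.single s c) \<cdot> of_matrices (M.single t d) =
      (c \<otimes>\<^bsub>K\<^esub> d) \<odot>\<^bsub>L\<^esub> (index_elem s \<cdot> index_elem t)" .
  show ?thesis
  proof (cases "i = i' \<and> \<beta> = \<alpha>'")
    case True
    have "M.valid_index (i, \<alpha>, \<beta>', k + k')" using s t True by (simp add: se te)
    from of_matrices_single[OF this, of "c \<otimes>\<^bsub>K\<^esub> d"] show ?thesis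
      unfolding R unfolding se te M.single_mult[OF s[unfolded se] t[unfolded te] c d]
        index_elem_mult[OF s[unfolded se] t[unfolded te]] if_P[OF True]
      using c d by simp
  next
    case False
    show ?thesis
      unfolding R unfolding se te M.single_mult[OF s[unfolded se] t[unfolded te] c d]
        index_elem_mult[OF s[unfolded se] t[unfolded te]] if_not_P[OF False] of_matrices_zero
      using c d by simp
  qed
qed

text \<open>Both sides are additive in each argument, so two inductions reduce the claim to scaled
  matrix units.\<close>

lemma of_matrices_mult:
  assumes f: "f \<in> carrier M.MS" and g: "g \<in> carrier M.MS"
  shows "of_matrices (f \<otimes>\<^bsub>M.MS\<^esub> g) = of_matrices f \<cdot> of_matrices g"
  using f
proof (induction f rule: M.MS_induct)
  case zero
  then show ?case using g of_matrices_closed[OF g] by (simp add: M.MS_mult_zeros of_matrices_zero)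
next
  case (single s c)
  note sc = M.single_closed[OF single]
  show ?case using g
  proof (induction g rule: M.MS_induct)
    case zero
    then show ?case using sc of_matrices_closed[OF sc] by (simp add: M.MS_mult_zeros of_matrices_zero)
  next
    case (single t d)
    then show ?case using of_matrices_single_mult \<open>M.valid_index s\<close> \<open>c \<in> carrier K\<close> by blast
  next
    case (add g h)
    then show ?case
      using of_matrices_add[OF M.MS_mult_closed[OF sc add.hyps(1)] M.MS_mult_closed[OF sc add.hyps(2)]]
        of_matrices_closed sc
      by (simp add: M.MS_mult_add(1)[OF sc] of_matrices_add LA.mult_add)
  qed
next
  case (add f h)
  then show ?case
    using of_matrices_add[OF M.MS_mult_closed[OF add.hyps(1) g] M.MS_mult_closed[OF add.hyps(2) g]]
      of_matrices_closed g
    by (simp add: M.MS_mult_add(2)[OF g] of_matrices_add LA.add_mult)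
qed

text \<open>One inclusion compares degrees. For the other, (CK2) pushes the common end of
  \<open>p\<close> and \<open>q\<close> forward along all edges, which keeps the difference of
  lengths, until it is a base vertex; there the monomial is the image of a matrix unit times a power
  of \<open>x\<close>.\<close>

lemma of_matrices_component_image: "of_matrices ` component M.MS d = component L d"
proof
  show "of_matrices ` component M.MS d \<subseteq> component L d"
  proof (rule image_subsetI)
    fix f assume "f \<in> component M.MS d"
    then have f: "f \<in> carrier M.MS"
      and deg: "\<And>i \<alpha> \<beta> k. (i, \<alpha>, \<beta>, k) \<in> M.coeff_support f \<Longrightarrow> k = d + row_degree i \<beta> - row_degree i \<alpha>"
      unfolding M.MS_component by auto
    show "of_matrices f \<in> component L d" unfolding of_matrices_def
    proof (rule component_finsum[OF M.MS_finite[OF f]])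
      fix s assume s: "s \<in> M.coeff_support f"
      have v: "M.valid_index s" by (rule M.valid_support[OF f s])
      obtain b p q k where b: "b \<in> Bases" "p \<in> enters b" "q \<in> enters b" "int (period b) dvd k"
        "s = (base_code b, walk_code b p, walk_code b q, k)" by (rule valid_index_cases[OF v])
      have "k = d + row_degree (base_code b) (walk_code b q) - row_degree (base_code b) (walk_code b p)"
        by (rule deg) (use s b(5) in simp)
      then have "k = d + int (length q) - int (length p)" unfolding row_degree_def row_walk .
      then have "index_elem s \<in> component L d"
        using unit_monomial_component[OF b(1-4)] b(5) by simp
      then show "coeff_at f s \<odot>\<^bsub>L\<^esub> index_elem s \<in> component L d"
        by (rule component_smult[OF coeff_at_closed[OF f v]])
    qed
  qed
  let ?S = "of_matrices ` component M.MS d"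
  have S_closed: "X \<in> carrier L" if X: "X \<in> ?S" for X
  proof -
    obtain f where f: "X = of_matrices f" "f \<in> component M.MS d" using X by (rule imageE)
    then have "f \<in> carrier M.MS" unfolding M.MS_component by auto
    then show ?thesis unfolding f(1) by (rule of_matrices_closed)
  qed
  have S_zero: "\<zero>\<^bsub>L\<^esub> \<in> ?S"
  proof -
    have "M.coeff_support \<zero>\<^bsub>M.MS\<^esub> = {}" by (auto simp: M.coeff_support_def M.MS_zero)
    then have "\<zero>\<^bsub>M.MS\<^esub> \<in> component M.MS d" by (simp add: M.MS_component M.MS_zero_closed)
    from imageI[OF this, of of_matrices] show ?thesis unfolding of_matrices_zero .
  qed
  have S_add: "X \<oplus>\<^bsub>L\<^esub> Y \<in> ?S" if XY: "X \<in> ?S" "Y \<in> ?S" for X Y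
  proof -
    obtain f where f: "X = of_matrices f" "f \<in> component M.MS d" using XY(1) by (rule imageE)
    obtain g where g: "Y = of_matrices g" "g \<in> component M.MS d" using XY(2) by (rule imageE)
    note fg = f(2) g(2)
    then have c: "f \<in> carrier M.MS" "g \<in> carrier M.MS" unfolding M.MS_component by auto
    have "M.coeff_support (f \<oplus>\<^bsub>M.MS\<^esub> g) \<subseteq> M.coeff_support f \<union> M.coeff_support g"
      by (auto simp: M.coeff_support_def M.MS_add)
    then have "f \<oplus>\<^bsub>M.MS\<^esub> g \<in> component M.MS d"
      using fg(1,2) M.MS_add_closed[OF c] unfolding M.MS_component by blast
    then show ?thesis unfolding f(1) g(1) of_matrices_add[OF c, symmetric] by (rule imageI)
  qed
  have S_smult: "a \<odot>\<^bsub>L\<^esub> X \<in> ?S" if a: "a \<in> carrier K" and X: "X \<in> ?S" for a X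
  proof -
    obtain f where f: "X = of_matrices f" "f \<in> component M.MS d" using X by (rule imageE)
    then have c: "f \<in> carrier M.MS" unfolding M.MS_component by auto
    have "a \<odot>\<^bsub>M.MS\<^esub> f \<in> component M.MS d"
      using f(2) MS_smult_closed[OF c a] smult_support[OF c a] unfolding M.MS_component by blast
    then show ?thesis unfolding f(1) of_matrices_smult[OF c a, symmetric] by (rule imageI)
  qed
  have S_sum: "(\<Oplus>\<^bsub>L\<^esub>x\<in>A. X x) \<in> ?S" if "finite A" "\<And>x. x \<in> A \<Longrightarrow> X x \<in> ?S" for A :: "'e set" and X
    using that
  proof (induction A rule: finite_induct)
    case (insert x A)
    have "X y \<in> carrier L" if "y \<in> insert x A" for y
      by (rule S_closed[OF insert.prems[OF that]])
    then have "(\<Oplus>\<^bsub>L\<^esub>x\<in>insert x A. X x) = X x \<oplus>\<^bsub>L\<^esub> (\<Oplus>\<^bsub>L\<^esub>x\<in>A. X x)"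
      using insert.hyps by (intro LA.A.finsum_insert) auto
    then show ?case using S_add insert by simp
  qed (use S_zero in simp)
  have mono: "walk_monomial p q w \<in> ?S"
    if "w \<in> verts G" "awalk u p w" "awalk u' q w" "int (length p) - int (length q) = d" for u u' p q w
    using that
  proof (induction w arbitrary: p q rule: vertex_induct)
    case (base b)
    obtain p' q' k where k: "p' \<in> enters b" "q' \<in> enters b" "int (period b) dvd k"
      "int (length p) - int (length q) = int (length p') + k - int (length q')"
      "walk_monomial p q b = unit_monomial b p' k q'"
      by (rule walk_monomial_unit[OF base(1-3)])
    let ?s = "(base_code b, walk_code b p', walk_code b q', k)"
    have v: "M.valid_index ?s" by (rule valid_indexI[OF base(1) k(1-3)])
    have one: "\<one>\<^bsub>K\<^esub> \<in> carrier K" by simp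
    have single: "M.single ?s \<one>\<^bsub>K\<^esub> \<in> component M.MS d"
      using M.single_closed[OF v one] M.single_support[of ?s "\<one>\<^bsub>K\<^esub>"] k(4) base(4)
      unfolding M.MS_component by (auto simp: row_degree_def)
    have "of_matrices (M.single ?s \<one>\<^bsub>K\<^esub>) = walk_monomial p q b"
      using of_matrices_single[OF v one] index_elem_closed[OF v] k(5) by simp
    then show ?case using imageI[OF single, of of_matrices] by simp
  next
    case (step v)
    have "walk_monomial (p @ [e]) (q @ [e]) (head G e) \<in> ?S" if e: "e \<in> out_arcs G v" for e
    proof (rule step.IH[OF e])
      have "awalk v [e] (head G e)" using e by (auto simp: awalk_Cons_iff awalk_Nil_iff)
      then show "awalk u (p @ [e]) (head G e)" "awalk u' (q @ [e]) (head G e)"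
        using step.prems(1,2) awalk_appendI by blast+
    qed (use step.prems(3) in simp)
    then show ?case
      unfolding walk_monomial_step[OF step.prems(1,2) regular[OF step.hyps(1)]]
      by (rule S_sum[OF finite_out[OF step.hyps(1)]])
  qed
  show "component L d \<subseteq> ?S"
  proof (rule component_subset)
    fix u p w u' q assume w: "awalk u p w" "awalk u' q w" "int (length p) - int (length q) = d"
    show "walk_monomial p q w \<in> ?S"
      by (rule mono[OF _ w]) (use awalk_last_in_verts[OF w(1)] in simp)
  qed (rule S_zero, erule (1) S_add, erule (1) S_smult)
qed

text \<open>The image is closed under the operations, so it suffices to reach the generators, which
  are homogeneous of degree 0, 1 and -1.\<close>

lemma of_matrices_surj: "carrier L \<subseteq> of_matrices ` carrier M.MS" (is "_ \<subseteq> ?S")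
proof -
  have comp: "x \<in> component L d \<Longrightarrow> x \<in> ?S" for d x
    unfolding of_matrices_component_image[symmetric]
    by (erule imageE) (simp add: M.MS_component)
  have add: "X \<oplus>\<^bsub>L\<^esub> Y \<in> ?S" if XY: "X \<in> ?S" "Y \<in> ?S" for X Y
  proof -
    obtain f where f: "X = of_matrices f" "f \<in> carrier M.MS" using XY(1) by (rule imageE)
    obtain g where g: "Y = of_matrices g" "g \<in> carrier M.MS" using XY(2) by (rule imageE)
    show ?thesis unfolding f(1) g(1) of_matrices_add[OF f(2) g(2), symmetric]
      by (rule imageI[OF M.MS_add_closed[OF f(2) g(2)]])
  qed
  have mult: "X \<cdot> Y \<in> ?S" if XY: "X \<in> ?S" "Y \<in> ?S" for X Y
  proof -
    obtain f where f: "X = of_matrices f" "f \<in> carrier M.MS" using XY(1) by (rule imageE)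
    obtain g where g: "Y = of_matrices g" "g \<in> carrier M.MS" using XY(2) by (rule imageE)
    show ?thesis unfolding f(1) g(1) of_matrices_mult[OF f(2) g(2), symmetric]
      by (rule imageI[OF M.MS_mult_closed[OF f(2) g(2)]])
  qed
  have smult: "a \<odot>\<^bsub>L\<^esub> X \<in> ?S" if a: "a \<in> carrier K" and X: "X \<in> ?S" for a X
  proof -
    obtain f where f: "X = of_matrices f" "f \<in> carrier M.MS" using X by (rule imageE)
    show ?thesis unfolding f(1) of_matrices_smult[OF f(2) a, symmetric]
      by (rule imageI[OF MS_smult_closed[OF f(2) a]])
  qed
  have "cl t \<in> ?S" if "t \<in> T" for t
    using that
  proof (induction rule: lterms.induct)
    case (1 v)
    have "walk_monomial [] [] v \<in> component L 0"
      by (rule component_monomial) (use 1 in \<open>auto simp: awalk_Nil_iff\<close>)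
    then show ?case using comp 1 by (simp add: walk_monomial_def vert_vert)
  next
    case (2 e)
    have "walk_monomial [e] [] (head G e) \<in> component L 1"
      by (rule component_monomial) (use 2 in \<open>auto simp: awalk_Nil_iff awalk_Cons_iff\<close>)
    then show ?case using comp 2 by (simp add: walk_monomial_def edge_units)
  next
    case (3 e)
    have "walk_monomial [] [e] (head G e) \<in> component L (- 1)"
      by (rule component_monomial) (use 3 in \<open>auto simp: awalk_Nil_iff awalk_Cons_iff\<close>)
    then show ?case using comp 3 by (simp add: walk_monomial_def edge_units)
  next
    case 4
    then show ?case using comp component_zero[of 0] by (auto simp: cl_zero)
  next
    case (5 s t)
    then show ?case using add[of "cl s" "cl t"] by (simp add: cl_add)
  next
    case (6 s t)
    then show ?case using mult[of "cl s" "cl t"] by (simp add: cl_mult)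
  next
    case (7 a t)
    then show ?case using smult[of a "cl t"] by (simp add: cl_smult)
  qed
  then show ?thesis by (blast elim: carrierE)
qed

section \<open>Independence of the matrix units\<close>

definition loop :: "'v \<Rightarrow> nat \<Rightarrow> 'e option" where
  "loop b = (\<lambda>i. Some (base_cycle b ! (i mod period b)))"

lemma loop_boundary: "b \<in> Bases \<Longrightarrow> boundary_path G b (loop b)"
proof -
  assume b: "b \<in> Bases"
  have ne: "base_cycle b \<noteq> []" by (simp add: base_cycle_def)
  have "inf_path G (\<lambda>i. base_cycle b ! (i mod period b))"
    using cycle_power_path[OF base_cycle_walk[OF b] ne] by (simp add: period_def)
  from boundary_path_inf_path[OF this] show "boundary_path G b (loop b)"
    using base_edge_in[OF b] by (simp add: loop_def base_cycle_def)
qed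

lemma prepend_loop: "prepend (base_power b k) (loop b) = loop b"
proof (induction k)
  case (Suc k)
  have "prepend (base_cycle b) (loop b) i = loop b i" for i
    by (simp add: prepend_nth loop_def flip: period_def) (simp add: le_mod_geq)
  then have "prepend (base_cycle b) (loop b) = loop b" by blast
  then show ?case using Suc by (simp add: base_power_def prepend_append)
qed simp

text \<open>An entering walk meets no base vertex before its end, so the first base vertex on the
  path and the edge taken there determine \<open>p\<close> and \<open>b\<close>.\<close>

lemma prepend_enters:
  assumes b: "b \<in> Bases" "p \<in> enters b" and b': "b' \<in> Bases" "p' \<in> enters b'" and k: "k > 0"
    and eq: "prepend p (loop b) = prepend (p' @ base_power b' k) h"
  shows "p = p' \<and> b = b'"
proof -
  \<comment> \<open>One turn is split off the infinite path, so that \<open>enters_prefix\<close>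
    sees the base vertex on both sides.\<close>
  have eq': "prepend (p @ base_power b 1) (loop b) = prepend (p' @ base_power b' k) h"
    using eq prepend_loop[of b 1] by (simp add: prepend_append)
  show ?thesis
  proof (cases "length (p @ base_power b 1) \<le> length (p' @ base_power b' k)")
    case True
    then obtain r where "p' @ base_power b' k = (p @ base_power b 1) @ r"
      using prepend_eq_le[OF eq'] by blast
    then show ?thesis using enters_prefix[OF b _ b' k, of 1 r] by simp
  next
    case False
    then obtain r where "p @ base_power b 1 = (p' @ base_power b' k) @ r"
      using prepend_eq_le[OF eq'[symmetric]] by auto
    then show ?thesis using enters_prefix[OF b' k b, of 1 r] by simp
  qed
qed

text \<open>Indicator of the path \<open>q ccc...\<close> at the integer \<open>length q\<close>.
  With this offset the coefficient of \<open>x ^ k\<close> is found at the integer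
  \<open>length p + k\<close>.\<close>

definition delta :: "'v \<Rightarrow> 'e list \<Rightarrow> ('v, 'e) path_state \<Rightarrow> 'k" where
  "delta b q = (\<lambda>x. if x = (source b q, prepend q (loop b), int (length q)) then \<one>\<^bsub>K\<^esub> else \<zero>\<^bsub>K\<^esub>)"

lemma delta_path_function: "b \<in> Bases \<Longrightarrow> q \<in> enters b \<Longrightarrow> delta b q \<in> path_functions"
  using boundary_path_prepend[OF enters_walk loop_boundary] by (auto simp: delta_def path_functions_def)

text \<open>\<open>p' c ^ j q'*\<close> carries \<open>q' ccc...\<close> to \<open>p' ccc...\<close>
  and raises the integer by \<open>length p' + k' - length q'\<close>. The paths detect the walks
  and the base vertex, the integer detects the exponent.\<close>

lemma rep_unit_monomial:
  assumes b: "b \<in> Bases" "p \<in> enters b" "q \<in> enters b"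
    and b': "b' \<in> Bases" "p' \<in> enters b'" "q' \<in> enters b'" "int (period b') dvd k'"
  shows "rep (unit_monomial b' p' k' q') (delta b q) (source b p, prepend p (loop b), int (length p) + k) =
    (if b = b' \<and> p = p' \<and> q = q' \<and> k = k' then \<one>\<^bsub>K\<^esub> else \<zero>\<^bsub>K\<^esub>)"
proof -
  define N where "N = nat \<bar>k'\<bar>"
  have N: "int N \<ge> \<bar>k'\<bar>" by (simp add: N_def)
  obtain x where x: "x > 0" "k' = (int x - int (Suc N)) * int (period b')"
    "unit_monomial b' p' k' q' = walk_monomial (p' @ base_power b' x) (q' @ base_power b' (Suc N)) b'"
    by (rule unit_monomial_split[OF b' N])
  note f = delta_path_function[OF b(1,3)]
  note w = enters_power_walk[OF b'(1,2), of x] enters_power_walk[OF b'(1,3), of "Suc N"]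
  show ?thesis
  proof (cases "b = b' \<and> p = p'")
    case True
    have st: "prepend p (loop b) = prepend (p' @ base_power b' x) (loop b')"
      using True prepend_loop by (simp add: prepend_append)
    have "rep (unit_monomial b' p' k' q') (delta b q) (source b p, prepend p (loop b), int (length p) + k) =
        delta b q (source b' q', prepend q' (loop b'), int (length p) + k -
          int (length (p' @ base_power b' x)) + int (length (q' @ base_power b' (Suc N))))"
      unfolding st x(3) using True rep_monomial[OF f w loop_boundary[OF b'(1)]] prepend_loop[of b' "Suc N"]
      by (simp add: prepend_append)
    also have "int (length p) + k - int (length (p' @ base_power b' x)) + int (length (q' @ base_power b' (Suc N))) =
        k - k' + int (length q')"
      using True unfolding x(2) by (simp add: algebra_simps)
    also have "delta b q (source b' q', prepend q' (loop b'), k - k' + int (length q')) =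
        (if q = q' \<and> k = k' then \<one>\<^bsub>K\<^esub> else \<zero>\<^bsub>K\<^esub>)"
    proof (cases "q = q'")
      case False
      have "prepend q' (loop b') \<noteq> prepend q (loop b)"
      proof
        assume "prepend q' (loop b') = prepend q (loop b)"
        then have "prepend q' (loop b') = prepend (q @ base_power b 1) (loop b)"
          using prepend_loop[of b 1] by (simp add: prepend_append)
        then show False using prepend_enters[OF b'(1,3) b(1,3)] False by auto
      qed
      then show ?thesis using False by (simp add: delta_def)
    qed (use True in \<open>auto simp: delta_def\<close>)
    finally show ?thesis using True by simp
  next
    case False
    have "rep (unit_monomial b' p' k' q') (delta b q) (source b p, prepend p (loop b), int (length p) + k) = \<zero>\<^bsub>K\<^esub>"
    proof (rule ccontr)
      assume "\<not> ?thesis"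
      then obtain h where "prepend p (loop b) = prepend (p' @ base_power b' x) h"
        unfolding x(3) using rep_monomial_support[OF f w] by blast
      then show False using prepend_enters[OF b(1,2) b'(1,2) x(1)] False by blast
    qed
    then show ?thesis using False by auto
  qed
qed

text \<open>Evaluation of \<open>delta b q\<close> at the state of \<open>p\<close> is the
  coordinate functional of a matrix unit, so every coefficient of \<open>f\<close> can be read off
  its image.\<close>

lemma rep_of_matrices:
  assumes f: "f \<in> carrier M.MS" and b: "b \<in> Bases" "p \<in> enters b" "q \<in> enters b" "int (period b) dvd k"
  shows "rep (of_matrices f) (delta b q) (source b p, prepend p (loop b), int (length p) + k) =
    f (base_code b) (walk_code b p) (walk_code b q) k"
proof -
  let ?s0 = "(base_code b, walk_code b p, walk_code b q, k)"
  let ?x = "(source b p, prepend p (loop b), int (length p) + k)"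
  note d = delta_path_function[OF b(1,3)]
  have v0: "M.valid_index ?s0" by (rule valid_indexI[OF b])
  have fin: "finite (insert ?s0 (M.coeff_support f))" using M.MS_finite[OF f] by simp
  have val: "M.valid_index s" if "s \<in> insert ?s0 (M.coeff_support f)" for s
    using that v0 M.valid_support[OF f] by blast
  have c: "coeff_at f s \<in> carrier K" "index_elem s \<in> carrier L" if "s \<in> insert ?s0 (M.coeff_support f)" for s
    using coeff_at_closed[OF f val[OF that]] index_elem_closed[OF val[OF that]] by auto
  have sup: "of_matrices f = (\<Oplus>\<^bsub>L\<^esub>s\<in>insert ?s0 (M.coeff_support f). coeff_at f s \<odot>\<^bsub>L\<^esub> index_elem s)"
    by (rule of_matrices_superset[OF f fin val subset_insertI])
  have r: "rep (coeff_at f s \<odot>\<^bsub>L\<^esub> index_elem s) (delta b q) ?x = (if ?s0 = s then coeff_at f s else \<zero>\<^bsub>K\<^esub>)"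
    if s: "s \<in> insert ?s0 (M.coeff_support f)" for s
  proof -
    obtain b' p' q' k' where b': "b' \<in> Bases" "p' \<in> enters b'" "q' \<in> enters b'" "int (period b') dvd k'"
      "s = (base_code b', walk_code b' p', walk_code b' q', k')" by (rule valid_index_cases[OF val[OF s]])
    have "b = b' \<and> p = p' \<and> q = q' \<and> k = k' \<longleftrightarrow> ?s0 = s"
      unfolding b'(5) using block_base walk_code_inj by (metis prod.inject)
    then have "rep (index_elem s) (delta b q) ?x = (if ?s0 = s then \<one>\<^bsub>K\<^esub> else \<zero>\<^bsub>K\<^esub>)"
      using rep_unit_monomial[OF b(1-3) b'(1-4)] b'(5) by simp
    then show ?thesis using rep_smult[OF c[OF s] d, of ?x] c[OF s] by simp
  qed
  have "rep (of_matrices f) (delta b q) ?x =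
      (\<Oplus>\<^bsub>K\<^esub>s\<in>insert ?s0 (M.coeff_support f). rep (coeff_at f s \<odot>\<^bsub>L\<^esub> index_elem s) (delta b q) ?x)"
    unfolding sup by (rule rep_finsum[OF d fin]) (use c in simp)
  also have "\<dots> = (\<Oplus>\<^bsub>K\<^esub>s\<in>insert ?s0 (M.coeff_support f). if ?s0 = s then coeff_at f s else \<zero>\<^bsub>K\<^esub>)"
    using c(1) by (intro finsum_cong' HOL.refl r) auto
  also have "\<dots> = coeff_at f ?s0"
    by (rule finsum_singleton) (use fin c(1) in auto)
  finally show ?thesis by simp
qed

lemma of_matrices_inj: "inj_on of_matrices (carrier M.MS)"
proof (rule inj_onI)
  fix f g assume f: "f \<in> carrier M.MS" and g: "g \<in> carrier M.MS" and eq: "of_matrices f = of_matrices g"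
  show "f = g"
  proof (rule M.MS_eqI[OF f g])
    fix i \<alpha> \<beta> k assume i: "i \<in> blocks"
    show "f i \<alpha> \<beta> k = g i \<alpha> \<beta> k"
    proof (cases "M.valid_index (i, \<alpha>, \<beta>, k)")
      case True
      then obtain b p q k' where b: "b \<in> Bases" "p \<in> enters b" "q \<in> enters b" "int (period b) dvd k'"
        "(i, \<alpha>, \<beta>, k) = (base_code b, walk_code b p, walk_code b q, k')" by (rule valid_index_cases)
      have "i = base_code b" "\<alpha> = walk_code b p" "\<beta> = walk_code b q" "k = k'" using b(5) by simp_all
      then show ?thesis using rep_of_matrices[OF f b(1-4)] rep_of_matrices[OF g b(1-4)] eq by simp
    next
      case False
      then have "h i \<alpha> \<beta> k = \<zero>\<^bsub>K\<^esub>" if "h \<in> carrier M.MS" for h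
        using M.MS_support[OF that i, of \<alpha> \<beta> k] i unfolding M.valid_index.simps by blast
      from this[OF f] this[OF g] show ?thesis by simp
    qed
  qed
qed

theorem leavitt_graded_isomorphic: "graded_isomorphic K L M.MS"
proof (rule graded_isomorphic_inverse)
  show "bij_betw of_matrices (carrier M.MS) (carrier L)"
    unfolding bij_betw_def using of_matrices_inj of_matrices_surj of_matrices_closed by blast
  show "component M.MS d \<subseteq> carrier M.MS" for d using M.MS_component by blast
qed (simp_all add: M.MS_add_closed M.MS_mult_closed MS_smult_closed of_matrices_add of_matrices_mult
    of_matrices_smult of_matrices_component_image)

lemma block_period_pos: "block_period i > 0"
  by (simp add: block_period_def period_pos)

end

section \<open>Comparison of each condition with tameness\<close>

context wf_digraph
begin

lemma tame_graph_if_periodic_vertices: "\<forall>v \<in> verts G. periodic G (vertex_elem v) \<Longrightarrow> tame_graph G"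
  by (intro tame_graphI periodic_imp_stably_periodic) blast

lemma vertex_elem_in_free_gamma: "v \<in> verts G \<Longrightarrow> vertex_elem v \<in> free_gamma G"
  by (simp add: vertex_elem_def free_gamma_def gens_def)

lemma tame_graph_iff_graph_monoid:
  "(\<exists>(I :: ('a, 'b) formal_sum set set) n. (\<forall>i \<in> I. n i > 0) \<and>
      gamma_isomorphic (graph_monoid G) (graph_monoid_act G)
        (sum_monoid I (\<lambda>i. cyc_monoid (n i))) (sum_act I (\<lambda>i. cyc_monoid_act (n i)))) \<longleftrightarrow>
    tame_graph G" (is "(\<exists>I n. ?P I n) \<longleftrightarrow> _")
proof
  assume "\<exists>I n. ?P I n"
  then obtain I and n :: "('a, 'b) formal_sum set \<Rightarrow> nat" where "?P I n" by (elim exE)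
  then have "\<forall>v \<in> verts G. periodic G (vertex_elem v)"
    by (intro ballI periodic_if_cyclic_sum[of I n] vertex_elem_in_free_gamma) blast+
  then show "tame_graph G" by (rule tame_graph_if_periodic_vertices)
next
  assume "tame_graph G"
  then interpret tame_graph G .
  show "\<exists>I n. ?P I n"
    by (intro exI conjI) (rule ballI, rule period_pos, rule graph_monoid_cyclic_sum)
qed

text \<open>Periodicity of all elements is read off from the decomposition into cyclic summands,
  where a product of the finitely many moduli involved is a period.\<close>

lemma tame_graph_iff_periodic: "(\<forall>a \<in> free_gamma G. periodic G a) \<longleftrightarrow> tame_graph G"
proof
  assume "\<forall>a \<in> free_gamma G. periodic G a"
  then show "tame_graph G" by (simp add: tame_graph_if_periodic_vertices vertex_elem_in_free_gamma)
next
  assume "tame_graph G"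
  then obtain I and n :: "('a, 'b) formal_sum set \<Rightarrow> nat" where
    "\<forall>i \<in> I. n i > 0" "gamma_isomorphic (graph_monoid G) (graph_monoid_act G)
        (sum_monoid I (\<lambda>i. cyc_monoid (n i))) (sum_act I (\<lambda>i. cyc_monoid_act (n i)))"
    unfolding tame_graph_iff_graph_monoid[symmetric] by (elim exE conjE)
  then show "\<forall>a \<in> free_gamma G. periodic G a" by (blast intro: periodic_if_cyclic_sum)
qed

lemma tame_graph_iff_periodic_vertices:
  "(\<forall>v \<in> verts G. periodic G (vertex_elem v)) \<longleftrightarrow> tame_graph G"
  using tame_graph_iff_periodic tame_graph_if_periodic_vertices vertex_elem_in_free_gamma by blast

lemma tame_graph_iff_groth:
  "(\<exists>(I :: (('a, 'b) formal_sum set \<times> ('a, 'b) formal_sum set) set set) n. (\<forall>i \<in> I. n i > 0) \<and>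
      gamma_isomorphic (groth_group (graph_monoid G))
        (groth_act (graph_monoid G) (graph_monoid_act G))
        (sum_group I (\<lambda>i. cyc_group (n i))) (sum_act I (\<lambda>i. cyc_group_act (n i)))) \<longleftrightarrow>
    tame_graph G" (is "(\<exists>I n. ?P I n) \<longleftrightarrow> _")
proof
  assume "\<exists>I n. ?P I n"
  then obtain I and n :: "(('a, 'b) formal_sum set \<times> ('a, 'b) formal_sum set) set \<Rightarrow> nat"
    where In: "?P I n" by (elim exE)
  show "tame_graph G"
  proof (rule tame_graphI)
    fix v assume "v \<in> verts G"
    then show "stably_periodic G (vertex_elem v)"
      using In by (intro stably_periodic_if_cyclic_sum_group[of I n] vertex_elem_in_free_gamma) blast+
  qed
next
  assume "tame_graph G"
  then obtain I and n :: "('a, 'b) formal_sum set \<Rightarrow> nat" where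
    pos: "\<forall>i \<in> I. n i > 0" and iso: "gamma_isomorphic (graph_monoid G) (graph_monoid_act G)
        (sum_monoid I (\<lambda>i. cyc_monoid (n i))) (sum_act I (\<lambda>i. cyc_monoid_act (n i)))"
    unfolding tame_graph_iff_graph_monoid[symmetric] by (elim exE conjE)
  \<comment> \<open>The indices of the group summands are sets of pairs of indices of the monoid
    summands; \<open>{(i, i)}\<close> is just a convenient injection.\<close>
  have inj: "inj_on (\<lambda>i. {(i, i)}) I" by (auto intro: inj_onI)
  have "n (inv_into I (\<lambda>i. {(i, i)}) x) > 0" if "x \<in> (\<lambda>i. {(i, i)}) ` I" for x
    using bspec[OF pos inv_into_into[OF that]] .
  then show "\<exists>I n. ?P I n"
    by (intro exI conjI)
      (rule ballI, assumption, rule gamma_isomorphic_groth[OF comm_monoid_graph_monoid graph_monoid_act_hom iso inj])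
qed

lemma tame_graph_iff_set_arrow:
  "(\<forall>v \<in> verts G. \<exists>V. set_arrow_A1 G {Proper v} V \<and> stationary G V \<and> core G V = V \<and>
       (\<forall>c. core_cycle G V c \<longrightarrow> \<not> has_exit G c)) \<longleftrightarrow> tame_graph G"
  by (rule iffI[OF tame_graph_if_set_arrow tame_graph.set_arrow_characterisation])

text \<open>One field over the type is enough to recover the graph conditions, and one is needed,
  since otherwise the left side would hold vacuously; the decomposition itself is available over
  each field.\<close>

lemma tame_graph_iff_leavitt:
  assumes "\<exists>K :: 'k ring. field K"
  shows "(\<forall>K :: 'k ring. field K \<longrightarrow>
      (\<exists>(I :: ('k, 'a, 'b) lterm set set) (\<mu> :: _ \<Rightarrow> ('k, 'a, 'b) lterm set set) n \<gamma>.
         (\<forall>i \<in> I. n i > 0) \<and>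
         graded_isomorphic K (leavitt K G)
           (sum_algebra I (\<lambda>i. matrix_algebra (laurent_algebra K (n i)) (\<mu> i) (\<gamma> i))))) \<longleftrightarrow>
    tame_graph G" (is "(\<forall>K. _ K \<longrightarrow> (\<exists>I \<mu> n \<gamma>. ?P K I \<mu> n \<gamma>)) \<longleftrightarrow> _")
proof
  assume ex: "\<forall>K :: 'k ring. field K \<longrightarrow> (\<exists>I \<mu> n \<gamma>. ?P K I \<mu> n \<gamma>)"
  obtain K :: "'k ring" where K: "field K" using assms by (elim exE)
  interpret leavitt_path G K using K wf_digraph_axioms by (simp add: leavitt_path_def)
  obtain I \<mu> n \<gamma> where P: "?P K I \<mu> n \<gamma>" using ex[rule_format, OF K] by (elim exE)
  show "tame_graph G"
    by (rule tame_if_matrix_sum[OF _ conjunct2[OF P]]) (use P in blast)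
next
  assume tame: "tame_graph G"
  show "\<forall>K :: 'k ring. field K \<longrightarrow> (\<exists>I \<mu> n \<gamma>. ?P K I \<mu> n \<gamma>)"
  proof (intro allI impI)
    fix K :: "'k ring" assume K: "field K"
    interpret tame_leavitt G K
      using K wf_digraph_axioms tame by (simp add: tame_leavitt_def leavitt_path_def)
    show "\<exists>I \<mu> n \<gamma>. ?P K I \<mu> n \<gamma>"
      by (intro exI conjI) (rule ballI, rule block_period_pos, rule leavitt_graded_isomorphic)
  qed
qed

end

lemma all_equivalentI: "list_all (\<lambda>P. P \<longleftrightarrow> Q) Ps \<Longrightarrow> all_equivalent Ps"
  by (auto simp: all_equivalent_def list_all_iff)

theorem theorem5p2:
  fixes E :: "('v, 'e) pre_digraph"
  assumes graph: "wf_digraph E"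
    and field_univ: "\<exists>K :: 'k ring. field K"
  shows "all_equivalent
   [\<forall>a \<in> free_gamma E. periodic E a,

    \<forall>v \<in> verts E. periodic E (vertex_elem v),

    \<forall>v \<in> verts E. \<exists>V. set_arrow_A1 E {Proper v} V \<and> stationary E V \<and> core E V = V \<and>
       (\<forall>c. core_cycle E V c \<longrightarrow> \<not> has_exit E c),

    (\<forall>u p w. pre_digraph.awalk E u p w \<longrightarrow>
       (\<exists>q z. pre_digraph.awalk E u (p @ q) z \<and>
          (\<exists>c. pre_digraph.cycle E c \<and> \<not> has_exit E c \<and> z \<in> cycle_verts E c) \<and>
          (\<forall>y \<in> set (pre_digraph.awalk_verts E u (p @ q)). regular E y))) \<and>
    (\<forall>f. inf_path E f \<longrightarrow>
       (\<exists>c. pre_digraph.cycle E c \<and> \<not> has_exit E c \<and> inf_path_ends_in f c)),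

    row_finite E \<and> no_exit_graph E \<and> \<not> (\<exists>v. sink E v) \<and>
    (\<forall>f. inf_path E f \<longrightarrow> (\<exists>c. pre_digraph.cycle E c \<and> inf_path_ends_in f c)),

    \<forall>K :: 'k ring. field K \<longrightarrow>
      (\<exists>(I :: ('k, 'v, 'e) lterm set set) (\<mu> :: _ \<Rightarrow> ('k, 'v, 'e) lterm set set) n \<gamma>.
         (\<forall>i \<in> I. n i > 0) \<and>
         graded_isomorphic K (leavitt K E)
           (sum_algebra I (\<lambda>i. matrix_algebra (laurent_algebra K (n i)) (\<mu> i) (\<gamma> i)))),

    \<exists>(I :: ('v, 'e) formal_sum set set) n.
      (\<forall>i \<in> I. n i > 0) \<and>
      gamma_isomorphic (graph_monoid E) (graph_monoid_act E)
        (sum_monoid I (\<lambda>i. cyc_monoid (n i))) (sum_act I (\<lambda>i. cyc_monoid_act (n i))),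

    \<exists>(I :: (('v, 'e) formal_sum set \<times> ('v, 'e) formal_sum set) set set) n.
      (\<forall>i \<in> I. n i > 0) \<and>
      gamma_isomorphic (groth_group (graph_monoid E))
        (groth_act (graph_monoid E) (graph_monoid_act E))
        (sum_group I (\<lambda>i. cyc_group (n i))) (sum_act I (\<lambda>i. cyc_group_act (n i)))]"
proof -
  interpret wf_digraph E by (rule graph)
  show ?thesis
    by (rule all_equivalentI[of "tame_graph E"], unfold list.pred_inject(2), intro conjI)
      (rule list.pred_inject(1) tame_graph_iff_periodic tame_graph_iff_periodic_vertices tame_graph_iff_set_arrow
        tame_graph_iff_paths[symmetric] tame_graph_iff[symmetric] tame_graph_iff_leavitt[OF field_univ]
        tame_graph_iff_graph_monoid tame_graph_iff_groth)+
qed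

end
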